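(* Let $\mathcal{F}$ be any family of tampering functions $f\colon\{0,1\}^n\to\{0,1\}^n$. For any $\epsilon,\eta>0$, with probability at least $1-\eta$ (over the random choice of the polynomial $P$), the pair $(\mathsf{EncMC},\mathsf{DecMC})$ of the Monte Carlo construction (described in the context) can be set up so as to achieve a non-malleable coding scheme with respect to $\mathcal{F}$ and with error $\epsilon$. Moreover, the scheme satisfies the following. 1. The code achieves $k \ge n - \log\log(|\mathcal{F}|/\eta) - \log n - 9\log(1/\epsilon) - O(1)$. 2. The number of random bits needed to specify the code is $O\big((n+\log(|\mathcal{F}|/\eta))\, n/\epsilon^6\big)$. 3. The encoder and the decoder run in worst-case time $\mathrm{poly}\big(\log(|\mathcal{F}|/\eta)\, n/\epsilon\big)$.
   Context: All logarithms are to base $2$. Two distributions are $\epsilon$-close if their statistical (total variation) distance is at most $\epsilon$. Coding scheme. A coding scheme with block length $n$ and message length $k\le n$ is a pair $\mathsf{Enc}\colon \{0,1\}^k \to \{0,1\}^n$, $\mathsf{Dec}\colon \{0,1\}^n \to \{0,1\}^k \cup \{\perp\}$, where $\mathsf{Enc}$ is randomized (using uniform internal coin flips), $\mathsf{Dec}$ is deterministic, and $\mathsf{Dec}(\mathsf{Enc}(s)) = s$ with probability $1$ for every $s\in\{0,1\}^k$. Non-malleability. For a special symbol $\mathsf{same}$, let $\mathrm{copy}(x,y) := x$ if $x\ne\mathsf{same}$ and $\mathrm{copy}(\mathsf{same},y) := y$. A coding scheme is non-malleable with error $\epsilon$ with respect to a family $\mathcal{F}$ of functions $\{0,1\}^n\to\{0,1\}^n$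 if for every $f\in\mathcal{F}$ there is a distribution $\mathcal{D}_f$ over $\{0,1\}^k\cup\{\perp,\mathsf{same}\}$ such that for every $s\in\{0,1\}^k$, the distribution of $\mathsf{Dec}(f(\mathsf{Enc}(s)))$ is $\epsilon$-close to the distribution of $\mathrm{copy}(S',s)$, where $S'\sim\mathcal{D}_f$. Monte Carlo construction. Parameters (to be set up as functions of $n,|\mathcal{F}|,\epsilon,\eta$): integers $0<k\le n$ and $t>1$ a power of two; let $b := \log(2t)$ and $m := n-k-b$. Vectors in $\{0,1\}^n$ are regarded as elements of the field $\mathbb{F}_{2^n}$ and vice versa. Randomness of the construction: a uniformly random polynomial $P$ over $\mathbb{F}_{2^n}$ of degree at most $9t-1$. Encoder $\mathsf{EncMC}$: given $s\in\{0,1\}^k$, let $E$ be the set of all $X\in\mathbb{F}_{2^n}$ with $P(X) = (s,0^m,z)$ for some $z\in\{0,1\}^b$; output a uniformly random element of $E$. Decoder $\mathsf{DecMC}$: given $x\in\{0,1\}^n$, compute $y := P(x) = (y_1,\dots,y_n)$; if $(y_{k+1},\dots,y_{k+m}) = 0^m$ output $(y_1,\dots,y_k)$, otherwise output $\perp$.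
   Formalization: Assumes ε ≤ 1, |F|/η ≥ 2 and that the lower bound on k in item 1 is positive (otherwise the claim fails, e.g. for all functions); the encoder may draw a uniform entry of a list in one step, as exact uniform sampling from E is impossible with fair coins in worst-case time. *)

theory Defs
  imports
    "HOL-Probability.Probability_Mass_Function"
    "HOL-Computational_Algebra.Polynomial"
    "HOL-Library.Z2"
begin

definition bvecs :: "nat \<Rightarrow> bit list set" where
  "bvecs n = {x. length x = n}"

definition stat_dist :: "'a pmf \<Rightarrow> 'a pmf \<Rightarrow> real" where
  "stat_dist p q = (SUP A. \<bar>measure_pmf.prob p A - measure_pmf.prob q A\<bar>)"

text \<open>The decoder's failure symbol is \<^const>\<open>None\<close>.\<close>

definition coding_scheme ::
  "nat \<Rightarrow> nat \<Rightarrow> (bit list \<Rightarrow> bit list pmf) \<Rightarrow> (bit list \<Rightarrow> bit list option) \<Rightarrow> bool" where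
  "coding_scheme n k Enc Dec \<longleftrightarrow>
     k \<le> n \<and>
     (\<forall>s\<in>bvecs k. set_pmf (Enc s) \<subseteq> bvecs n) \<and>
     (\<forall>x\<in>bvecs n. Dec x \<in> insert None (Some ` bvecs k)) \<and>
     (\<forall>s\<in>bvecs k. measure_pmf.prob (Enc s) {x. Dec x = Some s} = 1)"

datatype 'a outcome = Same | Val 'a

fun copy :: "bit list option outcome \<Rightarrow> bit list \<Rightarrow> bit list option" where
  "copy Same y = Some y"
| "copy (Val x) y = x"

definition non_malleable ::
  "nat \<Rightarrow> (bit list \<Rightarrow> bit list) set \<Rightarrow> real \<Rightarrow>
   (bit list \<Rightarrow> bit list pmf) \<Rightarrow> (bit list \<Rightarrow> bit list option) \<Rightarrow> bool" where
  "non_malleable k F \<epsilon> Enc Dec \<longleftrightarrow>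
     (\<forall>f\<in>F. \<exists>D. set_pmf D \<subseteq> insert Same (Val ` insert None (Some ` bvecs k)) \<and>
        (\<forall>s\<in>bvecs k. stat_dist (map_pmf (\<lambda>x. Dec (f x)) (Enc s))
                                 (map_pmf (\<lambda>s'. copy s' s) D) \<le> \<epsilon>))"

text \<open>
  The field with \<open>2 ^ n\<close> elements is the quotient of \<^typ>\<open>bit poly\<close> by an irreducible polynomial
  \<open>g\<close> of degree \<open>n\<close>, its elements being represented by the residues of degree below \<open>n\<close>. The vector
  \<open>[y\<^sub>1, \<dots>, y\<^sub>n]\<close> is identified with the residue whose coefficients, lowest degree first, are
  \<open>y\<^sub>1, \<dots>, y\<^sub>n\<close>. A polynomial over the field is a \<^typ>\<open>bit poly poly\<close> whose coefficients are such
  residues; since reduction modulo \<open>g\<close> is a ring homomorphism, its value at \<open>x\<close> in the field is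
  \<open>poly P x mod g\<close>.
\<close>

definition vec_of :: "nat \<Rightarrow> bit poly \<Rightarrow> bit list" where
  "vec_of n p = map (coeff p) [0..<n]"

definition mc_eval :: "nat \<Rightarrow> bit poly \<Rightarrow> bit poly poly \<Rightarrow> bit list \<Rightarrow> bit list" where
  "mc_eval n g P x = vec_of n (poly P (Poly x) mod g)"

definition mc_polys :: "nat \<Rightarrow> nat \<Rightarrow> bit poly poly set" where
  "mc_polys n t = {P. degree P \<le> 9 * t - 1 \<and> (\<forall>i. degree (coeff P i) < n)}"

definition mc_b :: "nat \<Rightarrow> nat" where
  "mc_b t = nat \<lfloor>log 2 (2 * real t)\<rfloor>"

definition mc_m :: "nat \<Rightarrow> nat \<Rightarrow> nat \<Rightarrow> nat" where
  "mc_m n k t = n - k - mc_b t"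

definition mc_params :: "nat \<Rightarrow> nat \<Rightarrow> nat \<Rightarrow> bool" where
  "mc_params n k t \<longleftrightarrow> 0 < k \<and> k \<le> n \<and> 1 < t \<and> (\<exists>a. t = 2 ^ a) \<and> k + mc_b t \<le> n"

definition mc_E ::
  "nat \<Rightarrow> nat \<Rightarrow> nat \<Rightarrow> bit poly \<Rightarrow> bit poly poly \<Rightarrow> bit list \<Rightarrow> bit list set" where
  "mc_E n k t g P s =
     {x \<in> bvecs n. \<exists>z\<in>bvecs (mc_b t). mc_eval n g P x = s @ replicate (mc_m n k t) 0 @ z}"

text \<open>
  The construction leaves the encoder undefined when there is nothing to choose from. The value taken
  here in that case is immaterial: if \<^term>\<open>mc_E n k t g P s\<close> is empty then no vector decodes to
  \<open>s\<close>, so the pair is not a coding scheme whatever the encoder outputs.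
\<close>

definition EncMC ::
  "nat \<Rightarrow> nat \<Rightarrow> nat \<Rightarrow> bit poly \<Rightarrow> bit poly poly \<Rightarrow> bit list \<Rightarrow> bit list pmf" where
  "EncMC n k t g P s =
     (if mc_E n k t g P s = {} then return_pmf (replicate n 0) else pmf_of_set (mc_E n k t g P s))"

definition DecMC ::
  "nat \<Rightarrow> nat \<Rightarrow> nat \<Rightarrow> bit poly \<Rightarrow> bit poly poly \<Rightarrow> bit list \<Rightarrow> bit list option" where
  "DecMC n k t g P x =
     (let y = mc_eval n g P x in
      if take (mc_m n k t) (drop k y) = replicate (mc_m n k t) 0 then Some (take k y) else None)"

text \<open>Specifying a uniform element of a set of size \<open>N\<close> takes \<open>log\<^sub>2 N\<close> random bits.\<close>

definition mc_random_bits :: "nat \<Rightarrow> nat \<Rightarrow> real" where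
  "mc_random_bits n t = log 2 (real (card (mc_polys n t)))"

text \<open>
  Running time is measured in Jones' WHILE language over binary trees, where each operation on
  variables takes one step. Up to polynomial factors its time is that of Turing machines: trees are
  stored with sharing, so that one step allocates at most one cell.

  The only source of randomness is \<open>Choose x y\<close>, which sets \<open>x\<close> to a uniformly random entry of the
  list in \<open>y\<close>. A coin flip is the choice from a list of length two. Bare coin flips would not do:
  in bounded time they yield only dyadic probabilities, whereas the encoder has to sample uniformly
  from a set whose size need not be a power of two. The length of the list in \<open>y\<close> never exceeds the
  size of the input plus the number of steps made so far, so unit cost is adequate here too.
\<close>

datatype cell = Atom | Cell cell cell

fun cell_of_list :: "cell list \<Rightarrow> cell" where
  "cell_of_list [] = Atom"
| "cell_of_list (x # xs) = Cell x (cell_of_list xs)"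

fun list_of_cell :: "cell \<Rightarrow> cell list" where
  "list_of_cell Atom = []"
| "list_of_cell (Cell x y) = x # list_of_cell y"

fun left :: "cell \<Rightarrow> cell" where
  "left Atom = Atom"
| "left (Cell x y) = x"

fun right :: "cell \<Rightarrow> cell" where
  "right Atom = Atom"
| "right (Cell x y) = y"

datatype com =
    SetAtom nat
  | Move nat nat
  | Pair nat nat nat
  | Left nat nat
  | Right nat nat
  | Choose nat nat
  | Seq com com
  | Cond nat com com
  | While nat com

text \<open>A configuration consists of the commands that remain to be executed and a store.\<close>

type_synonym config = "com list \<times> (nat \<Rightarrow> cell)"

definition choose_entry :: "cell \<Rightarrow> cell pmf" where
  "choose_entry c =
     (if c = Atom then return_pmf Atom
      else map_pmf (\<lambda>i. list_of_cell c ! i) (pmf_of_set {..<length (list_of_cell c)}))"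

fun step :: "config \<Rightarrow> config pmf" where
  "step ([], \<sigma>) = return_pmf ([], \<sigma>)"
| "step (SetAtom x # cs, \<sigma>) = return_pmf (cs, \<sigma>(x := Atom))"
| "step (Move x y # cs, \<sigma>) = return_pmf (cs, \<sigma>(x := \<sigma> y))"
| "step (Pair x y z # cs, \<sigma>) = return_pmf (cs, \<sigma>(x := Cell (\<sigma> y) (\<sigma> z)))"
| "step (Left x y # cs, \<sigma>) = return_pmf (cs, \<sigma>(x := left (\<sigma> y)))"
| "step (Right x y # cs, \<sigma>) = return_pmf (cs, \<sigma>(x := right (\<sigma> y)))"
| "step (Choose x y # cs, \<sigma>) = map_pmf (\<lambda>v. (cs, \<sigma>(x := v))) (choose_entry (\<sigma> y))"
| "step (Seq c d # cs, \<sigma>) = return_pmf (c # d # cs, \<sigma>)"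
| "step (Cond x c d # cs, \<sigma>) = return_pmf ((if \<sigma> x = Atom then d else c) # cs, \<sigma>)"
| "step (While x c # cs, \<sigma>) =
     return_pmf (if \<sigma> x = Atom then cs else c # While x c # cs, \<sigma>)"

definition run :: "nat \<Rightarrow> com \<Rightarrow> cell \<Rightarrow> config pmf" where
  "run T c inp =
     ((\<lambda>p. bind_pmf p step) ^^ T) (return_pmf ([c], (\<lambda>_. Atom)(0 := inp)))"

text \<open>
  Worst-case time: within the time bound the program halts on every outcome of its random choices.
  Input and output are in variable \<open>0\<close>.
\<close>

definition outputs_in_time :: "com \<Rightarrow> cell \<Rightarrow> cell pmf \<Rightarrow> real \<Rightarrow> bool" where
  "outputs_in_time c inp D B \<longleftrightarrow>
     (\<exists>T::nat. real T \<le> B \<and>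
        (\<forall>(cs, \<sigma>) \<in> set_pmf (run T c inp). cs = []) \<and>
        map_pmf (\<lambda>(cs, \<sigma>). \<sigma> 0) (run T c inp) = D)"

fun deterministic :: "com \<Rightarrow> bool" where
  "deterministic (Choose x y) = False"
| "deterministic (Seq c d) = (deterministic c \<and> deterministic d)"
| "deterministic (Cond x c d) = (deterministic c \<and> deterministic d)"
| "deterministic (While x c) = deterministic c"
| "deterministic _ = True"

definition cell_of_bit :: "bit \<Rightarrow> cell" where
  "cell_of_bit a = (if a = 0 then Atom else Cell Atom Atom)"

definition cell_of_vec :: "bit list \<Rightarrow> cell" where
  "cell_of_vec x = cell_of_list (map cell_of_bit x)"

fun cell_of_decoded :: "bit list option \<Rightarrow> cell" where
  "cell_of_decoded None = Atom"
| "cell_of_decoded (Some s) = Cell (cell_of_vec s) Atom"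

definition unary :: "nat \<Rightarrow> cell" where
  "unary i = cell_of_list (replicate i Atom)"

text \<open>
  The programs are uniform in all parameters: they read the field representation \<open>g\<close>, the \<open>9 t\<close>
  coefficients of \<open>P\<close> and the lengths \<open>k\<close>, \<open>m\<close>, \<open>b\<close> (in unary; all are at most \<open>n\<close>) together with the
  message or the received word.
\<close>

definition mc_input ::
  "nat \<Rightarrow> nat \<Rightarrow> nat \<Rightarrow> bit poly \<Rightarrow> bit poly poly \<Rightarrow> bit list \<Rightarrow> cell" where
  "mc_input n k t g P x = cell_of_list
     [cell_of_vec (vec_of (n + 1) g),
      cell_of_list (map (\<lambda>i. cell_of_vec (vec_of n (coeff P i))) [0..<9 * t]),
      unary k, unary (mc_m n k t), unary (mc_b t),
      cell_of_vec x]"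

end

theory Submission
  imports
    Defs
    "HOL-Library.Disjoint_Sets"
    "HOL-Algebra.Algebraic_Closure_Type"
begin

hide_const (open) Polynomials.degree Polynomials.lead_coeff Divisibility.irreducible Module.smult up_ring.coeff up_ring.monom

text \<open>A tampering function \<open>f\<close> partitions \<open>{0,1}\<^sup>n\<close> into its fixed points, the
  fibres of values taken with large mass, and the remaining points. As \<open>P\<close> is \<open>9t\<close>-wise
  independent, moment bounds show that with high probability the encodings of each message are
  spread over the first two kinds of points as a uniform vector would be, while few encodings in
  the third kind are mapped to a valid codeword; the decoder outcome is then simulated by the
  label of a uniform vector, and a union bound over \<open>f\<close> and the message finishes the argument.
  For the running time, the encoder has to find all roots of \<open>P - y\<close> for each \<open>y\<close> in a block:
  deterministically, by \<open>F\<^sub>2\<close>-linear splitting of \<open>gcd (P - y) (X\<^bsup>2^n\<^esup> - X)\<close>.\<close>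

text \<open>The simulator must not know the message. Labels depend on the block of admissible values
  only through its size, so one distribution serves all messages. A point is simulated wrongly only
  if its label says failure while its image decodes. Bounding these points is the hard part, as the
  points of one fibre share the event that their image decodes. Fibres receiving unusually many
  encodings are therefore set aside; in the others the edges from x to f x have bounded conflicts,
  so that disjoint ones can be counted by moments. With error 4/s and failure probability of order
  2^-\<tau>, setting fibres aside costs about \<tau> blocks of order s^2 points. This has to fit
  into 2t/s, whence t = 2^13 s^3 \<tau>.

  Worst-case time excludes random splitting. The polynomial X^(2^n) - X never enters a computation:
  it is the product of T and T + 1 for the trace polynomial T, so the first split by T already
  discards whatever has no root in the field. One obstacle remains: P may be constant with its value
  in the block. The set to sample from is then the whole space, too large to list, and it is sampled
  bit by bit.\<close>

section \<open>Limited independence and moments over disjoint patterns\<close>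

text \<open>Independence is required for membership in target sets rather than for exact values, and
  for lists of constraints rather than for sets: the events below have this form, and lists of
  constraints can be concatenated.\<close>

locale kwise =
  fixes p :: "'p pmf" and ev :: "'p \<Rightarrow> 'x \<Rightarrow> 'y" and Pts :: "'x set" and Y :: "'y set" and D :: nat
  assumes finite_p: "finite (set_pmf p)" and finite_Pts: "finite Pts"
    and finite_Y: "finite Y" and Y_ne: "Y \<noteq> {}"
    and kw: "\<And>cs. distinct (map fst cs) \<Longrightarrow> length cs \<le> D \<Longrightarrow> set cs \<subseteq> Pts \<times> Pow Y \<Longrightarrow>
      measure_pmf.prob p {P. \<forall>(x, V)\<in>set cs. ev P x \<in> V} =
        (\<Prod>(x, V)\<leftarrow>cs. real (card V) / real (card Y))"
begin

text \<open>A list of pairs of a point and a target set is called a pattern: an event that involves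
  few evaluations. Its weight \<open>wt\<close> is the probability that independence assigns to
  it.\<close>

definition sat :: "'p \<Rightarrow> ('x \<times> 'y set) list \<Rightarrow> bool" where
  "sat P cs \<longleftrightarrow> (\<forall>(x, V)\<in>set cs. ev P x \<in> V)"

definition wt :: "('x \<times> 'y set) list \<Rightarrow> real" where
  "wt cs = (\<Prod>(x, V)\<leftarrow>cs. real (card V) / real (card Y))"

lemma prob_sat:
  "distinct (map fst cs) \<Longrightarrow> length cs \<le> D \<Longrightarrow> set cs \<subseteq> Pts \<times> Pow Y \<Longrightarrow>
    measure_pmf.prob p {P. sat P cs} = wt cs"
  unfolding sat_def wt_def by (rule kw)

lemma wt_nonneg: "0 \<le> wt cs"
  unfolding wt_def by (induction cs) auto

lemma wt_concat: "wt (concat l) = (\<Prod>c\<leftarrow>l. wt c)"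
  unfolding wt_def by (induction l) auto

lemma sat_concat: "sat P (concat l) \<longleftrightarrow> (\<forall>c\<in>set l. sat P c)"
  unfolding sat_def by auto

lemma integrable_p: "integrable (measure_pmf p) (h :: 'p \<Rightarrow> real)"
  by (rule integrable_measure_pmf_finite[OF finite_p])

lemma expectation_card:
  assumes "finite L"
  shows "measure_pmf.expectation p (\<lambda>P. real (card {l\<in>L. Q P l})) =
    (\<Sum>l\<in>L. measure_pmf.prob p {P. Q P l})"
proof -
  have "real (card {l\<in>L. Q P l}) = (\<Sum>l\<in>L. indicator {P. Q P l} P)" for P
    using assms by (simp add: indicator_def sum.If_cases Collect_conj_eq)
  then show ?thesis
    using integrable_p by (simp add: Bochner_Integration.integral_sum)
qed

end

lemma sum_prod_list_lists:
  fixes h :: "'a \<Rightarrow> 'b::comm_semiring_1"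
  assumes "finite T"
  shows "(\<Sum>l | set l \<subseteq> T \<and> length l = v. \<Prod>c\<leftarrow>l. h c) = (\<Sum>c\<in>T. h c) ^ v"
proof (induction v)
  case 0
  have "{l. set l \<subseteq> T \<and> length l = 0} = {[]}" by auto
  then show ?case by simp
next
  case (Suc v)
  have eq: "{l. set l \<subseteq> T \<and> length l = Suc v} =
      (\<lambda>(c, l). c # l) ` (T \<times> {l. set l \<subseteq> T \<and> length l = v})"
    by (auto simp: length_Suc_conv image_iff)
  have inj: "inj_on (\<lambda>(c, l). c # l) (T \<times> {l. set l \<subseteq> T \<and> length l = v})"
    by (auto simp: inj_on_def)
  have "(\<Sum>l | set l \<subseteq> T \<and> length l = Suc v. \<Prod>c\<leftarrow>l. h c) =
      (\<Sum>(c, l)\<in>T \<times> {l. set l \<subseteq> T \<and> length l = v}. h c * (\<Prod>c\<leftarrow>l. h c))"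
    unfolding eq by (subst sum.reindex[OF inj]) (simp add: case_prod_unfold)
  also have "\<dots> = (\<Sum>c\<in>T. h c) * (\<Sum>l | set l \<subseteq> T \<and> length l = v. \<Prod>c\<leftarrow>l. h c)"
    unfolding sum_product sum.cartesian_product ..
  finally show ?case unfolding Suc by simp
qed

text \<open>Greedy extension: each chosen pattern excludes at most \<open>d\<close> others.\<close>

lemma card_disjoint_lists:
  fixes S :: "('x \<times> 'y set) list set"
  assumes "finite S" and W: "W \<le> card S"
    and dist: "\<And>c. c \<in> S \<Longrightarrow> distinct (map fst c)"
    and confl: "\<And>c. c \<in> S \<Longrightarrow> card {c'\<in>S. fst ` set c \<inter> fst ` set c' \<noteq> {}} \<le> d"
    and "u \<le> v"
  shows "(W - d * v) ^ u \<le> card {l. set l \<subseteq> S \<and> length l = u \<and> distinct (map fst (concat l))}"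
  using \<open>u \<le> v\<close>
proof (induction u)
  case 0
  have "{l. set l \<subseteq> S \<and> length l = 0 \<and> distinct (map fst (concat l))} = {[]}" by auto
  then show ?case by simp
next
  case (Suc u)
  let ?L = "{l. set l \<subseteq> S \<and> length l = u \<and> distinct (map fst (concat l))}"
  let ?A = "\<lambda>l. {c\<in>S. fst ` set c \<inter> fst ` set (concat l) = {}}"
  have finL: "finite ?L"
    by (rule finite_subset[OF _ finite_lists_length_eq[OF \<open>finite S\<close>, of u]]) auto
  have A: "W - d * v \<le> card (?A l)" if l: "l \<in> ?L" for l
  proof -
    let ?B = "\<Union>c\<in>set l. {c'\<in>S. fst ` set c \<inter> fst ` set c' \<noteq> {}}"
    have "card ?B \<le> (\<Sum>c\<in>set l. card {c'\<in>S. fst ` set c \<inter> fst ` set c' \<noteq> {}})"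
      by (rule card_UN_le) simp
    also have "\<dots> \<le> (\<Sum>c\<in>set l. d)"
      using l by (intro sum_mono confl) auto
    also have "\<dots> \<le> d * v"
      using l Suc.prems card_length[of l] by (simp add: mult.commute)
    finally have B: "card ?B \<le> d * v" .
    have "?A l = S - ?B" by auto
    then have "card (?A l) \<ge> card S - card ?B"
      using \<open>finite S\<close> by (simp add: diff_card_le_card_Diff)
    then show ?thesis using B W by linarith
  qed
  have sub: "(\<lambda>(l, c). c # l) ` (SIGMA l:?L. ?A l) \<subseteq>
      {l. set l \<subseteq> S \<and> length l = Suc u \<and> distinct (map fst (concat l))}"
    by (auto simp: dist)
  have "(W - d * v) ^ Suc u \<le> card ?L * (W - d * v)"
    using Suc by simp
  also have "\<dots> \<le> (\<Sum>l\<in>?L. card (?A l))"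
    using sum_mono[OF A, of ?L "\<lambda>l. l"] by simp
  also have "\<dots> = card (SIGMA l:?L. ?A l)"
    using finL \<open>finite S\<close> by simp
  also have "\<dots> = card ((\<lambda>(l, c). c # l) ` (SIGMA l:?L. ?A l))"
    by (rule card_image[symmetric]) (auto simp: inj_on_def)
  also have "\<dots> \<le> card {l. set l \<subseteq> S \<and> length l = Suc u \<and> distinct (map fst (concat l))}"
    by (rule card_mono[OF finite_subset[OF _ finite_lists_length_eq[OF \<open>finite S\<close>, of "Suc u"]] sub])
      auto
  finally show ?case .
qed

context kwise
begin

text \<open>A v-th moment bound in which only lists of v pairwise disjoint patterns are counted.
  Such a list involves at most a * v points, so its probability is exactly a product of weights, and
  the expected number of satisfied lists is at most the v-th power of the total weight. If Q P
  holds, greedy extension produces at least (W - d v)^v satisfied lists, and Markov's inequality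
  compares the two numbers.\<close>

lemma prob_many_patterns:
  assumes T: "finite T" "\<And>c. c \<in> T \<Longrightarrow> set c \<subseteq> Pts \<times> Pow Y \<and> length c \<le> a \<and> distinct (map fst c)"
    and len: "a * v \<le> D" and W: "d * v < W"
    and Q: "\<And>P. P \<in> set_pmf p \<Longrightarrow> Q P \<Longrightarrow> \<exists>S\<subseteq>T. W \<le> card S \<and> (\<forall>c\<in>S. sat P c \<and>
        card {c'\<in>S. fst ` set c \<inter> fst ` set c' \<noteq> {}} \<le> d)"
  shows "measure_pmf.prob p {P. Q P} \<le> ((\<Sum>c\<in>T. wt c) / real (W - d * v)) ^ v"
proof -
  let ?L = "{l. set l \<subseteq> T \<and> length l = v \<and> distinct (map fst (concat l))}"
  let ?N = "\<lambda>P. real (card {l\<in>?L. sat P (concat l)})"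
  let ?w = "real (W - d * v) ^ v"
  have "0 < W - d * v" using W by simp
  then have w: "?w > 0" by (intro zero_less_power) (simp only: of_nat_0_less_iff)
  have finL: "finite ?L"
    by (rule finite_subset[OF _ finite_lists_length_eq[OF T(1), of v]]) auto
  have lenc: "length (concat l) \<le> a * length l" if "set l \<subseteq> T" for l
    using that
  proof (induction l)
    case (Cons c l)
    then show ?case using T(2)[of c] by auto
  qed simp
  have E: "measure_pmf.expectation p ?N = (\<Sum>l\<in>?L. measure_pmf.prob p {P. sat P (concat l)})"
    by (rule expectation_card[OF finL])
  also have "\<dots> = (\<Sum>l\<in>?L. \<Prod>c\<leftarrow>l. wt c)"
  proof (rule sum.cong[OF refl])
    fix l assume l: "l \<in> ?L"
    have "set c \<subseteq> Pts \<times> Pow Y" if "c \<in> set l" for c using that l T(2) by blast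
    then have "set (concat l) \<subseteq> Pts \<times> Pow Y" by (simp add: UN_subset_iff)
    moreover have "length (concat l) \<le> D" using lenc[of l] l len by auto
    ultimately show "measure_pmf.prob p {P. sat P (concat l)} = (\<Prod>c\<leftarrow>l. wt c)"
      using l by (subst prob_sat) (auto simp: wt_concat)
  qed
  also have "\<dots> \<le> (\<Sum>l | set l \<subseteq> T \<and> length l = v. \<Prod>c\<leftarrow>l. wt c)"
  proof (rule sum_mono2)
    show "finite {l. set l \<subseteq> T \<and> length l = v}" by (rule finite_lists_length_eq[OF T(1)])
    show "0 \<le> (\<Prod>c\<leftarrow>l. wt c)" for l
      by (induction l) (auto simp: wt_nonneg)
  qed auto
  also have "\<dots> = (\<Sum>c\<in>T. wt c) ^ v" by (rule sum_prod_list_lists[OF T(1)])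
  finally have E: "measure_pmf.expectation p ?N \<le> (\<Sum>c\<in>T. wt c) ^ v" .
  have key: "?w \<le> ?N P" if PQ: "P \<in> set_pmf p" "Q P" for P
  proof -
    obtain S where S: "S \<subseteq> T" "W \<le> card S" "\<And>c. c\<in>S \<Longrightarrow> sat P c"
      "\<And>c. c \<in> S \<Longrightarrow> card {c'\<in>S. fst ` set c \<inter> fst ` set c' \<noteq> {}} \<le> d"
      using Q[OF PQ] by blast
    have "(W - d * v) ^ v \<le> card {l. set l \<subseteq> S \<and> length l = v \<and> distinct (map fst (concat l))}"
    proof (rule card_disjoint_lists)
      show "finite S" using S(1) T(1) by (rule finite_subset)
      show "distinct (map fst c)" if "c \<in> S" for c using that S(1) T(2) by blast
      show "card {c'\<in>S. fst ` set c \<inter> fst ` set c' \<noteq> {}} \<le> d" if "c \<in> S" for c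
        using that by (rule S(4))
    qed (rule S(2) order.refl)+
    also have "\<dots> \<le> card {l\<in>?L. sat P (concat l)}"
    proof (rule card_mono)
      show "finite {l\<in>?L. sat P (concat l)}" by (rule finite_subset[OF _ finL]) auto
      show "{l. set l \<subseteq> S \<and> length l = v \<and> distinct (map fst (concat l))} \<subseteq>
          {l\<in>?L. sat P (concat l)}"
        using S(1,3) by (auto simp only: sat_concat mem_Collect_eq subset_iff)
    qed
    finally have "real ((W - d * v) ^ v) \<le> ?N P" by (rule of_nat_mono)
    then show ?thesis by (simp only: of_nat_power)
  qed
  have "measure_pmf.prob p {P. Q P} = measure_pmf.prob p ({P. Q P} \<inter> set_pmf p)"
    by (rule measure_Int_set_pmf[symmetric])
  also have "\<dots> \<le> measure_pmf.prob p {P\<in>space (measure_pmf p). ?N P \<ge> ?w}"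
    by (rule measure_pmf.finite_measure_mono) (use key in auto)
  also have "\<dots> \<le> measure_pmf.expectation p ?N / ?w"
    by (rule integral_Markov_inequality_measure[where A = "{}"]) (use w integrable_p in auto)
  also have "\<dots> \<le> (\<Sum>c\<in>T. wt c) ^ v / ?w"
    using E w by (simp add: divide_right_mono)
  finally show ?thesis by (simp only: power_divide)
qed

end

section \<open>Tail bounds for the number of points mapped into a set\<close>

text \<open>Bonferroni: the truncations of \<open>(1 - u) ^ N\<close> alternate around it.\<close>

lemma bonferroni_sign:
  fixes u :: real assumes "0 \<le> u" "u \<le> 1"
  shows "0 \<le> (-1) ^ J * ((\<Sum>j\<le>J. (- u) ^ j * real (N choose j)) - (1 - u) ^ N)"
proof (induction N arbitrary: J)
  case 0
  have "(\<Sum>j\<le>J. (- u) ^ j * real (0 choose j)) = (\<Sum>j\<in>{0}. (- u) ^ j * real (0 choose j))"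
    by (rule sum.mono_neutral_right) (auto simp: binomial_eq_0)
  then show ?case by simp
next
  case (Suc N)
  show ?case
  proof (cases J)
    case 0
    have "(1 - u) ^ Suc N \<le> 1" using assms by (intro power_le_one) auto
    then show ?thesis using 0 by simp
  next
    case (Suc J')
    have "(\<Sum>j\<le>J. (- u) ^ j * real (Suc N choose j)) =
        1 + (\<Sum>j\<le>J'. (- u) ^ Suc j * (real (N choose j) + real (N choose Suc j)))"
      unfolding Suc by (subst sum.atMost_Suc_shift) simp
    also have "\<dots> = (1 + (\<Sum>j\<le>J'. (- u) ^ Suc j * real (N choose Suc j))) -
        u * (\<Sum>j\<le>J'. (- u) ^ j * real (N choose j))"
      by (simp add: sum.distrib distrib_left sum_distrib_left sum_negf sum_subtractf mult.assoc)
    also have "1 + (\<Sum>j\<le>J'. (- u) ^ Suc j * real (N choose Suc j)) =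
        (\<Sum>j\<le>J. (- u) ^ j * real (N choose j))"
      unfolding Suc using sum.atMost_Suc_shift[of "\<lambda>j. (- u) ^ j * real (N choose j)" J'] by simp
    \<comment> \<open>By Pascal's rule the remainder for \<open>Suc N\<close> at J is the remainder
      for N at J minus u times the one for N at J - 1. Their signs alternate with J, so both
      contributions have the sign (-1)^J.\<close>
    finally have *: "(\<Sum>j\<le>J. (- u) ^ j * real (Suc N choose j)) - (1 - u) ^ Suc N =
        ((\<Sum>j\<le>J. (- u) ^ j * real (N choose j)) - (1 - u) ^ N) -
        u * ((\<Sum>j\<le>J'. (- u) ^ j * real (N choose j)) - (1 - u) ^ N)"
      by (simp add: algebra_simps)
    have "0 \<le> u * ((-1) ^ J' * ((\<Sum>j\<le>J'. (- u) ^ j * real (N choose j)) - (1 - u) ^ N))"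
      using Suc.IH[of J'] assms by simp
    with Suc.IH[of J] show ?thesis
      unfolding * using \<open>J = Suc J'\<close> by (simp add: algebra_simps)
  qed
qed

text \<open>Two consecutive truncations lie on opposite sides of (1 - u)^N, so the error of one is
  at most their difference, which is the next term.\<close>

lemma bonferroni_truncation:
  fixes u :: real assumes "0 \<le> u" "u \<le> 1"
  shows "\<bar>(\<Sum>j\<le>J. (- u) ^ j * real (N choose j)) - (1 - u) ^ N\<bar> \<le> u ^ Suc J * real (N choose Suc J)"
proof -
  let ?R = "\<lambda>J. (\<Sum>j\<le>J. (- u) ^ j * real (N choose j)) - (1 - u) ^ N"
  have 1: "?R (Suc J) = ?R J + (- u) ^ Suc J * real (N choose Suc J)" by simp
  have 2: "(- u) ^ Suc J = (-1) ^ Suc J * u ^ Suc J" by (rule power_minus)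
  have "0 \<le> (-1) ^ J * ?R J" "0 \<le> (-1) ^ Suc J * ?R (Suc J)"
    using bonferroni_sign[OF assms] by blast+
  then show ?thesis
    unfolding 1 2 by (cases "even J") (auto simp: abs_le_iff)
qed


text \<open>A single term of the exponential series at q is at most its sum.\<close>

lemma power_self_le_fact_exp: "real q ^ q \<le> fact q * exp (real q)"
proof -
  have "real q ^ q / fact q \<le> (\<Sum>n. real q ^ n / fact n)"
    using sum_le_suminf[of "\<lambda>n. real q ^ n / fact n" "{q}"] summable_exp_generic[of "real q"]
    by (simp add: field_simps)
  also have "\<dots> = exp (real q)" by (simp add: exp_def field_simps)
  finally show ?thesis by (simp add: field_simps)
qed

text \<open>Stirling's lower bound for q! in its crudest form, with e rounded up to 3.\<close>

lemma power_div_fact_le: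
  fixes x :: real
  assumes "0 \<le> x" "0 < q"
  shows "x ^ q / fact q \<le> (3 * x / real q) ^ q"
proof -
  have "exp (real q) = exp 1 ^ q" by (simp add: exp_of_nat_mult[symmetric])
  also have "\<dots> \<le> 3 ^ q" using exp_le by (intro power_mono) auto
  finally have "fact q * exp (real q) \<le> fact q * 3 ^ q" by (intro mult_left_mono) auto
  with power_self_le_fact_exp[of q] have "real q ^ q \<le> fact q * 3 ^ q" by (rule order_trans)
  then have "x ^ q * real q ^ q \<le> x ^ q * (fact q * 3 ^ q)"
    using assms by (intro mult_left_mono) auto
  then show ?thesis using assms by (simp add: field_simps power_mult_distrib power_divide)
qed

lemma binomial_mult_power_le:
  fixes x :: real
  assumes "0 \<le> x"
  shows "real (N choose j) * x ^ j \<le> (real N * x) ^ j / fact j"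
proof -
  have "fact j * (N choose j) \<le> N ^ j"
    using binomial_fact_pow[of N j] by (simp add: mult.commute)
  then have "real (N choose j) \<le> real N ^ j / fact j"
    using of_nat_mono[of "fact j * (N choose j)" "N ^ j", where ?'a = real]
    by (simp add: field_simps)
  then have "real (N choose j) * x ^ j \<le> real N ^ j / fact j * x ^ j"
    using assms by (intro mult_right_mono) auto
  then show ?thesis by (simp add: power_mult_distrib)
qed

context kwise
begin

lemma prob_subset:
  assumes "finite T" "T \<subseteq> Pts" "V \<subseteq> Y" "card T \<le> D"
  shows "measure_pmf.prob p {P. \<forall>x\<in>T. ev P x \<in> V} = (real (card V) / real (card Y)) ^ card T"
proof -
  obtain xs where xs: "set xs = T" "distinct xs"
    using finite_distinct_list[OF assms(1)] by blast
  have "measure_pmf.prob p {P. sat P (map (\<lambda>x. (x, V)) xs)} = wt (map (\<lambda>x. (x, V)) xs)"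
    by (rule prob_sat) (use xs assms in \<open>auto simp: comp_def distinct_card[symmetric]\<close>)
  moreover have "wt (map (\<lambda>x. (x, V)) xs) = (real (card V) / real (card Y)) ^ length xs"
    unfolding wt_def by (induction xs) auto
  ultimately show ?thesis
    using xs by (simp add: sat_def distinct_card[symmetric] case_prod_unfold)
qed

text \<open>The binomial coefficient counts the j-subsets of A that are mapped into V entirely; each
  involves j \<le> D points. Hence binomial moments up to order D are those of fully independent
  evaluations.\<close>

lemma expectation_choose:
  assumes "A \<subseteq> Pts" "V \<subseteq> Y" "j \<le> D"
  shows "measure_pmf.expectation p (\<lambda>P. real (card {x\<in>A. ev P x \<in> V} choose j)) =
    real (card A choose j) * (real (card V) / real (card Y)) ^ j"
proof -
  have fin: "finite A" using assms(1) finite_Pts finite_subset by blast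
  let ?T = "{T. T \<subseteq> A \<and> card T = j}"
  have "card {x\<in>A. ev P x \<in> V} choose j = card {T\<in>?T. \<forall>x\<in>T. ev P x \<in> V}" for P
  proof -
    have "card {x\<in>A. ev P x \<in> V} choose j = card {T. T \<subseteq> {x\<in>A. ev P x \<in> V} \<and> card T = j}"
      using n_subsets[of "{x\<in>A. ev P x \<in> V}" j] fin by simp
    also have "{T. T \<subseteq> {x\<in>A. ev P x \<in> V} \<and> card T = j} = {T\<in>?T. \<forall>x\<in>T. ev P x \<in> V}" by auto
    finally show ?thesis .
  qed
  then have "measure_pmf.expectation p (\<lambda>P. real (card {x\<in>A. ev P x \<in> V} choose j)) =
      (\<Sum>T\<in>?T. measure_pmf.prob p {P. \<forall>x\<in>T. ev P x \<in> V})"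
    using expectation_card[of ?T "\<lambda>P T. \<forall>x\<in>T. ev P x \<in> V"] fin by simp
  also have "\<dots> = (\<Sum>T\<in>?T. (real (card V) / real (card Y)) ^ j)"
    using assms fin by (intro sum.cong refl, subst prob_subset) (auto intro: finite_subset)
  finally show ?thesis using n_subsets[OF fin, of j] by simp
qed

text \<open>Chernoff's argument applies Markov's inequality to (1 - u)^N, where N counts the points
  of A mapped into V. Limited independence does not determine the expectation of this power. It is
  replaced by its Bonferroni truncation S of an even order J \<le> D: S is an upper bound pointwise,
  and its expectation exceeds (1 - u pr)^|A| by at most one more term, which is tiny because J + 1
  is at least 16 u m.\<close>

lemma prob_lower_tail:
  fixes \<mu> e :: real
  assumes A: "A \<subseteq> Pts" and V: "V \<subseteq> Y" and e: "0 < e" "e \<le> 1"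
    and \<mu>: "real (card V) / real (card Y) * real (card A) \<le> \<mu>" and D: "4 * \<mu> + 2 \<le> real D"
  shows "measure_pmf.prob p {P. real (card {x\<in>A. ev P x \<in> V}) \<le>
      real (card V) / real (card Y) * real (card A) - e * \<mu>} \<le> 2 * exp (- (e\<^sup>2 * \<mu> / 8))"
proof -
  define pr where "pr = real (card V) / real (card Y)"
  define m where "m = pr * real (card A)"
  \<comment> \<open>This u minimises the exponent 2 u^2 \<mu> - e \<mu> u that is reached at the
    end; the minimum is - e^2 \<mu> / 8.\<close>
  define u where "u = e / 4"
  define a where "a = m - e * \<mu>"
  \<comment> \<open>The largest even number up to D: evenness makes the truncation an upper
    bound.\<close>
  define J where "J = 2 * (D div 2)"
  define N where "N = (\<lambda>P. card {x\<in>A. ev P x \<in> V})"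
  define S where "S = (\<lambda>P. \<Sum>j\<le>J. (- u) ^ j * real (N P choose j))"
  have u: "0 < u" "u \<le> 1 / 4" using e by (auto simp: u_def)
  have "card V \<le> card Y" using V finite_Y by (rule card_mono[rotated])
  then have pr: "0 \<le> pr" "pr \<le> 1" unfolding pr_def by (auto simp: divide_le_eq_1)
  have m: "0 \<le> m" "m \<le> \<mu>" using \<mu> pr by (auto simp: m_def pr_def)
  have J: "J \<le> D" "even J" "real J + 1 \<ge> real D" by (auto simp: J_def)
  show ?thesis
  proof (cases "0 \<le> a")
    case False
    then have "{P. real (N P) \<le> a} = {}" by auto
    then show ?thesis unfolding N_def a_def m_def pr_def by simp
  next
    case a: True
    have S_ge: "(1 - u) ^ N P \<le> S P" for P
      using bonferroni_sign[of u J "N P"] u J(2) by (simp add: S_def)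
    have "measure_pmf.expectation p S =
        (\<Sum>j\<le>J. (- u) ^ j * (real (card A choose j) * pr ^ j))"
      unfolding S_def N_def
      using J(1) expectation_choose[OF A V] integrable_p
      by (subst Bochner_Integration.integral_sum) (auto simp: pr_def intro!: sum.cong)
    also have "\<dots> = (\<Sum>j\<le>J. (- (u * pr)) ^ j * real (card A choose j))"
      by (intro sum.cong refl) (simp add: power_mult_distrib[symmetric] mult_ac)
    also have "\<dots> \<le> (1 - u * pr) ^ card A + (u * pr) ^ Suc J * real (card A choose Suc J)"
    proof -
      have "u * pr \<le> 1" using u pr by (intro mult_le_one) auto
      then show ?thesis
        using bonferroni_truncation[of "u * pr" "card A" J] u pr by simp
    qed
    also have "(1 - u * pr) ^ card A \<le> exp (- (u * m))"
    proof -
      have "u * pr \<le> 1" using u pr by (intro mult_le_one) auto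
      then have "(1 - u * pr) ^ card A \<le> exp (- (u * pr)) ^ card A"
        using exp_ge_add_one_self[of "- (u * pr)"] by (intro power_mono) auto
      also have "\<dots> = exp (- (u * m))"
        by (simp add: exp_of_nat_mult[symmetric] m_def mult_ac)
      finally show ?thesis .
    qed
    also have "(u * pr) ^ Suc J * real (card A choose Suc J) \<le> exp (- (u * m))"
    proof -
      let ?q = "Suc J" let ?x = "u * m"
      have x: "0 \<le> ?x" "16 * ?x \<le> real ?q"
      proof -
        have "16 * ?x \<le> 4 * m" using u m mult_right_mono[of u "1/4" m] by linarith
        then show "16 * ?x \<le> real ?q" using m D J(3) by linarith
      qed (use u m in auto)
      have "(u * pr) ^ ?q * real (card A choose ?q) \<le> (real (card A) * (u * pr)) ^ ?q / fact ?q"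
        using binomial_mult_power_le[of "u * pr" "card A" ?q] u pr by (simp add: mult.commute)
      also have "real (card A) * (u * pr) = ?x" by (simp add: m_def)
      also have "?x ^ ?q / fact ?q \<le> (3 * ?x / real ?q) ^ ?q"
        by (rule power_div_fact_le) (use x in auto)
      also have "\<dots> \<le> (exp (-1)) ^ ?q"
      proof (rule power_mono)
        have "3 * ?x / real ?q \<le> 1 / 3" using x by (simp add: field_simps)
        also have "1 / 3 \<le> exp (-1 :: real)"
          using exp_le by (simp add: exp_minus field_simps)
        finally show "3 * ?x / real ?q \<le> exp (-1)" .
      qed (use x in auto)
      also have "\<dots> = exp (- real ?q)" by (subst exp_of_nat_mult[symmetric]) simp
      also have "\<dots> \<le> exp (- ?x)" using x by simp
      finally show ?thesis .
    qed
    finally have ES: "measure_pmf.expectation p S \<le> 2 * exp (- (u * m))" by simp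
    \<comment> \<open>Since ln (1 - u) is at least - u - 2 u^2, a count of at most a forces (1 -
      u)^N, and with it S, to be large.\<close>
    have low: "exp (- (a * (u + 2 * u\<^sup>2))) \<le> S P" if "real (N P) \<le> a" for P
    proof -
      have "a * (- u - 2 * u\<^sup>2) \<le> real (N P) * (- u - 2 * u\<^sup>2)"
      proof (rule mult_right_mono_neg[OF that])
        have "0 \<le> u\<^sup>2" by simp
        then show "- u - 2 * u\<^sup>2 \<le> 0" using u by linarith
      qed
      also have "\<dots> \<le> real (N P) * ln (1 - u)"
        by (intro mult_left_mono ln_one_minus_pos_lower_bound) (use u in auto)
      finally have "exp (- (a * (u + 2 * u\<^sup>2))) \<le> exp (real (N P) * ln (1 - u))"
        by (simp add: algebra_simps)
      also have "\<dots> = (1 - u) ^ N P" using u by (simp add: exp_of_nat_mult)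
      finally show ?thesis using S_ge[of P] by simp
    qed
    have S0: "0 \<le> S P" for P by (rule order_trans[OF zero_le_power S_ge]) (use u in simp)
    have "measure_pmf.prob p {P. real (N P) \<le> a} \<le>
        measure_pmf.prob p {P\<in>space (measure_pmf p). S P \<ge> exp (- (a * (u + 2 * u\<^sup>2)))}"
      by (rule measure_pmf.finite_measure_mono) (use low in auto)
    also have "\<dots> \<le> measure_pmf.expectation p S / exp (- (a * (u + 2 * u\<^sup>2)))"
      by (rule integral_Markov_inequality_measure[where A = "{}"]) (use S0 integrable_p in auto)
    also have "\<dots> \<le> 2 * exp (- (u * m)) / exp (- (a * (u + 2 * u\<^sup>2)))"
      using ES by (intro divide_right_mono) auto
    also have "\<dots> = 2 * exp (a * (u + 2 * u\<^sup>2) - u * m)"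
      by (simp add: exp_minus exp_diff divide_inverse)
    also have "\<dots> \<le> 2 * exp (- (e\<^sup>2 * \<mu> / 8))"
    proof -
      have "a * (u + 2 * u\<^sup>2) - u * m = 2 * u\<^sup>2 * m - e * \<mu> * u - 2 * (e * \<mu> * u\<^sup>2)"
        by (simp add: a_def algebra_simps)
      also have "\<dots> \<le> 2 * u\<^sup>2 * \<mu> - e * \<mu> * u"
      proof -
        have "2 * u\<^sup>2 * m \<le> 2 * u\<^sup>2 * \<mu>" using m by (intro mult_left_mono) auto
        moreover have "0 \<le> e * \<mu> * u\<^sup>2" using m e by simp
        ultimately show ?thesis by linarith
      qed
      also have "\<dots> = - (e\<^sup>2 * \<mu> / 8)" by (simp add: u_def power2_eq_square field_simps)
      finally show ?thesis by simp
    qed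
    finally show ?thesis unfolding N_def a_def m_def pr_def .
  qed
qed

text \<open>The patterns are single points. Each conflicts with itself only, hence d = 1 in
  \<open>prob_many_patterns\<close>.\<close>

lemma prob_upper_tail:
  assumes "V \<subseteq> Y" "v < W" "v \<le> D"
  shows "measure_pmf.prob p {P. W \<le> card {x\<in>Pts. ev P x \<in> V}} \<le>
    (real (card Pts) * (real (card V) / real (card Y)) / real (W - v)) ^ v"
proof -
  let ?T = "(\<lambda>x. [(x, V)]) ` Pts"
  have inj: "inj_on (\<lambda>x. [(x, V)]) S" for S by (auto simp: inj_on_def)
  have "measure_pmf.prob p {P. W \<le> card {x\<in>Pts. ev P x \<in> V}} \<le>
      ((\<Sum>c\<in>?T. wt c) / real (W - 1 * v)) ^ v"
  proof (rule prob_many_patterns[where a = 1])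
    fix P assume P: "W \<le> card {x\<in>Pts. ev P x \<in> V}"
    show "\<exists>S\<subseteq>?T. W \<le> card S \<and> (\<forall>c\<in>S. sat P c \<and>
        card {c'\<in>S. fst ` set c \<inter> fst ` set c' \<noteq> {}} \<le> 1)"
    proof (intro exI[of _ "(\<lambda>x. [(x, V)]) ` {x\<in>Pts. ev P x \<in> V}"] conjI ballI)
      fix c assume c: "c \<in> (\<lambda>x. [(x, V)]) ` {x\<in>Pts. ev P x \<in> V}"
      then have "{c'\<in>(\<lambda>x. [(x, V)]) ` {x\<in>Pts. ev P x \<in> V}. fst ` set c \<inter> fst ` set c' \<noteq> {}} = {c}"
        by auto
      then show "card {c'\<in>(\<lambda>x. [(x, V)]) ` {x\<in>Pts. ev P x \<in> V}. fst ` set c \<inter> fst ` set c' \<noteq> {}} \<le> 1"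
        by simp
    qed (use P in \<open>auto simp: card_image[OF inj] sat_def\<close>)
  qed (use assms finite_Pts in auto)
  also have "(\<Sum>c\<in>?T. wt c) = real (card Pts) * (real (card V) / real (card Y))"
    by (subst sum.reindex[OF inj]) (simp add: wt_def)
  finally show ?thesis by simp
qed

end

section \<open>Collisions: overloaded fibres and edges from a point to its image\<close>

text \<open>Cutting the fibres of size at least \<open>a\<close> into blocks of size \<open>a\<close> loses at most half.\<close>

lemma disjoint_blocks_in_fibres:
  assumes "finite U" "0 < a" "\<And>x. x \<in> U \<Longrightarrow> a \<le> card {x'\<in>U. f x' = f x}"
  shows "\<exists>\<D>. finite \<D> \<and> disjoint \<D> \<and> card U \<le> 2 * a * card \<D> \<and>
    (\<forall>T\<in>\<D>. T \<subseteq> U \<and> card T = a \<and> (\<exists>y. \<forall>x\<in>T. f x = y))"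
  using assms
proof (induction "card U" arbitrary: U rule: less_induct)
  case less
  show ?case
  proof (cases "U = {}")
    case True
    then show ?thesis by (intro exI[of _ "{}"]) (auto simp: disjoint_def)
  next
    case False
    then obtain x where x: "x \<in> U" by blast
    define Fx where "Fx = {x'\<in>U. f x' = f x}"
    have Fx: "Fx \<subseteq> U" "finite Fx" "a \<le> card Fx"
      using less.prems x by (auto simp: Fx_def)
    obtain T where T: "T \<subseteq> Fx" "card T = a" "finite T"
      using obtain_subset_with_card_n[OF Fx(3)] by blast
    \<comment> \<open>The part removed along with the block T: only T if at least a further points
      of the fibre remain, the whole fibre otherwise. So at most 2a points are lost per block, and
      every fibre that is still present keeps at least a points.\<close>
    define R where "R = (if 2 * a \<le> card Fx then T else Fx)"
    have R: "T \<subseteq> R" "R \<subseteq> Fx" "card R \<le> 2 * a" "finite R"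
      using T Fx by (auto simp: R_def)
    have "card R > 0" using R T less.prems(2) by (metis card_mono gr_zeroI le_zero_eq)
    moreover have "card (U - R) = card U - card R" "card R \<le> card U"
      using R Fx less.prems(1) by (auto intro: card_Diff_subset card_mono)
    ultimately have cardU: "card (U - R) < card U" "card U = card R + card (U - R)"
      by linarith+
    have fib: "a \<le> card {x'\<in>U - R. f x' = f z}" if z: "z \<in> U - R" for z
    proof (cases "f z = f x")
      case False
      then have "{x'\<in>U - R. f x' = f z} = {x'\<in>U. f x' = f z}" using R Fx_def by auto
      then show ?thesis using less.prems(3)[of z] z by simp
    next
      case True
      then have "z \<in> Fx" using z by (auto simp: Fx_def)
      then have "R = T" "2 * a \<le> card Fx" using z by (auto simp: R_def split: if_splits)
      moreover have "{x'\<in>U - R. f x' = f z} = Fx - R" using True by (auto simp: Fx_def)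
      ultimately show ?thesis using T by (simp add: card_Diff_subset)
    qed
    obtain \<D> where D: "finite \<D>" "disjoint \<D>" "card (U - R) \<le> 2 * a * card \<D>"
      "\<And>T. T \<in> \<D> \<Longrightarrow> T \<subseteq> U - R \<and> card T = a \<and> (\<exists>y. \<forall>x\<in>T. f x = y)"
      using less.hyps[OF cardU(1) _ less.prems(2) fib] less.prems(1) by (metis finite_Diff)
    have "T \<noteq> {}" using T less.prems(2) by auto
    then have "T \<notin> \<D>" using D(4)[of T] R(1) by blast
    moreover have "disjoint (insert T \<D>)"
      using D(2,4) R(1) by (fastforce simp: disjoint_def)
    moreover have "\<exists>y. \<forall>x\<in>T. f x = y" using T by (auto simp: Fx_def)
    ultimately show ?thesis
      using D T Fx R(3) cardU(2)
      by (intro exI[of _ "insert T \<D>"]) auto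
  qed
qed

context kwise
begin

text \<open>Fibres of g have mean load at most \<kappa>, and a load of a \<ge> 16 \<kappa> is
  exceptional. Patterns are the a-subsets of fibres, with every point required to go into V.
  Overloaded points contain disjoint blocks of this kind covering at least half of them, which
  explains the factor 2 a. Disjoint blocks do not conflict, and the total weight of all patterns is
  at most \<mu> (1/4)^a.\<close>

lemma prob_overloaded:
  fixes \<mu> \<kappa> :: real and g :: "'x \<Rightarrow> 'c"
  assumes Pts': "Pts' \<subseteq> Pts" and V: "V \<subseteq> Y"
    and light: "\<And>x. x \<in> Pts' \<Longrightarrow>
      real (card {x'\<in>Pts'. g x' = g x}) * (real (card V) / real (card Y)) \<le> \<kappa>"
    and \<kappa>: "1 \<le> \<kappa>" "16 * \<kappa> \<le> real a"
    and \<mu>: "real (card Pts) * (real (card V) / real (card Y)) \<le> \<mu>"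
    and v: "v < W" "a * v \<le> D"
  shows "measure_pmf.prob p {P. 2 * a * W \<le>
      card {x\<in>Pts'. ev P x \<in> V \<and> a \<le> card {x'\<in>Pts'. ev P x' \<in> V \<and> g x' = g x}}} \<le>
    (\<mu> * (1 / 4) ^ a / real (W - v)) ^ v"
proof -
  define pr where "pr = real (card V) / real (card Y)"
  \<comment> \<open>Patterns are lists, so every finite set is given one fixed enumeration.\<close>
  define lst where "lst = (\<lambda>T::'x set. SOME xs. set xs = T \<and> distinct xs)"
  define pat where "pat = (\<lambda>T. map (\<lambda>x. (x, V)) (lst T))"
  define \<T> where "\<T> = (\<Union>y\<in>g ` Pts'. pat ` {T. T \<subseteq> {x\<in>Pts'. g x = y} \<and> card T = a})"
  have a: "0 < a" using \<kappa> by (cases a) auto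
  have finX': "finite Pts'" using Pts' finite_Pts finite_subset by blast
  have pr: "0 \<le> pr" by (simp add: pr_def)
  have lst: "set (lst T) = T" "distinct (lst T)" if "finite T" for T
    using someI_ex[OF finite_distinct_list[OF that]] by (auto simp: lst_def)
  have pat: "set (pat T) = T \<times> {V}" "distinct (map fst (pat T))" "length (pat T) = card T"
    "fst ` set (pat T) = T" "wt (pat T) = pr ^ card T" if "finite T" for T
  proof -
    have len: "length (lst T) = card T" using lst[OF that] distinct_card by metis
    show "set (pat T) = T \<times> {V}" "fst ` set (pat T) = T"
      using lst[OF that] by (auto simp: pat_def image_image)
    show "distinct (map fst (pat T))" "length (pat T) = card T"
      using lst[OF that] len by (auto simp: pat_def comp_def)
    have "wt (map (\<lambda>x. (x, V)) xs) = pr ^ length xs" for xs :: "'x list"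
      unfolding wt_def pr_def by (induction xs) auto
    then show "wt (pat T) = pr ^ card T" using len by (simp add: pat_def)
  qed
  have fin: "finite {T. T \<subseteq> {x\<in>Pts'. g x = y} \<and> card T = a}" for y
    using finX' by simp
  have \<T>: "\<exists>T. c = pat T \<and> T \<subseteq> Pts' \<and> card T = a \<and> finite T" if c: "c \<in> \<T>" for c
  proof -
    obtain T y where T: "c = pat T" "T \<subseteq> {x\<in>Pts'. g x = y}" "card T = a"
      using c by (auto simp: \<T>_def)
    then have "T \<subseteq> Pts'" by blast
    then show ?thesis using T finite_subset[OF _ finX'] by blast
  qed
  have "measure_pmf.prob p {P. 2 * a * W \<le>
      card {x\<in>Pts'. ev P x \<in> V \<and> a \<le> card {x'\<in>Pts'. ev P x' \<in> V \<and> g x' = g x}}} \<le>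
      ((\<Sum>c\<in>\<T>. wt c) / real (W - 1 * v)) ^ v"
  proof (rule prob_many_patterns[where a = a])
    show "finite \<T>" unfolding \<T>_def using fin finX' by auto
    show "set c \<subseteq> Pts \<times> Pow Y \<and> length c \<le> a \<and> distinct (map fst c)" if c: "c \<in> \<T>" for c
    proof -
      obtain T where T: "c = pat T" "T \<subseteq> Pts'" "card T = a" "finite T" using \<T>[OF c] by blast
      show ?thesis unfolding T(1) pat(1)[OF T(4)] pat(3)[OF T(4)]
        using T pat(2)[OF T(4)] Pts' V by auto
    qed
    show "1 * v < W" using v by simp
  next
    fix P
    let ?U = "{x\<in>Pts'. ev P x \<in> V \<and> a \<le> card {x'\<in>Pts'. ev P x' \<in> V \<and> g x' = g x}}"
    assume U: "2 * a * W \<le> card ?U"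
    have finU: "finite ?U" using finX' by simp
    have fib: "a \<le> card {x'\<in>?U. g x' = g x}" if "x \<in> ?U" for x
    proof -
      have "{x'\<in>?U. g x' = g x} = {x'\<in>Pts'. ev P x' \<in> V \<and> g x' = g x}" using that by auto
      then show ?thesis using that by simp
    qed
    have "\<exists>\<D>. finite \<D> \<and> disjoint \<D> \<and> card ?U \<le> 2 * a * card \<D> \<and>
        (\<forall>T\<in>\<D>. T \<subseteq> ?U \<and> card T = a \<and> (\<exists>y. \<forall>x\<in>T. g x = y))"
      by (rule disjoint_blocks_in_fibres[OF finU a fib])
    then obtain \<D> where "finite \<D> \<and> disjoint \<D> \<and> card ?U \<le> 2 * a * card \<D> \<and>
        (\<forall>T\<in>\<D>. T \<subseteq> ?U \<and> card T = a \<and> (\<exists>y. \<forall>x\<in>T. g x = y))" ..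
    then have D: "finite \<D>" "disjoint \<D>" "card ?U \<le> 2 * a * card \<D>"
      "\<And>T. T \<in> \<D> \<Longrightarrow> T \<subseteq> ?U \<and> card T = a \<and> (\<exists>y. \<forall>x\<in>T. g x = y)"
      by (simp_all only: simp_thms)
    have "2 * a * W \<le> 2 * a * card \<D>" using U D(3) by linarith
    then have W: "W \<le> card \<D>" using a by simp
    have finT: "finite T" if "T \<in> \<D>" for T
      using D(4)[OF that] a by (intro card_ge_0_finite) simp
    have inj: "inj_on pat \<D>"
      by (rule inj_onI) (metis finT pat(4))
    show "\<exists>S\<subseteq>\<T>. W \<le> card S \<and> (\<forall>c\<in>S. sat P c \<and>
        card {c'\<in>S. fst ` set c \<inter> fst ` set c' \<noteq> {}} \<le> 1)"
    proof (intro exI[of _ "pat ` \<D>"] conjI ballI)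
      show "pat ` \<D> \<subseteq> \<T>"
      proof
        fix c assume "c \<in> pat ` \<D>"
        then obtain T where T: "T \<in> \<D>" "c = pat T" by blast
        obtain y where y: "\<forall>x\<in>T. g x = y" using D(4)[OF T(1)] by blast
        have "T \<noteq> {}" using D(4)[OF T(1)] a by auto
        then have "y \<in> g ` Pts'" "T \<subseteq> {x\<in>Pts'. g x = y}" using y D(4)[OF T(1)] by auto
        then show "c \<in> \<T>" unfolding \<T>_def T(2) using D(4)[OF T(1)] by blast
      qed
      show "W \<le> card (pat ` \<D>)" using W by (simp add: card_image[OF inj])
      fix c assume "c \<in> pat ` \<D>"
      then obtain T where T: "T \<in> \<D>" "c = pat T" by blast
      show "sat P c" using D(4)[OF T(1)] pat(1)[OF finT[OF T(1)]] by (auto simp: sat_def T(2))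
      have "{c'\<in>pat ` \<D>. fst ` set c \<inter> fst ` set c' \<noteq> {}} \<subseteq> {c}"
      proof
        fix c' assume "c' \<in> {c'\<in>pat ` \<D>. fst ` set c \<inter> fst ` set c' \<noteq> {}}"
        then obtain T' where T': "T' \<in> \<D>" "c' = pat T'" "fst ` set c \<inter> fst ` set c' \<noteq> {}" by blast
        have "T \<inter> T' \<noteq> {}" using T'(3) pat(4)[OF finT[OF T(1)]] pat(4)[OF finT[OF T'(1)]]
          unfolding T(2) T'(2) by simp
        then have "T = T'" using disjointD[OF D(2) T(1) T'(1)] by blast
        then show "c' \<in> {c}" using T T' by simp
      qed
      then show "card {c'\<in>pat ` \<D>. fst ` set c \<inter> fst ` set c' \<noteq> {}} \<le> 1"
        using card_mono[of "{c}"] by fastforce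
    qed
  qed (use v in auto)
  also have "\<dots> \<le> (\<mu> * (1 / 4) ^ a / real (W - v)) ^ v"
  proof (intro power_mono)
    have "(\<Sum>c\<in>\<T>. wt c) = (\<Sum>c\<in>\<T>. pr ^ a)"
      by (rule sum.cong[OF refl]) (use \<T> pat(5) in fastforce)
    also have "\<dots> = real (card \<T>) * pr ^ a" by simp
    also have "\<dots> \<le> (\<Sum>y\<in>g ` Pts'. real (card {x\<in>Pts'. g x = y} choose a)) * pr ^ a"
    proof (intro mult_right_mono)
      have "card \<T> \<le> (\<Sum>y\<in>g ` Pts'. card (pat ` {T. T \<subseteq> {x\<in>Pts'. g x = y} \<and> card T = a}))"
        unfolding \<T>_def by (rule card_UN_le) (use finX' in simp)
      also have "\<dots> \<le> (\<Sum>y\<in>g ` Pts'. card {x\<in>Pts'. g x = y} choose a)"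
      proof (rule sum_mono)
        fix y
        show "card (pat ` {T. T \<subseteq> {x\<in>Pts'. g x = y} \<and> card T = a}) \<le> card {x\<in>Pts'. g x = y} choose a"
          using card_image_le[OF fin, of pat y] n_subsets[of "{x\<in>Pts'. g x = y}" a] finX' by simp
      qed
      finally have "real (card \<T>) \<le> real (\<Sum>y\<in>g ` Pts'. card {x\<in>Pts'. g x = y} choose a)"
        by (rule of_nat_mono)
      then show "real (card \<T>) \<le> (\<Sum>y\<in>g ` Pts'. real (card {x\<in>Pts'. g x = y} choose a))" by simp
    qed (use pr in simp)
    also have "\<dots> = (\<Sum>y\<in>g ` Pts'. real (card {x\<in>Pts'. g x = y} choose a) * pr ^ a)"
      by (rule sum_distrib_right)
    also have "\<dots> \<le> (\<Sum>y\<in>g ` Pts'. real (card {x\<in>Pts'. g x = y}) * (pr * (1 / 4) ^ a))"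
    proof (rule sum_mono)
      fix y assume "y \<in> g ` Pts'"
      then obtain x where x: "x \<in> Pts'" "y = g x" by blast
      let ?d = "real (card {x\<in>Pts'. g x = y}) * pr"
      obtain a' where a': "a = Suc a'" using a by (cases a) auto
      have d: "0 \<le> ?d" "?d \<le> \<kappa>" using light[OF x(1)] pr by (auto simp: pr_def x(2))
      have "real (card {x\<in>Pts'. g x = y} choose a) * pr ^ a \<le> ?d ^ a / fact a"
        by (rule binomial_mult_power_le[OF pr])
      \<comment> \<open>One factor of the mean load is kept, so that summing over the fibres gives
        \<mu>; the other a - 1 factors are bounded by \<kappa> \<ge> 1. The quotient by a! is then
        at most (3 \<kappa> / a)^a, and 3/16 is below 1/4.\<close>
      also have "\<dots> \<le> ?d * \<kappa> ^ a / fact a"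
      proof (intro divide_right_mono)
        have "?d ^ a' \<le> \<kappa> ^ a'" using d by (intro power_mono) auto
        also have "\<dots> \<le> \<kappa> ^ a" unfolding a' using \<kappa> by simp
        finally show "?d ^ a \<le> ?d * \<kappa> ^ a"
          using d(1) mult_left_mono[of "?d ^ a'" "\<kappa> ^ a" ?d] by (simp add: a')
      qed simp
      also have "\<dots> = ?d * (\<kappa> ^ a / fact a)" by simp
      also have "\<dots> \<le> ?d * (1 / 4) ^ a"
      proof (rule mult_left_mono[OF _ d(1)])
        have "\<kappa> ^ a / fact a \<le> (3 * \<kappa> / real a) ^ a"
          by (rule power_div_fact_le) (use \<kappa> a in auto)
        also have "\<dots> \<le> (1 / 4) ^ a"
          using \<kappa> a by (intro power_mono) (auto simp: field_simps)
        finally show "\<kappa> ^ a / fact a \<le> (1 / 4) ^ a" .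
      qed
      finally show "real (card {x\<in>Pts'. g x = y} choose a) * pr ^ a \<le>
          real (card {x\<in>Pts'. g x = y}) * (pr * (1 / 4) ^ a)" by (simp only: mult.assoc)
    qed
    also have "\<dots> = real (\<Sum>y\<in>g ` Pts'. card {x\<in>Pts'. g x = y}) * (pr * (1 / 4) ^ a)"
      by (simp add: sum_distrib_right)
    also have "(\<Sum>y\<in>g ` Pts'. card {x\<in>Pts'. g x = y}) = card Pts'"
      using sum_fun_comp[OF finX', of "g ` Pts'" g "\<lambda>_. 1::nat"] finX' by simp
    also have "real (card Pts') * (pr * (1 / 4) ^ a) \<le> \<mu> * (1 / 4) ^ a"
    proof -
      have "real (card Pts') \<le> real (card Pts)" using card_mono[OF finite_Pts Pts'] by simp
      then have "real (card Pts') * pr \<le> \<mu>"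
        using \<mu> mult_right_mono[OF _ pr, of "real (card Pts')" "real (card Pts)"] by (simp add: pr_def)
      then have "real (card Pts') * pr * (1 / 4) ^ a \<le> \<mu> * (1 / 4) ^ a"
        by (intro mult_right_mono) auto
      then show ?thesis by (simp only: mult.assoc)
    qed
    finally show "(\<Sum>c\<in>\<T>. wt c) / real (W - 1 * v) \<le> \<mu> * (1 / 4) ^ a / real (W - v)"
      by (simp add: divide_right_mono)
    show "0 \<le> (\<Sum>c\<in>\<T>. wt c) / real (W - 1 * v)"
      by (intro divide_nonneg_nonneg sum_nonneg wt_nonneg) simp
  qed
  finally show ?thesis .
qed

text \<open>Patterns are the edges from x to f x, with x required to go into V and f x into Z; they
  involve two distinct points as f moves every point of \<open>Pts'\<close>. The condition that
  fewer than a points mapped into V share the image of x bounds the number of edges meeting a given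
  one by 4 a. Overloaded fibres are exactly what this condition excludes.\<close>

lemma prob_edges:
  assumes Pts': "Pts' \<subseteq> Pts" "f ` Pts' \<subseteq> Pts" "\<And>x. x \<in> Pts' \<Longrightarrow> f x \<noteq> x"
    and V: "V \<subseteq> Y" "Z \<subseteq> Y" and a: "0 < a" and v: "4 * a * v < W" "2 * v \<le> D"
  shows "measure_pmf.prob p {P. W \<le> card {x\<in>Pts'. ev P x \<in> V \<and> ev P (f x) \<in> Z \<and>
      card {x'\<in>Pts'. ev P x' \<in> V \<and> f x' = f x} < a}} \<le>
    (real (card Pts) * (real (card V) / real (card Y)) * (real (card Z) / real (card Y)) /
      real (W - 4 * a * v)) ^ v"
proof -
  define pat where "pat = (\<lambda>x. [(x, V), (f x, Z)])"
  have inj: "inj_on pat S" for S by (auto simp: inj_on_def pat_def)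
  have finX': "finite Pts'" using Pts' finite_Pts finite_subset by blast
  have "measure_pmf.prob p {P. W \<le> card {x\<in>Pts'. ev P x \<in> V \<and> ev P (f x) \<in> Z \<and>
      card {x'\<in>Pts'. ev P x' \<in> V \<and> f x' = f x} < a}} \<le>
      ((\<Sum>c\<in>pat ` Pts'. wt c) / real (W - (4 * a) * v)) ^ v"
  proof (rule prob_many_patterns[where a = 2])
    show "finite (pat ` Pts')" using finX' by simp
    show "set c \<subseteq> Pts \<times> Pow Y \<and> length c \<le> 2 \<and> distinct (map fst c)" if c: "c \<in> pat ` Pts'" for c
    proof -
      obtain x where x: "x \<in> Pts'" "c = pat x" using c by blast
      show ?thesis using Pts'(3)[OF x(1), symmetric] x Pts'(1,2) V by (auto simp: pat_def)
    qed
  next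
    fix P
    let ?E = "\<lambda>y. {x'\<in>Pts'. ev P x' \<in> V \<and> f x' = y}"
    let ?U = "{x\<in>Pts'. ev P x \<in> V \<and> ev P (f x) \<in> Z \<and> card (?E (f x)) < a}"
    assume W: "W \<le> card ?U"
    show "\<exists>S\<subseteq>pat ` Pts'. W \<le> card S \<and> (\<forall>c\<in>S. sat P c \<and>
        card {c'\<in>S. fst ` set c \<inter> fst ` set c' \<noteq> {}} \<le> 4 * a)"
    proof (intro exI[of _ "pat ` ?U"] conjI ballI)
      show "W \<le> card (pat ` ?U)" using W by (simp add: card_image[OF inj])
      fix c assume "c \<in> pat ` ?U"
      then obtain x where x: "x \<in> ?U" "c = pat x" by blast
      show "sat P c" using x by (auto simp: pat_def sat_def)
      \<comment> \<open>Contains the starting points of all counted edges that meet the edge of x: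
        those that start at x or f x, those that end at x, and those that end at f x.\<close>
      let ?C = "{x, f x} \<union> (?E x \<inter> ?U) \<union> ?E (f x)"
      have finC: "finite ?C" using finX' by simp
      \<comment> \<open>If some counted edge ends at x, its own membership in \<open>?U\<close> says
        that the fibre over x has fewer than a such points.\<close>
      have "card (?E x \<inter> ?U) \<le> a"
      proof (cases "?E x \<inter> ?U = {}")
        case False
        then obtain x' where "x' \<in> ?U" "f x' = x" by blast
        then have "card (?E x) < a" by auto
        moreover have "card (?E x \<inter> ?U) \<le> card (?E x)" using finX' by (intro card_mono) auto
        ultimately show ?thesis by linarith
      next
        case True
        then show ?thesis by (simp only: card.empty)
      qed
      moreover have "card (?E (f x)) < a" using x by simp
      moreover have "card ?C \<le> card {x, f x} + card (?E x \<inter> ?U) + card (?E (f x))"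
        by (intro order_trans[OF card_Un_le] add_mono order.refl card_Un_le)
      moreover have "card {x, f x} \<le> 2" by (simp add: card_insert_if)
      ultimately have C: "card ?C \<le> 4 * a" using a by linarith
      have "{c'\<in>pat ` ?U. fst ` set c \<inter> fst ` set c' \<noteq> {}} \<subseteq> pat ` ?C"
        unfolding x(2) by (auto simp: pat_def)
      then have "card {c'\<in>pat ` ?U. fst ` set c \<inter> fst ` set c' \<noteq> {}} \<le> card (pat ` ?C)"
        using finC by (intro card_mono) auto
      also have "\<dots> \<le> card ?C" by (rule card_image_le[OF finC])
      finally show "card {c'\<in>pat ` ?U. fst ` set c \<inter> fst ` set c' \<noteq> {}} \<le> 4 * a" using C by linarith
    qed auto
  qed (use v in auto)
  also have "(\<Sum>c\<in>pat ` Pts'. wt c) =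
      real (card Pts') * (real (card V) / real (card Y)) * (real (card Z) / real (card Y))"
    by (subst sum.reindex[OF inj]) (simp add: wt_def pat_def)
  also have "(\<dots> / real (W - 4 * a * v)) ^ v \<le>
      (real (card Pts) * (real (card V) / real (card Y)) * (real (card Z) / real (card Y)) /
        real (W - 4 * a * v)) ^ v"
    using card_mono[OF finite_Pts Pts'(1)]
    by (intro power_mono divide_right_mono mult_right_mono) auto
  finally show ?thesis .
qed

end

section \<open>Labels of points and the good event for a single tampering function and
  message\<close>

context kwise
begin

text \<open>The expected number of points that f moves to y and whose evaluation falls into
  V.\<close>

definition cell_mass :: "('x \<Rightarrow> 'x) \<Rightarrow> 'y set \<Rightarrow> 'x \<Rightarrow> real" where
  "cell_mass f V y = real (card {x\<in>Pts. f x = y \<and> f x \<noteq> x}) * (real (card V) / real (card Y))"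

text \<open>\<open>Same\<close> marks the fixed points of \<open>f\<close>, \<open>Val (Some y)\<close> the points mapped to a value \<open>y\<close> with
  a fibre of mass at least \<open>\<kappa>\<close>, and \<open>Val None\<close> all others.\<close>

definition label :: "real \<Rightarrow> ('x \<Rightarrow> 'x) \<Rightarrow> 'y set \<Rightarrow> 'x \<Rightarrow> 'x option outcome" where
  "label \<kappa> f V x =
    (if f x = x then Same else if cell_mass f V (f x) < \<kappa> then Val None else Val (Some (f x)))"

text \<open>Each heavy value takes up mass at least \<kappa> of a total of at most \<kappa> M, so at
  most M values are heavy. The additional 2 stands for \<open>Same\<close> and
  \<open>Val None\<close>.\<close>

lemma card_label_image:
  assumes "0 < \<kappa>" "real (card Pts) * (real (card V) / real (card Y)) \<le> \<kappa> * real M"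
  shows "card (label \<kappa> f V ` Pts) \<le> M + 2"
proof -
  let ?pr = "real (card V) / real (card Y)"
  let ?H = "{y \<in> f ` Pts. \<kappa> \<le> cell_mass f V y}"
  have finH: "finite ?H" using finite_Pts by simp
  have "\<kappa> * real (card ?H) = (\<Sum>y\<in>?H. \<kappa>)" by simp
  also have "\<dots> \<le> (\<Sum>y\<in>?H. cell_mass f V y)" by (rule sum_mono) simp
  also have "\<dots> = real (\<Sum>y\<in>?H. card {x\<in>Pts. f x = y \<and> f x \<noteq> x}) * ?pr"
    by (simp add: cell_mass_def sum_distrib_right sum_divide_distrib)
  also have "(\<Sum>y\<in>?H. card {x\<in>Pts. f x = y \<and> f x \<noteq> x}) =
      card (\<Union>y\<in>?H. {x\<in>Pts. f x = y \<and> f x \<noteq> x})"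
    by (rule card_UN_disjoint[symmetric]) (use finH finite_Pts in auto)
  also have "real (card (\<Union>y\<in>?H. {x\<in>Pts. f x = y \<and> f x \<noteq> x})) * ?pr \<le> real (card Pts) * ?pr"
    by (intro mult_right_mono of_nat_mono card_mono) (use finite_Pts in auto)
  finally have "\<kappa> * real (card ?H) \<le> \<kappa> * real M" using assms(2) by linarith
  then have H: "card ?H \<le> M" using assms(1) by simp
  have "label \<kappa> f V ` Pts \<subseteq> {Same, Val None} \<union> (\<lambda>y. Val (Some y)) ` ?H"
    by (auto simp: label_def)
  then have "card (label \<kappa> f V ` Pts) \<le> card ({Same, Val None} \<union> (\<lambda>y. Val (Some y)) ` ?H)"
    using finH by (intro card_mono) auto
  also have "\<dots> \<le> card {Same, Val None :: 'x option outcome} + card ((\<lambda>y. Val (Some y)) ` ?H)"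
    by (rule card_Un_le)
  also have "\<dots> \<le> 2 + M"
    using card_image_le[OF finH, of "\<lambda>y. Val (Some y)"] H by (simp add: card_insert_if)
  finally show ?thesis by simp
qed

text \<open>Everything is measured in units of 1/s of the expected number 2t of encodings. Label
  classes are bounded from below only: with the upper bound on the total, the lower bound for the
  complement of a class bounds the class from above. The last condition concerns the points on which
  the label wrongly predicts failure.\<close>

definition good :: "nat \<Rightarrow> nat \<Rightarrow> ('x \<Rightarrow> 'x) \<Rightarrow> 'y set \<Rightarrow> 'y set \<Rightarrow> 'p \<Rightarrow> bool" where
  "good s t f V Z P \<longleftrightarrow>
     real (card {x\<in>Pts. ev P x \<in> V}) \<le> (1 + 1 / real s) * (2 * real t) \<and>
     (\<forall>L\<subseteq>label (16 * (real s)\<^sup>2) f V ` Pts.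
        real (card V) / real (card Y) * real (card {x\<in>Pts. label (16 * (real s)\<^sup>2) f V x \<in> L}) -
          1 / real s * (2 * real t) \<le>
        real (card {x\<in>Pts. ev P x \<in> V \<and> label (16 * (real s)\<^sup>2) f V x \<in> L})) \<and>
     real (card {x\<in>Pts. ev P x \<in> V \<and> label (16 * (real s)\<^sup>2) f V x = Val None \<and> ev P (f x) \<in> Z}) \<le>
       1 / real s * (2 * real t)"

text \<open>With t = s v, an excess of 2t/s is 2v, and v-th moments leave 2t + v in the denominator.
  The ratio is 1 / (1 + 1/(2s)); by Bernoulli's inequality 2s such factors contribute at most 1/2,
  and v is 2s times 2^12 s \<tau>.\<close>

lemma prob_size_large:
  assumes s: "0 < s" and \<tau>: "0 < \<tau>" and t: "t = 2 ^ 13 * s ^ 3 * \<tau>" and V: "V \<subseteq> Y"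
    and \<mu>: "real (card Pts) * (real (card V) / real (card Y)) = 2 * real t" and D: "9 * t \<le> D"
  shows "measure_pmf.prob p {P. \<not> real (card {x\<in>Pts. ev P x \<in> V}) \<le> (1 + 1 / real s) * (2 * real t)}
    \<le> (1 / 2) ^ \<tau>"
proof -
  define v where "v = 2 ^ 13 * s ^ 2 * \<tau>"
  have tv: "t = s * v" unfolding t v_def by (simp only: power3_eq_cube power2_eq_square mult_ac)
  have v0: "0 < v" using s \<tau> by (simp add: v_def)
  have "v \<le> t" unfolding tv using s by simp
  have "measure_pmf.prob p {P. \<not> real (card {x\<in>Pts. ev P x \<in> V}) \<le> (1 + 1 / real s) * (2 * real t)}
      \<le> measure_pmf.prob p {P. 2 * t + 2 * v \<le> card {x\<in>Pts. ev P x \<in> V}}"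
  proof (rule measure_pmf.finite_measure_mono)
    have "(1 + 1 / real s) * (2 * (real s * real v)) = 2 * (real s * real v) + 2 * real v"
      using s by (simp add: distrib_right)
    then have "(1 + 1 / real s) * (2 * real t) = real (2 * t + 2 * v)"
      by (simp only: tv of_nat_add of_nat_mult of_nat_numeral)
    then show "{P. \<not> real (card {x\<in>Pts. ev P x \<in> V}) \<le> (1 + 1 / real s) * (2 * real t)} \<subseteq>
        {P. 2 * t + 2 * v \<le> card {x\<in>Pts. ev P x \<in> V}}"
      by (auto simp del: of_nat_add of_nat_mult)
  qed simp
  also have "\<dots> \<le> (real (card Pts) * (real (card V) / real (card Y)) / real (2 * t + 2 * v - v)) ^ v"
    by (rule prob_upper_tail[OF V]) (use v0 \<open>v \<le> t\<close> D in auto)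
  also have "real (2 * t + 2 * v - v) = real v * (2 * real s + 1)"
    by (simp add: tv algebra_simps)
  also have "real (card Pts) * (real (card V) / real (card Y)) / (real v * (2 * real s + 1)) =
      1 / (1 + 1 / (2 * real s))"
  proof -
    have "2 * real t / (real v * (2 * real s + 1)) = 2 * real s / (2 * real s + 1)"
      using v0 by (simp add: tv)
    also have "\<dots> = 1 / (1 + 1 / (2 * real s))" using s by (simp add: field_simps)
    finally show ?thesis unfolding \<mu> .
  qed
  also have "(1 / (1 + 1 / (2 * real s))) ^ v \<le> (1 / 2) ^ \<tau>"
  proof -
    have "1 + real (2 * s) * (1 / (2 * real s)) \<le> (1 + 1 / (2 * real s)) ^ (2 * s)"
      by (rule Bernoulli_inequality) (use s in \<open>auto intro: order_trans[of _ 0]\<close>)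
    then have "2 \<le> (1 + 1 / (2 * real s)) ^ (2 * s)" using s by simp
    then have "2 ^ (2 ^ 12 * s * \<tau>) \<le> ((1 + 1 / (2 * real s)) ^ (2 * s)) ^ (2 ^ 12 * s * \<tau>)"
      by (intro power_mono) auto
    also have "\<dots> = (1 + 1 / (2 * real s)) ^ v"
      by (simp add: v_def power_mult[symmetric] power2_eq_square mult_ac)
    finally have "2 ^ (2 ^ 12 * s * \<tau>) \<le> (1 + 1 / (2 * real s)) ^ v" .
    moreover have "(2::real) ^ \<tau> \<le> 2 ^ (2 ^ 12 * s * \<tau>)"
      using s by (intro power_increasing) auto
    ultimately have "(2::real) ^ \<tau> \<le> (1 + 1 / (2 * real s)) ^ v" by linarith
    then have "1 / (1 + 1 / (2 * real s)) ^ v \<le> 1 / 2 ^ \<tau>"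
      by (rule divide_left_mono) (auto intro!: mult_pos_pos zero_less_power add_pos_nonneg)
    then show ?thesis by (simp only: power_one_over)
  qed
  finally show ?thesis .
qed

text \<open>This is where the threshold \<kappa> = 16 s^2 comes from. Writing 2t = \<kappa> M, at
  most M + 2 labels occur, so there are at most 2^(M+2) sets L of labels, while the lower tail with
  deviation 2t/s has the exponent 2t/(8 s^2) = 2M. The union bound over all L therefore still gains
  a factor 2^M.\<close>

lemma prob_label_class_small:
  assumes s: "0 < s" and \<tau>: "0 < \<tau>" and t: "t = 2 ^ 13 * s ^ 3 * \<tau>" and V: "V \<subseteq> Y"
    and \<mu>: "real (card Pts) * (real (card V) / real (card Y)) = 2 * real t" and D: "9 * t \<le> D"
  shows "measure_pmf.prob p {P. \<not> (\<forall>L\<subseteq>label (16 * (real s)\<^sup>2) f V ` Pts.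
        real (card V) / real (card Y) * real (card {x\<in>Pts. label (16 * (real s)\<^sup>2) f V x \<in> L}) -
          1 / real s * (2 * real t) \<le>
        real (card {x\<in>Pts. ev P x \<in> V \<and> label (16 * (real s)\<^sup>2) f V x \<in> L}))} \<le> (1 / 2) ^ \<tau>"
proof -
  let ?lab = "label (16 * (real s)\<^sup>2) f V"
  define M where "M = 2 ^ 10 * s * \<tau>"
  let ?B = "\<lambda>L. {P. real (card {x\<in>{x\<in>Pts. ?lab x \<in> L}. ev P x \<in> V}) \<le>
    real (card V) / real (card Y) * real (card {x\<in>Pts. ?lab x \<in> L}) - 1 / real s * (2 * real t)}"
  have eqs: "{x\<in>{x\<in>Pts. ?lab x \<in> L}. ev P x \<in> V} = {x\<in>Pts. ev P x \<in> V \<and> ?lab x \<in> L}" for L P by auto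
  have tM: "(1 / real s)\<^sup>2 * (2 * real t) / 8 = 2 * real M" "2 * real t = 16 * (real s)\<^sup>2 * real M"
    using s by (simp_all add: t M_def field_simps power2_eq_square power3_eq_cube)
  have finL: "finite (Pow (?lab ` Pts))" using finite_Pts by simp
  have "measure_pmf.prob p {P. \<not> (\<forall>L\<subseteq>?lab ` Pts.
      real (card V) / real (card Y) * real (card {x\<in>Pts. ?lab x \<in> L}) - 1 / real s * (2 * real t) \<le>
      real (card {x\<in>Pts. ev P x \<in> V \<and> ?lab x \<in> L}))} \<le>
      measure_pmf.prob p (\<Union>L\<in>Pow (?lab ` Pts). ?B L)"
  proof (rule measure_pmf.finite_measure_mono, rule subsetI)
    fix P
    assume "P \<in> {P. \<not> (\<forall>L\<subseteq>?lab ` Pts.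
      real (card V) / real (card Y) * real (card {x\<in>Pts. ?lab x \<in> L}) - 1 / real s * (2 * real t) \<le>
      real (card {x\<in>Pts. ev P x \<in> V \<and> ?lab x \<in> L}))}"
    then obtain L where L: "L \<in> Pow (?lab ` Pts)" "\<not> (real (card V) / real (card Y) *
        real (card {x\<in>Pts. ?lab x \<in> L}) - 1 / real s * (2 * real t) \<le>
        real (card {x\<in>Pts. ev P x \<in> V \<and> ?lab x \<in> L}))"
      by blast
    have "P \<in> ?B L"
      unfolding eqs by (rule CollectI, rule less_imp_le, rule not_le_imp_less, rule L(2))
    with L(1) show "P \<in> (\<Union>L\<in>Pow (?lab ` Pts). ?B L)" by blast
  qed simp
  also have "\<dots> \<le> (\<Sum>L\<in>Pow (?lab ` Pts). measure_pmf.prob p (?B L))"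
    by (rule measure_pmf.finite_measure_subadditive_finite[OF finL]) auto
  also have "\<dots> \<le> (\<Sum>L\<in>Pow (?lab ` Pts). 2 * exp (- ((1 / real s)\<^sup>2 * (2 * real t) / 8)))"
  proof (rule sum_mono)
    fix L assume "L \<in> Pow (?lab ` Pts)"
    have "real (card V) / real (card Y) * real (card {x\<in>Pts. ?lab x \<in> L}) \<le> 2 * real t"
      unfolding \<mu>[symmetric] mult.commute[of "real (card Pts)"]
      by (intro mult_left_mono of_nat_mono card_mono) (use finite_Pts in auto)
    moreover have "2 \<le> t"
    proof -
      have "1 \<le> s ^ 3 * \<tau>" using s \<tau> by simp
      then show ?thesis unfolding t by simp
    qed
    then have "4 * (2 * real t) + 2 \<le> real D" using D by linarith
    ultimately show "measure_pmf.prob p (?B L) \<le> 2 * exp (- ((1 / real s)\<^sup>2 * (2 * real t) / 8))"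
      by (intro prob_lower_tail) (use V s in auto)
  qed
  also have "\<dots> = 2 ^ card (?lab ` Pts) * (2 * exp (- (2 * real M)))"
    unfolding tM(1) using finite_Pts by (simp add: card_Pow)
  also have "\<dots> \<le> 2 ^ (M + 2) * (2 * exp (- (2 * real M)))"
  proof (intro mult_right_mono power_increasing)
    show "card (?lab ` Pts) \<le> M + 2"
      by (rule card_label_image) (use s \<mu> tM in auto)
  qed auto
  also have "exp (- (2 * real M)) \<le> (1 / 2) ^ (2 * M)"
  proof -
    have "exp (- (2 * real M)) = exp (-1) ^ (2 * M)" by (simp add: exp_of_nat_mult[symmetric])
    also have "exp (-1) \<le> (1 / 2 :: real)"
      using exp_ge_add_one_self[of 1] by (simp add: exp_minus field_simps)
    then have "exp (-1) ^ (2 * M) \<le> (1 / 2 :: real) ^ (2 * M)" by (intro power_mono) auto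
    finally show ?thesis .
  qed
  then have "2 ^ (M + 2) * (2 * exp (- (2 * real M))) \<le> 2 ^ (M + 2) * (2 * (1 / 2) ^ (2 * M))"
    by simp
  also have "\<dots> = 8 * (1 / 2) ^ M"
  proof -
    have "(2::real) ^ M * (1 / 2) ^ M = 1" by (simp add: power_mult_distrib[symmetric])
    moreover have "(1 / 2 :: real) ^ (2 * M) = (1 / 2) ^ M * (1 / 2) ^ M"
      by (simp only: mult_2 power_add)
    moreover have "4 * x * (2 * (y * y)) = 8 * (x * y) * y" for x y :: real by simp
    moreover have "(2::real) ^ (M + 2) = 4 * 2 ^ M" by (simp add: power_add)
    ultimately show ?thesis by simp
  qed
  also have "\<dots> \<le> 8 * (1 / 2) ^ (\<tau> + 3)"
  proof -
    have "\<tau> + 3 \<le> 2 ^ 10 * \<tau>" using \<tau> by simp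
    also have "\<dots> \<le> M" using s by (simp add: M_def)
    finally have "(1 / 2 :: real) ^ M \<le> (1 / 2) ^ (\<tau> + 3)" by (intro power_decreasing) auto
    then show ?thesis by simp
  qed
  also have "\<dots> = (1 / 2) ^ \<tau>" by (simp add: power_add power3_eq_cube)
  finally show ?thesis by simp
qed

text \<open>The budget 2t/s = 2^14 s^2 \<tau> is divided into equal halves. One is for points in
  overloaded fibres, with a = 16 \<kappa> = 256 s^2 and 2 a (16 \<tau>) = 2^13 s^2 \<tau>. The other
  is for edges whose fibre is not overloaded: the density 1/(8s) of Z makes their expected number at
  most 2^11 s^2 \<tau>, half of the 2^12 s^2 \<tau> that remain after subtracting the conflicts 4 a
  (4 \<tau>).\<close>

lemma prob_light_decoded:
  assumes s: "0 < s" and \<tau>: "0 < \<tau>" and t: "t = 2 ^ 13 * s ^ 3 * \<tau>" and V: "V \<subseteq> Y"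
    and \<mu>: "real (card Pts) * (real (card V) / real (card Y)) = 2 * real t" and D: "9 * t \<le> D"
    and f: "f ` Pts \<subseteq> Pts" and Z: "Z \<subseteq> Y" "real (card Z) / real (card Y) \<le> 1 / (8 * real s)"
  shows "measure_pmf.prob p {P. \<not> real (card {x\<in>Pts. ev P x \<in> V \<and>
      label (16 * (real s)\<^sup>2) f V x = Val None \<and> ev P (f x) \<in> Z}) \<le> 1 / real s * (2 * real t)} \<le>
    2 * (1 / 2) ^ \<tau>"
proof -
  let ?lab = "label (16 * (real s)\<^sup>2) f V"
  define a where "a = 256 * s ^ 2"
  define Pts' where "Pts' = {x\<in>Pts. ?lab x = Val None}"
  let ?deg = "\<lambda>P x. card {x'\<in>Pts'. ev P x' \<in> V \<and> f x' = f x}"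
  let ?O = "\<lambda>P. {x\<in>Pts'. ev P x \<in> V \<and> a \<le> ?deg P x}"
  let ?U = "\<lambda>P. {x\<in>Pts'. ev P x \<in> V \<and> ev P (f x) \<in> Z \<and> ?deg P x < a}"
  have Pts': "Pts' \<subseteq> Pts" "f ` Pts' \<subseteq> Pts" "\<And>x. x \<in> Pts' \<Longrightarrow> f x \<noteq> x"
    using f by (auto simp: Pts'_def label_def split: if_splits)
  have finX': "finite Pts'" using Pts'(1) finite_Pts finite_subset by blast
  have O: "measure_pmf.prob p {P. 2 * a * (16 * \<tau>) \<le> card (?O P)} \<le> (1 / 2) ^ \<tau>"
  proof -
    have "measure_pmf.prob p {P. 2 * a * (16 * \<tau>) \<le> card (?O P)} \<le>
        (2 * real t * (1 / 4) ^ a / real (16 * \<tau> - 8 * \<tau>)) ^ (8 * \<tau>)"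
    proof (rule prob_overloaded[where \<kappa> = "16 * (real s)\<^sup>2"])
      fix x assume x: "x \<in> Pts'"
      then have "cell_mass f V (f x) < 16 * (real s)\<^sup>2"
        by (auto simp: Pts'_def label_def split: if_splits)
      moreover have "card {x'\<in>Pts'. f x' = f x} \<le> card {x'\<in>Pts. f x' = f x \<and> f x' \<noteq> x'}"
        using Pts' finite_Pts by (intro card_mono) auto
      then have "real (card {x'\<in>Pts'. f x' = f x}) * (real (card V) / real (card Y)) \<le>
          cell_mass f V (f x)"
        unfolding cell_mass_def by (intro mult_right_mono) auto
      ultimately show "real (card {x'\<in>Pts'. f x' = f x}) * (real (card V) / real (card Y)) \<le>
          16 * (real s)\<^sup>2" by linarith
    next
      have "1 \<le> (real s)\<^sup>2" using s by (simp add: one_le_power)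
      then show "1 \<le> 16 * (real s)\<^sup>2" by linarith
      have "s ^ 2 * 1 \<le> s ^ 2 * s" using s by (intro mult_left_mono) auto
      then have "s ^ 2 \<le> s ^ 3" by (simp add: power2_eq_square power3_eq_cube)
      then have "a * (8 * \<tau>) \<le> t" by (simp add: a_def t)
      then show "a * (8 * \<tau>) \<le> D" using D by linarith
    qed (use Pts' V \<mu> \<tau> in \<open>auto simp: a_def\<close>)
    also have "\<dots> \<le> (1 / 2) ^ (8 * \<tau>)"
    proof (rule power_mono)
      \<comment> \<open>After cancelling \<tau> the claim reads 2^12 s^3 \<le> 4^a.\<close>
      have "s ^ 3 \<le> (2 ^ s) ^ 3" by (intro power_mono) (auto intro: less_imp_le)
      then have "2 ^ 12 * s ^ 3 \<le> 2 ^ 12 * (2 ^ s) ^ 3" by (rule mult_le_mono2)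
      also have "\<dots> = 2 ^ (12 + 3 * s)" by (simp only: power_add power_mult mult.commute[of 3 s])
      also have "(2::nat) ^ (12 + 3 * s) \<le> 2 ^ (2 * a)"
      proof (rule power_increasing)
        have "s * 1 \<le> s * s" using s by (intro mult_left_mono) auto
        moreover have "1 \<le> s" using s by simp
        ultimately have "12 + 3 * s \<le> 512 * (s * s)" by linarith
        then show "12 + 3 * s \<le> 2 * a" by (simp add: a_def power2_eq_square)
      qed simp
      finally have "real (2 ^ 12 * s ^ 3) \<le> real (2 ^ (2 * a))" by (rule of_nat_mono)
      then have "2 ^ 12 * real s ^ 3 \<le> 4 ^ a" by (simp add: power_mult)
      then show "2 * real t * (1 / 4) ^ a / real (16 * \<tau> - 8 * \<tau>) \<le> 1 / 2"
        using \<tau> by (simp add: t field_simps)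
    qed auto
    also have "\<dots> \<le> (1 / 2) ^ \<tau>" by (intro power_decreasing) auto
    finally show ?thesis .
  qed
  have U: "measure_pmf.prob p {P. 2 ^ 13 * s ^ 2 * \<tau> \<le> card (?U P)} \<le> (1 / 2) ^ \<tau>"
  proof -
    have diff: "2 ^ 13 * s ^ 2 * \<tau> - 4 * a * (4 * \<tau>) = 2 ^ 12 * s ^ 2 * \<tau>"
      by (simp add: a_def)
    have "measure_pmf.prob p {P. 2 ^ 13 * s ^ 2 * \<tau> \<le> card (?U P)} \<le>
        (real (card Pts) * (real (card V) / real (card Y)) * (real (card Z) / real (card Y)) /
          real (2 ^ 13 * s ^ 2 * \<tau> - 4 * a * (4 * \<tau>))) ^ (4 * \<tau>)"
    proof (rule prob_edges)
      show "4 * a * (4 * \<tau>) < 2 ^ 13 * s ^ 2 * \<tau>" using s \<tau> by (simp add: a_def)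
      have "\<tau> \<le> s ^ 3 * \<tau>" using s by simp
      then have "2 * (4 * \<tau>) \<le> t" unfolding t by simp
      then show "2 * (4 * \<tau>) \<le> D" using D by linarith
    qed (use Pts' V Z s in \<open>auto simp: a_def\<close>)
    also have "\<dots> \<le> (1 / 2) ^ (4 * \<tau>)"
    proof (rule power_mono)
      have "2 * real t * (real (card Z) / real (card Y)) \<le> 2 * real t * (1 / (8 * real s))"
        by (intro mult_left_mono Z) auto
      also have "\<dots> = 1 / 2 * real (2 ^ 12 * s ^ 2 * \<tau>)"
        using s by (simp add: t power2_eq_square power3_eq_cube field_simps)
      finally have le: "2 * real t * (real (card Z) / real (card Y)) \<le>
          1 / 2 * real (2 ^ 12 * s ^ 2 * \<tau>)" .
      show "real (card Pts) * (real (card V) / real (card Y)) * (real (card Z) / real (card Y)) /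
          real (2 ^ 13 * s ^ 2 * \<tau> - 4 * a * (4 * \<tau>)) \<le> 1 / 2"
      proof -
        have "0 < real (2 ^ 12 * s ^ 2 * \<tau>)" using s \<tau> by simp
        then show ?thesis unfolding \<mu> diff using le by (simp only: pos_divide_le_eq)
      qed
    qed auto
    also have "\<dots> \<le> (1 / 2) ^ \<tau>" by (intro power_decreasing) auto
    finally show ?thesis .
  qed
  have "measure_pmf.prob p {P. \<not> real (card {x\<in>Pts. ev P x \<in> V \<and>
      ?lab x = Val None \<and> ev P (f x) \<in> Z}) \<le> 1 / real s * (2 * real t)} \<le>
      measure_pmf.prob p ({P. 2 * a * (16 * \<tau>) \<le> card (?O P)} \<union> {P. 2 ^ 13 * s ^ 2 * \<tau> \<le> card (?U P)})"
  proof (rule measure_pmf.finite_measure_mono)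
    show "{P. \<not> real (card {x\<in>Pts. ev P x \<in> V \<and> ?lab x = Val None \<and> ev P (f x) \<in> Z}) \<le>
        1 / real s * (2 * real t)} \<subseteq>
      {P. 2 * a * (16 * \<tau>) \<le> card (?O P)} \<union> {P. 2 ^ 13 * s ^ 2 * \<tau> \<le> card (?U P)}"
    proof
      fix P assume "P \<in> {P. \<not> real (card {x\<in>Pts. ev P x \<in> V \<and> ?lab x = Val None \<and> ev P (f x) \<in> Z}) \<le>
        1 / real s * (2 * real t)}"
      moreover have "1 / real s * (2 * real t) = real (2 ^ 14 * s ^ 2 * \<tau>)"
        using s by (simp add: t power2_eq_square power3_eq_cube)
      ultimately have "2 ^ 14 * s ^ 2 * \<tau> <
          card {x\<in>Pts. ev P x \<in> V \<and> ?lab x = Val None \<and> ev P (f x) \<in> Z}"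
        by (simp only: mem_Collect_eq of_nat_le_iff not_le)
      also have "\<dots> \<le> card (?O P \<union> ?U P)"
      proof (rule card_mono)
        show "finite (?O P \<union> ?U P)" by (rule finite_subset[OF _ finX']) auto
      qed (auto simp: Pts'_def)
      also have "\<dots> \<le> card (?O P) + card (?U P)" by (rule card_Un_le)
      finally have lt: "2 ^ 14 * s ^ 2 * \<tau> < card (?O P) + card (?U P)" .
      have "2 ^ 14 * s ^ 2 * \<tau> = 2 ^ 13 * s ^ 2 * \<tau> + 2 ^ 13 * s ^ 2 * \<tau>" by simp
      moreover have "y \<le> c \<or> y \<le> d" if "x < c + d" "x = y + y" for x y c d :: nat
        using that by linarith
      ultimately have "2 ^ 13 * s ^ 2 * \<tau> \<le> card (?O P) \<or> 2 ^ 13 * s ^ 2 * \<tau> \<le> card (?U P)"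
        using lt by blast
      moreover have "2 * a * (16 * \<tau>) = 2 ^ 13 * s ^ 2 * \<tau>" by (simp add: a_def)
      ultimately show "P \<in> {P. 2 * a * (16 * \<tau>) \<le> card (?O P)} \<union> {P. 2 ^ 13 * s ^ 2 * \<tau> \<le> card (?U P)}"
        by (simp only: Un_iff mem_Collect_eq)
    qed
  qed simp
  also have "\<dots> \<le> measure_pmf.prob p {P. 2 * a * (16 * \<tau>) \<le> card (?O P)} +
      measure_pmf.prob p {P. 2 ^ 13 * s ^ 2 * \<tau> \<le> card (?U P)}"
    by (rule measure_Un_le) auto
  also have "\<dots> \<le> 2 * (1 / 2) ^ \<tau>" using O U by linarith
  finally show ?thesis .
qed

theorem prob_not_good:
  assumes "0 < s" "0 < \<tau>" "t = 2 ^ 13 * s ^ 3 * \<tau>" "V \<subseteq> Y"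
    "real (card Pts) * (real (card V) / real (card Y)) = 2 * real t" "9 * t \<le> D"
    "f ` Pts \<subseteq> Pts" "Z \<subseteq> Y" "real (card Z) / real (card Y) \<le> 1 / (8 * real s)"
  shows "measure_pmf.prob p {P. \<not> good s t f V Z P} \<le> 4 * (1 / 2) ^ \<tau>"
proof -
  have "{P. \<not> good s t f V Z P} =
      {P. \<not> real (card {x\<in>Pts. ev P x \<in> V}) \<le> (1 + 1 / real s) * (2 * real t)} \<union>
      ({P. \<not> (\<forall>L\<subseteq>label (16 * (real s)\<^sup>2) f V ` Pts.
        real (card V) / real (card Y) * real (card {x\<in>Pts. label (16 * (real s)\<^sup>2) f V x \<in> L}) -
          1 / real s * (2 * real t) \<le>
        real (card {x\<in>Pts. ev P x \<in> V \<and> label (16 * (real s)\<^sup>2) f V x \<in> L}))} \<union>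
      {P. \<not> real (card {x\<in>Pts. ev P x \<in> V \<and>
        label (16 * (real s)\<^sup>2) f V x = Val None \<and> ev P (f x) \<in> Z}) \<le> 1 / real s * (2 * real t)})"
    (is "_ = ?A \<union> (?B \<union> ?C)")
    unfolding good_def by blast
  then have "measure_pmf.prob p {P. \<not> good s t f V Z P} \<le>
      measure_pmf.prob p ?A + measure_pmf.prob p (?B \<union> ?C)"
    by (simp only:) (rule measure_Un_le, auto)
  moreover have "measure_pmf.prob p (?B \<union> ?C) \<le> measure_pmf.prob p ?B + measure_pmf.prob p ?C"
    by (rule measure_Un_le) auto
  ultimately show ?thesis
    using prob_size_large[OF assms(1-6)] prob_label_class_small[OF assms(1-6), of f]
      prob_light_decoded[OF assms(1-6) assms(7-9)] by linarith
qed

end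

section \<open>From counting bounds to statistical distance\<close>

lemma stat_dist_leI:
  assumes "\<And>A. \<bar>measure_pmf.prob p A - measure_pmf.prob q A\<bar> \<le> e"
  shows "stat_dist p q \<le> e"
  unfolding stat_dist_def by (rule cSUP_least) (use assms in auto)

text \<open>The lower bound for the complement of T, together with the bound on the size of E,
  supplies the missing upper bound, so h' on E and h' on all of \<open>Pts\<close> are 2e-close.
  Points where h and h' differ number at most e \<mu>, which is at most 2 e |E| because E has at
  least (1 - e) \<mu> \<ge> \<mu> / 2 elements.\<close>

lemma stat_dist_sample_le:
  fixes e \<mu> pr :: real and h h' :: "'x \<Rightarrow> 'r"
  assumes fin: "finite Pts" "Pts \<noteq> {}" and E: "E \<subseteq> Pts" "E \<noteq> {}" and e: "0 < e" "e \<le> 1 / 2" and \<mu>: "0 < \<mu>"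
    and pr: "pr * real (card Pts) = \<mu>"
    and upper: "real (card E) \<le> (1 + e) * \<mu>"
    and lower: "\<And>T. pr * real (card {x\<in>Pts. h' x \<in> T}) - e * \<mu> \<le> real (card {x\<in>E. h' x \<in> T})"
    and bad: "real (card {x\<in>E. h x \<noteq> h' x}) \<le> e * \<mu>"
  shows "stat_dist (map_pmf h (pmf_of_set E)) (map_pmf h' (pmf_of_set Pts)) \<le> 4 * e"
proof (rule stat_dist_leI)
  fix T
  have finE: "finite E" using E fin finite_subset by blast
  let ?n = "real (card E)"
  let ?a = "real (card {x\<in>E. h x \<in> T})" and ?b = "\<lambda>T. real (card {x\<in>E. h' x \<in> T})"
  define c where "c = (\<lambda>T. real (card {x\<in>Pts. h' x \<in> T}) / real (card Pts))"
  have n: "0 < ?n" using E finE by (simp add: card_gt_0_iff)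
  have X0: "0 < real (card Pts)" using fin by (simp add: card_gt_0_iff)
  have prc: "pr * real (card {x\<in>Pts. h' x \<in> T}) = c T * \<mu>" for T
    using X0 by (simp add: pr[symmetric] c_def)
  have n_ge: "(1 - e) * \<mu> \<le> ?n"
    using lower[of UNIV] pr by (simp add: algebra_simps)
  have c1: "c T \<le> 1" for T
    using X0 card_mono[OF fin(1), of "{x\<in>Pts. h' x \<in> T}"] by (simp add: divide_le_eq c_def)
  have b_ge: "(c T - 2 * e) * ?n \<le> ?b T" for T
  proof (cases "0 \<le> c T - 2 * e")
    case True
    have "(c T - 2 * e) * ?n \<le> (c T - 2 * e) * ((1 + e) * \<mu>)"
      by (rule mult_left_mono[OF upper True])
    also have "\<dots> = (c T - e) * \<mu> - ((1 - c T) * e + 2 * e\<^sup>2) * \<mu>"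
      by (simp add: algebra_simps power2_eq_square)
    also have "\<dots> \<le> (c T - e) * \<mu>"
      using c1[of T] e \<mu> by (simp add: add_nonneg_nonneg)
    also have "\<dots> \<le> ?b T" using lower[of T] prc[of T] by (simp add: algebra_simps)
    finally show ?thesis .
  next
    case False
    then have "(c T - 2 * e) * ?n \<le> 0" using n by (simp add: mult_nonpos_nonneg)
    then show ?thesis by (rule order_trans) simp
  qed
  have compl: "?b (- T) = ?n - ?b T" "c (- T) = 1 - c T"
  proof -
    have "{x\<in>E. h' x \<in> - T} = E - {x\<in>E. h' x \<in> T}" by auto
    then show "?b (- T) = ?n - ?b T"
      using finE card_mono[OF finE, of "{x\<in>E. h' x \<in> T}"] by (simp add: card_Diff_subset)
    have "{x\<in>Pts. h' x \<in> - T} = Pts - {x\<in>Pts. h' x \<in> T}" by auto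
    then show "c (- T) = 1 - c T"
      using fin X0 card_mono[OF fin(1), of "{x\<in>Pts. h' x \<in> T}"]
      by (simp add: card_Diff_subset diff_divide_distrib c_def)
  qed
  have b_le: "?b T \<le> (c T + 2 * e) * ?n"
    using b_ge[of "- T"] unfolding compl by (simp add: algebra_simps)
  have ab: "\<bar>?a - ?b T\<bar> \<le> 2 * e * ?n"
  proof -
    let ?D = "{x\<in>E. h x \<noteq> h' x}"
    have "card {x\<in>E. h x \<in> T} \<le> card ({x\<in>E. h' x \<in> T} \<union> ?D)"
      "card {x\<in>E. h' x \<in> T} \<le> card ({x\<in>E. h x \<in> T} \<union> ?D)"
      using finE by (auto intro!: card_mono)
    then have "card {x\<in>E. h x \<in> T} \<le> card {x\<in>E. h' x \<in> T} + card ?D"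
      "card {x\<in>E. h' x \<in> T} \<le> card {x\<in>E. h x \<in> T} + card ?D"
      using card_Un_le[of "{x\<in>E. h' x \<in> T}" ?D] card_Un_le[of "{x\<in>E. h x \<in> T}" ?D] by linarith+
    then have "\<bar>?a - ?b T\<bar> \<le> e * \<mu>" using bad by linarith
    also have "e * \<mu> \<le> 2 * e * ((1 - e) * \<mu>)"
    proof -
      have "\<mu> * 1 \<le> \<mu> * (2 * (1 - e))" using e \<mu> by (intro mult_left_mono) auto
      then have "e * \<mu> \<le> e * (\<mu> * (2 * (1 - e)))" using e by (intro mult_left_mono) auto
      then show ?thesis by (simp add: mult_ac)
    qed
    also have "\<dots> \<le> 2 * e * ?n" using n_ge e by (intro mult_left_mono) auto
    finally show ?thesis .
  qed
  have "\<bar>?a - c T * ?n\<bar> \<le> 4 * e * ?n"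
    using ab b_ge[of T] b_le by (simp add: algebra_simps)
  then have "\<bar>?a / ?n - c T\<bar> \<le> 4 * e"
    using n by (simp add: field_simps abs_le_iff)
  moreover have "measure_pmf.prob (map_pmf h (pmf_of_set E)) T = ?a / ?n"
    using finE E(2) by (simp add: measure_pmf_of_set vimage_def Int_def conj_commute)
  moreover have "measure_pmf.prob (map_pmf h' (pmf_of_set Pts)) T = c T"
    using fin by (simp add: c_def measure_pmf_of_set vimage_def Int_def conj_commute)
  ultimately show "\<bar>measure_pmf.prob (map_pmf h (pmf_of_set E)) T -
      measure_pmf.prob (map_pmf h' (pmf_of_set Pts)) T\<bar> \<le> 4 * e"
    by simp
qed

section \<open>A functional expression language compiled to WHILE programs\<close>

definition iterate :: "nat \<Rightarrow> config pmf \<Rightarrow> config pmf" where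
  "iterate T = (\<lambda>p. bind_pmf p step) ^^ T"

text \<open>All T steps together have a single possible outcome, so deterministic stretches of a
  program can be treated without distributions.\<close>

definition steps :: "nat \<Rightarrow> config \<Rightarrow> config \<Rightarrow> bool" where
  "steps T c d \<longleftrightarrow> iterate T (return_pmf c) = return_pmf d"

lemma iterate_0 [simp]: "iterate 0 p = p"
  by (simp add: iterate_def)

lemma iterate_add: "iterate (S + T) p = iterate T (iterate S p)"
  by (simp add: iterate_def add.commute[of S T] funpow_add)

lemma iterate_Suc: "iterate (Suc T) (return_pmf c) = iterate T (step c)"
  using iterate_add[of 1 T "return_pmf c"] by (simp add: iterate_def bind_return_pmf)

lemma iterate_bind: "iterate T p = bind_pmf p (\<lambda>c. iterate T (return_pmf c))"
proof (induction T)
  case (Suc T)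
  have *: "iterate (Suc T) q = bind_pmf (iterate T q) step" for q by (simp add: iterate_def)
  show ?case unfolding * by (subst Suc) (simp only: bind_assoc_pmf)
qed (simp add: bind_return_pmf')

lemma steps_0: "steps 0 c c"
  by (simp add: steps_def)

lemma steps_trans: "steps S c d \<Longrightarrow> steps T d e \<Longrightarrow> steps (S + T) c e"
  by (simp add: steps_def iterate_add)

lemma steps_Suc: "step c = return_pmf d \<Longrightarrow> steps T d e \<Longrightarrow> steps (Suc T) c e"
  by (simp add: steps_def iterate_Suc)

lemma steps_step: "step c = return_pmf d \<Longrightarrow> steps 1 c d"
  using steps_Suc[OF _ steps_0] by simp

text \<open>Variables are addressed by position in the environment, new ones being appended. The
  only loop is \<open>EFold\<close>, which stops after as many rounds as the clock has entries, so that
  running times are bounded syntactically.\<close>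

datatype exp =
    EVar nat
  | ENil
  | EClk
  | ECons exp exp
  | EHd exp
  | ETl exp
  | EIf exp exp exp
  | ELet exp exp
  | EFold exp exp exp
  | ECall exp "exp list"

definition clen :: "cell \<Rightarrow> nat" where
  "clen k = length (list_of_cell k)"

text \<open>At most as many entries of l are read as the clock k has. Every later correctness
  statement therefore assumes the clock to be long enough for the lists that occur.\<close>

definition cfold :: "cell \<Rightarrow> (cell \<Rightarrow> cell \<Rightarrow> cell) \<Rightarrow> cell \<Rightarrow> cell \<Rightarrow> cell" where
  "cfold k g a l = foldl g a (take (clen k) (list_of_cell l))"

text \<open>The body of a fold finds the current entry at position \<open>length env\<close> and the
  accumulator right after it; the body of a call sees its arguments only. The numeric indices in the
  programs below are determined by these two rules.\<close>

fun ev :: "cell \<Rightarrow> exp \<Rightarrow> cell list \<Rightarrow> cell" where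
  "ev k (EVar i) env = (if i < length env then env ! i else Atom)"
| "ev k ENil env = Atom"
| "ev k EClk env = k"
| "ev k (ECons a b) env = Cell (ev k a env) (ev k b env)"
| "ev k (EHd a) env = left (ev k a env)"
| "ev k (ETl a) env = right (ev k a env)"
| "ev k (EIf c a b) env = (if ev k c env = Atom then ev k b env else ev k a env)"
| "ev k (ELet a b) env = ev k b (env @ [ev k a env])"
| "ev k (EFold l i b) env =
     cfold k (\<lambda>acc x. ev k b (env @ [x, acc])) (ev k i env) (ev k l env)"
| "ev k (ECall f es) env = ev k f (map (\<lambda>e. ev k e env) es)"

text \<open>Register 0 holds the clock and \<open>vs\<close> the registers of the environment, all
  of them below r. The result is left in r, and no register below r changes, so that intermediate
  values survive without being saved. In a fold the registers r to r + 3 hold the remaining list,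
  the accumulator, the remaining clock and the current entry; when the list ends first, the loop
  idles until the clock has run out.\<close>

fun compile :: "exp \<Rightarrow> nat list \<Rightarrow> nat \<Rightarrow> com" and compiles :: "exp list \<Rightarrow> nat list \<Rightarrow> nat \<Rightarrow> com" where
  "compile (EVar i) vs r = (if i < length vs then Move r (vs ! i) else SetAtom r)"
| "compile ENil vs r = SetAtom r"
| "compile EClk vs r = Move r 0"
| "compile (ECons a b) vs r = Seq (compile a vs r) (Seq (compile b vs (Suc r)) (Pair r r (Suc r)))"
| "compile (EHd a) vs r = Seq (compile a vs r) (Left r r)"
| "compile (ETl a) vs r = Seq (compile a vs r) (Right r r)"
| "compile (EIf c a b) vs r = Seq (compile c vs r) (Cond r (compile a vs r) (compile b vs r))"
| "compile (ELet a b) vs r =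
     Seq (compile a vs r) (Seq (compile b (vs @ [r]) (Suc r)) (Move r (Suc r)))"
| "compile (EFold l i b) vs r =
     Seq (compile l vs r) (Seq (compile i vs (Suc r)) (Seq (Move (Suc (Suc r)) 0) (Seq
       (While (Suc (Suc r)) (Seq (Right (Suc (Suc r)) (Suc (Suc r))) (Cond r
          (Seq (Left (r + 3) r) (Seq (Right r r)
            (Seq (compile b (vs @ [r + 3, Suc r]) (r + 4)) (Move (Suc r) (r + 4)))))
          (SetAtom (r + 3)))))
       (Move r (Suc r)))))"
| "compile (ECall f es) vs r =
     Seq (compiles es vs r) (Seq (compile f [r..<r + length es] (r + length es))
       (Move r (r + length es)))"
| "compiles [] vs r = SetAtom r"
| "compiles (e # es) vs r = Seq (compile e vs r) (compiles es vs (Suc r))"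

fun cost :: "exp \<Rightarrow> nat \<Rightarrow> nat" and costs :: "exp list \<Rightarrow> nat \<Rightarrow> nat" where
  "cost (EVar i) Z = 1"
| "cost ENil Z = 1"
| "cost EClk Z = 1"
| "cost (ECons a b) Z = cost a Z + cost b Z + 3"
| "cost (EHd a) Z = cost a Z + 2"
| "cost (ETl a) Z = cost a Z + 2"
| "cost (EIf c a b) Z = cost c Z + cost a Z + cost b Z + 2"
| "cost (ELet a b) Z = cost a Z + cost b Z + 3"
| "cost (EFold l i b) Z = cost l Z + cost i Z + Z * (cost b Z + 10) + 7"
| "cost (ECall f es) Z = costs es Z + cost f Z + 3"
| "costs [] Z = 1"
| "costs (e # es) Z = cost e Z + costs es Z + 1"

lemma deterministic_compile:
  "deterministic (compile e vs r)" "deterministic (compiles es vs r)"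
  by (induction e vs r and es vs r rule: compile_compiles.induct) auto

text \<open>The pending commands \<open>cs\<close> are arbitrary, so that specifications of
  subcommands can be chained.\<close>

definition computes :: "com \<Rightarrow> nat \<Rightarrow> cell \<Rightarrow> nat list \<Rightarrow> nat \<Rightarrow> (cell list \<Rightarrow> cell) \<Rightarrow> bool" where
  "computes c T k vs r F \<longleftrightarrow> (\<forall>\<sigma> cs. 0 < r \<and> \<sigma> 0 = k \<and> (\<forall>v\<in>set vs. v < r) \<longrightarrow>
     (\<exists>S \<sigma>'. S \<le> T \<and> steps S (c # cs, \<sigma>) (cs, \<sigma>') \<and> \<sigma>' r = F (map \<sigma> vs) \<and> (\<forall>j<r. \<sigma>' j = \<sigma> j)))"

lemma computesI:
  assumes "\<And>\<sigma> cs. 0 < r \<Longrightarrow> \<sigma> 0 = k \<Longrightarrow> (\<And>v. v \<in> set vs \<Longrightarrow> v < r) \<Longrightarrow>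
    \<exists>S \<sigma>'. S \<le> T \<and> steps S (c # cs, \<sigma>) (cs, \<sigma>') \<and> \<sigma>' r = F (map \<sigma> vs) \<and> (\<forall>j<r. \<sigma>' j = \<sigma> j)"
  shows "computes c T k vs r F"
  using assms unfolding computes_def by blast

lemma computesD:
  assumes "computes c T k vs r F" "0 < r" "\<sigma> 0 = k" "\<And>v. v \<in> set vs \<Longrightarrow> v < r"
  shows "\<exists>S \<sigma>'. S \<le> T \<and> steps S (c # cs, \<sigma>) (cs, \<sigma>') \<and> \<sigma>' r = F (map \<sigma> vs) \<and>
    (\<forall>j<r. \<sigma>' j = \<sigma> j)"
  using assms unfolding computes_def by blast

lemma steps_Seq: "steps T (c # d # cs, \<sigma>) e \<Longrightarrow> steps (Suc T) (Seq c d # cs, \<sigma>) e"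
  by (rule steps_Suc) auto

text \<open>Induction on the clock. A round takes at most T + 10 steps: three to enter it and
  advance the clock, six to take an entry off the list, T for the body and one to store the
  accumulator. The final 1 is the test that leaves the loop.\<close>

lemma fold_loop:
  assumes body: "computes b T k (vs @ [r + 3, Suc r]) (r + 4) F"
    and r: "0 < r" "\<And>v. v \<in> set vs \<Longrightarrow> v < r"
  shows "\<sigma> 0 = k \<Longrightarrow> \<exists>S \<sigma>'. S \<le> length (list_of_cell (\<sigma> (Suc (Suc r)))) * (T + 10) + 1 \<and>
    steps S (While (Suc (Suc r)) (Seq (Right (Suc (Suc r)) (Suc (Suc r))) (Cond r
          (Seq (Left (r + 3) r) (Seq (Right r r) (Seq b (Move (Suc r) (r + 4)))))
          (SetAtom (r + 3)))) # cs, \<sigma>) (cs, \<sigma>') \<and>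
    \<sigma>' (Suc r) = foldl (\<lambda>acc x. F (map \<sigma> vs @ [x, acc])) (\<sigma> (Suc r))
      (take (length (list_of_cell (\<sigma> (Suc (Suc r))))) (list_of_cell (\<sigma> r))) \<and>
    (\<forall>j<r. \<sigma>' j = \<sigma> j)"
proof (induction "\<sigma> (Suc (Suc r))" arbitrary: \<sigma>)
  case Atom
  then have k2: "\<sigma> (Suc (Suc r)) = Atom" by simp
  show ?case
    by (intro exI[of _ "Suc 0"] exI[of _ \<sigma>] conjI) (simp_all add: steps_def iterate_Suc k2)
next
  case (Cell x kr)
  let ?C = "Cond r (Seq (Left (r + 3) r) (Seq (Right r r) (Seq b (Move (Suc r) (r + 4)))))
          (SetAtom (r + 3))"
  let ?W = "While (Suc (Suc r)) (Seq (Right (Suc (Suc r)) (Suc (Suc r))) ?C)"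
  let ?\<sigma>1 = "\<sigma>(Suc (Suc r) := kr)"
  note IH = Cell.hyps(2)
  have k2: "\<sigma> (Suc (Suc r)) = Cell x kr" using Cell by simp
  have s1: "steps (Suc (Suc (Suc 0))) (?W # cs, \<sigma>) (?C # ?W # cs, ?\<sigma>1)"
    by (simp add: steps_def iterate_Suc k2)
  show ?case
  proof (cases "\<sigma> r")
    case Atom
    let ?\<sigma>2 = "?\<sigma>1(r + 3 := Atom)"
    have s2: "steps (Suc (Suc 0)) (?C # ?W # cs, ?\<sigma>1) (?W # cs, ?\<sigma>2)"
      by (simp add: steps_def iterate_Suc Atom)
    have q: "?\<sigma>2 (Suc (Suc r)) = kr" "?\<sigma>2 0 = k" "?\<sigma>2 r = Atom" "?\<sigma>2 (Suc r) = \<sigma> (Suc r)"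
      using \<open>\<sigma> 0 = k\<close> r Atom by auto
    obtain S \<sigma>' where S: "S \<le> length (list_of_cell kr) * (T + 10) + 1"
      "steps S (?W # cs, ?\<sigma>2) (cs, \<sigma>')"
      "\<sigma>' (Suc r) = foldl (\<lambda>acc x. F (map ?\<sigma>2 vs @ [x, acc])) (\<sigma> (Suc r))
        (take (length (list_of_cell kr)) (list_of_cell Atom))" "\<forall>j<r. \<sigma>' j = ?\<sigma>2 j"
      using Cell.hyps(2)[OF q(1)[symmetric] q(2)] unfolding q by blast
    show ?thesis
    proof (intro exI conjI)
      show "steps (Suc (Suc (Suc 0)) + Suc (Suc 0) + S) (?W # cs, \<sigma>) (cs, \<sigma>')"
        by (rule steps_trans[OF steps_trans[OF s1 s2] S(2)])
    qed (use S(1,3,4) Atom k2 in auto)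
  next
    case (Cell y lr)
    let ?\<sigma>2 = "?\<sigma>1(r + 3 := y, r := lr)"
    have s2: "steps (Suc (Suc (Suc (Suc (Suc (Suc 0)))))) (?C # ?W # cs, ?\<sigma>1)
        (b # Move (Suc r) (r + 4) # ?W # cs, ?\<sigma>2)"
      by (simp add: steps_def iterate_Suc Cell)
    have c: "0 < r + 4" "?\<sigma>2 0 = k" "\<And>v. v \<in> set (vs @ [r + 3, Suc r]) \<Longrightarrow> v < r + 4"
      using \<open>\<sigma> 0 = k\<close> r by (auto dest!: r(2))
    obtain S \<sigma>3 where S: "S \<le> T"
      "steps S (b # Move (Suc r) (r + 4) # ?W # cs, ?\<sigma>2) (Move (Suc r) (r + 4) # ?W # cs, \<sigma>3)"
      "\<sigma>3 (r + 4) = F (map ?\<sigma>2 (vs @ [r + 3, Suc r]))" "\<And>j. j < r + 4 \<Longrightarrow> \<sigma>3 j = ?\<sigma>2 j"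
      using computesD[where \<sigma> = ?\<sigma>2 and cs = "Move (Suc r) (r + 4) # ?W # cs", OF body c] by blast
    have below: "?\<sigma>2 j = \<sigma> j" if "j < r" for j using that by simp
    have m: "map ?\<sigma>2 (vs @ [r + 3, Suc r]) = map \<sigma> vs @ [y, \<sigma> (Suc r)]"
    proof -
      have "map ?\<sigma>2 vs = map \<sigma> vs" by (intro map_cong refl below r(2))
      then show ?thesis by simp
    qed
    let ?\<sigma>4 = "\<sigma>3(Suc r := F (map \<sigma> vs @ [y, \<sigma> (Suc r)]))"
    have s3: "steps (Suc 0) (Move (Suc r) (r + 4) # ?W # cs, \<sigma>3) (?W # cs, ?\<sigma>4)"
      unfolding steps_def iterate_Suc step.simps S(3) m by simp
    have \<sigma>4: "?\<sigma>4 (Suc (Suc r)) = kr" "?\<sigma>4 0 = k" "?\<sigma>4 r = lr"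
      "?\<sigma>4 (Suc r) = F (map \<sigma> vs @ [y, \<sigma> (Suc r)])"
      using S(4) r \<open>\<sigma> 0 = k\<close> by auto
    have below4: "?\<sigma>4 j = \<sigma> j" if "j < r" for j using that S(4)[of j] by simp
    have m4: "map ?\<sigma>4 vs = map \<sigma> vs" by (intro map_cong refl below4 r(2))
    obtain S' \<sigma>' where S':
      "S' \<le> length (list_of_cell kr) * (T + 10) + 1" "steps S' (?W # cs, ?\<sigma>4) (cs, \<sigma>')"
      "\<sigma>' (Suc r) = foldl (\<lambda>acc x. F (map \<sigma> vs @ [x, acc])) (F (map \<sigma> vs @ [y, \<sigma> (Suc r)]))
        (take (length (list_of_cell kr)) (list_of_cell lr))" "\<forall>j<r. \<sigma>' j = ?\<sigma>4 j"
      using IH[OF \<sigma>4(1)[symmetric] \<sigma>4(2)] unfolding \<sigma>4 m4 by blast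
    show ?thesis
    proof (intro exI conjI)
      show "steps (Suc (Suc (Suc 0)) + Suc (Suc (Suc (Suc (Suc (Suc 0))))) + S + Suc 0 + S')
          (?W # cs, \<sigma>) (cs, \<sigma>')"
        by (rule steps_trans[OF steps_trans[OF steps_trans[OF steps_trans[OF s1 s2] S(2)] s3] S'(2)])
      show "\<forall>j<r. \<sigma>' j = \<sigma> j" using S'(4) below4 by simp
    qed (use S(1) S'(1,3) Cell k2 in auto)
  qed
qed

text \<open>The second statement concerns the arguments of a call: their values end up in
  consecutive registers from r on, which then serve as the environment of the called body.\<close>

lemma compile_correct:
  "computes (compile e vs r) (cost e (clen k)) k vs r (ev k e)"
  "\<forall>\<sigma> cs. 0 < r \<and> \<sigma> 0 = k \<and> (\<forall>v\<in>set vs. v < r) \<longrightarrow>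
     (\<exists>S \<sigma>'. S \<le> costs es (clen k) \<and> steps S (compiles es vs r # cs, \<sigma>) (cs, \<sigma>') \<and>
       map \<sigma>' [r..<r + length es] = map (\<lambda>e. ev k e (map \<sigma> vs)) es \<and> (\<forall>j<r. \<sigma>' j = \<sigma> j))"
proof (induction e vs r and es vs r rule: compile_compiles.induct)
  case (4 a b vs r)
  show ?case
  proof (rule computesI)
    fix \<sigma> :: "nat \<Rightarrow> cell" and cs assume r: "0 < r" "\<sigma> 0 = k" "\<And>v. v \<in> set vs \<Longrightarrow> v < r"
    obtain S1 \<sigma>1 where 1: "S1 \<le> cost a (clen k)"
      "steps S1 (compile a vs r # Seq (compile b vs (Suc r)) (Pair r r (Suc r)) # cs, \<sigma>)
        (Seq (compile b vs (Suc r)) (Pair r r (Suc r)) # cs, \<sigma>1)"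
      "\<sigma>1 r = ev k a (map \<sigma> vs)" "\<And>j. j < r \<Longrightarrow> \<sigma>1 j = \<sigma> j"
      using computesD[where \<sigma> = \<sigma>, OF 4(1) r] by blast
    have m: "map \<sigma>1 vs = map \<sigma> vs" by (intro map_cong refl 1(4) r(3))
    have r1: "0 < Suc r" "\<sigma>1 0 = k" "\<And>v. v \<in> set vs \<Longrightarrow> v < Suc r"
      using 1(4) r by (auto simp: less_Suc_eq)
    obtain S2 \<sigma>2 where 2: "S2 \<le> cost b (clen k)"
      "steps S2 (compile b vs (Suc r) # Pair r r (Suc r) # cs, \<sigma>1) (Pair r r (Suc r) # cs, \<sigma>2)"
      "\<sigma>2 (Suc r) = ev k b (map \<sigma>1 vs)" "\<And>j. j < Suc r \<Longrightarrow> \<sigma>2 j = \<sigma>1 j"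
      using computesD[where \<sigma> = \<sigma>1, OF 4(2) r1] by blast
    have "steps (Suc (S1 + Suc (S2 + 1))) (compile (ECons a b) vs r # cs, \<sigma>)
        (cs, \<sigma>2(r := Cell (\<sigma>2 r) (\<sigma>2 (Suc r))))"
      unfolding compile.simps
      by (intro steps_Seq steps_trans[OF 1(2)] steps_trans[OF 2(2)] steps_step) simp
    then show "\<exists>S \<sigma>'. S \<le> cost (ECons a b) (clen k) \<and>
        steps S (compile (ECons a b) vs r # cs, \<sigma>) (cs, \<sigma>') \<and>
        \<sigma>' r = ev k (ECons a b) (map \<sigma> vs) \<and> (\<forall>j<r. \<sigma>' j = \<sigma> j)"
      using 1(1,3,4) 2(1,3,4) m
      by (intro exI[of _ "Suc (S1 + Suc (S2 + 1))"] exI[of _ "\<sigma>2(r := Cell (\<sigma>2 r) (\<sigma>2 (Suc r)))"] conjI) auto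
  qed
next
  case (5 a vs r)
  show ?case
  proof (rule computesI)
    fix \<sigma> :: "nat \<Rightarrow> cell" and cs assume r: "0 < r" "\<sigma> 0 = k" "\<And>v. v \<in> set vs \<Longrightarrow> v < r"
    obtain S1 \<sigma>1 where 1: "S1 \<le> cost a (clen k)"
      "steps S1 (compile a vs r # Left r r # cs, \<sigma>) (Left r r # cs, \<sigma>1)"
      "\<sigma>1 r = ev k a (map \<sigma> vs)" "\<And>j. j < r \<Longrightarrow> \<sigma>1 j = \<sigma> j"
      using computesD[where \<sigma> = \<sigma>, OF 5 r] by blast
    have "steps (Suc (S1 + 1)) (compile (EHd a) vs r # cs, \<sigma>) (cs, \<sigma>1(r := left (\<sigma>1 r)))"
      unfolding compile.simps by (intro steps_Seq steps_trans[OF 1(2)] steps_step) simp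
    then show "\<exists>S \<sigma>'. S \<le> cost (EHd a) (clen k) \<and> steps S (compile (EHd a) vs r # cs, \<sigma>) (cs, \<sigma>') \<and>
        \<sigma>' r = ev k (EHd a) (map \<sigma> vs) \<and> (\<forall>j<r. \<sigma>' j = \<sigma> j)"
      using 1(1,3,4) by (intro exI[of _ "Suc (S1 + 1)"] exI[of _ "\<sigma>1(r := left (\<sigma>1 r))"] conjI) auto
  qed
next
  case (6 a vs r)
  show ?case
  proof (rule computesI)
    fix \<sigma> :: "nat \<Rightarrow> cell" and cs assume r: "0 < r" "\<sigma> 0 = k" "\<And>v. v \<in> set vs \<Longrightarrow> v < r"
    obtain S1 \<sigma>1 where 1: "S1 \<le> cost a (clen k)"
      "steps S1 (compile a vs r # Right r r # cs, \<sigma>) (Right r r # cs, \<sigma>1)"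
      "\<sigma>1 r = ev k a (map \<sigma> vs)" "\<And>j. j < r \<Longrightarrow> \<sigma>1 j = \<sigma> j"
      using computesD[where \<sigma> = \<sigma>, OF 6 r] by blast
    have "steps (Suc (S1 + 1)) (compile (ETl a) vs r # cs, \<sigma>) (cs, \<sigma>1(r := right (\<sigma>1 r)))"
      unfolding compile.simps by (intro steps_Seq steps_trans[OF 1(2)] steps_step) simp
    then show "\<exists>S \<sigma>'. S \<le> cost (ETl a) (clen k) \<and> steps S (compile (ETl a) vs r # cs, \<sigma>) (cs, \<sigma>') \<and>
        \<sigma>' r = ev k (ETl a) (map \<sigma> vs) \<and> (\<forall>j<r. \<sigma>' j = \<sigma> j)"
      using 1(1,3,4) by (intro exI[of _ "Suc (S1 + 1)"] exI[of _ "\<sigma>1(r := right (\<sigma>1 r))"] conjI) auto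
  qed
next
  case (7 c a b vs r)
  show ?case
  proof (rule computesI)
    fix \<sigma> :: "nat \<Rightarrow> cell" and cs assume r: "0 < r" "\<sigma> 0 = k" "\<And>v. v \<in> set vs \<Longrightarrow> v < r"
    let ?I = "Cond r (compile a vs r) (compile b vs r)"
    obtain S1 \<sigma>1 where 1: "S1 \<le> cost c (clen k)"
      "steps S1 (compile c vs r # ?I # cs, \<sigma>) (?I # cs, \<sigma>1)"
      "\<sigma>1 r = ev k c (map \<sigma> vs)" "\<And>j. j < r \<Longrightarrow> \<sigma>1 j = \<sigma> j"
      using computesD[where \<sigma> = \<sigma>, OF 7(1) r] by blast
    have r1: "\<sigma>1 0 = k" using 1(4) r by auto
    have m: "map \<sigma>1 vs = map \<sigma> vs" by (intro map_cong refl 1(4) r(3))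
    define e where "e = (if \<sigma>1 r = Atom then b else a)"
    have IH: "computes (compile e vs r) (cost e (clen k)) k vs r (ev k e)"
      using 7(2,3) by (simp add: e_def)
    obtain S2 \<sigma>2 where 2: "S2 \<le> cost e (clen k)"
      "steps S2 (compile e vs r # cs, \<sigma>1) (cs, \<sigma>2)"
      "\<sigma>2 r = ev k e (map \<sigma>1 vs)" "\<And>j. j < r \<Longrightarrow> \<sigma>2 j = \<sigma>1 j"
      using computesD[where \<sigma> = \<sigma>1, OF IH r(1) r1 r(3)] by blast
    have "steps 1 (?I # cs, \<sigma>1) (compile e vs r # cs, \<sigma>1)"
      by (rule steps_step) (simp add: e_def)
    then have "steps (Suc (S1 + (1 + S2))) (compile (EIf c a b) vs r # cs, \<sigma>) (cs, \<sigma>2)"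
      unfolding compile.simps by (intro steps_Seq steps_trans[OF 1(2)] steps_trans[OF _ 2(2)])
    moreover have "cost e (clen k) \<le> cost a (clen k) + cost b (clen k)" by (simp add: e_def)
    ultimately show "\<exists>S \<sigma>'. S \<le> cost (EIf c a b) (clen k) \<and>
        steps S (compile (EIf c a b) vs r # cs, \<sigma>) (cs, \<sigma>') \<and>
        \<sigma>' r = ev k (EIf c a b) (map \<sigma> vs) \<and> (\<forall>j<r. \<sigma>' j = \<sigma> j)"
      using 1(1,3,4) 2(1,3,4) m
      by (intro exI[of _ "Suc (S1 + (1 + S2))"] exI[of _ \<sigma>2] conjI) (auto simp: e_def)
  qed
next
  case (8 a b vs r)
  show ?case
  proof (rule computesI)
    fix \<sigma> :: "nat \<Rightarrow> cell" and cs assume r: "0 < r" "\<sigma> 0 = k" "\<And>v. v \<in> set vs \<Longrightarrow> v < r"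
    let ?R = "Seq (compile b (vs @ [r]) (Suc r)) (Move r (Suc r))"
    obtain S1 \<sigma>1 where 1: "S1 \<le> cost a (clen k)"
      "steps S1 (compile a vs r # ?R # cs, \<sigma>) (?R # cs, \<sigma>1)"
      "\<sigma>1 r = ev k a (map \<sigma> vs)" "\<And>j. j < r \<Longrightarrow> \<sigma>1 j = \<sigma> j"
      using computesD[where \<sigma> = \<sigma>, OF 8(1) r] by blast
    have m: "map \<sigma>1 vs = map \<sigma> vs" by (intro map_cong refl 1(4) r(3))
    have r1: "0 < Suc r" "\<sigma>1 0 = k" "\<And>v. v \<in> set (vs @ [r]) \<Longrightarrow> v < Suc r"
      using 1(4) r by (auto simp: less_Suc_eq)
    obtain S2 \<sigma>2 where 2: "S2 \<le> cost b (clen k)"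
      "steps S2 (compile b (vs @ [r]) (Suc r) # Move r (Suc r) # cs, \<sigma>1) (Move r (Suc r) # cs, \<sigma>2)"
      "\<sigma>2 (Suc r) = ev k b (map \<sigma>1 (vs @ [r]))" "\<And>j. j < Suc r \<Longrightarrow> \<sigma>2 j = \<sigma>1 j"
      using computesD[where \<sigma> = \<sigma>1, OF 8(2) r1] by blast
    have "steps (Suc (S1 + Suc (S2 + 1))) (compile (ELet a b) vs r # cs, \<sigma>)
        (cs, \<sigma>2(r := \<sigma>2 (Suc r)))"
      unfolding compile.simps
      by (intro steps_Seq steps_trans[OF 1(2)] steps_trans[OF 2(2)] steps_step) simp
    then show "\<exists>S \<sigma>'. S \<le> cost (ELet a b) (clen k) \<and>
        steps S (compile (ELet a b) vs r # cs, \<sigma>) (cs, \<sigma>') \<and>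
        \<sigma>' r = ev k (ELet a b) (map \<sigma> vs) \<and> (\<forall>j<r. \<sigma>' j = \<sigma> j)"
      using 1(1,3,4) 2(1,3,4) m
      by (intro exI[of _ "Suc (S1 + Suc (S2 + 1))"] exI[of _ "\<sigma>2(r := \<sigma>2 (Suc r))"] conjI) auto
  qed
next
  case (9 l i b vs r)
  show ?case
  proof (rule computesI)
    fix \<sigma> :: "nat \<Rightarrow> cell" and cs assume r: "0 < r" "\<sigma> 0 = k" "\<And>v. v \<in> set vs \<Longrightarrow> v < r"
    let ?W = "While (Suc (Suc r)) (Seq (Right (Suc (Suc r)) (Suc (Suc r))) (Cond r
          (Seq (Left (r + 3) r) (Seq (Right r r)
            (Seq (compile b (vs @ [r + 3, Suc r]) (r + 4)) (Move (Suc r) (r + 4)))))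
          (SetAtom (r + 3))))"
    let ?R3 = "Seq ?W (Move r (Suc r))"
    let ?R2 = "Seq (Move (Suc (Suc r)) 0) ?R3"
    let ?R1 = "Seq (compile i vs (Suc r)) ?R2"
    obtain S1 \<sigma>1 where 1: "S1 \<le> cost l (clen k)"
      "steps S1 (compile l vs r # ?R1 # cs, \<sigma>) (?R1 # cs, \<sigma>1)"
      "\<sigma>1 r = ev k l (map \<sigma> vs)" "\<And>j. j < r \<Longrightarrow> \<sigma>1 j = \<sigma> j"
      using computesD[where \<sigma> = \<sigma>, OF 9(1) r] by blast
    have r1: "0 < Suc r" "\<sigma>1 0 = k" "\<And>v. v \<in> set vs \<Longrightarrow> v < Suc r"
      using 1(4) r by (auto simp: less_Suc_eq)
    obtain S2 \<sigma>2 where 2: "S2 \<le> cost i (clen k)"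
      "steps S2 (compile i vs (Suc r) # ?R2 # cs, \<sigma>1) (?R2 # cs, \<sigma>2)"
      "\<sigma>2 (Suc r) = ev k i (map \<sigma>1 vs)" "\<And>j. j < Suc r \<Longrightarrow> \<sigma>2 j = \<sigma>1 j"
      using computesD[where \<sigma> = \<sigma>1, OF 9(2) r1] by blast
    let ?\<sigma>3 = "\<sigma>2(Suc (Suc r) := k)"
    have k3: "?\<sigma>3 0 = k" "\<sigma>2 0 = k" using 2(4) r1 r by auto
    have below: "\<And>j. j < r \<Longrightarrow> ?\<sigma>3 j = \<sigma> j" using 1(4) 2(4) by simp
    have m1: "map \<sigma>1 vs = map \<sigma> vs" by (rule map_cong[OF refl 1(4)[OF r(3)]])
    have m3: "map ?\<sigma>3 vs = map \<sigma> vs" by (rule map_cong[OF refl below[OF r(3)]])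
    note m = m1 m3
    have st: "?\<sigma>3 r = ev k l (map \<sigma> vs)" "?\<sigma>3 (Suc r) = ev k i (map \<sigma> vs)" "?\<sigma>3 (Suc (Suc r)) = k"
      using 1(3) 2(3,4) m by auto
    from fold_loop[where \<sigma> = ?\<sigma>3 and cs = "Move r (Suc r) # cs", OF 9(3) r(1,3) k3(1)]
    obtain S3 \<sigma>' where 3: "S3 \<le> clen k * (cost b (clen k) + 10) + 1"
      "steps S3 (?W # Move r (Suc r) # cs, ?\<sigma>3) (Move r (Suc r) # cs, \<sigma>')"
      "\<sigma>' (Suc r) = ev k (EFold l i b) (map \<sigma> vs)" "\<forall>j<r. \<sigma>' j = ?\<sigma>3 j"
      unfolding st m ev.simps clen_def cfold_def by blast
    have s2: "steps 1 (Move (Suc (Suc r)) 0 # ?R3 # cs, \<sigma>2) (?R3 # cs, ?\<sigma>3)"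
      using k3(2) by (intro steps_step) simp
    have "steps (Suc (S1 + Suc (S2 + Suc (1 + Suc (S3 + 1))))) (compile (EFold l i b) vs r # cs, \<sigma>)
        (cs, \<sigma>'(r := \<sigma>' (Suc r)))"
      unfolding compile.simps
      by (intro steps_Seq steps_trans[OF 1(2)] steps_trans[OF 2(2)] steps_trans[OF s2]
          steps_trans[OF 3(2)] steps_step) simp
    then show "\<exists>S \<sigma>'. S \<le> cost (EFold l i b) (clen k) \<and>
        steps S (compile (EFold l i b) vs r # cs, \<sigma>) (cs, \<sigma>') \<and>
        \<sigma>' r = ev k (EFold l i b) (map \<sigma> vs) \<and> (\<forall>j<r. \<sigma>' j = \<sigma> j)"
      using 1(1) 2(1) 3(1,3,4) below
      by (intro exI[of _ "Suc (S1 + Suc (S2 + Suc (1 + Suc (S3 + 1))))"]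
          exI[of _ "\<sigma>'(r := \<sigma>' (Suc r))"] conjI) (simp_all del: ev.simps)
  qed
next
  case (10 f es vs r)
  show ?case
  proof (rule computesI)
    fix \<sigma> :: "nat \<Rightarrow> cell" and cs assume r: "0 < r" "\<sigma> 0 = k" "\<And>v. v \<in> set vs \<Longrightarrow> v < r"
    let ?q = "r + length es"
    let ?R = "Seq (compile f [r..<?q] ?q) (Move r ?q)"
    obtain S1 \<sigma>1 where 1: "S1 \<le> costs es (clen k)"
      "steps S1 (compiles es vs r # ?R # cs, \<sigma>) (?R # cs, \<sigma>1)"
      "map \<sigma>1 [r..<?q] = map (\<lambda>e. ev k e (map \<sigma> vs)) es" "\<forall>j<r. \<sigma>1 j = \<sigma> j"
      using 10(1) r by blast
    have r1: "0 < ?q" "\<sigma>1 0 = k" "\<And>v. v \<in> set [r..<?q] \<Longrightarrow> v < ?q" using 1(4) r by auto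
    obtain S2 \<sigma>2 where 2: "S2 \<le> cost f (clen k)"
      "steps S2 (compile f [r..<?q] ?q # Move r ?q # cs, \<sigma>1) (Move r ?q # cs, \<sigma>2)"
      "\<sigma>2 ?q = ev k f (map \<sigma>1 [r..<?q])" "\<And>j. j < ?q \<Longrightarrow> \<sigma>2 j = \<sigma>1 j"
      using computesD[where \<sigma> = \<sigma>1, OF 10(2) r1] by blast
    have "steps (Suc (S1 + Suc (S2 + 1))) (compile (ECall f es) vs r # cs, \<sigma>) (cs, \<sigma>2(r := \<sigma>2 ?q))"
      unfolding compile.simps
      by (intro steps_Seq steps_trans[OF 1(2)] steps_trans[OF 2(2)] steps_step) simp
    then show "\<exists>S \<sigma>'. S \<le> cost (ECall f es) (clen k) \<and>
        steps S (compile (ECall f es) vs r # cs, \<sigma>) (cs, \<sigma>') \<and>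
        \<sigma>' r = ev k (ECall f es) (map \<sigma> vs) \<and> (\<forall>j<r. \<sigma>' j = \<sigma> j)"
      using 1(1,4) 2(1,4) 2(3)[unfolded 1(3)]
      by (intro exI[of _ "Suc (S1 + Suc (S2 + 1))"] exI[of _ "\<sigma>2(r := \<sigma>2 ?q)"] conjI) auto
  qed
next
  case (11 vs r)
  show ?case
    by (auto intro!: exI[of _ 1] steps_step)
next
  case (12 e es vs r)
  show ?case
  proof (intro allI impI)
    fix \<sigma> :: "nat \<Rightarrow> cell" and cs assume "0 < r \<and> \<sigma> 0 = k \<and> (\<forall>v\<in>set vs. v < r)"
    then have r: "0 < r" "\<sigma> 0 = k" "\<And>v. v \<in> set vs \<Longrightarrow> v < r" by auto
    obtain S1 \<sigma>1 where 1: "S1 \<le> cost e (clen k)"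
      "steps S1 (compile e vs r # compiles es vs (Suc r) # cs, \<sigma>) (compiles es vs (Suc r) # cs, \<sigma>1)"
      "\<sigma>1 r = ev k e (map \<sigma> vs)" "\<And>j. j < r \<Longrightarrow> \<sigma>1 j = \<sigma> j"
      using computesD[where \<sigma> = \<sigma>, OF 12(1) r] by blast
    have r1: "0 < Suc r \<and> \<sigma>1 0 = k \<and> (\<forall>v\<in>set vs. v < Suc r)"
      using 1(4) r by (auto simp: less_Suc_eq)
    obtain S2 \<sigma>2 where 2: "S2 \<le> costs es (clen k)"
      "steps S2 (compiles es vs (Suc r) # cs, \<sigma>1) (cs, \<sigma>2)"
      "map \<sigma>2 [Suc r..<Suc r + length es] = map (\<lambda>e. ev k e (map \<sigma>1 vs)) es" "\<forall>j<Suc r. \<sigma>2 j = \<sigma>1 j"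
      using 12(2) r1 by blast
    have m: "map \<sigma>1 vs = map \<sigma> vs" by (intro map_cong refl 1(4) r(3))
    have "steps (Suc (S1 + S2)) (compiles (e # es) vs r # cs, \<sigma>) (cs, \<sigma>2)"
      unfolding compiles.simps by (intro steps_Seq steps_trans[OF 1(2)] 2(2))
    moreover have "[r..<r + length (e # es)] = r # [Suc r..<Suc r + length es]"
      using upt_conv_Cons[of r "r + length (e # es)"] by simp
    ultimately show "\<exists>S \<sigma>'. S \<le> costs (e # es) (clen k) \<and>
        steps S (compiles (e # es) vs r # cs, \<sigma>) (cs, \<sigma>') \<and>
        map \<sigma>' [r..<r + length (e # es)] = map (\<lambda>e. ev k e (map \<sigma> vs)) (e # es) \<and> (\<forall>j<r. \<sigma>' j = \<sigma> j)"
      using 1(1,3,4) 2(1,4) 2(3)[unfolded m]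
      by (intro exI[of _ "Suc (S1 + S2)"] exI[of _ \<sigma>2] conjI) auto
  qed
qed (auto intro!: computesI exI[of _ 1] steps_step exI[of _ "_(_ := _)"])

section \<open>Polynomial bounds on the cost of expressions\<close>

definition poly_bounded :: "(nat \<Rightarrow> nat) \<Rightarrow> bool" where
  "poly_bounded h \<longleftrightarrow> (\<exists>c. \<forall>Z\<ge>1. h Z \<le> c * Z ^ c)"

lemma poly_boundedI:
  assumes "\<And>Z. Z \<ge> 1 \<Longrightarrow> h Z \<le> c * Z ^ d"
  shows "poly_bounded h"
  unfolding poly_bounded_def
proof (intro exI[of _ "c + d"] allI impI)
  fix Z :: nat assume Z: "1 \<le> Z"
  have "h Z \<le> c * Z ^ d" by (rule assms[OF Z])
  also have "\<dots> \<le> (c + d) * Z ^ (c + d)"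
    using Z by (intro mult_mono power_increasing) auto
  finally show "h Z \<le> (c + d) * Z ^ (c + d)" .
qed

lemma poly_bounded_const: "poly_bounded (\<lambda>_. c)"
  by (rule poly_boundedI[of _ c 0]) simp

lemma poly_bounded_id: "poly_bounded (\<lambda>Z. Z)"
  by (rule poly_boundedI[of _ 1 1]) simp

lemma poly_bounded_add:
  assumes "poly_bounded g" "poly_bounded h" shows "poly_bounded (\<lambda>Z. g Z + h Z)"
proof -
  obtain c d where c: "\<And>Z. Z \<ge> 1 \<Longrightarrow> g Z \<le> c * Z ^ c" and d: "\<And>Z. Z \<ge> 1 \<Longrightarrow> h Z \<le> d * Z ^ d"
    using assms unfolding poly_bounded_def by blast
  show ?thesis
  proof (rule poly_boundedI[of _ "c + d" "c + d"])
    fix Z :: nat assume Z: "1 \<le> Z"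
    have "c * Z ^ c \<le> c * Z ^ (c + d)" "d * Z ^ d \<le> d * Z ^ (c + d)"
      by (intro mult_le_mono2 power_increasing; use Z in simp)+
    then have "g Z + h Z \<le> c * Z ^ (c + d) + d * Z ^ (c + d)"
      using c[OF Z] d[OF Z] by linarith
    then show "g Z + h Z \<le> (c + d) * Z ^ (c + d)" by (simp only: distrib_right)
  qed
qed

lemma poly_bounded_mult:
  assumes "poly_bounded g" "poly_bounded h" shows "poly_bounded (\<lambda>Z. g Z * h Z)"
proof -
  obtain c d where c: "\<And>Z. Z \<ge> 1 \<Longrightarrow> g Z \<le> c * Z ^ c" and d: "\<And>Z. Z \<ge> 1 \<Longrightarrow> h Z \<le> d * Z ^ d"
    using assms unfolding poly_bounded_def by blast
  show ?thesis
  proof (rule poly_boundedI[of _ "c * d" "c + d"])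
    fix Z :: nat assume Z: "1 \<le> Z"
    show "g Z * h Z \<le> c * d * Z ^ (c + d)"
      using mult_mono[OF c[OF Z] d[OF Z]] by (simp add: power_add mult_ac)
  qed
qed

lemma poly_bounded_cong: "(\<And>Z. h Z = g Z) \<Longrightarrow> poly_bounded g \<Longrightarrow> poly_bounded h"
  by (simp add: poly_bounded_def)

lemma poly_bounded_costs:
  "(\<And>e. e \<in> set es \<Longrightarrow> poly_bounded (cost e)) \<Longrightarrow> poly_bounded (costs es)"
  by (induction es)
    (rule poly_bounded_cong, rule costs.simps,
      intro poly_bounded_add poly_bounded_const; simp)+

text \<open>Only folds multiply by the clock length, once each, and the expression is fixed; so the
  degree is bounded by the nesting of its folds.\<close>

lemma poly_bounded_cost: "poly_bounded (cost e)"
  by (induction e)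
    (rule poly_bounded_cong, rule cost.simps,
      intro poly_bounded_add poly_bounded_mult poly_bounded_const poly_bounded_id poly_bounded_costs;
      assumption)+

section \<open>Arithmetic in characteristic 2 and enumeration of vectors and polynomials\<close>

lemma bit_double_alg_closure [simp]: "x + x = (0 :: bit alg_closure)"
proof -
  have "(1 + 1 :: bit alg_closure) = to_ac (1 + 1 :: bit)" by (simp only: to_ac_add to_ac_1)
  also have "\<dots> = 0" by simp
  finally have "(1 + 1) * x = 0" by simp
  then show ?thesis by (simp add: distrib_right)
qed

lemma uminus_bit_alg_closure [simp]: "- x = (x :: bit alg_closure)"
  using bit_double_alg_closure[of x] by (simp add: eq_neg_iff_add_eq_0 minus_unique)

text \<open>As a rewrite rule this removes every difference. Where facts stated for differences are
  used, it is taken out of the simplifier again.\<close>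

lemma minus_bit_alg_closure [simp]: "x - y = (x + y :: bit alg_closure)"
  unfolding diff_conv_add_uminus by simp

lemma poly_double_alg_closure [simp]: "p + p = (0 :: bit alg_closure poly)"
  by (rule poly_eqI) (simp only: coeff_add bit_double_alg_closure coeff_0)

lemma poly_minus_alg_closure [simp]: "p - q = (p + q :: bit alg_closure poly)"
  by (rule poly_eqI) simp

lemma square_add_alg_closure: "(x + y)\<^sup>2 = x\<^sup>2 + (y\<^sup>2 :: bit alg_closure)"
proof -
  have "(x + y)\<^sup>2 = x\<^sup>2 + y\<^sup>2 + (x * y + x * y)"
    by (simp add: power2_eq_square distrib_left distrib_right add_ac mult_ac del: bit_double_alg_closure)
  then show ?thesis by simp
qed

lemma square_add_poly: "(p + q)\<^sup>2 = p\<^sup>2 + (q\<^sup>2 :: bit alg_closure poly)"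
proof -
  have "(p + q)\<^sup>2 = p\<^sup>2 + q\<^sup>2 + (p * q + p * q)"
    by (simp add: power2_eq_square distrib_left distrib_right add_ac mult_ac del: poly_double_alg_closure)
  then show ?thesis by simp
qed

lemma square_double_exponent: "(x ^ 2 ^ i)\<^sup>2 = (x ^ 2 ^ Suc i :: 'a::comm_monoid_mult)"
  by (simp add: power_mult[symmetric] mult.commute)

lemma card_bvecs: "card (bvecs n) = 2 ^ n" "finite (bvecs n)"
proof -
  have U: "(UNIV :: bit set) = {0, 1}" by (auto intro: bit.exhaust)
  have eq: "bvecs n = {xs. set xs \<subseteq> {0, 1} \<and> length xs = n}"
    by (auto simp: bvecs_def U[symmetric])
  show "finite (bvecs n)" unfolding eq by (rule finite_lists_length_eq) simp
  show "card (bvecs n) = 2 ^ n" unfolding eq by (subst card_lists_length_eq) (simp_all add: numeral_2_eq_2)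
qed

lemma vec_of_Poly: "length v = n \<Longrightarrow> vec_of n (Poly v) = v"
  by (auto simp: vec_of_def coeff_Poly_eq nth_default_nth intro!: nth_equalityI)

lemma Poly_vec_of: "degree p < n \<Longrightarrow> Poly (vec_of n p) = p"
  by (rule poly_eqI) (auto simp: coeff_Poly_eq nth_default_def vec_of_def coeff_eq_0)

lemma degree_Poly_less: "0 < n \<Longrightarrow> length v = n \<Longrightarrow> degree (Poly v) < n"
  by (rule degree_lessI) (auto simp: coeff_Poly_eq nth_default_beyond)

lemma length_vec_of [simp]: "length (vec_of n p) = n"
  by (simp add: vec_of_def)

lemma card_small_polys:
  assumes n_pos: "0 < n"
  shows "card {q :: bit poly. degree q < n} = 2 ^ n" "finite {q :: bit poly. degree q < n}"
proof -
  have "bij_betw Poly (bvecs n) {q :: bit poly. degree q < n}"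
  proof (rule bij_betw_byWitness[where f' = "vec_of n"])
    show "Poly ` bvecs n \<subseteq> {q. degree q < n}" using degree_Poly_less[OF n_pos] by (auto simp: bvecs_def)
    show "\<forall>v\<in>bvecs n. vec_of n (Poly v) = v" by (auto simp: bvecs_def vec_of_Poly)
    show "\<forall>q\<in>{q. degree q < n}. Poly (vec_of n q) = q" by (auto simp: Poly_vec_of)
    show "vec_of n ` {q. degree q < n} \<subseteq> bvecs n" by (auto simp: bvecs_def)
  qed
  then show "card {q :: bit poly. degree q < n} = 2 ^ n" "finite {q :: bit poly. degree q < n}"
    using bij_betw_same_card bij_betw_finite card_bvecs by metis+
qed

lemma card_mc_polys:
  assumes n_pos: "0 < n" and "0 < t" shows "card (mc_polys n t) = (2 ^ n) ^ (9 * t)" "finite (mc_polys n t)"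
proof -
  let ?Q = "{q :: bit poly. degree q < n}"
  let ?A = "{l. set l \<subseteq> ?Q \<and> length l = 9 * t}"
  have "bij_betw Poly ?A (mc_polys n t)"
  proof (rule bij_betw_byWitness[where f' = "\<lambda>P :: bit poly poly. map (coeff P) [0..<9 * t]"])
    show "\<forall>l\<in>?A. map (coeff (Poly l)) [0..<9 * t] = l"
      by (auto simp: coeff_Poly_eq nth_default_nth intro!: nth_equalityI)
    show "\<forall>P\<in>mc_polys n t. Poly (map (coeff P) [0..<9 * t]) = P"
    proof (rule ballI, rule poly_eqI)
      fix P :: "bit poly poly" and i assume "P \<in> mc_polys n t"
      then have "degree P < 9 * t" using assms(2) by (auto simp: mc_polys_def)
      then show "coeff (Poly (map (coeff P) [0..<9 * t])) i = coeff P i"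
        by (auto simp: coeff_Poly_eq nth_default_def coeff_eq_0)
    qed
    show "Poly ` ?A \<subseteq> mc_polys n t"
    proof
      fix P assume "P \<in> Poly ` ?A"
      then obtain l where l: "l \<in> ?A" "P = Poly l" by blast
      have "degree P < 9 * t" unfolding l(2) using assms(2) l(1)
        by (intro degree_lessI) (auto simp: coeff_Poly_eq nth_default_beyond)
      moreover have "degree (coeff P i) < n" for i
      proof (cases "i < length l")
        case True
        then have "l ! i \<in> {q. degree q < n}" using l(1) nth_mem by blast
        then show ?thesis using True by (simp add: l(2) coeff_Poly_eq nth_default_def)
      qed (simp add: l(2) coeff_Poly_eq nth_default_def n_pos)
      ultimately show "P \<in> mc_polys n t" by (auto simp: mc_polys_def)
    qed
    show "(\<lambda>P. map (coeff P) [0..<9 * t]) ` mc_polys n t \<subseteq> ?A" by (auto simp: mc_polys_def)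
  qed
  note bij = this
  show "card (mc_polys n t) = (2 ^ n) ^ (9 * t)"
    using bij_betw_same_card[OF bij] card_lists_length_eq[OF card_small_polys(2)[OF n_pos], of "9 * t"]
    by (simp only: card_small_polys(1)[OF n_pos])
  show "finite (mc_polys n t)"
    using bij_betw_finite[OF bij] finite_lists_length_eq[OF card_small_polys(2)[OF n_pos], of "9 * t"] by simp
qed

section \<open>The field with 2^n elements inside the algebraic closure of the two-element
  field\<close>

locale gf =
  fixes n :: nat and g :: "bit poly"
  assumes irr: "irreducible g" and deg_g: "degree g = n" and n_pos: "0 < n"
begin

text \<open>The residue ring modulo g depends on n and g and would need its own type. Adjoining a
  root of g inside the algebraic closure realises it as a subset of a fixed field type, where the
  theory of roots of polynomials is available.\<close>

definition \<alpha> :: "bit alg_closure" where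
  "\<alpha> = (SOME a. poly (map_poly to_ac g) a = 0)"

definition \<phi> :: "bit poly \<Rightarrow> bit alg_closure" where
  "\<phi> p = poly (map_poly to_ac p) \<alpha>"

lemma \<phi>_g: "\<phi> g = 0"
proof -
  have "degree (map_poly to_ac g) = n" by (simp add: degree_map_poly deg_g)
  then have "\<exists>a. poly (map_poly to_ac g) a = 0"
    by (intro alg_closed_imp_poly_has_root) (simp add: n_pos)
  then show ?thesis unfolding \<phi>_def \<alpha>_def by (rule someI_ex)
qed

lemma \<phi>_0 [simp]: "\<phi> 0 = 0"
  by (simp add: \<phi>_def)

lemma \<phi>_pCons [simp]: "\<phi> (pCons a p) = to_ac a + \<alpha> * \<phi> p"
  by (simp add: \<phi>_def map_poly_pCons)

lemma \<phi>_1 [simp]: "\<phi> 1 = 1"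
  by (simp add: \<phi>_def)

lemma \<phi>_add: "\<phi> (p + q) = \<phi> p + \<phi> q"
proof (induction p q rule: poly_induct2)
  case (pCons a p b q)
  have "\<phi> (pCons a p + pCons b q) = to_ac a + to_ac b + \<alpha> * (\<phi> p + \<phi> q)"
    by (simp only: add_pCons \<phi>_pCons to_ac_add pCons)
  also have "\<dots> = \<phi> (pCons a p) + \<phi> (pCons b q)" by (simp add: distrib_left add_ac)
  finally show ?case .
qed simp

lemma \<phi>_smult: "\<phi> (smult a p) = to_ac a * \<phi> p"
  by (induction p) (simp_all add: algebra_simps del: minus_bit_alg_closure)

lemma \<phi>_mult: "\<phi> (p * q) = \<phi> p * \<phi> q"
  by (induction p) (simp_all add: \<phi>_add \<phi>_smult algebra_simps del: minus_bit_alg_closure)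

lemma \<phi>_mod: "\<phi> (p mod g) = \<phi> p"
proof -
  have "\<phi> p = \<phi> (p div g * g + p mod g)" by simp
  then show ?thesis by (simp only: \<phi>_add \<phi>_mult \<phi>_g) simp
qed

text \<open>A nonzero polynomial q of least degree that vanishes at \<alpha> divides g, by division
  with remainder. As g is irreducible, q would have degree n or be a constant; both are
  impossible.\<close>

lemma \<phi>_neq_0:
  assumes "p \<noteq> 0" "degree p < n" shows "\<phi> p \<noteq> 0"
proof
  assume "\<phi> p = 0"
  then have "\<exists>d q. q \<noteq> 0 \<and> \<phi> q = 0 \<and> degree q < n \<and> degree q = d" using assms by blast
  then obtain d q where q: "q \<noteq> 0" "\<phi> q = 0" "degree q < n" "degree q = d"
    and least: "\<And>d' q'. q' \<noteq> 0 \<Longrightarrow> \<phi> q' = 0 \<Longrightarrow> degree q' < n \<Longrightarrow> degree q' = d' \<Longrightarrow> d \<le> d'"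
    using exists_least_iff[of "\<lambda>d. \<exists>q. q \<noteq> 0 \<and> \<phi> q = 0 \<and> degree q < n \<and> degree q = d"]
    by (metis (no_types, lifting) not_less)
  have "\<phi> g = \<phi> (g div q) * \<phi> q + \<phi> (g mod q)"
    by (simp only: \<phi>_add[symmetric] \<phi>_mult[symmetric] div_mult_mod_eq)
  then have r: "\<phi> (g mod q) = 0" by (simp add: \<phi>_g q(2))
  have "g mod q = 0"
  proof (rule ccontr)
    assume nz: "g mod q \<noteq> 0"
    then have "degree (g mod q) < degree q" using degree_mod_less[OF q(1), of g] by simp
    then show False using least[OF nz r _ refl] q by simp
  qed
  then have "q dvd g" by (simp add: mod_eq_0_iff_dvd)
  then have "g dvd q \<or> is_unit q" by (rule irreducibleD'[OF irr])
  then show False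
  proof
    assume "g dvd q"
    then show False using dvd_imp_degree_le[OF _ q(1)] q(3) deg_g by fastforce
  next
    assume "is_unit q"
    then obtain c where "q = [:c:]" "c dvd 1" using is_unit_polyE by blast
    then show False using q by simp
  qed
qed

definition \<psi> :: "bit list \<Rightarrow> bit alg_closure" where
  "\<psi> v = \<phi> (Poly v)"

definition F :: "bit alg_closure set" where
  "F = \<psi> ` bvecs n"

definition vec :: "bit alg_closure \<Rightarrow> bit list" where
  "vec = the_inv_into (bvecs n) \<psi>"

lemma \<psi>_Nil [simp]: "\<psi> [] = 0"
  by (simp add: \<psi>_def)

lemma \<psi>_Cons [simp]: "\<psi> (b # v) = to_ac b + \<alpha> * \<psi> v"
  by (simp add: \<psi>_def)

lemma inj_\<psi>: "inj_on \<psi> (bvecs n)"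
proof (rule inj_onI)
  fix u v assume uv: "u \<in> bvecs n" "v \<in> bvecs n" "\<psi> u = \<psi> v"
  then have len: "length u = n" "length v = n" by (auto simp: bvecs_def)
  let ?d = "Poly u - Poly v"
  have "degree ?d < n" using degree_diff_less degree_Poly_less[OF n_pos] len by blast
  moreover have "\<phi> ?d = 0"
  proof -
    have "\<phi> (?d + Poly v) = \<phi> (Poly v)" using uv(3) by (simp add: \<psi>_def)
    then show ?thesis unfolding \<phi>_add by simp
  qed
  ultimately have "?d = 0" using \<phi>_neq_0 by blast
  then have "vec_of n (Poly u) = vec_of n (Poly v)" by simp
  then show "u = v" using len by (simp add: vec_of_Poly)
qed

lemma card_F: "card F = 2 ^ n" "finite F"
  unfolding F_def by (simp_all add: card_image[OF inj_\<psi>] card_bvecs)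

lemma \<psi>_in_F: "v \<in> bvecs n \<Longrightarrow> \<psi> v \<in> F"
  by (simp add: F_def)

lemma vec_\<psi>: "v \<in> bvecs n \<Longrightarrow> vec (\<psi> v) = v"
  unfolding vec_def by (rule the_inv_into_f_f[OF inj_\<psi>])

lemma \<psi>_vec: "y \<in> F \<Longrightarrow> \<psi> (vec y) = y"
  and vec_in: "y \<in> F \<Longrightarrow> vec y \<in> bvecs n"
  by (auto simp: F_def vec_\<psi>)

lemma \<phi>_in_F: "\<phi> p \<in> F"
proof -
  have "g \<noteq> 0" using deg_g n_pos by auto
  then have "degree (p mod g) < n"
    using degree_mod_less'[of g p] deg_g n_pos by (cases "p mod g = 0") auto
  then have "Poly (vec_of n (p mod g)) = p mod g" by (rule Poly_vec_of)
  then have "\<psi> (vec_of n (p mod g)) = \<phi> p" by (simp add: \<psi>_def \<phi>_mod)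
  then show ?thesis using \<psi>_in_F[of "vec_of n (p mod g)"] by (simp add: bvecs_def)
qed

lemma F_range: "F = range \<phi>"
  using \<phi>_in_F by (auto simp: F_def \<psi>_def)

lemma F_0: "0 \<in> F" and F_1: "1 \<in> F"
  using \<phi>_in_F[of 0] \<phi>_in_F[of 1] by simp_all

lemma F_add: "x \<in> F \<Longrightarrow> y \<in> F \<Longrightarrow> x + y \<in> F"
  unfolding F_range by (auto simp: \<phi>_add[symmetric])

lemma F_mult: "x \<in> F \<Longrightarrow> y \<in> F \<Longrightarrow> x * y \<in> F"
  unfolding F_range by (auto simp: \<phi>_mult[symmetric])

lemma F_\<alpha>: "\<alpha> \<in> F"
  using \<phi>_in_F[of "[:0, 1:]"] by simp

lemma F_power: "x \<in> F \<Longrightarrow> x ^ i \<in> F"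
  by (induction i) (simp_all add: F_1 F_mult)

lemma F_mult_surj:
  assumes "d \<in> F" "d \<noteq> 0" shows "(\<lambda>x. x * d) ` F = F"
proof (rule card_subset_eq[OF card_F(2)])
  show "(\<lambda>x. x * d) ` F \<subseteq> F" using assms F_mult by auto
  show "card ((\<lambda>x. x * d) ` F) = card F"
    by (rule card_image) (use assms(2) in \<open>auto simp: inj_on_def\<close>)
qed

text \<open>Multiplication by x \<noteq> 0 permutes the nonzero elements of F. Comparing the
  products over all of them shows that x to their number is 1.\<close>

lemma F_fermat:
  assumes "x \<in> F" shows "x ^ 2 ^ n = x"
proof (cases "x = 0")
  case False
  let ?F = "F - {0}"
  have inj: "inj_on (\<lambda>y. y * x) ?F" using False by (auto simp: inj_on_def)
  have im: "(\<lambda>y. y * x) ` ?F = ?F"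
  proof -
    have "(\<lambda>y. y * x) ` ?F = (\<lambda>y. y * x) ` F - {0}" using False by auto
    then show ?thesis by (simp only: F_mult_surj[OF assms False])
  qed
  have "\<Prod>?F = (\<Prod>y\<in>(\<lambda>y. y * x) ` ?F. y)" by (simp only: im)
  also have "\<dots> = (\<Prod>y\<in>?F. y * x)" by (subst prod.reindex[OF inj]) simp
  also have "\<dots> = \<Prod>?F * x ^ card ?F" by (simp add: prod.distrib)
  finally have "\<Prod>?F * 1 = \<Prod>?F * x ^ card ?F" by simp
  moreover have "\<Prod>?F \<noteq> 0" using card_F(2) by simp
  ultimately have "x ^ card ?F = 1" by (metis mult_left_cancel)
  moreover have "2 ^ n = Suc (card ?F)"
    using card_F F_0 card_Suc_Diff1[of F 0] by simp
  ultimately show ?thesis by simp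
qed simp

text \<open>The exponents 2, 4, ..., 2^(n-1) add up to 2^n - 2. This form of the inverse needs only
  n - 1 squarings and multiplications, and the inversion program computes it.\<close>

lemma F_inverse_power:
  assumes "x \<in> F" "x \<noteq> 0" shows "(\<Prod>i\<in>{1..<n}. x ^ 2 ^ i) * x = 1"
proof -
  have "(\<Prod>i\<in>{1..<Suc m}. x ^ 2 ^ i) * x * x = x ^ 2 ^ Suc m" for m
  proof (induction m)
    case (Suc m)
    have "(\<Prod>i\<in>{1..<Suc (Suc m)}. x ^ 2 ^ i) * x * x =
        ((\<Prod>i\<in>{1..<Suc m}. x ^ 2 ^ i) * x * x) * x ^ 2 ^ Suc m" by (simp add: mult_ac)
    also have "\<dots> = x ^ 2 ^ Suc (Suc m)"
      unfolding Suc by (simp only: power2_eq_square[symmetric] square_double_exponent)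
    finally show ?case .
  qed (simp add: power2_eq_square)
  from this[of "n - 1"] have "(\<Prod>i\<in>{1..<n}. x ^ 2 ^ i) * x * x = 1 * x"
    using n_pos F_fermat[OF assms(1)] by simp
  then show ?thesis using assms(2) by (simp only: mult_right_cancel[OF assms(2)])
qed

lemma \<psi>_mc_eval: "\<psi> (mc_eval n g P x) = poly (map_poly \<phi> P) (\<psi> x)"
proof -
  have "\<psi> (mc_eval n g P x) = \<phi> (poly P (Poly x))"
  proof -
    have "g \<noteq> 0" using deg_g n_pos by auto
    then have "degree (poly P (Poly x) mod g) < n"
      using degree_mod_less'[of g "poly P (Poly x)"] deg_g n_pos
      by (cases "poly P (Poly x) mod g = 0") auto
    then show ?thesis by (simp add: mc_eval_def \<psi>_def Poly_vec_of \<phi>_mod)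
  qed
  also have "\<dots> = poly (map_poly \<phi> P) (\<psi> x)"
    by (induction P) (simp_all add: \<phi>_add \<phi>_mult \<psi>_def map_poly_pCons)
  finally show ?thesis .
qed

lemma mc_eval_in: "mc_eval n g P x \<in> bvecs n"
  by (simp add: mc_eval_def bvecs_def)

text \<open>A nonzero difference would have degree below 9t and yet 9t roots.\<close>

lemma mc_eval_inj:
  assumes t: "0 < t" and I: "I \<subseteq> bvecs n" "card I = 9 * t"
    and P: "P \<in> mc_polys n t" "Q \<in> mc_polys n t" and eq: "\<And>x. x \<in> I \<Longrightarrow> mc_eval n g P x = mc_eval n g Q x"
  shows "P = Q"
proof -
  let ?D = "map_poly \<phi> P - map_poly \<phi> Q"
  have "degree ?D < 9 * t"
  proof -
    have "degree (map_poly \<phi> R) < 9 * t" if "R \<in> mc_polys n t" for R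
      using that t map_poly_degree_leq[of \<phi> R] by (auto simp: mc_polys_def)
    then show ?thesis using degree_diff_less[of "map_poly \<phi> P" "9 * t" "map_poly \<phi> Q"] P by blast
  qed
  moreover have "9 * t \<le> card {x. poly ?D x = 0}" if "?D \<noteq> 0"
  proof -
    have "\<psi> ` I \<subseteq> {x. poly ?D x = 0}"
      using eq by (auto simp del: poly_minus_alg_closure simp: \<psi>_mc_eval[symmetric])
    moreover have "card (\<psi> ` I) = 9 * t"
      using card_image[OF inj_on_subset[OF inj_\<psi> I(1)]] I(2) by simp
    ultimately show ?thesis using card_mono[OF poly_roots_finite[OF that]] by metis
  qed
  ultimately have D: "?D = 0" using card_poly_roots_bound[of ?D] by fastforce
  show ?thesis
  proof (rule poly_eqI)
    fix i
    have "\<phi> (coeff P i) = \<phi> (coeff Q i)"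
      using arg_cong[OF D, of "\<lambda>p. coeff p i"]
      by (simp add: coeff_map_poly del: poly_minus_alg_closure minus_bit_alg_closure)
    moreover have "\<phi> (coeff P i) = \<phi> (coeff P i - coeff Q i) + \<phi> (coeff Q i)"
      by (simp add: \<phi>_add[symmetric])
    ultimately have "\<phi> (coeff P i - coeff Q i) = 0" by simp
    moreover have "degree (coeff P i - coeff Q i) < n"
      using P by (intro degree_diff_less) (auto simp: mc_polys_def)
    ultimately show "coeff P i = coeff Q i" using \<phi>_neq_0[of "coeff P i - coeff Q i"] by auto
  qed
qed


text \<open>Interpolation by counting: restricting evaluation to 9t points is injective on the
  polynomials, and there are as many polynomials as functions on these points. So the values at the
  points are those of a uniformly random function. The bound 9t \<le> 2^n guarantees that enough
  points exist.\<close>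

lemma kwise_mc_polys:
  assumes t: "0 < t" "9 * t \<le> 2 ^ n"
  shows "kwise (pmf_of_set (mc_polys n t)) (mc_eval n g) (bvecs n) (bvecs n) (9 * t)"
proof
  let ?Y = "bvecs n"
  have fin: "finite (mc_polys n t)" and ne: "mc_polys n t \<noteq> {}"
    using card_mc_polys[OF n_pos t(1)] card_gt_0_iff[of "mc_polys n t"] by auto
  show "finite (set_pmf (pmf_of_set (mc_polys n t)))" using fin ne by simp
  show "finite ?Y" by (rule card_bvecs)
  show "?Y \<noteq> {}" using card_bvecs[of n] by auto
  fix cs :: "(bit list \<times> bit list set) list"
  assume cs: "distinct (map fst cs)" "length cs \<le> 9 * t" "set cs \<subseteq> ?Y \<times> Pow ?Y"
  let ?A = "set (map fst cs)"
  have "card ?A \<le> 9 * t" using card_length[of "map fst cs"] cs(2) by simp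
  moreover have "?A \<subseteq> ?Y" using cs(3) by auto
  ultimately obtain I where I: "?A \<subseteq> I" "I \<subseteq> ?Y" "card I = 9 * t"
    using exists_subset_between[of ?A "9 * t" ?Y] t(2) card_bvecs[of n] by auto
  have finI: "finite I" using I(2) card_bvecs finite_subset by blast
  \<comment> \<open>The constrained points were completed to exactly 9t. Added points get the full
    set as their target and contribute the factor 1.\<close>
  define W where "W = (\<lambda>x. case map_of cs x of Some V \<Rightarrow> V | None \<Rightarrow> ?Y)"
  have W_in: "W x = V" if "(x, V) \<in> set cs" for x V
    using map_of_is_SomeI[OF cs(1) that] by (simp add: W_def)
  have W_out: "W x = ?Y" if "x \<notin> ?A" for x
    using that map_of_eq_None_iff[of cs x] by (simp add: W_def)
  have W_sub: "W x \<subseteq> ?Y" for x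
    using cs(3) map_of_SomeD[of cs x] by (auto simp: W_def split: option.splits)
  let ?R = "\<lambda>P. restrict (mc_eval n g P) I"
  have inj: "inj_on ?R (mc_polys n t)"
  proof (rule inj_onI)
    fix P Q assume PQ: "P \<in> mc_polys n t" "Q \<in> mc_polys n t" "?R P = ?R Q"
    show "P = Q"
      by (rule mc_eval_inj[OF t(1) I(2,3) PQ(1,2)]) (use PQ(3) in \<open>metis restrict_apply'\<close>)
  qed
  have im: "?R ` mc_polys n t = I \<rightarrow>\<^sub>E ?Y"
  proof (rule card_subset_eq)
    show "finite (I \<rightarrow>\<^sub>E ?Y)" using finI card_bvecs by (intro finite_PiE) auto
    show "?R ` mc_polys n t \<subseteq> I \<rightarrow>\<^sub>E ?Y" using mc_eval_in by auto
    show "card (?R ` mc_polys n t) = card (I \<rightarrow>\<^sub>E ?Y)"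
      using card_mc_polys[OF n_pos t(1)] I(3) finI by (simp add: card_image[OF inj] card_PiE card_bvecs)
  qed
  let ?G = "{P. \<forall>(x, V)\<in>set cs. mc_eval n g P x \<in> V}"
  have G: "P \<in> ?G \<longleftrightarrow> ?R P \<in> PiE I W" for P
  proof
    assume P: "P \<in> ?G"
    have "mc_eval n g P x \<in> W x" if "x \<in> I" for x
    proof (cases "x \<in> ?A")
      case True
      then obtain V where "(x, V) \<in> set cs" by auto
      then show ?thesis using P W_in by auto
    next
      case False
      then show ?thesis using W_out[OF False] mc_eval_in by simp
    qed
    then show "?R P \<in> PiE I W" by auto
  next
    assume P: "?R P \<in> PiE I W"
    show "P \<in> ?G"
    proof (clarify)
      fix x V assume xV: "(x, V) \<in> set cs"
      then have "x \<in> I" using I(1) by force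
      then have "mc_eval n g P x \<in> W x" using P by (metis PiE_mem restrict_apply')
      then show "mc_eval n g P x \<in> V" using W_in[OF xV] by simp
    qed
  qed
  have "card (mc_polys n t \<inter> ?G) = card (?R ` (mc_polys n t \<inter> ?G))"
    by (rule card_image[symmetric]) (rule inj_on_subset[OF inj], simp)
  also have "?R ` (mc_polys n t \<inter> ?G) = PiE I W"
  proof
    show "?R ` (mc_polys n t \<inter> ?G) \<subseteq> PiE I W" using G by blast
    show "PiE I W \<subseteq> ?R ` (mc_polys n t \<inter> ?G)"
    proof
      fix w assume w: "w \<in> PiE I W"
      then have "w \<in> I \<rightarrow>\<^sub>E ?Y" using W_sub by (meson PiE_mono subsetD)
      then have "w \<in> ?R ` mc_polys n t" by (simp only: im)
      then obtain P where "P \<in> mc_polys n t" "w = ?R P" by blast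
      then show "w \<in> ?R ` (mc_polys n t \<inter> ?G)" using w G by blast
    qed
  qed
  also have "card (PiE I W) = (\<Prod>x\<in>I. card (W x))" by (rule card_PiE[OF finI])
  finally have c: "card (mc_polys n t \<inter> ?G) = (\<Prod>x\<in>I. card (W x))" .
  have "card (mc_polys n t) = (\<Prod>x\<in>I. card ?Y)"
    using card_mc_polys[OF n_pos t(1)] I(3) by (simp add: card_bvecs)
  then have "measure_pmf.prob (pmf_of_set (mc_polys n t)) ?G =
      real (\<Prod>x\<in>I. card (W x)) / real (\<Prod>x\<in>I. card ?Y)"
    using measure_pmf_of_set[OF ne fin] c by simp
  also have "\<dots> = (\<Prod>x\<in>I. real (card (W x)) / real (card ?Y))"
    by (simp only: of_nat_prod prod_dividef)
  also have "\<dots> = (\<Prod>x\<in>?A. real (card (W x)) / real (card ?Y))"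
  proof (rule prod.mono_neutral_right[OF finI I(1)])
    show "\<forall>x\<in>I - ?A. real (card (W x)) / real (card ?Y) = 1"
      using W_out by (simp add: card_bvecs)
  qed
  also have "\<dots> = (\<Prod>x\<leftarrow>map fst cs. real (card (W x)) / real (card ?Y))"
    by (rule prod.distinct_set_conv_list[OF cs(1)])
  also have "\<dots> = (\<Prod>(x, V)\<leftarrow>cs. real (card V) / real (card ?Y))"
    unfolding map_map comp_def
    by (rule arg_cong[of _ _ prod_list], rule map_cong[OF refl]) (use W_in in auto)
  finally show "measure_pmf.prob (pmf_of_set (mc_polys n t)) ?G =
      (\<Prod>(x, V)\<leftarrow>cs. real (card V) / real (card ?Y))" .
qed

section \<open>The trace and its polynomial\<close>

text \<open>On F this is the absolute trace to the two-element field.\<close>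

definition tr :: "bit alg_closure \<Rightarrow> bit alg_closure" where
  "tr x = (\<Sum>i<n. x ^ 2 ^ i)"

definition TrP :: "bit alg_closure \<Rightarrow> bit alg_closure poly" where
  "TrP \<beta> = (\<Sum>i<n. [:0, \<beta>:] ^ 2 ^ i)"

lemma power_2_add: "(x + y) ^ 2 ^ i = x ^ 2 ^ i + (y ^ 2 ^ i :: bit alg_closure)"
proof (induction i)
  case (Suc i)
  have "(x + y) ^ 2 ^ Suc i = ((x + y) ^ 2 ^ i)\<^sup>2" by (simp only: square_double_exponent)
  also have "\<dots> = x ^ 2 ^ Suc i + y ^ 2 ^ Suc i"
    unfolding Suc square_add_alg_closure by (simp only: square_double_exponent)
  finally show ?case .
qed simp

lemma tr_add: "tr (x + y) = tr x + tr y"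
  by (simp add: tr_def power_2_add sum.distrib)

lemma tr_0 [simp]: "tr 0 = 0"
  by (simp add: tr_def power_0_left)

lemma tr_sum: "tr (\<Sum>i\<in>A. h i) = (\<Sum>i\<in>A. tr (h i))"
  by (induction A rule: infinite_finite_induct) (simp_all add: tr_add)

lemma poly_TrP: "poly (TrP \<beta>) x = tr (\<beta> * x)"
  by (simp add: TrP_def tr_def poly_sum mult.commute)

text \<open>Squaring shifts the sum by one place, so that all inner terms cancel. For \<beta> = 1
  the right-hand side vanishes on all of F, and the left-hand side is T (T + 1) with T =
  \<open>TrP 1\<close>.\<close>

lemma TrP_square: "(TrP \<beta>)\<^sup>2 + TrP \<beta> = [:0, \<beta>:] ^ 2 ^ n + [:0, \<beta>:]"
proof -
  have "(\<Sum>i<m. [:0, \<beta>:] ^ 2 ^ i)\<^sup>2 + (\<Sum>i<m. [:0, \<beta>:] ^ 2 ^ i) = [:0, \<beta>:] ^ 2 ^ m + [:0, \<beta>:]" for m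
  proof (induction m)
    case (Suc m)
    let ?S = "\<Sum>i<m. [:0, \<beta>:] ^ 2 ^ i" and ?x = "[:0, \<beta>:] ^ 2 ^ m"
    have "(\<Sum>i<Suc m. [:0, \<beta>:] ^ 2 ^ i)\<^sup>2 + (\<Sum>i<Suc m. [:0, \<beta>:] ^ 2 ^ i) =
        (?S\<^sup>2 + ?S) + (?x\<^sup>2 + ?x)"
      unfolding sum.lessThan_Suc square_add_poly by (simp only: add_ac)
    also have "\<dots> = [:0, \<beta>:] ^ 2 ^ Suc m + [:0, \<beta>:] + (?x + ?x)"
      unfolding Suc square_double_exponent by (simp only: add_ac)
    finally show ?case by (simp only: poly_double_alg_closure add_0_right)
  next
    case 0
    show ?case by (simp only: lessThan_0 sum.empty power2_eq_square mult_zero_left add_0_right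
        power_0 power_one_right poly_double_alg_closure)
  qed
  then show ?thesis unfolding TrP_def .
qed

lemma tr_values:
  assumes "x \<in> F" shows "tr x = 0 \<or> tr x = 1"
proof -
  have "poly ((TrP 1)\<^sup>2 + TrP 1) x = poly ([:0, 1:] ^ 2 ^ n + [:0, 1:]) x" by (simp only: TrP_square)
  then have "(tr x)\<^sup>2 + tr x = x ^ 2 ^ n + x" by (simp add: poly_TrP)
  then have "(tr x)\<^sup>2 + tr x = 0" unfolding F_fermat[OF assms] by (simp only: bit_double_alg_closure)
  then have "tr x * (tr x + 1) = 0" by (simp add: power2_eq_square distrib_left)
  moreover have "tr x = 1" if "tr x + 1 = 0"
    using that by (metis add.inverse_unique uminus_bit_alg_closure add.commute)
  ultimately show ?thesis by (metis mult_eq_0_iff)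
qed

lemma \<psi>_sum: "\<psi> v = (\<Sum>i<length v. to_ac (v ! i) * \<alpha> ^ i)"
proof (induction v)
  case (Cons b v)
  show ?case
    by (simp add: Cons sum.lessThan_Suc_shift sum_distrib_left mult_ac del: sum.lessThan_Suc)
qed simp

text \<open>Nondegeneracy of the trace form. If the traces agree for all i, then d = x + y satisfies
  tr (\<alpha>^i d) = 0. As every element of F is a multiple of d, and so a combination of the
  \<alpha>^i d with coefficients 0 and 1, the trace would vanish on F. That gives
  \<open>TrP 1\<close> more roots than its degree permits.\<close>

lemma tr_separates:
  assumes x: "x \<in> F" "y \<in> F" "x \<noteq> y"
  shows "\<exists>i<n. tr (\<alpha> ^ i * x) \<noteq> tr (\<alpha> ^ i * y)"
proof (rule ccontr)
  assume "\<not> ?thesis"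
  then have eq: "tr (\<alpha> ^ i * x) = tr (\<alpha> ^ i * y)" if "i < n" for i using that by blast
  define d where "d = x + y"
  have d: "d \<in> F" "d \<noteq> 0"
    using x F_add minus_bit_alg_closure[of x y] by (auto simp: d_def simp del: minus_bit_alg_closure)
      (metis eq_iff_diff_eq_0 minus_bit_alg_closure)
  have trd: "tr (\<alpha> ^ i * d) = 0" if "i < n" for i
    unfolding d_def distrib_left tr_add eq[OF that] by simp
  have zero: "tr z = 0" if z: "z \<in> F" for z
  proof -
    obtain y' where y': "y' \<in> F" "z = y' * d" using F_mult_surj[OF d] z by blast
    obtain v where v: "v \<in> bvecs n" "y' = \<psi> v" using y'(1) by (auto simp: F_def)
    have "z = (\<Sum>i<n. to_ac (v ! i) * (\<alpha> ^ i * d))"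
      using v(1) unfolding y'(2) v(2) \<psi>_sum by (simp add: bvecs_def sum_distrib_right mult.assoc)
    also have "tr \<dots> = (\<Sum>i<n. tr (to_ac (v ! i) * (\<alpha> ^ i * d)))" by (rule tr_sum)
    also have "\<dots> = 0"
    proof (rule sum.neutral, rule ballI)
      fix i assume "i \<in> {..<n}"
      then show "tr (to_ac (v ! i) * (\<alpha> ^ i * d)) = 0"
        by (cases "v ! i" rule: bit.exhaust) (simp_all add: trd)
    qed
    finally show ?thesis .
  qed
  \<comment> \<open>The coefficient of X shows that the trace polynomial is nonzero, so its degree
    bounds the number of its roots.\<close>
  have deg: "degree (\<Sum>i<m. [:0, 1 :: bit alg_closure:] ^ 2 ^ i) < 2 ^ m \<and>
      (0 < m \<longrightarrow> coeff (\<Sum>i<m. [:0, 1 :: bit alg_closure:] ^ 2 ^ i) 1 = 1)" for m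
  proof (induction m)
    case (Suc m)
    let ?S = "\<Sum>i<m. [:0, 1 :: bit alg_closure:] ^ 2 ^ i"
    have mono: "[:0, 1 :: bit alg_closure:] ^ 2 ^ m = monom 1 (2 ^ m)" by (simp add: monom_altdef)
    have "degree (?S + monom 1 (2 ^ m)) < 2 ^ Suc m"
      using Suc by (intro degree_add_less) (auto intro: le_less_trans[OF degree_monom_le])
    moreover have "coeff (?S + monom 1 (2 ^ m)) 1 = 1"
      using Suc by (cases m) auto
    ultimately show ?case unfolding sum.lessThan_Suc mono by blast
  qed simp
  have nz: "TrP 1 \<noteq> 0" using deg[of n] n_pos by (auto simp: TrP_def)
  have "F \<subseteq> {x. poly (TrP 1) x = 0}" using zero by (auto simp: poly_TrP)
  then have "card F \<le> card {x. poly (TrP 1) x = 0}"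
    by (rule card_mono[OF poly_roots_finite[OF nz]])
  also have "\<dots> \<le> degree (TrP 1)" by (rule card_poly_roots_bound[OF nz])
  also have "\<dots> < 2 ^ n" using deg[of n] by (simp add: TrP_def)
  finally show False using card_F by simp
qed

text \<open>Such an h divides X^(2^n) + X, a polynomial of degree 2^n that vanishes at all 2^n
  elements of F. The cofactor accounts for at most as many of them as its own degree, so h must have
  its full number of roots in F. Hence a split with \<beta> = 1 leaves only factors with distinct
  roots, all in F.\<close>

lemma card_roots_dvd_TrP:
  assumes h: "h \<noteq> 0" and dvd: "h dvd TrP 1 + [:c:]" and c: "c = 0 \<or> c = 1"
  shows "card {x\<in>F. poly h x = 0} = degree h"
proof -
  have "(TrP 1 + [:c:]) * (TrP 1 + [:c + 1:]) = (TrP 1)\<^sup>2 + TrP 1"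
    using c
  proof
    assume "c = 1"
    then have "TrP 1 + [:c + 1:] = TrP 1" by simp
    then show ?thesis using \<open>c = 1\<close> by (simp add: power2_eq_square distrib_right one_pCons[symmetric])
  qed (simp add: power2_eq_square distrib_left one_pCons[symmetric])
  then have "h dvd [:0, 1:] ^ 2 ^ n + [:0, 1:]"
    using dvd unfolding TrP_square by (metis dvd_mult2)
  then obtain k where k: "[:0, 1:] ^ 2 ^ n + [:0, 1:] = h * k" by (elim dvdE)
  have mono: "[:0, 1 :: bit alg_closure:] ^ 2 ^ n = monom 1 (2 ^ n)" by (simp add: monom_altdef)
  have n2: "1 < (2::nat) ^ n" using n_pos by (metis one_less_numeral_iff one_less_power semiring_norm(76))
  have deg: "degree ([:0, 1 :: bit alg_closure:] ^ 2 ^ n + [:0, 1:]) = 2 ^ n"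
    unfolding mono using n2 by (subst degree_add_eq_left) (simp_all add: degree_monom_eq)
  then have nz: "h * k \<noteq> 0" using k n2 by (metis degree_0 not_one_less_zero)
  then have kz: "k \<noteq> 0" by auto
  have sum: "degree h + degree k = 2 ^ n" using degree_mult_eq[OF h kz] k deg by simp
  have roots: "F \<subseteq> {x\<in>F. poly h x = 0} \<union> {x\<in>F. poly k x = 0}"
  proof
    fix x assume x: "x \<in> F"
    have "poly (h * k) x = x ^ 2 ^ n + x" unfolding k[symmetric] by simp
    then have "poly h x * poly k x = 0" unfolding F_fermat[OF x] by simp
    then show "x \<in> {x\<in>F. poly h x = 0} \<union> {x\<in>F. poly k x = 0}" using x by auto
  qed
  have le: "card {x\<in>F. poly q x = 0} \<le> degree q" if "q \<noteq> 0" for q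
    using card_mono[OF poly_roots_finite[OF that], of "{x\<in>F. poly q x = 0}"]
      card_poly_roots_bound[OF that] by (auto intro: order_trans)
  have "2 ^ n \<le> card ({x\<in>F. poly h x = 0} \<union> {x\<in>F. poly k x = 0})"
    using card_mono[OF _ roots] card_F by simp
  also have "\<dots> \<le> card {x\<in>F. poly h x = 0} + card {x\<in>F. poly k x = 0}" by (rule card_Un_le)
  finally show ?thesis using le[OF h] le[OF kz] sum by linarith
qed

end

section \<open>Division-free polynomial arithmetic on coefficient lists\<close>

text \<open>Polynomials over the field are lists of coefficients, highest degree first.\<close>

type_synonym kpoly = "bit alg_closure list"

definition hpoly :: "kpoly \<Rightarrow> bit alg_closure poly" where
  "hpoly xs = Poly (rev xs)"

lemma hpoly_Nil [simp]: "hpoly [] = 0"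
  by (simp add: hpoly_def)

lemma hpoly_Cons: "hpoly (x # xs) = monom x (length xs) + hpoly xs"
  by (simp add: hpoly_def Poly_append monom_altdef Poly_snoc add.commute smult_monom)

definition strip :: "kpoly \<Rightarrow> kpoly" where
  "strip = dropWhile (\<lambda>x. x = 0)"

lemma hpoly_strip [simp]: "hpoly (strip xs) = hpoly xs"
  by (induction xs) (auto simp: strip_def hpoly_Cons)

lemma length_strip: "length (strip xs) \<le> length xs"
  by (simp add: strip_def length_dropWhile_le)

definition stripped :: "kpoly \<Rightarrow> bool" where
  "stripped xs \<longleftrightarrow> xs = [] \<or> hd xs \<noteq> 0"

lemma stripped_strip: "stripped (strip xs)"
  using hd_dropWhile[of "\<lambda>x. x = 0" xs] by (auto simp: stripped_def strip_def)

lemma degree_hpoly_less: "xs \<noteq> [] \<Longrightarrow> degree (hpoly xs) < length xs"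
  by (rule degree_lessI) (auto simp: hpoly_def coeff_Poly_eq nth_default_beyond)

lemma coeff_hpoly_top: "coeff (hpoly (x # xs)) (length xs) = x"
  by (simp add: hpoly_def coeff_Poly_eq nth_default_append)

lemma degree_stripped: "stripped xs \<Longrightarrow> xs \<noteq> [] \<Longrightarrow> degree (hpoly xs) = length xs - 1"
proof (cases xs)
  case (Cons x ys)
  assume "stripped xs"
  then have "coeff (hpoly xs) (length ys) \<noteq> 0" using Cons coeff_hpoly_top[of x ys] by (simp add: stripped_def)
  then have "length ys \<le> degree (hpoly xs)" by (rule le_degree)
  then show ?thesis using degree_hpoly_less[of xs] Cons by simp
qed simp

lemma stripped_hpoly_0: "stripped xs \<Longrightarrow> hpoly xs = 0 \<longleftrightarrow> xs = []"
  by (cases xs) (use coeff_hpoly_top in \<open>auto simp: stripped_def\<close>, metis coeff_0)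

text \<open>The lists are aligned at their leading ends, and a missing entry of the second one
  counts as zero.\<close>

fun comb :: "bit alg_closure \<Rightarrow> bit alg_closure \<Rightarrow> kpoly \<Rightarrow> kpoly \<Rightarrow> kpoly" where
  "comb a b [] ys = []"
| "comb a b (x # xs) [] = b * x # comb a b xs []"
| "comb a b (x # xs) (y # ys) = (b * x + a * y) # comb a b xs ys"

lemma length_comb [simp]: "length (comb a b xs ys) = length xs"
  by (induction a b xs ys rule: comb.induct) auto

lemma hpoly_comb:
  "length ys \<le> length xs \<Longrightarrow>
    hpoly (comb a b xs ys) = smult b (hpoly xs) + monom a (length xs - length ys) * hpoly ys"
proof (induction a b xs ys rule: comb.induct)
  case (3 a b x xs y ys)
  then show ?case
    by (simp add: hpoly_Cons smult_add_right smult_monom mult_monom distrib_left add_monom[symmetric] add_ac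
        del: poly_minus_alg_closure)
qed (auto simp: hpoly_Cons smult_add_right smult_monom)

text \<open>One division step with the leading coefficients multiplied crosswise, so that no inverse
  is computed. The two leading terms cancel and are dropped.\<close>

definition red :: "kpoly \<Rightarrow> kpoly \<Rightarrow> kpoly" where
  "red a b = comb (hd a) (hd b) (tl a) (tl b)"

lemma length_red [simp]: "length (red a b) = length a - 1"
  by (simp add: red_def)

lemma hpoly_red:
  assumes "length b \<le> length a" "b \<noteq> []"
  shows "hpoly (red a b) =
    smult (hd b) (hpoly a) + monom (hd a) (length a - length b) * hpoly b"
proof -
  obtain x xs y ys where ab: "a = x # xs" "b = y # ys"
    using assms by (cases a; cases b) auto
  let ?A = "monom (x * y) (length xs)" and ?D = "monom x (length xs - length ys)"
  have "smult y (monom x (length xs) + hpoly xs) = ?A + smult y (hpoly xs)"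
    by (simp only: smult_add_right smult_monom mult.commute[of y x])
  moreover have "?D * (monom y (length ys) + hpoly ys) = ?A + ?D * hpoly ys"
    using assms(1) by (simp add: ab distrib_left mult_monom)
  moreover have "(?A + p) + (?A + q) = (?A + ?A) + (p + q)" for p q by (simp only: add_ac)
  ultimately have "smult y (monom x (length xs) + hpoly xs) + ?D * (monom y (length ys) + hpoly ys) =
      smult y (hpoly xs) + ?D * hpoly ys"
    by (simp only: poly_double_alg_closure add_0_left)
  then show ?thesis
    using assms(1) by (simp add: ab red_def hpoly_Cons hpoly_comb)
qed

text \<open>Euclid's algorithm cut into moves that are either a swap or a single reduction. Nothing
  changes once b is empty, so the move can be iterated for as long as the clock runs.\<close>

definition gstep :: "kpoly \<times> kpoly \<Rightarrow> kpoly \<times> kpoly" where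
  "gstep = (\<lambda>(a, b). if b = [] then (a, b) else if length a < length b then (b, a)
     else (strip (red a b), b))"

text \<open>The invariant is the set of common divisors. Scaling a by the nonzero constant
  \<open>hd b\<close> does not affect divisibility.\<close>

lemma gstep_dvd:
  assumes "stripped a" "stripped b" and ab: "gstep (a, b) = (a', b')"
  shows "stripped a' \<and> stripped b' \<and>
    (d dvd hpoly a' \<and> d dvd hpoly b' \<longleftrightarrow> d dvd hpoly a \<and> d dvd hpoly b)"
proof (cases "b = [] \<or> length a < length b")
  case True
  then show ?thesis using assms by (auto simp: gstep_def split: if_splits)
next
  case False
  then have b: "b \<noteq> []" "length b \<le> length a" by auto
  then have eq: "a' = strip (red a b)" "b' = b" using ab by (auto simp: gstep_def)
  have "hd b \<noteq> 0" using assms(2) b by (simp add: stripped_def)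
  then have "d dvd smult (hd b) (hpoly a) \<longleftrightarrow> d dvd hpoly a" by (rule dvd_smult_iff)
  moreover have "d dvd p + m * q \<longleftrightarrow> d dvd p" if "d dvd q" for p m q
    using that by (simp add: dvd_add_left_iff)
  ultimately show ?thesis
    unfolding eq hpoly_strip hpoly_red[OF b(2,1)] using assms(2) stripped_strip by blast
qed

text \<open>The extra 1 marks a pending swap: a swap removes it, and a reduction may create it but
  lowers the doubled total length by at least 2.\<close>

lemma gstep_measure:
  fixes a b :: kpoly
  assumes "b \<noteq> []" "gstep (a, b) = (a', b')"
  shows "2 * (length a' + length b') + (if length a' < length b' then 1 else 0) <
    2 * (length a + length b) + (if length a < length b then 1 else (0::nat))"
proof (cases "length a < length b")
  case True
  then show ?thesis using assms by (auto simp: gstep_def)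
next
  case False
  then have eq: "a' = strip (red a b)" "b' = b" using assms by (auto simp: gstep_def)
  have "length a' \<le> length a - 1" unfolding eq using length_strip[of "red a b"] by simp
  moreover have "0 < length a" using False assms(1) by (cases a) auto
  ultimately have "length a' + 1 \<le> length a" by linarith
  then show ?thesis using False eq(2) by auto
qed

lemma gstep_iterate_dvd:
  assumes "stripped a" "stripped b" "(gstep ^^ N) (a, b) = (a', b')"
  shows "stripped a' \<and> stripped b' \<and>
    (d dvd hpoly a' \<and> d dvd hpoly b' \<longleftrightarrow> d dvd hpoly a \<and> d dvd hpoly b)"
  using assms(3)
proof (induction N arbitrary: a' b')
  case (Suc N)
  obtain a1 b1 where ab: "(gstep ^^ N) (a, b) = (a1, b1)" by force
  then have "gstep (a1, b1) = (a', b')" using Suc.prems by simp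
  then show ?case using Suc.IH[OF ab] gstep_dvd by blast
qed (use assms in auto)

lemma gstep_iterate_terminates:
  assumes "2 * (length a + length b) + 1 \<le> N"
  shows "snd ((gstep ^^ N) (a, b)) = []"
proof -
  have "snd ((gstep ^^ N) (a, b)) = []"
    if "2 * (length a + length b) + (if length a < length b then 1 else 0) \<le> N" for N a b
    using that
  proof (induction N arbitrary: a b)
    case 0
    then show ?case by (auto split: if_splits)
  next
    case (Suc N)
    obtain a1 b1 where ab: "gstep (a, b) = (a1, b1)" by force
    show ?case
    proof (cases "b = []")
      case True
      have "(gstep ^^ M) (a, []) = (a, [])" for M by (induction M) (auto simp: gstep_def)
      from this[of "Suc N"] show ?thesis using True by (simp only: snd_conv)
    next
      case False
      have "snd ((gstep ^^ N) (a1, b1)) = []"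
        by (rule Suc.IH) (use gstep_measure[OF False ab] Suc.prems in linarith)
      then show ?thesis by (simp add: funpow_swap1 ab)
    qed
  qed
  then show ?thesis using assms by auto
qed

definition gcdl :: "nat \<Rightarrow> kpoly \<Rightarrow> kpoly \<Rightarrow> kpoly" where
  "gcdl Z a b = fst ((gstep ^^ Z) (a, b))"

lemma gcdl:
  assumes "stripped a" "stripped b" "2 * (length a + length b) + 1 \<le> Z"
  shows "stripped (gcdl Z a b)" "d dvd hpoly (gcdl Z a b) \<longleftrightarrow> d dvd hpoly a \<and> d dvd hpoly b"
proof -
  obtain c c' where c: "(gstep ^^ Z) (a, b) = (c, c')" by force
  have "c' = []" using gstep_iterate_terminates[OF assms(3)] c by simp
  then show "stripped (gcdl Z a b)" "d dvd hpoly (gcdl Z a b) \<longleftrightarrow> d dvd hpoly a \<and> d dvd hpoly b"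
    using gstep_iterate_dvd[OF assms(1,2) c, of d] c by (auto simp: gcdl_def)
qed

definition monic :: "kpoly \<Rightarrow> kpoly" where
  "monic a = map (\<lambda>x. inverse (hd a) * x) a"

lemma hpoly_map_mult: "hpoly (map (\<lambda>x. c * x) a) = smult c (hpoly a)"
  by (induction a) (simp_all add: hpoly_Cons smult_add_right smult_monom)

lemma monic:
  assumes "stripped a" "a \<noteq> []"
  shows "hd (monic a) = 1" "length (monic a) = length a" "hpoly (monic a) dvd d \<longleftrightarrow> hpoly a dvd d"
    "d dvd hpoly (monic a) \<longleftrightarrow> d dvd hpoly a" "poly (hpoly (monic a)) x = 0 \<longleftrightarrow> poly (hpoly a) x = 0"
proof -
  have h: "hd a \<noteq> 0" using assms by (simp add: stripped_def)
  then show "hd (monic a) = 1" "length (monic a) = length a" using assms by (auto simp: monic_def hd_map)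
  have eq: "hpoly (monic a) = smult (inverse (hd a)) (hpoly a)"
    unfolding monic_def by (rule hpoly_map_mult)
  show "hpoly (monic a) dvd d \<longleftrightarrow> hpoly a dvd d" "d dvd hpoly (monic a) \<longleftrightarrow> d dvd hpoly a"
    "poly (hpoly (monic a)) x = 0 \<longleftrightarrow> poly (hpoly a) x = 0"
    unfolding eq using h by (simp_all add: smult_dvd_iff dvd_smult_iff)
qed

definition rstep :: "kpoly \<Rightarrow> kpoly \<Rightarrow> kpoly" where
  "rstep h a = (if length a < length h then a else red a h)"

definition reml :: "nat \<Rightarrow> kpoly \<Rightarrow> kpoly \<Rightarrow> kpoly" where
  "reml Z a h = (rstep h ^^ Z) a"

text \<open>As h is monic, the crosswise step adds a multiple of h to a without scaling a, so the
  residue class modulo h is kept.\<close>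

lemma reml:
  assumes "h \<noteq> []" "hd h = 1"
  shows "hpoly h dvd hpoly (reml Z a h) + hpoly a" "length (reml Z a h) \<le> length a"
    "length a \<le> Z \<Longrightarrow> length (reml Z a h) < length h"
proof -
  have step: "hpoly h dvd hpoly (rstep h a) + hpoly a" for a
  proof (cases "length a < length h")
    case False
    then have "hpoly (rstep h a) + hpoly a =
        monom (hd a) (length a - length h) * hpoly h + (hpoly a + hpoly a)"
      using hpoly_red[of h a] assms by (simp add: rstep_def add_ac del: poly_double_alg_closure)
    then show ?thesis by (simp only: poly_double_alg_closure add_0_right dvd_triv_right)
  qed (simp add: rstep_def)
  have "hpoly h dvd hpoly ((rstep h ^^ N) a) + hpoly a" for N
  proof (induction N)
    case (Suc N)
    have "(r + s) + (s + p) = r + p + (s + s)" for r s p :: "bit alg_closure poly"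
      by (simp only: add_ac)
    then have "hpoly ((rstep h ^^ Suc N) a) + hpoly a =
        (hpoly (rstep h ((rstep h ^^ N) a)) + hpoly ((rstep h ^^ N) a)) +
        (hpoly ((rstep h ^^ N) a) + hpoly a)"
      by (simp only: poly_double_alg_closure add_0_right funpow.simps comp_apply)
    then show ?case using step[of "(rstep h ^^ N) a"] Suc by (simp only: dvd_add)
  qed simp
  then show "hpoly h dvd hpoly (reml Z a h) + hpoly a" by (simp add: reml_def)
  have len: "length ((rstep h ^^ N) a) \<le> length a \<and>
      length ((rstep h ^^ N) a) \<le> max (length h - 1) (length a - N)" for N
    by (induction N) (auto simp: rstep_def)
  then show "length (reml Z a h) \<le> length a" by (simp add: reml_def)
  assume "length a \<le> Z"
  then have "length (reml Z a h) \<le> length h - 1" using len[of Z] by (simp add: reml_def)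
  then show "length (reml Z a h) < length h" using assms(1) by (cases h) auto
qed

text \<open>In characteristic 2 the square of a polynomial has the squared coefficients at doubled
  exponents. Each x becomes a pair 0, x^2, since the highest degree comes first and the constant
  term has to stay last.\<close>

fun sql :: "kpoly \<Rightarrow> kpoly" where
  "sql [] = []"
| "sql (x # xs) = 0 # x\<^sup>2 # sql xs"

lemma length_sql [simp]: "length (sql xs) = 2 * length xs"
  by (induction xs rule: sql.induct) auto

lemma hpoly_sql: "hpoly (sql xs) = (hpoly xs)\<^sup>2"
proof (induction xs rule: sql.induct)
  case (2 x xs)
  have "(monom x (length xs))\<^sup>2 = monom (x\<^sup>2) (2 * length xs)"
    by (simp add: power2_eq_square mult_monom mult_2)
  then show ?case by (simp add: hpoly_Cons 2 square_add_poly)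
qed simp

text \<open>Sums are kept lowest degree first, padded to a fixed length.\<close>

fun addp :: "kpoly \<Rightarrow> kpoly \<Rightarrow> kpoly" where
  "addp [] ys = []"
| "addp (x # xs) [] = x # addp xs []"
| "addp (x # xs) (y # ys) = (x + y) # addp xs ys"

lemma length_addp [simp]: "length (addp xs ys) = length xs"
  by (induction xs ys rule: addp.induct) auto

lemma Poly_addp: "length ys \<le> length xs \<Longrightarrow> Poly (addp xs ys) = Poly xs + Poly ys"
  by (induction xs ys rule: addp.induct) (auto simp: add.commute)

text \<open>The pair consists of the current power of \<beta> X modulo h, highest degree first, and
  the sum of the earlier ones, lowest degree first.\<close>

definition trstep :: "nat \<Rightarrow> kpoly \<Rightarrow> kpoly \<times> kpoly \<Rightarrow> kpoly \<times> kpoly" where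
  "trstep Z h = (\<lambda>(s, T). (reml Z (sql s) h, addp T (rev s)))"

section \<open>Finding all roots in the field by splitting with traces\<close>

context gf
begin

text \<open>\<open>TrP\<close> has degree exponential in n, so only a residue of it modulo h is ever
  formed, by n squarings with a reduction after each.\<close>

definition trl :: "nat \<Rightarrow> bit alg_closure \<Rightarrow> kpoly \<Rightarrow> kpoly" where
  "trl Z \<beta> h = snd ((trstep Z h ^^ n) (reml Z [\<beta>, 0] h, map (\<lambda>_. 0) h))"

lemma Poly_zeros: "Poly (map (\<lambda>_. 0) h) = 0"
  by (induction h) auto

lemma trl:
  assumes h: "h \<noteq> []" "hd h = 1" and Z: "2 * length h \<le> Z" "2 \<le> Z"
  shows "length (trl Z \<beta> h) = length h" "hpoly h dvd Poly (trl Z \<beta> h) + TrP \<beta>"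
proof -
  let ?H = "hpoly h"
  have inv: "case (trstep Z h ^^ m) (reml Z [\<beta>, 0] h, map (\<lambda>_. 0) h) of (s, T) \<Rightarrow>
      length s < length h \<and> length T = length h \<and> ?H dvd hpoly s + [:0, \<beta>:] ^ 2 ^ m \<and>
      ?H dvd Poly T + (\<Sum>i<m. [:0, \<beta>:] ^ 2 ^ i)" for m
  proof (induction m)
    case 0
    have "hpoly [\<beta>, 0] = [:0, \<beta>:]" by (simp add: hpoly_def)
    then show ?case using reml[OF h, where Z = Z and a = "[\<beta>, 0]"] Z h by (simp add: Poly_zeros)
  next
    case (Suc m)
    obtain s T where sT: "(trstep Z h ^^ m) (reml Z [\<beta>, 0] h, map (\<lambda>_. 0) h) = (s, T)" by force
    have IH: "length s < length h" "length T = length h" "?H dvd hpoly s + [:0, \<beta>:] ^ 2 ^ m"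
      "?H dvd Poly T + (\<Sum>i<m. [:0, \<beta>:] ^ 2 ^ i)"
      using Suc unfolding sT by auto
    have "length (reml Z (sql s) h) < length h" by (rule reml(3)[OF h]) (use IH(1) Z in simp)
    moreover have "?H dvd hpoly (reml Z (sql s) h) + [:0, \<beta>:] ^ 2 ^ Suc m"
    proof -
      have "?H dvd (hpoly s + [:0, \<beta>:] ^ 2 ^ m)\<^sup>2"
        using IH(3) by (simp only: power2_eq_square dvd_mult)
      then have 1: "?H dvd (hpoly s)\<^sup>2 + [:0, \<beta>:] ^ 2 ^ Suc m"
        by (simp only: square_add_poly square_double_exponent)
      have 2: "?H dvd hpoly (reml Z (sql s) h) + (hpoly s)\<^sup>2"
        using reml(1)[OF h, where Z = Z and a = "sql s"] by (simp only: hpoly_sql)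
      have "(hpoly (reml Z (sql s) h) + (hpoly s)\<^sup>2) + ((hpoly s)\<^sup>2 + [:0, \<beta>:] ^ 2 ^ Suc m) =
          hpoly (reml Z (sql s) h) + [:0, \<beta>:] ^ 2 ^ Suc m + ((hpoly s)\<^sup>2 + (hpoly s)\<^sup>2)"
        by (simp only: add_ac)
      then show ?thesis using dvd_add[OF 2 1] by (simp only: poly_double_alg_closure add_0_right)
    qed
    moreover have "?H dvd Poly (addp T (rev s)) + (\<Sum>i<Suc m. [:0, \<beta>:] ^ 2 ^ i)"
    proof -
      have "Poly (addp T (rev s)) = Poly T + hpoly s"
        using IH(1,2) by (simp add: Poly_addp hpoly_def)
      then have "Poly (addp T (rev s)) + (\<Sum>i<Suc m. [:0, \<beta>:] ^ 2 ^ i) =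
          (Poly T + (\<Sum>i<m. [:0, \<beta>:] ^ 2 ^ i)) + (hpoly s + [:0, \<beta>:] ^ 2 ^ m)"
        by (simp only: sum.lessThan_Suc add_ac)
      then show ?thesis using dvd_add[OF IH(4,3)] by (simp only:)
    qed
    ultimately show ?case
      using IH(2) by (simp only: funpow.simps comp_apply sT) (simp add: trstep_def)
  qed
  show "length (trl Z \<beta> h) = length h" "hpoly h dvd Poly (trl Z \<beta> h) + TrP \<beta>"
    using inv[of n] by (auto simp: trl_def TrP_def split: prod.splits)
qed

text \<open>The list has its lowest degree first, so its head is the constant term.\<close>

definition addone :: "kpoly \<Rightarrow> kpoly" where
  "addone T = (hd T + 1) # tl T"

text \<open>The two greatest common divisors collect the roots x of h whose trace tr (\<beta> x) is
  0 and 1 respectively. Constant ones have no roots and are dropped.\<close>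

definition split2 :: "nat \<Rightarrow> bit alg_closure \<Rightarrow> kpoly \<Rightarrow> kpoly list" where
  "split2 Z \<beta> h = filter (\<lambda>p. 2 \<le> length p)
     [monic (gcdl Z h (strip (rev (trl Z \<beta> h)))),
      monic (gcdl Z h (strip (rev (addone (trl Z \<beta> h)))))]"

definition piece :: "nat \<Rightarrow> kpoly \<Rightarrow> bool" where
  "piece d p \<longleftrightarrow> 2 \<le> length p \<and> length p \<le> d \<and> hd p = 1"

lemma piece_props:
  assumes "piece d p"
  shows "p \<noteq> []" "stripped p" "hpoly p \<noteq> 0" "degree (hpoly p) = length p - 1"
proof -
  show p: "p \<noteq> []" "stripped p" using assms by (auto simp: piece_def stripped_def)
  then show "hpoly p \<noteq> 0" "degree (hpoly p) = length p - 1"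
    using stripped_hpoly_0 degree_stripped by auto
qed

text \<open>The trace takes only the values 0 and 1 on F, so a root of h in F passes to exactly one
  part. Counting parts by the length of a filtered list also rules out that a part is listed twice;
  this later gives distinct roots.\<close>

lemma split2:
  assumes h: "piece d h" and Z: "4 * d + 1 \<le> Z" and \<beta>: "\<beta> \<in> F"
  shows "\<And>p. p \<in> set (split2 Z \<beta> h) \<Longrightarrow> piece d p \<and> hpoly p dvd hpoly h \<and>
      (hpoly p dvd TrP \<beta> + [:0:] \<or> hpoly p dvd TrP \<beta> + [:1:])"
    and "\<And>x. x \<in> F \<Longrightarrow> length (filter (\<lambda>p. poly (hpoly p) x = 0) (split2 Z \<beta> h)) =
      (if poly (hpoly h) x = 0 then 1 else 0)"
proof -
  note hp = piece_props[OF h]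
  have h1: "hd h = 1" "2 \<le> length h" "length h \<le> d" using h by (auto simp: piece_def)
  let ?T = "trl Z \<beta> h"
  have T: "length ?T = length h" "hpoly h dvd Poly ?T + TrP \<beta>"
    using trl[OF hp(1) h1(1), of Z \<beta>] h1 Z by auto
  have T1: "Poly (addone ?T) = Poly ?T + [:1:]" "length (addone ?T) = length h"
    using T(1) h1(2) by (cases ?T; auto simp: addone_def)+
  define q where "q = (\<lambda>c :: bit alg_closure. gcdl Z h (strip (rev (if c = 0 then ?T else addone ?T))))"
  have PT: "hpoly (rev (if c = 0 then ?T else addone ?T)) = Poly ?T + [:c:]" if "c = 0 \<or> c = 1" for c
    using that T1(1) by (auto simp: hpoly_def)
  have lenT: "length (strip (rev (if c = 0 then ?T else addone ?T))) \<le> length h" for c :: "bit alg_closure"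
    using length_strip[of "rev (if c = 0 then ?T else addone ?T)"] T(1) T1(2) by (simp split: if_splits)
  have q: "stripped (q c)" "e dvd hpoly (q c) \<longleftrightarrow> e dvd hpoly h \<and> e dvd Poly ?T + [:c:]"
    if "c = 0 \<or> c = 1" for c e
  proof -
    let ?t = "rev (if c = 0 then ?T else addone ?T)"
    have "2 * (length h + length (strip ?t)) + 1 \<le> Z"
    proof -
      have "2 * (a + b) + 1 \<le> Z" if "b \<le> a" "a \<le> d" for a b :: nat
      proof -
        have "2 * (a + b) + 1 \<le> 2 * (d + d) + 1"
          using that by (intro add_le_mono mult_le_mono2 order.refl) (auto intro: order_trans)
        also have "\<dots> = 4 * d + 1" by simp
        finally show ?thesis using Z by (rule order_trans)
      qed
      then show ?thesis using lenT[of c] h1(3) by blast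
    qed
    note gcdl[OF hp(2) stripped_strip this]
    then show "stripped (q c)" "e dvd hpoly (q c) \<longleftrightarrow> e dvd hpoly h \<and> e dvd Poly ?T + [:c:]"
      unfolding q_def hpoly_strip PT[OF that] by blast+
  qed
  \<comment> \<open>Modulo h the computed list and \<open>TrP \<beta>\<close> agree, so they have
    the same common divisors with h.\<close>
  have q': "e dvd hpoly (q c) \<longleftrightarrow> e dvd hpoly h \<and> e dvd TrP \<beta> + [:c:]" if "c = 0 \<or> c = 1" for c e
  proof -
    have "(TrP \<beta> + [:c:]) + (Poly ?T + TrP \<beta>) = Poly ?T + [:c:] + (TrP \<beta> + TrP \<beta>)"
      by (simp only: add_ac)
    then have eq: "(TrP \<beta> + [:c:]) + (Poly ?T + TrP \<beta>) = Poly ?T + [:c:]"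
      by (simp only: poly_double_alg_closure add_0_right)
    have "e dvd Poly ?T + [:c:] \<longleftrightarrow> e dvd TrP \<beta> + [:c:]" if "e dvd hpoly h"
      using dvd_add_left_iff[of e "Poly ?T + TrP \<beta>" "TrP \<beta> + [:c:]"] dvd_trans[OF that T(2)] eq by simp
    then show ?thesis unfolding q(2)[OF that] by blast
  qed
  have qne: "q c \<noteq> []" if "c = 0 \<or> c = 1" for c
  proof
    assume "q c = []"
    then have "0 dvd hpoly h" using q'[OF that, of 0] by simp
    then show False using hp(3) by simp
  qed
  have split: "split2 Z \<beta> h = filter (\<lambda>p. 2 \<le> length p) [monic (q 0), monic (q 1)]"
    by (simp add: split2_def q_def)
  have c01: "(0 :: bit alg_closure) = 0 \<or> (0 :: bit alg_closure) = 1"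
    "(1 :: bit alg_closure) = 0 \<or> (1 :: bit alg_closure) = 1" by auto
  have P: "piece d (monic (q c)) \<and> hpoly (monic (q c)) dvd hpoly h \<and> hpoly (monic (q c)) dvd TrP \<beta> + [:c:]"
    if c: "c = 0 \<or> c = 1" and "2 \<le> length (monic (q c))" for c
  proof -
    note m = monic[OF q(1)[OF c] qne[OF c]]
    have dvd: "hpoly (q c) dvd hpoly h" "hpoly (q c) dvd TrP \<beta> + [:c:]"
      using q'[OF c, of "hpoly (q c)"] by auto
    have "length (q c) - 1 \<le> length h - 1"
      using dvd_imp_degree_le[OF dvd(1) hp(3)] degree_stripped[OF q(1)[OF c] qne[OF c]] hp(4) by simp
    then show ?thesis using that(2) m dvd h1 by (auto simp: piece_def)
  qed
  show "piece d p \<and> hpoly p dvd hpoly h \<and> (hpoly p dvd TrP \<beta> + [:0:] \<or> hpoly p dvd TrP \<beta> + [:1:])"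
    if "p \<in> set (split2 Z \<beta> h)" for p
  proof -
    have "2 \<le> length p" "p = monic (q 0) \<or> p = monic (q 1)"
      using that unfolding split
      by (simp_all only: set_filter mem_Collect_eq list.set insert_iff empty_iff simp_thms)
    then show ?thesis using P[OF c01(1)] P[OF c01(2)] by auto
  qed
  fix x assume x: "x \<in> F"
  have root: "poly (hpoly (monic (q c))) x = 0 \<longleftrightarrow> poly (hpoly h) x = 0 \<and> tr (\<beta> * x) = c"
    if c: "c = 0 \<or> c = 1" for c
  proof -
    have "poly (hpoly (monic (q c))) x = 0 \<longleftrightarrow> [:- x, 1:] dvd hpoly (q c)"
      using monic(5)[OF q(1)[OF c] qne[OF c]] by (simp only: poly_eq_0_iff_dvd)
    also have "\<dots> \<longleftrightarrow> poly (hpoly h) x = 0 \<and> poly (TrP \<beta> + [:c:]) x = 0"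
      unfolding q'[OF c] by (simp only: poly_eq_0_iff_dvd)
    also have "poly (TrP \<beta> + [:c:]) x = 0 \<longleftrightarrow> tr (\<beta> * x) = c"
      by (simp add: poly_TrP) (metis add_eq_0_iff uminus_bit_alg_closure)
    finally show ?thesis .
  qed
  have long: "2 \<le> length (monic (q c))" if c: "c = 0 \<or> c = 1" and r: "poly (hpoly (monic (q c))) x = 0" for c
  proof (rule ccontr)
    note m = monic[OF q(1)[OF c] qne[OF c]]
    assume "\<not> ?thesis"
    then obtain y where "monic (q c) = [y]" using m(2) qne[OF c] by (cases "monic (q c)"; cases "tl (monic (q c))") auto
    then show False using m(1) r by (simp add: hpoly_Cons)
  qed
  have "tr (\<beta> * x) = 0 \<or> tr (\<beta> * x) = 1" using tr_values F_mult[OF \<beta> x] by blast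
  then show "length (filter (\<lambda>p. poly (hpoly p) x = 0) (split2 Z \<beta> h)) =
      (if poly (hpoly h) x = 0 then 1 else 0)"
    using root[OF c01(1)] root[OF c01(2)] long[OF c01(1)] long[OF c01(2)]
    unfolding split by auto
qed

text \<open>One round for each \<beta> = \<alpha>^0, ..., \<alpha>^(n-1). By
  \<open>tr_separates\<close> the traces against these n elements determine an element of F, so no
  two roots in F can stay together through all rounds.\<close>

definition pieces :: "nat \<Rightarrow> kpoly \<Rightarrow> nat \<Rightarrow> kpoly list" where
  "pieces Z f i = snd (((\<lambda>(\<beta>, L). (\<alpha> * \<beta>, concat (map (split2 Z \<beta>) L))) ^^ i)
     (1, filter (\<lambda>p. 2 \<le> length p) [monic f]))"

text \<open>A final piece is [1, r], that is X + r, and its root in characteristic 2 is r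
  itself.\<close>

definition rootlist :: "nat \<Rightarrow> kpoly \<Rightarrow> bit alg_closure list" where
  "rootlist Z f = map (\<lambda>p. hd (tl p)) (pieces Z f n)"


lemma pieces_0: "pieces Z f 0 = filter (\<lambda>p. 2 \<le> length p) [monic f]"
  by (simp add: pieces_def)

lemma pieces_Suc: "pieces Z f (Suc i) = concat (map (split2 Z (\<alpha> ^ i)) (pieces Z f i))"
proof -
  let ?s = "\<lambda>(\<beta>, L). (\<alpha> * \<beta>, concat (map (split2 Z \<beta>) L))"
  have "fst ((?s ^^ i) (1, L)) = \<alpha> ^ i" for L
    by (induction i) (auto simp: case_prod_unfold)
  then show ?thesis by (simp add: pieces_def case_prod_unfold)
qed

lemma length_filter_concat:
  "length (filter P (concat (map h L))) = (\<Sum>p\<leftarrow>L. length (filter P (h p)))"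
  by (induction L) auto

lemma sum_list_indicator: "(\<Sum>p\<leftarrow>L. if P p then 1 else 0) = length (filter P L)"
  by (induction L) auto

text \<open>Two invariants: a piece has one constant trace on its roots for every \<beta> used so
  far, expressed by divisibility, and every root of f in F belongs to exactly one piece. In the
  initial state, the case that f is a nonzero constant gives the empty list.\<close>

lemma pieces:
  assumes f: "stripped f" "f \<noteq> []" "length f \<le> d" and Z: "4 * d + 1 \<le> Z"
  shows "(\<forall>p\<in>set (pieces Z f i). piece d p \<and> (\<forall>j<i. hpoly p dvd TrP (\<alpha> ^ j) + [:0:] \<or>
      hpoly p dvd TrP (\<alpha> ^ j) + [:1:])) \<and>
    (\<forall>x\<in>F. length (filter (\<lambda>p. poly (hpoly p) x = 0) (pieces Z f i)) =
      (if poly (hpoly f) x = 0 then 1 else 0))"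
proof (induction i)
  case 0
  note m = monic[OF f(1,2)]
  have "2 \<le> length (monic f)" if r: "poly (hpoly (monic f)) x = 0" for x
  proof (rule ccontr)
    assume "\<not> ?thesis"
    then obtain y where "monic f = [y]" using m(2) f(2) by (cases "monic f"; cases "tl (monic f)") auto
    then show False using m(1) r by (simp add: hpoly_Cons)
  qed
  then show ?case using m f(3) by (auto simp: pieces_0 piece_def)
next
  case (Suc i)
  have \<beta>: "\<alpha> ^ i \<in> F" by (rule F_power[OF F_\<alpha>])
  have IH: "piece d p" "\<And>j. j < i \<Longrightarrow> hpoly p dvd TrP (\<alpha> ^ j) + [:0:] \<or> hpoly p dvd TrP (\<alpha> ^ j) + [:1:]"
    if "p \<in> set (pieces Z f i)" for p
    using Suc that by auto
  have "piece d p \<and> (\<forall>j<Suc i. hpoly p dvd TrP (\<alpha> ^ j) + [:0:] \<or> hpoly p dvd TrP (\<alpha> ^ j) + [:1:])"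
    if p: "p \<in> set (pieces Z f (Suc i))" for p
  proof -
    obtain p' where p': "p' \<in> set (pieces Z f i)" "p \<in> set (split2 Z (\<alpha> ^ i) p')"
      using p unfolding pieces_Suc by auto
    note s = split2(1)[OF IH(1)[OF p'(1)] Z \<beta> p'(2)]
    then show ?thesis using IH(2)[OF p'(1)] dvd_trans by (metis less_Suc_eq)
  qed
  moreover have "length (filter (\<lambda>p. poly (hpoly p) x = 0) (pieces Z f (Suc i))) =
      (if poly (hpoly f) x = 0 then 1 else 0)" if x: "x \<in> F" for x
  proof -
    have "length (filter (\<lambda>p. poly (hpoly p) x = 0) (pieces Z f (Suc i))) =
        (\<Sum>p\<leftarrow>pieces Z f i. if poly (hpoly p) x = 0 then 1 else 0)"
      unfolding pieces_Suc length_filter_concat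
      by (rule arg_cong[of _ _ sum_list], rule map_cong[OF refl], rule split2(2)[OF IH(1) Z \<beta> x])
    then show ?thesis using Suc x by (simp only: sum_list_indicator)
  qed
  ultimately show ?case by blast
qed

lemma distinct_map_filter:
  "(\<And>x. length (filter (\<lambda>p. h p = x) L) \<le> 1) \<Longrightarrow> distinct (map h L)"
proof (induction L)
  case (Cons a L)
  have "filter (\<lambda>p. h p = h a) L = []" using Cons.prems[of "h a"] by simp
  then have "h a \<notin> h ` set L" by (auto simp: filter_empty_conv)
  moreover have "length (filter (\<lambda>p. h p = x) L) \<le> 1" for x
    using Cons.prems[of x] by (simp split: if_splits)
  ultimately show ?case using Cons.IH by simp
qed simp

text \<open>The round \<beta> = 1 ensures that a piece has as many roots in F as its degree; all n
  rounds together ensure that it has at most one. As pieces are not constant, they are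
  linear.\<close>

lemma rootlist:
  assumes f: "stripped f" "f \<noteq> []" "length f \<le> d" and Z: "4 * d + 1 \<le> Z"
  shows "set (rootlist Z f) = {x\<in>F. poly (hpoly f) x = 0}" "distinct (rootlist Z f)"
    "\<And>p. p \<in> set (pieces Z f n) \<Longrightarrow> length p = 2"
proof -
  note P = pieces[OF f Z, of n]
  have lin: "\<exists>r\<in>F. p = [1, r]" if p: "p \<in> set (pieces Z f n)" for p
  proof -
    have pc: "piece d p" and dvd: "\<And>j. j < n \<Longrightarrow> \<exists>c. (c = 0 \<or> c = 1) \<and> hpoly p dvd TrP (\<alpha> ^ j) + [:c:]"
      using P p by blast+
    note pp = piece_props[OF pc]
    obtain c where "c = 0 \<or> c = 1" "hpoly p dvd TrP 1 + [:c:]" using dvd[OF n_pos] by auto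
    then have card: "card {x\<in>F. poly (hpoly p) x = 0} = length p - 1"
      using card_roots_dvd_TrP[OF pp(3)] pp(4) by simp
    have uniq: "x = y" if xy: "x \<in> F" "poly (hpoly p) x = 0" "y \<in> F" "poly (hpoly p) y = 0" for x y
    proof (rule ccontr)
      assume "x \<noteq> y"
      then obtain i where i: "i < n" "tr (\<alpha> ^ i * x) \<noteq> tr (\<alpha> ^ i * y)"
        using tr_separates[OF xy(1,3)] by blast
      obtain c where c: "hpoly p dvd TrP (\<alpha> ^ i) + [:c:]" using dvd[OF i(1)] by blast
      have "tr (\<alpha> ^ i * z) = c" if z: "poly (hpoly p) z = 0" for z
      proof -
        obtain k where "TrP (\<alpha> ^ i) + [:c:] = hpoly p * k" using c by (elim dvdE)
        then have "poly (TrP (\<alpha> ^ i) + [:c:]) z = 0" using z by simp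
        then show ?thesis by (simp add: poly_TrP) (metis add_eq_0_iff uminus_bit_alg_closure)
      qed
      then show False using i(2) xy by simp
    qed
    have len: "length p = 2"
    proof -
      have "card {x\<in>F. poly (hpoly p) x = 0} \<le> 1"
        using uniq card_F(2) by (simp add: card_le_Suc0_iff_eq)
      then show ?thesis using card pc unfolding piece_def by arith
    qed
    then obtain r where r: "p = [1, r]"
      using pc by (auto simp: piece_def length_Suc_conv numeral_2_eq_2)
    have "card {x\<in>F. poly (hpoly p) x = 0} = 1" using card len by simp
    then obtain x where x: "x \<in> F" "poly (hpoly p) x = 0" by (metis (mono_tags, lifting) card_1_singletonE mem_Collect_eq singletonI)
    have "x = r" using x(2) r by (simp add: hpoly_Cons poly_monom) (metis add_eq_0_iff uminus_bit_alg_closure)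
    then show ?thesis using r x(1) by blast
  qed
  show "length p = 2" if "p \<in> set (pieces Z f n)" for p using lin[OF that] by auto
  have root: "poly (hpoly p) x = 0 \<longleftrightarrow> hd (tl p) = x" if "p \<in> set (pieces Z f n)" for p x
    using lin[OF that] by (auto simp: hpoly_Cons poly_monom) (metis add_eq_0_iff uminus_bit_alg_closure)
  have cnt: "length (filter (\<lambda>p. hd (tl p) = x) (pieces Z f n)) = (if poly (hpoly f) x = 0 then 1 else 0)"
    if x: "x \<in> F" for x
  proof -
    have "filter (\<lambda>p. hd (tl p) = x) (pieces Z f n) = filter (\<lambda>p. poly (hpoly p) x = 0) (pieces Z f n)"
      by (rule filter_cong[OF refl]) (simp add: root)
    then show ?thesis using P x by simp
  qed
  have out: "filter (\<lambda>p. hd (tl p) = x) (pieces Z f n) = []" if "x \<notin> F" for x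
    using lin that by (fastforce simp: filter_empty_conv)
  show "distinct (rootlist Z f)"
    unfolding rootlist_def
  proof (rule distinct_map_filter)
    fix x show "length (filter (\<lambda>p. hd (tl p) = x) (pieces Z f n)) \<le> 1"
      using cnt[of x] out[of x] by (cases "x \<in> F") auto
  qed
  show "set (rootlist Z f) = {x\<in>F. poly (hpoly f) x = 0}"
  proof (rule Set.set_eqI)
    fix x
    have "x \<in> set (rootlist Z f) \<longleftrightarrow> filter (\<lambda>p. hd (tl p) = x) (pieces Z f n) \<noteq> []"
      by (auto simp: rootlist_def filter_empty_conv)
    also have "\<dots> \<longleftrightarrow> x \<in> F \<and> poly (hpoly f) x = 0"
      using cnt[of x] out[of x] by (cases "x \<in> F") (auto split: if_splits simp flip: length_greater_0_conv)
    finally show "x \<in> set (rootlist Z f) \<longleftrightarrow> x \<in> {x\<in>F. poly (hpoly f) x = 0}" by simp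
  qed
qed

end

section \<open>Programs for lists and for arithmetic in the field\<close>

lemma list_of_cell_of_list [simp]: "list_of_cell (cell_of_list xs) = xs"
  by (induction xs) auto

lemma clen_cell_of_list [simp]: "clen (cell_of_list xs) = length xs"
  by (simp add: clen_def)

lemma cfold_cell_of_list: "length xs \<le> clen k \<Longrightarrow> cfold k h a (cell_of_list xs) = foldl h a xs"
  by (simp add: cfold_def)

lemma right_cell_of_list [simp]: "right (cell_of_list xs) = cell_of_list (tl xs)"
  by (cases xs) auto

lemma cell_of_list_eq_Atom [simp]: "cell_of_list xs = Atom \<longleftrightarrow> xs = []"
  by (cases xs) auto

definition "e_one = ECons ENil ENil"
definition "e_rev = EFold (EVar 0) ENil (ECons (EVar 1) (EVar 2))"
text \<open>The parameter d has to be the length of the environment: the body finds the entry at d,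
  and the accumulator is at d + 1. Consing during a fold reverses the list, so a final reversal
  restores the order.\<close>

definition "e_map d l b = ECall e_rev [EFold l ENil (ECons b (EVar (Suc d)))]"
definition "e_zip = ECall e_rev [ETl (EFold (EVar 0) (ECons (EVar 1) ENil)
   (ECons (ETl (EHd (EVar 3))) (ECons (ECons (EVar 2) (EHd (EHd (EVar 3)))) (ETl (EVar 3)))))]"

lemma foldl_Cell: "foldl (\<lambda>acc x. Cell (h x) acc) (cell_of_list ys) xs = cell_of_list (rev (map h xs) @ ys)"
  by (induction xs arbitrary: ys) (auto simp flip: cell_of_list.simps(2))

lemma ev_rev: "length xs \<le> clen k \<Longrightarrow> ev k e_rev [cell_of_list xs] = cell_of_list (rev xs)"
  using foldl_Cell[of "\<lambda>x. x" "[]" xs] by (simp add: e_rev_def cfold_cell_of_list)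

lemma ev_map:
  assumes "ev k l env = cell_of_list xs" "length xs \<le> clen k" "length env = d"
    "\<And>x acc. x \<in> set xs \<Longrightarrow> ev k b (env @ [x, acc]) = h x"
  shows "ev k (e_map d l b) env = cell_of_list (map h xs)"
proof -
  have "foldl (\<lambda>acc x. Cell (ev k b (env @ [x, acc])) ((env @ [x, acc]) ! Suc d)) Atom xs =
      foldl (\<lambda>acc x. Cell (h x) acc) (cell_of_list []) xs"
    using assms(3,4) by (simp add: nth_append cong: foldl_cong)
  then show ?thesis
    unfolding e_map_def using assms(1-3) foldl_Cell[of h "[]" xs] ev_rev[of "rev (map h xs)" k]
    by (simp add: cfold_cell_of_list)
qed

text \<open>The first list alone determines the length: a second list that is too long is cut, and
  one that is too short supplies \<open>Atom\<close>.\<close>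

fun zipc :: "cell list \<Rightarrow> cell \<Rightarrow> cell list" where
  "zipc [] c = []"
| "zipc (x # xs) c = Cell x (left c) # zipc xs (right c)"

lemma length_zipc [simp]: "length (zipc xs c) = length xs"
  by (induction xs c rule: zipc.induct) auto

lemma ev_zip: "length xs \<le> clen k \<Longrightarrow> ev k e_zip [cell_of_list xs, c] = cell_of_list (zipc xs c)"
proof -
  assume len: "length xs \<le> clen k"
  have "\<exists>d. foldl (\<lambda>acc x. Cell (right (left acc)) (Cell (Cell x (left (left acc))) (right acc)))
      (Cell c (cell_of_list ys)) xs = Cell d (cell_of_list (rev (zipc xs c) @ ys))" for ys
  proof (induction xs arbitrary: c ys)
    case (Cons x xs)
    from Cons[of "right c" "Cell x (left c) # ys"] show ?case by simp
  qed simp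
  from this[of "[]"] obtain d where
    "foldl (\<lambda>acc x. Cell (right (left acc)) (Cell (Cell x (left (left acc))) (right acc)))
      (Cell c Atom) xs = Cell d (cell_of_list (rev (zipc xs c)))" by auto
  then show ?thesis
    using len ev_rev[of "rev (zipc xs c)" k] by (simp add: e_zip_def cfold_cell_of_list)
qed

definition "e_vadd = e_map 2 (ECall e_zip [EVar 0, EVar 1])
  (EIf (EHd (EVar 2)) (EIf (ETl (EVar 2)) ENil e_one) (ETl (EVar 2)))"
text \<open>Multiplication by \<alpha>: shift the coefficients up and, if the top one was 1, add g.
  The list of g has n + 1 entries, but the sum is as long as its first argument; this drops the
  leading 1, which stands for the bit shifted out.\<close>

definition "e_valpha = ELet (ECall e_rev [EVar 0]) (ELet (ECons ENil (ECall e_rev [ETl (EVar 2)]))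
  (EIf (EHd (EVar 2)) (ECall e_vadd [EVar 3, EVar 1]) (EVar 3)))"
definition "e_vzero = e_map 1 (EVar 0) ENil"
definition "e_vone = ECons e_one (ETl (ECall e_vzero [EVar 0]))"
text \<open>Horner's rule in \<alpha> over the bits of the second factor, highest first.\<close>

definition "e_vmul = EFold (ECall e_rev [EVar 1]) (ECall e_vzero [EVar 0])
  (ELet (ECall e_valpha [EVar 4, EVar 2]) (EIf (EVar 3) (ECall e_vadd [EVar 5, EVar 0]) (EVar 5)))"
definition "e_vnz = EFold (EVar 0) ENil (EIf (EVar 1) e_one (EVar 2))"
text \<open>Evaluates the product in \<open>F_inverse_power\<close>. The accumulator pairs the
  current power of x with the partial product, and the n - 1 entries in the tail of the vector serve
  as loop counter.\<close>

definition "e_vinv = ETl (EFold (ETl (EVar 0)) (ECons (EVar 0) (ECall e_vone [EVar 0]))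
  (ELet (ECall e_vmul [EHd (EVar 3), EHd (EVar 3), EVar 1])
    (ECons (EVar 4) (ECall e_vmul [ETl (EVar 3), EVar 4, EVar 1]))))"

lemma bit_cases: "(b :: bit) = 0 \<or> b = 1"
  by (cases b) auto

lemma cell_of_bit_simps [simp]: "cell_of_bit 0 = Atom" "cell_of_bit 1 = Cell Atom Atom"
  by (simp_all add: cell_of_bit_def)

lemma cell_of_bit_eq_Atom [simp]: "cell_of_bit b = Atom \<longleftrightarrow> b = 0"
  by (simp add: cell_of_bit_def)

lemma cell_of_vec_Cons: "cell_of_vec (b # v) = Cell (cell_of_bit b) (cell_of_vec v)"
  by (simp add: cell_of_vec_def)

lemma cell_of_vec_inj: "cell_of_vec u = cell_of_vec v \<Longrightarrow> u = v"
proof -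
  assume "cell_of_vec u = cell_of_vec v"
  then have "map cell_of_bit u = map cell_of_bit v"
    unfolding cell_of_vec_def by (metis list_of_cell_of_list)
  moreover have "inj cell_of_bit" by (rule injI) (simp add: cell_of_bit_def split: if_splits)
  ultimately show ?thesis by (metis inj_map_eq_map)
qed

definition vplus :: "bit list \<Rightarrow> bit list \<Rightarrow> bit list" where
  "vplus u v = map2 (+) u v"

lemma length_vplus: "length (vplus u v) = min (length u) (length v)"
  by (simp add: vplus_def)

text \<open>The second clause treats a missing summand as zero, as needed when coefficient lists of
  different lengths are zipped.\<close>

lemma ev_vadd:
  assumes "length u \<le> clen k"
  shows "length u \<le> length v \<Longrightarrow> ev k e_vadd [cell_of_vec u, cell_of_vec v] = cell_of_vec (vplus u v)"
    and "ev k e_vadd [cell_of_vec u, Atom] = cell_of_vec u"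
proof -
  define h where "h = (\<lambda>p. if left p = Atom then right p else if right p = Atom then Cell Atom Atom else Atom)"
  have ev: "ev k e_vadd [cell_of_vec u, c] = cell_of_list (map h (zipc (map cell_of_bit u) c))" for c
    unfolding e_vadd_def
    by (rule ev_map) (use assms in \<open>auto simp: cell_of_vec_def ev_zip h_def e_one_def\<close>)
  have A: "map h (zipc (map cell_of_bit u) (cell_of_vec v)) = map cell_of_bit (map2 (+) u v)"
    if "length u \<le> length v" for u v
    using that
  proof (induction u arbitrary: v)
    case (Cons a u)
    then obtain b w where "v = b # w" by (cases v) auto
    then show ?case using Cons bit_cases[of a] bit_cases[of b]
      by (auto simp: cell_of_vec_Cons h_def)
  qed simp
  show "ev k e_vadd [cell_of_vec u, cell_of_vec v] = cell_of_vec (vplus u v)"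
    if "length u \<le> length v"
    by (simp only: ev A[OF that] vplus_def) (simp only: cell_of_vec_def)
  have B: "map h (zipc (map cell_of_bit u) Atom) = map cell_of_bit u"
  proof (induction u)
    case (Cons a u)
    then show ?case using bit_cases[of a] by (auto simp: h_def)
  qed simp
  show "ev k e_vadd [cell_of_vec u, Atom] = cell_of_vec u"
    by (simp only: ev B) (simp only: cell_of_vec_def)
qed

lemma ev_vzero: "length v \<le> clen k \<Longrightarrow>
    ev k e_vzero [cell_of_vec v] = cell_of_vec (replicate (length v) 0)"
proof -
  assume len: "length v \<le> clen k"
  have "ev k e_vzero [cell_of_vec v] = cell_of_list (map (\<lambda>_. Atom) (map cell_of_bit v))"
    unfolding e_vzero_def by (rule ev_map) (use len in \<open>auto simp: cell_of_vec_def\<close>)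
  then show ?thesis by (simp add: cell_of_vec_def map_replicate_const comp_def)
qed

lemma ev_vnz: "length v \<le> clen k \<Longrightarrow> ev k e_vnz [cell_of_vec v] = Atom \<longleftrightarrow> (\<forall>b\<in>set v. b = 0)"
proof -
  assume len: "length v \<le> clen k"
  have "foldl (\<lambda>acc x. if x = Atom then acc else Cell Atom Atom) a (map cell_of_bit v) = Atom \<longleftrightarrow>
      a = Atom \<and> (\<forall>b\<in>set v. b = 0)" for a
    by (induction v arbitrary: a) auto
  then show ?thesis using len by (simp add: e_vnz_def e_one_def cell_of_vec_def cfold_cell_of_list cong: if_cong)
qed

context gf
begin

definition enc :: "bit alg_closure \<Rightarrow> cell" where
  "enc y = cell_of_vec (vec y)"

definition G :: cell where
  "G = cell_of_vec (vec_of (n + 1) g)"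

lemma length_vec: "y \<in> F \<Longrightarrow> length (vec y) = n"
  using vec_in by (simp add: bvecs_def)

lemma enc_\<psi>: "length v = n \<Longrightarrow> enc (\<psi> v) = cell_of_vec v"
  by (simp add: enc_def vec_\<psi> bvecs_def)

lemma enc_eqI: "length v = n \<Longrightarrow> \<psi> v = y \<Longrightarrow> cell_of_vec v = enc y"
  using enc_\<psi>[of v] by simp

lemma \<psi>_append: "\<psi> (u @ v) = \<psi> u + \<alpha> ^ length u * \<psi> v"
proof (induction u)
  case (Cons b u)
  have "\<psi> ((b # u) @ v) = to_ac b + \<alpha> * (\<psi> u + \<alpha> ^ length u * \<psi> v)"
    by (simp only: append_Cons \<psi>_Cons Cons)
  also have "\<dots> = (to_ac b + \<alpha> * \<psi> u) + (\<alpha> * \<alpha> ^ length u) * \<psi> v"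
    by (simp only: distrib_left add.assoc mult.assoc)
  finally show ?case by (simp only: \<psi>_Cons length_Cons power_Suc)
qed simp

lemma to_ac_bit_add: "to_ac (a + b :: bit) = to_ac a + to_ac b"
  by (rule to_ac_add)

lemma \<psi>_map2_add: "length u = length v \<Longrightarrow> \<psi> (vplus u v) = \<psi> u + \<psi> v"
  unfolding vplus_def
proof (induction u v rule: list_induct2)
  case (Cons a u b v)
  then show ?case
    by (simp only: list.map zip_Cons_Cons prod.case \<psi>_Cons to_ac_bit_add distrib_left add_ac)
qed simp

lemma \<psi>_replicate_0: "\<psi> (replicate m 0) = 0"
  by (induction m) auto

lemma \<psi>_one: "\<psi> (1 # replicate m 0) = 1"
  by (simp add: \<psi>_replicate_0)

text \<open>From g(\<alpha>) = 0 and the leading coefficient 1. This is the reduction rule behind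
  multiplication by \<alpha>.\<close>

lemma \<alpha>_power_n: "\<alpha> ^ n = \<psi> (vec_of n g)"
proof -
  have c: "coeff g n = 1"
    using bit_cases[of "coeff g n"] deg_g n_pos leading_coeff_0_iff[of g] by (metis degree_0 less_irrefl)
  have "Poly (vec_of (n + 1) g) = g" by (rule Poly_vec_of) (simp add: deg_g)
  then have "\<psi> (vec_of (n + 1) g) = 0" by (simp add: \<psi>_def \<phi>_g)
  moreover have "vec_of (n + 1) g = vec_of n g @ [1]" using c by (simp add: vec_of_def)
  ultimately have "\<psi> (vec_of n g) + \<alpha> ^ n = 0" by (simp add: \<psi>_append)
  then show ?thesis by (metis add_eq_0_iff uminus_bit_alg_closure)
qed

lemma ev_enc_vadd:
  assumes "n \<le> clen k" "x \<in> F" "y \<in> F"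
  shows "ev k e_vadd [enc x, enc y] = enc (x + y)" "ev k e_vadd [enc x, Atom] = enc x"
proof -
  have "ev k e_vadd [enc x, enc y] = cell_of_vec (vplus (vec x) (vec y))"
    unfolding enc_def by (rule ev_vadd) (use assms length_vec in auto)
  also have "\<dots> = enc (x + y)"
    by (rule enc_eqI) (use assms in \<open>auto simp: length_vec \<psi>_map2_add \<psi>_vec length_vplus\<close>)
  finally show "ev k e_vadd [enc x, enc y] = enc (x + y)" .
  show "ev k e_vadd [enc x, Atom] = enc x"
    unfolding enc_def by (rule ev_vadd(2)) (use assms length_vec in auto)
qed

lemma ev_enc_vzero: "n \<le> clen k \<Longrightarrow> x \<in> F \<Longrightarrow> ev k e_vzero [enc x] = enc 0"
  using ev_vzero[of "vec x" k] enc_eqI[of "replicate n 0" 0] \<psi>_replicate_0[of n]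
  by (simp add: enc_def length_vec)

lemma ev_enc_vone: "n \<le> clen k \<Longrightarrow> x \<in> F \<Longrightarrow> ev k e_vone [enc x] = enc 1"
proof -
  assume a: "n \<le> clen k" "x \<in> F"
  obtain m where m: "n = Suc m" using n_pos by (cases n) auto
  have "ev k e_vzero [enc x] = cell_of_vec (replicate n 0)"
    using ev_vzero[of "vec x" k] a by (simp add: enc_def length_vec)
  then have "ev k e_vone [enc x] = cell_of_vec (1 # replicate m 0)"
    by (simp add: e_vone_def e_one_def cell_of_vec_Cons m)
  also have "\<dots> = enc 1" by (rule enc_eqI[OF _ \<psi>_one]) (simp add: m)
  finally show ?thesis .
qed

lemma ev_enc_valpha:
  assumes k: "n \<le> clen k" and x: "x \<in> F"
  shows "ev k e_valpha [enc x, G] = enc (\<alpha> * x)"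
proof -
  define v where "v = vec x"
  have v: "length v = n" "\<psi> v = x" using x by (auto simp: v_def length_vec \<psi>_vec)
  then obtain w b where wb: "v = w @ [b]" using n_pos by (cases v rule: rev_cases) auto
  have lw: "Suc (length w) = n" using v wb by simp
  have r: "ev k e_rev [enc x] = cell_of_vec (b # rev w)"
    using ev_rev[of "map cell_of_bit v" k] k v(1) by (simp add: enc_def v_def[symmetric] cell_of_vec_def wb rev_map)
  have r2: "ev k e_rev [cell_of_vec (rev w)] = cell_of_vec w"
    using ev_rev[of "map cell_of_bit (rev w)" k] k lw by (simp add: cell_of_vec_def rev_map)
  have s: "\<alpha> * x = \<psi> (0 # w) + to_ac b * \<alpha> ^ n"
    unfolding v(2)[symmetric] wb \<psi>_append by (simp add: distrib_left lw[symmetric] mult_ac)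
  have ev: "ev k e_valpha [enc x, G] = (if b = 0 then cell_of_vec (0 # w)
      else ev k e_vadd [cell_of_vec (0 # w), G])"
    by (simp add: e_valpha_def r r2 cell_of_vec_Cons)
  show ?thesis
  proof (cases "b = 0")
    case True
    have "cell_of_vec (0 # w) = enc (\<alpha> * x)"
      by (rule enc_eqI) (simp_all only: length_Cons lw s True to_ac_0 mult_zero_left add_0_right)
    then show ?thesis unfolding ev using True by simp
  next
    case False
    then have b: "b = 1" using bit_cases by blast
    have "ev k e_vadd [cell_of_vec (0 # w), G] = cell_of_vec (vplus (0 # w) (vec_of (n + 1) g))"
      unfolding G_def by (rule ev_vadd) (use k lw in auto)
    also have "vplus (0 # w) (vec_of (n + 1) g) = vplus (0 # w) (vec_of n g)"
    proof -
      have "zip u (v @ v') = zip u v" if "length u = length v" for u v v' :: "bit list"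
        using that by (simp add: zip_append2)
      moreover have "vec_of (n + 1) g = vec_of n g @ [coeff g n]" by (simp add: vec_of_def)
      ultimately show ?thesis using lw unfolding vplus_def by simp
    qed
    also have "cell_of_vec \<dots> = enc (\<alpha> * x)"
    proof (rule enc_eqI)
      show "\<psi> (vplus (0 # w) (vec_of n g)) = \<alpha> * x"
        using s b lw \<psi>_map2_add[of "0 # w" "vec_of n g"]
        by (simp only: length_Cons length_vec_of \<alpha>_power_n to_ac_1 mult_1_left)
      show "length (vplus (0 # w) (vec_of n g)) = n" using lw by (simp add: vplus_def)
    qed
    finally show ?thesis unfolding ev using False by simp
  qed
qed

lemma ev_enc_vmul:
  assumes k: "n \<le> clen k" and x: "x \<in> F"
  shows "y \<in> F \<Longrightarrow> ev k e_vmul [enc x, enc y, G] = enc (x * y)"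
    and "ev k e_vmul [enc x, Atom, G] = enc 0"
proof -
  let ?h = "\<lambda>acc b. if b = Atom then ev k e_valpha [acc, G] else ev k e_vadd [ev k e_valpha [acc, G], enc x]"
  have fold: "foldl ?h (enc 0) (rev (map cell_of_bit v)) = enc (x * \<psi> v) \<and> \<psi> v \<in> F" for v
  proof (induction v)
    case (Cons b v)
    have \<psi>: "\<psi> v \<in> F" "x * \<psi> v \<in> F" "\<alpha> * (x * \<psi> v) \<in> F" "\<psi> (b # v) \<in> F"
      using Cons x F_mult F_\<alpha> F_add F_0 F_1 bit_cases[of b] by auto
    then show ?case
      using Cons bit_cases[of b] ev_enc_valpha[OF k \<psi>(2)] ev_enc_vadd(1)[OF k \<psi>(3) x]
      by (auto simp: distrib_left mult_ac add_ac)
  qed (simp add: F_0)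
  have ev: "ev k e_vmul [enc x, cell_of_vec v, G] = enc (x * \<psi> v)" if "length v \<le> clen k" for v
    using fold[of v] that ev_rev[of "map cell_of_bit v" k] ev_enc_vzero[OF k x]
      cfold_cell_of_list[of "rev (map cell_of_bit v)" k ?h "enc 0"]
    by (simp add: e_vmul_def cell_of_vec_def cong: if_cong)
  show "y \<in> F \<Longrightarrow> ev k e_vmul [enc x, enc y, G] = enc (x * y)"
    using ev[of "vec y"] k by (simp add: enc_def length_vec \<psi>_vec)
  show "ev k e_vmul [enc x, Atom, G] = enc 0"
    using ev[of "[]"] by (simp add: cell_of_vec_def)
qed

lemma \<psi>_eq_0: "length v = n \<Longrightarrow> \<psi> v = 0 \<longleftrightarrow> (\<forall>b\<in>set v. b = 0)"
proof
  assume "length v = n" "\<psi> v = 0"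
  then have "v = replicate n 0"
    using inj_onD[OF inj_\<psi>, of v "replicate n 0"] \<psi>_replicate_0 by (simp add: bvecs_def)
  then show "\<forall>b\<in>set v. b = 0" by simp
next
  assume "length v = n" "\<forall>b\<in>set v. b = 0"
  then have "v = replicate n 0" by (metis replicate_length_same)
  then show "\<psi> v = 0" by (simp add: \<psi>_replicate_0)
qed

lemma ev_enc_vnz: "n \<le> clen k \<Longrightarrow> x \<in> F \<Longrightarrow> ev k e_vnz [enc x] = Atom \<longleftrightarrow> x = 0"
  using ev_vnz[of "vec x" k] \<psi>_eq_0[of "vec x"] by (simp add: enc_def length_vec \<psi>_vec)

lemma ev_enc_vinv:
  assumes k: "n \<le> clen k" and x: "x \<in> F" "x \<noteq> 0"
  shows "ev k e_vinv [enc x, G] = enc (inverse x)" "inverse x \<in> F"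
proof -
  have pow: "x ^ i \<in> F" for i by (rule F_power[OF x(1)])
  have prd: "(\<Prod>i\<in>A. x ^ h i) \<in> F" for h and A :: "nat set"
    by (induction A rule: infinite_finite_induct) (auto intro: pow F_mult F_1)
  let ?s = "\<lambda>acc (b :: cell). Cell (ev k e_vmul [left acc, left acc, G])
    (ev k e_vmul [right acc, ev k e_vmul [left acc, left acc, G], G])"
  have fold: "foldl ?s (Cell (enc x) (enc 1)) bs =
      Cell (enc (x ^ 2 ^ length bs)) (enc (\<Prod>i\<in>{1..<Suc (length bs)}. x ^ 2 ^ i))" for bs
  proof (induction bs rule: rev_induct)
    case (snoc b bs)
    have sq: "ev k e_vmul [enc (x ^ 2 ^ length bs), enc (x ^ 2 ^ length bs), G] = enc (x ^ 2 ^ Suc (length bs))"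
      using ev_enc_vmul(1)[OF k pow pow, of "2 ^ length bs" "2 ^ length bs"]
      by (simp add: power_add[symmetric] mult_2)
    show ?case
      using snoc sq ev_enc_vmul(1)[OF k prd[of "\<lambda>i. 2 ^ i" "{1..<Suc (length bs)}"] pow[of "2 ^ Suc (length bs)"]]
      by simp
  qed simp
  obtain b ys where ys: "vec x = b # ys" using length_vec[OF x(1)] n_pos by (cases "vec x") auto
  have tl: "right (enc x) = cell_of_list (map cell_of_bit ys)"
    by (simp add: enc_def cell_of_vec_def ys)
  have len: "Suc (length ys) = n" using length_vec[OF x(1)] ys by simp
  then have len': "length (map cell_of_bit ys) \<le> clen k" using k by simp
  have "ev k e_vinv [enc x, G] = enc (\<Prod>i\<in>{1..<n}. x ^ 2 ^ i)"
    using fold[of "map cell_of_bit ys", unfolded length_map len] ev_enc_vone[OF k x(1)]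
      cfold_cell_of_list[OF len', of ?s "Cell (enc x) (enc 1)"]
    by (simp add: e_vinv_def tl)
  moreover have "(\<Prod>i\<in>{1..<n}. x ^ 2 ^ i) = inverse x"
    using F_inverse_power[OF x] by (metis inverse_unique mult.commute)
  ultimately show "ev k e_vinv [enc x, G] = enc (inverse x)" "inverse x \<in> F"
    using prd[of "\<lambda>i. 2 ^ i" "{1..<n}"] by simp_all
qed

end

section \<open>Programs for polynomial arithmetic and root finding\<close>

definition "e_hzero = EIf (EVar 0) (EIf (ECall e_vnz [EHd (EVar 0)]) ENil e_one) ENil"
definition "e_strip = EFold EClk (EVar 0) (EIf (ECall e_hzero [EVar 2]) (ETl (EVar 2)) (EVar 2))"
definition "e_red = ELet (EHd (EVar 0)) (ELet (EHd (EVar 1))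
  (e_map 5 (ECall e_zip [ETl (EVar 0), ETl (EVar 1)])
    (ECall e_vadd [ECall e_vmul [EVar 4, EHd (EVar 5), EVar 2],
      ECall e_vmul [EVar 3, ETl (EVar 5), EVar 2]])))"
text \<open>Drops one entry of the second list for each entry of the first. Something is left
  exactly if the first list is shorter, so lengths are compared without numbers.\<close>

definition "e_shorter = EFold (EVar 0) (EVar 1) (ETl (EVar 3))"
text \<open>Folding over the clock itself iterates the body as often as the clock is long. Surplus
  rounds are harmless because \<open>gstep\<close> is stationary once it is done; stripping and
  reduction modulo h use the same device.\<close>

definition "e_gcd = EHd (EFold EClk (ECons (EVar 0) (EVar 1))
  (ELet (EHd (EVar 4)) (ELet (ETl (EVar 4))
    (EIf (EVar 6)
      (EIf (ECall e_shorter [EVar 5, EVar 6]) (ECons (EVar 6) (EVar 5))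
        (ECons (ECall e_strip [ECall e_red [EVar 5, EVar 6, EVar 2]]) (EVar 6)))
      (EVar 4)))))"
definition "e_monic = ELet (ECall e_vinv [EHd (EVar 0), EVar 1])
  (e_map 3 (EVar 0) (ECall e_vmul [EVar 2, EVar 3, EVar 1]))"
definition "e_rem = EFold EClk (EVar 0)
  (EIf (ECall e_shorter [EVar 4, EVar 1]) (EVar 4) (ECall e_red [EVar 4, EVar 1, EVar 2]))"
definition "e_sq = ECall e_rev [EFold (EVar 0) ENil
  (ECons (ECall e_vmul [EVar 2, EVar 2, EVar 1]) (ECons (ECall e_vzero [EVar 2]) (EVar 3)))]"
definition "e_addp = e_map 2 (ECall e_zip [EVar 0, EVar 1]) (ECall e_vadd [EHd (EVar 2), ETl (EVar 2)])"
text \<open>The fold runs over the vector \<beta> only to obtain n rounds; its bits are ignored.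
  \<open>e_roots\<close> uses the vector of 1 in the same way.\<close>

definition "e_tr = ETl (EFold (EVar 0)
  (ECons (ECall e_rem [ECons (EVar 0) (ECons (ECall e_vzero [EVar 0]) ENil), EVar 1, EVar 2])
    (e_map 3 (EVar 1) (ECall e_vzero [EVar 3])))
  (ECons (ECall e_rem [ECall e_sq [EHd (EVar 4), EVar 2], EVar 1, EVar 2])
    (ECall e_addp [ETl (EVar 4), ECall e_rev [EHd (EVar 4)]])))"
definition "e_gcdm = ECall e_monic [ECall e_gcd [EVar 0, ECall e_strip [ECall e_rev [EVar 1]], EVar 2], EVar 2]"
text \<open>A tail that is not empty means length at least 2, so this is the filter in
  \<open>split2\<close>.\<close>

definition "e_consif = EIf (ETl (EVar 0)) (ECons (EVar 0) (EVar 1)) (EVar 1)"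
definition "e_split = ELet (ECall e_tr [EVar 0, EVar 1, EVar 2])
  (ELet (ECons (ECall e_vadd [EHd (EVar 4), ECall e_vone [EVar 0]]) (ETl (EVar 4)))
    (ECall e_consif [ECall e_gcdm [EVar 1, EVar 4, EVar 2],
      ECall e_consif [ECall e_gcdm [EVar 1, EVar 5, EVar 2], EVar 3]]))"
definition "e_roots = ELet (ECall e_vone [EHd (EVar 0)])
  (e_map 3 (ETl (EFold (EVar 2)
    (ECons (EVar 2) (ECall e_consif [ECall e_monic [EVar 0, EVar 1], ENil]))
    (ECons (ECall e_valpha [EHd (EVar 4), EVar 1])
      (EFold (ECall e_rev [ETl (EVar 4)]) ENil
        (ECall e_split [EHd (EVar 4), EVar 5, EVar 1, EVar 6])))))
    (EHd (ETl (EVar 3))))"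

lemma foldl_const: "foldl (\<lambda>a _. h a) a xs = (h ^^ length xs) a"
  by (induction xs arbitrary: a) (auto simp: funpow_swap1)

text \<open>The simulation principle by which iterations on trees are related to iterations on lists
  of field elements.\<close>

lemma funpow_rel: "R a b \<Longrightarrow> (\<And>a b. R a b \<Longrightarrow> R (h a) (h' b)) \<Longrightarrow> R ((h ^^ m) a) ((h' ^^ m) b)"
  by (induction m) auto

lemma cfold_clock: "cfold k (\<lambda>a _. h a) a k = (h ^^ clen k) a"
  by (simp add: cfold_def foldl_const clen_def)

context gf
begin

definition rep :: "kpoly \<Rightarrow> cell \<Rightarrow> bool" where
  "rep xs c \<longleftrightarrow> set xs \<subseteq> F \<and> c = cell_of_list (map enc xs)"

lemma rep_Cons: "x \<in> F \<Longrightarrow> rep xs c \<Longrightarrow> rep (x # xs) (Cell (enc x) c)"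
  by (simp add: rep_def)

lemma rep_left: "rep xs c \<Longrightarrow> xs \<noteq> [] \<Longrightarrow> left c = enc (hd xs) \<and> hd xs \<in> F"
  by (cases xs) (auto simp: rep_def)

lemma rep_right: "rep xs c \<Longrightarrow> rep (tl xs) (right c)"
  by (cases xs) (auto simp: rep_def)

lemma rep_Atom: "rep xs c \<Longrightarrow> c = Atom \<longleftrightarrow> xs = []"
  by (auto simp: rep_def)

lemma ev_rep_rev: "rep xs c \<Longrightarrow> length xs \<le> clen k \<Longrightarrow> rep (rev xs) (ev k e_rev [c])"
  by (simp add: rep_def ev_rev rev_map)

lemma ev_strip:
  assumes k: "n \<le> clen k" and xs: "rep xs c" "length xs \<le> clen k"
  shows "rep (strip xs) (ev k e_strip [c])"
proof -
  define h where "h = (\<lambda>xs. case xs of [] \<Rightarrow> [] | x # ys \<Rightarrow> if x = (0 :: bit alg_closure) then ys else xs)"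
  have one: "rep (h ys) (if ev k e_hzero [d] = Atom then d else right d)" if "rep ys d" for ys d
  proof (cases ys)
    case Nil
    then show ?thesis using that by (simp add: rep_def h_def e_hzero_def)
  next
    case (Cons y zs)
    then have "y \<in> F" "d = Cell (enc y) (cell_of_list (map enc zs))" "set zs \<subseteq> F"
      using that by (auto simp: rep_def)
    then show ?thesis
      using Cons ev_enc_vnz[OF k, of y] by (simp add: rep_def h_def e_hzero_def e_one_def)
  qed
  have fold: "rep ((h ^^ m) xs) (((\<lambda>d. if ev k e_hzero [d] = Atom then d else right d) ^^ m) c)" for m
    by (rule funpow_rel[where R = rep]) (use xs(1) one in blast)+
  have strip_eq: "(h ^^ m) ys = strip ys" if "length ys \<le> m" for m ys
    using that
  proof (induction m arbitrary: ys)
    case (Suc m)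
    show ?case
    proof (cases ys)
      case (Cons y zs)
      show ?thesis
      proof (cases "y = 0")
        case True
        then have "h ys = zs" "strip ys = strip zs" using Cons by (simp_all add: h_def strip_def)
        moreover have "(h ^^ m) zs = strip zs" by (rule Suc.IH) (use Suc.prems Cons in simp)
        ultimately show ?thesis by (simp only: funpow_Suc_right comp_apply)
      next
        case False
        then have "h ys = ys" "strip ys = ys" using Cons by (simp_all add: h_def strip_def)
        moreover from this(1) have "(h ^^ N) ys = ys" for N by (induction N) auto
        ultimately show ?thesis by (simp only:)
      qed
    next
      case Nil
      have "(h ^^ N) [] = []" for N by (induction N) (auto simp: h_def)
      then show ?thesis using Nil by (simp only: strip_def dropWhile.simps)
    qed
  qed (simp add: strip_def)
  have "rep (strip xs) (((\<lambda>d. if ev k e_hzero [d] = Atom then d else right d) ^^ clen k) c)"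
    using fold[of "clen k"] strip_eq[OF xs(2)] by (simp only:)
  then show ?thesis
    using cfold_clock[of k "\<lambda>d. if ev k e_hzero [d] = Atom then d else right d" c]
    by (simp add: e_strip_def cong: if_cong)
qed

lemma zipc_comb:
  assumes k: "n \<le> clen k"
  shows "a \<in> F \<Longrightarrow> b \<in> F \<Longrightarrow> set xs \<subseteq> F \<Longrightarrow> set ys \<subseteq> F \<Longrightarrow>
    map (\<lambda>p. ev k e_vadd [ev k e_vmul [enc b, left p, G], ev k e_vmul [enc a, right p, G]])
      (zipc (map enc xs) (cell_of_list (map enc ys))) = map enc (comb a b xs ys) \<and>
    set (comb a b xs ys) \<subseteq> F"
proof (induction a b xs ys rule: comb.induct)
  case (2 a b x xs)
  then have "b * x \<in> F" by (simp add: F_mult)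
  then show ?case
    using 2 ev_enc_vmul(1)[OF k, of b x] ev_enc_vmul(2)[OF k, of a]
      ev_enc_vadd(1)[OF k \<open>b * x \<in> F\<close> F_0] by simp
next
  case (3 a b x xs y ys)
  then have "b * x \<in> F" "a * y \<in> F" by (simp_all add: F_mult)
  then show ?case
    using 3 ev_enc_vmul(1)[OF k, of b x] ev_enc_vmul(1)[OF k, of a y]
      ev_enc_vadd(1)[OF k, of "b * x" "a * y"] F_add[of "b * x" "a * y"] by simp
qed simp

lemma ev_red:
  assumes k: "n \<le> clen k" and a: "rep a c" "a \<noteq> []" "length a \<le> clen k" and b: "rep b d" "b \<noteq> []"
  shows "rep (red a b) (ev k e_red [c, d, G])"
proof -
  obtain x xs y ys where ab: "a = x # xs" "b = y # ys" using a(2) b(2) by (cases a; cases b) auto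
  have F: "x \<in> F" "set xs \<subseteq> F" "y \<in> F" "set ys \<subseteq> F"
    and c: "c = Cell (enc x) (cell_of_list (map enc xs))" "d = Cell (enc y) (cell_of_list (map enc ys))"
    using a b ab by (auto simp: rep_def)
  have z: "ev k e_zip [cell_of_list (map enc xs), e] = cell_of_list (zipc (map enc xs) e)" for e
    by (rule ev_zip) (use a(3) ab in simp)
  let ?h = "\<lambda>p. ev k e_vadd [ev k e_vmul [enc y, left p, G], ev k e_vmul [enc x, right p, G]]"
  have "ev k (e_map 5 (ECall e_zip [ETl (EVar 0), ETl (EVar 1)])
      (ECall e_vadd [ECall e_vmul [EVar 4, EHd (EVar 5), EVar 2],
        ECall e_vmul [EVar 3, ETl (EVar 5), EVar 2]])) [c, d, G, enc x, enc y] =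
      cell_of_list (map ?h (zipc (map enc xs) (cell_of_list (map enc ys))))"
    by (rule ev_map) (use a(3) ab in \<open>simp_all add: c z\<close>)
  then show ?thesis
    using zipc_comb[OF k F(1,3,2,4)] by (simp add: e_red_def red_def rep_def c ab)
qed

lemma ev_shorter:
  assumes "rep a c" "rep b d" "length a \<le> clen k"
  shows "ev k e_shorter [c, d] = Atom \<longleftrightarrow> \<not> length a < length b"
proof -
  have "foldl (\<lambda>acc _. right acc) (cell_of_list ys) xs = cell_of_list (drop (length xs) ys)" for xs ys :: "cell list"
    by (induction xs arbitrary: ys) (auto simp: drop_Suc)
  from this[of "map enc b" "map enc a"] show ?thesis
    using assms by (simp add: e_shorter_def rep_def cfold_cell_of_list drop_map not_less)
qed

lemma length_strip_red: "a \<noteq> [] \<Longrightarrow> length (strip (red a b)) \<le> length a"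
  using length_strip[of "red a b"] by simp

lemma ev_gcd:
  assumes k: "n \<le> clen k" and a: "rep a c" "length a \<le> clen k" and b: "rep b d" "length b \<le> clen k"
  shows "rep (gcdl (clen k) a b) (ev k e_gcd [c, d, G])"
proof -
  define R where "R = (\<lambda>(a, b) c. rep a (left c) \<and> rep b (right c) \<and> length a \<le> clen k \<and> length b \<le> clen k)"
  define h where "h = (\<lambda>c. if right c \<noteq> Atom then
      (if ev k e_shorter [left c, right c] \<noteq> Atom then Cell (right c) (left c)
       else Cell (ev k e_strip [ev k e_red [left c, right c, G]]) (right c)) else c)"
  have step: "R (gstep p) (h c)" if R: "R p c" for p c
  proof -
    obtain a b where p: "p = (a, b)" by force
    have r: "rep a (left c)" "rep b (right c)" "length a \<le> clen k" "length b \<le> clen k"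
      using R by (auto simp: R_def p)
    show ?thesis
    proof (cases "b = [] \<or> length a < length b")
      case True
      then show ?thesis
        using r ev_shorter[OF r(1,2,3)] rep_Atom[OF r(2)] by (auto simp: R_def p h_def gstep_def)
    next
      case False
      then have ne: "a \<noteq> []" "b \<noteq> []" by auto
      have "rep (red a b) (ev k e_red [left c, right c, G])"
        by (rule ev_red[OF k r(1) ne(1) r(3) r(2) ne(2)])
      then have "rep (strip (red a b)) (ev k e_strip [ev k e_red [left c, right c, G]])"
        using r(3) by (intro ev_strip[OF k]) simp_all
      then show ?thesis
        using False r ev_shorter[OF r(1,2,3)] rep_Atom[OF r(2)] length_strip_red[OF ne(1), of b]
        by (simp add: R_def p h_def gstep_def)
    qed
  qed
  have "R ((gstep ^^ clen k) (a, b)) ((h ^^ clen k) (Cell c d))"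
    by (rule funpow_rel[where R = R, OF _ step]) (use a b in \<open>simp add: R_def\<close>)
  then have "rep (gcdl (clen k) a b) (left ((h ^^ clen k) (Cell c d)))"
    by (auto simp: R_def gcdl_def split: prod.splits)
  moreover have "ev k e_gcd [c, d, G] = left (cfold k (\<lambda>a _. h a) (Cell c d) k)"
    by (simp add: e_gcd_def h_def cong: if_cong)
      (rule arg_cong[of _ _ left], rule arg_cong[of _ _ "\<lambda>f. cfold k f _ _"], simp add: fun_eq_iff)
  ultimately show ?thesis by (simp only: cfold_clock)
qed

lemma ev_monic:
  assumes k: "n \<le> clen k" and a: "rep a c" "length a \<le> clen k" "stripped a" "a \<noteq> []"
  shows "rep (monic a) (ev k e_monic [c, G])"
proof -
  have h: "left c = enc (hd a)" "hd a \<in> F" "hd a \<noteq> 0"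
    using rep_left[OF a(1,4)] a(3,4) by (auto simp: stripped_def)
  note inv = ev_enc_vinv[OF k h(2,3)]
  have c: "c = cell_of_list (map enc a)" "set a \<subseteq> F" using a(1) by (auto simp: rep_def)
  have "ev k (e_map 3 (EVar 0) (ECall e_vmul [EVar 2, EVar 3, EVar 1])) [c, G, enc (inverse (hd a))] =
      cell_of_list (map (\<lambda>x. ev k e_vmul [enc (inverse (hd a)), x, G]) (map enc a))"
    by (rule ev_map) (use a(2) in \<open>simp_all add: c(1)\<close>)
  also have "map (\<lambda>x. ev k e_vmul [enc (inverse (hd a)), x, G]) (map enc a) = map enc (monic a)"
    using c(2) ev_enc_vmul(1)[OF k inv(2)] by (auto simp: monic_def)
  finally show ?thesis
    using c(2) F_mult[OF inv(2)] by (auto simp: e_monic_def h(1) inv(1) rep_def monic_def)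
qed

lemma ev_rem:
  assumes k: "n \<le> clen k" and a: "rep a c" "length a \<le> clen k" and h: "rep h d" "h \<noteq> []"
  shows "rep (reml (clen k) a h) (ev k e_rem [c, d, G])"
proof -
  define R where "R = (\<lambda>a c. rep a c \<and> length a \<le> clen k)"
  define s where "s = (\<lambda>c. if ev k e_shorter [c, d] \<noteq> Atom then c else ev k e_red [c, d, G])"
  have step: "R (rstep h a) (s c)" if R: "R a c" for a c
  proof (cases "length a < length h")
    case True
    then show ?thesis using R ev_shorter[of a c h d k] h by (simp add: R_def s_def rstep_def)
  next
    case False
    then have ne: "a \<noteq> []" using h by auto
    have r: "rep a c" "length a \<le> clen k" using R by (simp_all add: R_def)
    then have "length (red a h) \<le> clen k" by simp
    then show ?thesis
      using False ne r ev_shorter[of a c h d k] h ev_red[OF k, of a c h d]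
      by (simp add: R_def s_def rstep_def del: length_red)
  qed
  have "R ((rstep h ^^ clen k) a) ((s ^^ clen k) c)"
    by (rule funpow_rel[where R = R, OF _ step]) (use a in \<open>simp add: R_def\<close>)
  moreover have "ev k e_rem [c, d, G] = cfold k (\<lambda>a _. s a) c k"
    by (simp add: e_rem_def s_def cong: if_cong)
      (rule arg_cong[of _ _ "\<lambda>f. cfold k f _ _"], simp add: fun_eq_iff)
  ultimately show ?thesis by (simp add: R_def reml_def cfold_clock)
qed

lemma ev_sq:
  assumes k: "n \<le> clen k" and a: "rep a c" "2 * length a \<le> clen k"
  shows "rep (sql a) (ev k e_sq [c, G])"
proof -
  let ?h = "\<lambda>acc x. Cell (ev k e_vmul [x, x, G]) (Cell (ev k e_vzero [x]) acc)"
  have c: "c = cell_of_list (map enc a)" "set a \<subseteq> F" using a(1) by (auto simp: rep_def)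
  have "foldl ?h (cell_of_list (map enc ys)) (map enc xs) = cell_of_list (map enc (rev (sql xs) @ ys)) \<and>
      set (sql xs) \<subseteq> F" if "set xs \<subseteq> F" for xs ys
    using that
  proof (induction xs arbitrary: ys)
    case (Cons x xs)
    have "foldl ?h (cell_of_list (map enc (x\<^sup>2 # 0 # ys))) (map enc xs) =
        cell_of_list (map enc (rev (sql xs) @ x\<^sup>2 # 0 # ys)) \<and> set (sql xs) \<subseteq> F"
      by (rule Cons.IH) (use Cons.prems in simp)
    moreover have "x \<in> F" "x\<^sup>2 \<in> F" using Cons.prems F_power by auto
    ultimately show ?case
      using ev_enc_vmul(1)[OF k, of x x] ev_enc_vzero[OF k, of x] F_0 by (simp add: power2_eq_square)
  qed simp
  from this[OF c(2), of "[]"]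
  have f: "foldl ?h Atom (map enc a) = cell_of_list (map enc (rev (sql a)))" "set (sql a) \<subseteq> F" by auto
  have "cfold k ?h Atom (cell_of_list (map enc a)) = cell_of_list (rev (map enc (sql a)))"
    using f(1) a(2) by (simp add: cfold_cell_of_list rev_map)
  then have "ev k e_sq [c, G] = ev k e_rev [cell_of_list (rev (map enc (sql a)))]"
    by (simp add: e_sq_def c(1))
  also have "\<dots> = cell_of_list (map enc (sql a))"
    using ev_rev[of "rev (map enc (sql a))" k] a(2) by simp
  finally show ?thesis using f(2) by (simp add: rep_def)
qed

lemma ev_addp:
  assumes k: "n \<le> clen k" and a: "rep a c" "length a \<le> clen k" and b: "rep b d"
  shows "rep (addp a b) (ev k e_addp [c, d])"
proof -
  have c: "c = cell_of_list (map enc a)" "set a \<subseteq> F" "d = cell_of_list (map enc b)" "set b \<subseteq> F"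
    using a(1) b by (auto simp: rep_def)
  let ?h = "\<lambda>p. ev k e_vadd [left p, right p]"
  have z: "ev k e_zip [c, e] = cell_of_list (zipc (map enc a) e)" for e
    unfolding c(1) by (rule ev_zip) (use a(2) in simp)
  have "ev k e_addp [c, d] = cell_of_list (map ?h (zipc (map enc a) (cell_of_list (map enc b))))"
    unfolding e_addp_def by (rule ev_map) (use a(2) in \<open>simp_all add: z c(3)\<close>)
  moreover have "set xs \<subseteq> F \<Longrightarrow> set ys \<subseteq> F \<Longrightarrow>
      map ?h (zipc (map enc xs) (cell_of_list (map enc ys))) = map enc (addp xs ys) \<and> set (addp xs ys) \<subseteq> F"
    for xs ys
  proof (induction xs ys rule: addp.induct)
    case (2 x xs)
    then show ?case using ev_enc_vadd(2)[OF k, of x x] by simp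
  next
    case (3 x xs y ys)
    then show ?case using ev_enc_vadd(1)[OF k, of x y] F_add[of x y] by simp
  qed simp
  ultimately show ?thesis using c(2,4) by (simp add: rep_def)
qed

lemma ev_tr:
  assumes k: "n \<le> clen k" and \<beta>: "\<beta> \<in> F" and h: "rep h d" "h \<noteq> []" "hd h = 1"
    and len: "2 * length h \<le> clen k" "4 \<le> clen k"
  shows "rep (trl (clen k) \<beta> h) (ev k e_tr [enc \<beta>, d, G])"
proof -
  let ?Z = "clen k"
  \<comment> \<open>The initial residue may have length 2, whatever h is; all later ones are shorter
    than h. This m bounds both.\<close>
  define m where "m = max 2 (length h)"
  have m: "2 * m \<le> ?Z" "length h \<le> m" "2 \<le> m" using len by (auto simp: m_def)
  define R where "R = (\<lambda>(s, T) c. rep s (left c) \<and> rep T (right c) \<and> length s \<le> m \<and> length T = length h)"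
  define s where "s = (\<lambda>c. Cell (ev k e_rem [ev k e_sq [left c, G], d, G])
      (ev k e_addp [right c, ev k e_rev [left c]]))"
  have step: "R (trstep ?Z h p) (s c)" if R: "R p c" for p c
  proof -
    obtain u T where p: "p = (u, T)" by force
    have r: "rep u (left c)" "rep T (right c)" "length u \<le> m" "length T = length h"
      using R by (auto simp: R_def p)
    have sq: "rep (sql u) (ev k e_sq [left c, G])" by (rule ev_sq[OF k r(1)]) (use r(3) m in simp)
    have l: "length (sql u) \<le> ?Z" using r(3) m by simp
    have "rep (reml ?Z (sql u) h) (ev k e_rem [ev k e_sq [left c, G], d, G])"
      by (rule ev_rem[OF k sq l h(1,2)])
    moreover have "length (reml ?Z (sql u) h) \<le> m"
      using reml(3)[OF h(2,3) l] m(2) by simp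
    moreover have "rep (addp T (rev u)) (ev k e_addp [right c, ev k e_rev [left c]])"
      by (rule ev_addp[OF k r(2) _ ev_rep_rev[OF r(1)]]) (use r m in simp_all)
    ultimately show ?thesis using r(4) by (simp add: R_def p s_def trstep_def)
  qed
  have b0: "rep [\<beta>, 0] (Cell (enc \<beta>) (Cell (enc 0) Atom))" using \<beta> F_0 by (simp add: rep_def)
  have "ev k (e_map 3 (EVar 1) (ECall e_vzero [EVar 3])) [enc \<beta>, d, G] =
      cell_of_list (map (\<lambda>x. ev k e_vzero [x]) (map enc h))"
    by (rule ev_map) (use h(1) len in \<open>simp_all add: rep_def\<close>)
  moreover have "map (\<lambda>x. ev k e_vzero [x]) (map enc h) = map enc (map (\<lambda>_. 0) h)"
    using h(1) ev_enc_vzero[OF k] by (auto simp: rep_def)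
  ultimately have e: "ev k (e_map 3 (EVar 1) (ECall e_vzero [EVar 3])) [enc \<beta>, d, G] =
      cell_of_list (map enc (map (\<lambda>_. 0) h))" by (simp only:)
  have zeros: "rep (map (\<lambda>_. 0) h) (ev k (e_map 3 (EVar 1) (ECall e_vzero [EVar 3])) [enc \<beta>, d, G])"
    unfolding rep_def e using F_0 by auto
  have "rep (reml ?Z [\<beta>, 0] h) (ev k e_rem [Cell (enc \<beta>) (Cell (enc 0) Atom), d, G])"
    by (rule ev_rem[OF k b0 _ h(1,2)]) (use len in simp)
  moreover have "length (reml ?Z [\<beta>, 0] h) \<le> m"
    using reml(2)[OF h(2,3), of ?Z "[\<beta>, 0]"] m(3) by simp
  moreover note zeros
  ultimately have "R (reml ?Z [\<beta>, 0] h, map (\<lambda>_. 0) h)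
      (Cell (ev k e_rem [Cell (enc \<beta>) (Cell (enc 0) Atom), d, G])
        (ev k (e_map 3 (EVar 1) (ECall e_vzero [EVar 3])) [enc \<beta>, d, G]))"
    by (simp add: R_def)
  then have "R ((trstep ?Z h ^^ n) (reml ?Z [\<beta>, 0] h, map (\<lambda>_. 0) h))
      ((s ^^ n) (Cell (ev k e_rem [Cell (enc \<beta>) (Cell (enc 0) Atom), d, G])
        (ev k (e_map 3 (EVar 1) (ECall e_vzero [EVar 3])) [enc \<beta>, d, G])))"
    by (rule funpow_rel[where R = R, OF _ step])
  moreover have "cfold k (\<lambda>a _. s a) c (enc \<beta>) = (s ^^ n) c" for c
    using k length_vec[OF \<beta>] by (simp add: enc_def cell_of_vec_def cfold_cell_of_list foldl_const)
  moreover have "ev k e_tr [enc \<beta>, d, G] = right (cfold k (\<lambda>a _. s a)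
      (Cell (ev k e_rem [Cell (enc \<beta>) (Cell (enc 0) Atom), d, G])
        (ev k (e_map 3 (EVar 1) (ECall e_vzero [EVar 3])) [enc \<beta>, d, G])) (enc \<beta>))"
    using ev_enc_vzero[OF k \<beta>] by (simp add: e_tr_def s_def)
  ultimately show ?thesis by (auto simp: trl_def R_def split: prod.splits)
qed

definition repL :: "kpoly list \<Rightarrow> cell \<Rightarrow> bool" where
  "repL L c \<longleftrightarrow> (\<forall>p\<in>set L. set p \<subseteq> F) \<and> c = cell_of_list (map (\<lambda>p. cell_of_list (map enc p)) L)"

lemma ev_consif:
  assumes "rep p c" "repL L d"
  shows "repL (filter (\<lambda>p. 2 \<le> length p) [p] @ L) (ev k e_consif [c, d])"
  using assms by (cases p; cases "tl p") (auto simp: e_consif_def rep_def repL_def)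

lemma ev_gcdm:
  assumes k: "n \<le> clen k" and h: "piece d h" "rep h c" and T: "rep T e" "length T \<le> d" and Z: "4 * d + 1 \<le> clen k"
  shows "rep (monic (gcdl (clen k) h (strip (rev T)))) (ev k e_gcdm [c, e, G])"
proof -
  let ?q = "gcdl (clen k) h (strip (rev T))"
  note hp = piece_props[OF h(1)]
  have lh: "length h \<le> d" using h(1) by (simp add: piece_def)
  have ls: "length (strip (rev T)) \<le> d" using length_strip[of "rev T"] T(2) by simp
  have s: "rep (strip (rev T)) (ev k e_strip [ev k e_rev [e]])"
    by (rule ev_strip[OF k ev_rep_rev[OF T(1)]]) (use T(2) Z in simp_all)
  have bound: "2 * (length h + length (strip (rev T))) + 1 \<le> clen k"
  proof -
    have "2 * (length h + length (strip (rev T))) + 1 \<le> 2 * (d + d) + 1"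
      using lh ls by (intro add_le_mono mult_le_mono2 order.refl)
    then show ?thesis using Z by simp
  qed
  note g = gcdl[OF hp(2) stripped_strip bound]
  have ne: "?q \<noteq> []"
  proof
    assume "?q = []"
    then have "0 dvd hpoly h" using g(2)[of 0] by simp
    then show False using hp(3) by simp
  qed
  have "degree (hpoly ?q) \<le> degree (hpoly h)"
    using g(2)[of "hpoly ?q"] dvd_imp_degree_le[OF _ hp(3)] by simp
  then have "length ?q - 1 \<le> length h - 1" using degree_stripped[OF g(1) ne] hp(4) by simp
  then have lq: "length ?q \<le> clen k" using ne hp(1) lh Z by (cases ?q; cases h) auto
  have "rep ?q (ev k e_gcd [c, ev k e_strip [ev k e_rev [e]], G])"
    by (rule ev_gcd[OF k h(2) _ s]) (use lh ls Z in simp_all)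
  then show ?thesis using ev_monic[OF k _ lq g(1) ne] by (simp add: e_gcdm_def)
qed

lemma ev_split:
  assumes k: "n \<le> clen k" and h: "piece d h" "rep h c" and \<beta>: "\<beta> \<in> F"
    and L: "repL L e" and Z: "4 * d + 1 \<le> clen k"
  shows "repL (split2 (clen k) \<beta> h @ L) (ev k e_split [enc \<beta>, c, G, e])"
proof -
  let ?T = "trl (clen k) \<beta> h"
  note hp = piece_props[OF h(1)]
  have h1: "hd h = 1" "2 \<le> length h" "length h \<le> d" using h(1) by (auto simp: piece_def)
  have T: "rep ?T (ev k e_tr [enc \<beta>, c, G])"
    by (rule ev_tr[OF k \<beta> h(2) hp(1) h1(1)]) (use h1 Z in simp_all)
  have lT: "length ?T = length h" by (rule trl[OF hp(1) h1(1)]) (use h1 Z in simp_all)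
  then have ne: "?T \<noteq> []" using h1 by auto
  let ?t = "ev k e_tr [enc \<beta>, c, G]"
  have hdT: "left ?t = enc (hd ?T)" "hd ?T \<in> F" using rep_left[OF T ne] by auto
  have T1: "rep (addone ?T) (Cell (ev k e_vadd [left ?t, ev k e_vone [enc \<beta>]]) (right ?t))"
    unfolding addone_def hdT(1) ev_enc_vone[OF k \<beta>] ev_enc_vadd(1)[OF k hdT(2) F_1]
    by (rule rep_Cons[OF F_add[OF hdT(2) F_1] rep_right[OF T]])
  have lT1: "length (addone ?T) \<le> d" using ne lT h1 by (cases ?T) (auto simp: addone_def)
  let ?e1 = "ev k e_gcdm [c, ?t, G]"
  let ?e2 = "ev k e_gcdm [c, Cell (ev k e_vadd [left ?t, ev k e_vone [enc \<beta>]]) (right ?t), G]"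
  let ?p = "\<lambda>T. monic (gcdl (clen k) h (strip (rev T)))"
  have 1: "rep (?p ?T) ?e1"
    by (rule ev_gcdm[OF k h T _ Z]) (use lT h1 in simp)
  have 2: "rep (?p (addone ?T)) ?e2" by (rule ev_gcdm[OF k h T1 lT1 Z])
  have "repL (filter (\<lambda>p. 2 \<le> length p) [?p ?T] @ (filter (\<lambda>p. 2 \<le> length p) [?p (addone ?T)] @ L))
      (ev k e_consif [?e1, ev k e_consif [?e2, e]])"
    by (rule ev_consif[OF 1 ev_consif[OF 2 L]])
  moreover have "ev k e_split [enc \<beta>, c, G, e] = ev k e_consif [?e1, ev k e_consif [?e2, e]]"
    by (simp add: e_split_def)
  moreover have "filter (\<lambda>p. 2 \<le> length p) [?p ?T] @ (filter (\<lambda>p. 2 \<le> length p) [?p (addone ?T)] @ L) =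
      split2 (clen k) \<beta> h @ L" by (simp add: split2_def)
  ultimately show ?thesis by (simp only:)
qed

lemma sum_list_card_filter:
  "(\<Sum>p\<leftarrow>L. card {x\<in>F. Q p x}) = (\<Sum>x\<in>F. length (filter (\<lambda>p. Q p x) L))"
proof (induction L)
  case (Cons p L)
  have "card {x\<in>F. Q p x} = (\<Sum>x\<in>F. if Q p x then 1 else 0)"
    using card_F(2) by (simp add: sum.If_cases Collect_conj_eq Int_commute)
  then show ?case by (simp add: Cons sum.distrib[symmetric] if_distrib cong: if_cong sum.cong)
      (rule sum.cong, auto)
qed simp

text \<open>Needed for the clock to suffice for folds over the pieces. After the first round every
  piece has a root in F, no root belongs to two pieces, and f has fewer than d roots.\<close>

lemma length_pieces:
  assumes f: "stripped f" "f \<noteq> []" "length f \<le> d" and Z: "4 * d + 1 \<le> Z"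
  shows "length (pieces Z f i) \<le> d"
proof (cases i)
  case 0
  have "1 \<le> length f" using f(2) by (cases f) auto
  then show ?thesis using 0 f(3) by (simp add: pieces_0)
next
  case (Suc j)
  note P = pieces[OF f Z, of i]
  have one: "1 \<le> card {x\<in>F. poly (hpoly p) x = 0}" if p: "p \<in> set (pieces Z f i)" for p
  proof -
    have pc: "piece d p" using P p by blast
    obtain c where c: "c = 0 \<or> c = 1" "hpoly p dvd TrP 1 + [:c:]"
      using P p Suc by (metis power_0 zero_less_Suc)
    have "2 \<le> length p" using pc by (simp add: piece_def)
    then show ?thesis
      using card_roots_dvd_TrP[OF piece_props(3)[OF pc] c(2,1)] piece_props(4)[OF pc] by simp
  qed
  have "length (pieces Z f i) = (\<Sum>p\<leftarrow>pieces Z f i. 1)" by (simp add: sum_list_triv)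
  also have "\<dots> \<le> (\<Sum>p\<leftarrow>pieces Z f i. card {x\<in>F. poly (hpoly p) x = 0})"
    by (rule sum_list_mono) (rule one)
  also have "\<dots> = (\<Sum>x\<in>F. length (filter (\<lambda>p. poly (hpoly p) x = 0) (pieces Z f i)))"
    by (rule sum_list_card_filter)
  also have "\<dots> = (\<Sum>x\<in>F. if poly (hpoly f) x = 0 then 1 else 0)"
    by (rule sum.cong[OF refl]) (use P in blast)
  also have "\<dots> = card {x\<in>F. poly (hpoly f) x = 0}"
    using card_F(2) by (simp add: sum.If_cases Collect_conj_eq Int_commute)
  also have "\<dots> \<le> d"
  proof -
    have nz: "hpoly f \<noteq> 0" using stripped_hpoly_0[OF f(1)] f(2) by simp
    have "card {x\<in>F. poly (hpoly f) x = 0} \<le> card {x. poly (hpoly f) x = 0}"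
      by (rule card_mono[OF poly_roots_finite[OF nz]]) auto
    also have "\<dots> \<le> degree (hpoly f)" by (rule card_poly_roots_bound[OF nz])
    finally show ?thesis using degree_stripped[OF f(1,2)] f(3) by simp
  qed
  finally show ?thesis .
qed

lemma ev_roots:
  assumes k: "n \<le> clen k" and f: "stripped f" "f \<noteq> []" "length f \<le> d" "rep f c" and Z: "4 * d + 1 \<le> clen k"
  shows "ev k e_roots [c, G] = cell_of_list (map enc (rootlist (clen k) f))"
proof -
  let ?Z = "clen k"
  define R where "R = (\<lambda>i c. left c = enc (\<alpha> ^ i) \<and> repL (pieces ?Z f i) (right c))"
  define s where "s = (\<lambda>c. Cell (ev k e_valpha [left c, G])
      (cfold k (\<lambda>acc h. ev k e_split [left c, h, G, acc]) Atom (ev k e_rev [right c])))"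
  have hd: "left c = enc (hd f)" "hd f \<in> F" using rep_left[OF f(4,2)] by auto
  have pw: "\<alpha> ^ i \<in> F" for i by (rule F_power[OF F_\<alpha>])
  have step: "R (Suc i) (s c)" if R: "R i c" for i c
  proof -
    have r: "left c = enc (\<alpha> ^ i)" "repL (pieces ?Z f i) (right c)" using R by (auto simp: R_def)
    have len: "length (pieces ?Z f i) \<le> ?Z" using length_pieces[OF f(1-3) Z, of i] Z by simp
    have pc: "piece d p" if "p \<in> set (pieces ?Z f i)" for p using pieces[OF f(1-3) Z, of i] that by blast
    let ?enc = "\<lambda>p. cell_of_list (map enc p)"
    \<comment> \<open>Parts are prepended to the accumulator, so the pieces are traversed in reverse
      to obtain the order of \<open>concat\<close>.\<close>
    have fold: "repL (concat (map (split2 ?Z (\<alpha> ^ i)) (rev L)) @ M)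
        (foldl (\<lambda>acc h. ev k e_split [left c, h, G, acc]) m (map ?enc L))"
      if "\<And>p. p \<in> set L \<Longrightarrow> piece d p \<and> set p \<subseteq> F" "repL M m" for L M m
      using that
    proof (induction L arbitrary: M m)
      case (Cons p L)
      have "repL (split2 ?Z (\<alpha> ^ i) p @ M) (ev k e_split [left c, ?enc p, G, m])"
        unfolding r(1) by (rule ev_split[OF k _ _ pw Cons.prems(2) Z]) (use Cons.prems(1)[of p] in \<open>auto simp: rep_def\<close>)
      then show ?case using Cons.IH[of "split2 ?Z (\<alpha> ^ i) p @ M"] Cons.prems(1) by simp
    qed simp
    have rv: "ev k e_rev [right c] = cell_of_list (map ?enc (rev (pieces ?Z f i)))"
      using r(2) len ev_rev[of "map ?enc (pieces ?Z f i)" k] by (simp add: repL_def rev_map)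
    have "repL (concat (map (split2 ?Z (\<alpha> ^ i)) (rev (rev (pieces ?Z f i)))) @ [])
        (foldl (\<lambda>acc h. ev k e_split [left c, h, G, acc]) Atom (map ?enc (rev (pieces ?Z f i))))"
      by (rule fold) (use pc r(2) in \<open>auto simp: repL_def\<close>)
    then have "repL (pieces ?Z f (Suc i)) (cfold k (\<lambda>acc h. ev k e_split [left c, h, G, acc]) Atom (ev k e_rev [right c]))"
      unfolding rv pieces_Suc using len by (simp add: cfold_cell_of_list)
    then show ?thesis using ev_enc_valpha[OF k pw] by (simp add: R_def s_def r(1))
  qed
  have m: "rep (monic f) (ev k e_monic [c, G])"
    by (rule ev_monic[OF k f(4) _ f(1,2)]) (use f(3) Z in simp)
  have "R 0 (Cell (enc 1) (ev k e_consif [ev k e_monic [c, G], Atom]))"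
    using ev_consif[OF m, of "[]" Atom k] by (simp add: R_def pieces_0 repL_def)
  then have "R i ((s ^^ i) (Cell (enc 1) (ev k e_consif [ev k e_monic [c, G], Atom])))" for i
    by (induction i) (simp_all add: step)
  then have L: "repL (pieces ?Z f n) (right ((s ^^ n) (Cell (enc 1) (ev k e_consif [ev k e_monic [c, G], Atom]))))"
    by (simp add: R_def)
  have fold: "cfold k (\<lambda>a _. s a) c' (enc 1) = (s ^^ n) c'" for c'
    using k length_vec[OF F_1] by (simp add: enc_def cell_of_vec_def cfold_cell_of_list foldl_const)
  let ?E = "ETl (EFold (EVar 2)
    (ECons (EVar 2) (ECall e_consif [ECall e_monic [EVar 0, EVar 1], ENil]))
    (ECons (ECall e_valpha [EHd (EVar 4), EVar 1])
      (EFold (ECall e_rev [ETl (EVar 4)]) ENil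
        (ECall e_split [EHd (EVar 4), EVar 5, EVar 1, EVar 6]))))"
  have E: "ev k ?E [c, G, enc 1] = cell_of_list (map (\<lambda>p. cell_of_list (map enc p)) (pieces ?Z f n))"
    using L fold[of "Cell (enc 1) (ev k e_consif [ev k e_monic [c, G], Atom])"]
    by (simp add: s_def repL_def)
  have "ev k (e_map 3 ?E (EHd (ETl (EVar 3)))) [c, G, enc 1] =
      cell_of_list (map (\<lambda>x. left (right x)) (map (\<lambda>p. cell_of_list (map enc p)) (pieces ?Z f n)))"
    by (rule ev_map[OF E]) (use length_pieces[OF f(1-3) Z, of n] Z in simp_all)
  also have "map (\<lambda>x. left (right x)) (map (\<lambda>p. cell_of_list (map enc p)) (pieces ?Z f n)) =
      map enc (rootlist ?Z f)"
  proof -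
    have "left (right (cell_of_list (map enc p))) = enc (hd (tl p))" if "p \<in> set (pieces ?Z f n)" for p
      using rootlist(3)[OF f(1-3) Z that] by (cases p; cases "tl p") auto
    then show ?thesis by (simp add: rootlist_def)
  qed
  finally show ?thesis
    using ev_enc_vone[OF k hd(2)] by (simp add: e_roots_def hd(1))
qed

end

section \<open>The decoder and encoder as expressions\<close>

text \<open>The only clock available at the start is the list of the 9t coefficients of P. Greatest
  common divisors need 4 (9t) + 1 rounds, so the clock is first made eight times as long.\<close>

definition "e_clock = EFold EClk ENil (ECons ENil (ECons ENil (ECons ENil (ECons ENil
  (ECons ENil (ECons ENil (ECons ENil (ECons ENil (EVar 2)))))))))"
definition "e_zvec = e_map 1 (ETl (EVar 0)) ENil"
definition "e_args = [EHd (EVar 0), EHd (ETl (EVar 0)), EHd (ETl (ETl (EVar 0))),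
  EHd (ETl (ETl (ETl (EVar 0)))), EHd (ETl (ETl (ETl (ETl (EVar 0))))),
  EHd (ETl (ETl (ETl (ETl (ETl (EVar 0))))))]"
definition "e_eval = EFold (ECall e_rev [EVar 1]) (ECall e_zvec [EVar 0])
  (ECall e_vadd [ECall e_vmul [EVar 4, EVar 2, EVar 0], EVar 3])"
definition "e_take = EFold (EVar 0) (ECons (EVar 1) ENil)
  (ECons (ETl (EHd (EVar 3))) (ECons (EHd (EHd (EVar 3))) (ETl (EVar 3))))"
definition "e_check = ETl (EFold (EVar 0) (ECons (EVar 1) ENil)
  (ECons (ETl (EHd (EVar 3))) (EIf (EHd (EHd (EVar 3))) e_one (ETl (EVar 3)))))"
definition "e_dec = ECall
  (ELet (ECall e_take [EVar 2, ECall e_eval [EVar 0, EVar 1, EVar 5]])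
    (EIf (ECall e_check [EVar 3, EHd (EVar 6)]) ENil (ECons (ECall e_rev [ETl (EVar 6)]) ENil))) e_args"

definition "e_words = EFold (EVar 0) (ECons (EVar 1) ENil)
  (EFold (EVar 3) ENil (ECons (ECons ENil (EVar 4)) (ECons (ECons e_one (EVar 4)) (EVar 5))))"
definition "e_pad = EFold (EVar 0) (ECall e_rev [EVar 1]) (ECons ENil (EVar 3))"
text \<open>P - y is obtained by adding y to the constant term, the head of the list; reversing and
  stripping turn it into the format of the root finder. The word y arrives reversed.\<close>

definition "e_shift = ECall e_strip [ECall e_rev
  [ECons (ECall e_vadd [EHd (EVar 0), ECall e_rev [EVar 1]]) (ETl (EVar 0))]]"
definition "e_append = EFold (EVar 0) (EVar 1) (ECons (EVar 2) (EVar 3))"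
text \<open>The accumulator pairs a flag with the roots found so far. The flag records that P - y is
  the zero polynomial for some y: then every vector is a solution, and no list of them could be
  written down in time.\<close>

definition "e_solve = EFold (EVar 2) (ECons ENil ENil)
  (ELet (ECall e_shift [EVar 1, EVar 3])
    (EIf (EVar 5) (ECons (EHd (EVar 4)) (ECall e_append [ECall e_roots [EVar 5, EVar 0], ETl (EVar 4)]))
      (ECons e_one (ETl (EVar 4)))))"
text \<open>The expression makes no random choice but returns a flag and the lists to choose from.
  If P is constant with its value in the block, these are n lists of the two bits. Otherwise there
  is one list, which enumerates the set to sample from or, if that set is empty, holds the zero
  vector, as in \<open>EncMC\<close>.\<close>

definition "e_enc = ECall
  (ELet (ECall e_solve [EVar 0, EVar 1, ECall e_words [EVar 4, ECall e_pad [EVar 3, EVar 5]]])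
    (EIf (EHd (EVar 6))
      (ECons ENil (e_map 7 (ETl (EVar 0)) (ECons ENil (ECons e_one ENil))))
      (ECons e_one (ECons (EIf (ETl (EVar 6)) (ETl (EVar 6)) (ECons (ECall e_zvec [EVar 0]) ENil)) ENil)))) e_args"

lemma clen_clock: "clen (ev k e_clock [c]) = 8 * clen k"
proof -
  let ?h = "\<lambda>acc. Cell Atom (Cell Atom (Cell Atom (Cell Atom (Cell Atom (Cell Atom (Cell Atom (Cell Atom acc)))))))"
  have "clen ((?h ^^ m) Atom) = 8 * m" for m
    by (induction m) (auto simp: clen_def)
  moreover have "ev k e_clock [c] = cfold k (\<lambda>acc _. ?h acc) Atom k"
    by (simp add: e_clock_def)
  ultimately show ?thesis by (simp only: cfold_clock)
qed

lemma ev_args: "map (\<lambda>e. ev k e [cell_of_list [a, b, c, d, e', f]]) e_args = [a, b, c, d, e', f]"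
  by (simp add: e_args_def)

lemma ev_take:
  assumes "i \<le> clen k" "i \<le> length y"
  shows "ev k e_take [unary i, cell_of_vec y] = Cell (cell_of_vec (drop i y)) (cell_of_vec (rev (take i y)))"
proof -
  let ?h = "\<lambda>acc. Cell (right (left acc)) (Cell (left (left acc)) (right acc))"
  have "(?h ^^ i) (Cell (cell_of_vec y) (cell_of_vec out)) =
      Cell (cell_of_vec (drop i y)) (cell_of_vec (rev (take i y) @ out))" if "i \<le> length y" for i y out
    using that
  proof (induction i arbitrary: y out)
    case (Suc i)
    then obtain b z where y: "y = b # z" by (cases y) auto
    have "(?h ^^ Suc i) (Cell (cell_of_vec y) (cell_of_vec out)) =
        (?h ^^ i) (?h (Cell (cell_of_vec y) (cell_of_vec out)))"
      by (simp only: funpow_Suc_right comp_apply)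
    also have "?h (Cell (cell_of_vec y) (cell_of_vec out)) = Cell (cell_of_vec z) (cell_of_vec (b # out))"
      by (simp add: y cell_of_vec_Cons)
    also have "(?h ^^ i) \<dots> = Cell (cell_of_vec (drop i z)) (cell_of_vec (rev (take i z) @ b # out))"
      by (rule Suc.IH) (use Suc.prems y in simp)
    finally show ?case by (simp add: y)
  qed simp
  from this[OF assms(2), of "[]"] show ?thesis
    using assms(1) by (simp add: e_take_def unary_def cfold_cell_of_list foldl_const cell_of_vec_def)
qed

lemma ev_check:
  assumes "i \<le> clen k" "i \<le> length y"
  shows "ev k e_check [unary i, cell_of_vec y] = Atom \<longleftrightarrow> take i y = replicate i 0"
proof -
  let ?h = "\<lambda>acc. Cell (right (left acc)) (if left (left acc) = Atom then right acc else Cell Atom Atom)"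
  have "right ((?h ^^ i) (Cell (cell_of_vec y) a)) = Atom \<longleftrightarrow> a = Atom \<and> take i y = replicate i 0"
    if "i \<le> length y" for i y a
    using that
  proof (induction i arbitrary: y a)
    case (Suc i)
    then obtain b z where y: "y = b # z" by (cases y) auto
    have "(?h ^^ Suc i) (Cell (cell_of_vec y) a) = (?h ^^ i) (?h (Cell (cell_of_vec y) a))"
      by (simp only: funpow_Suc_right comp_apply)
    also have "?h (Cell (cell_of_vec y) a) = Cell (cell_of_vec z) (if b = 0 then a else Cell Atom Atom)"
      by (simp add: y cell_of_vec_Cons)
    also have "right ((?h ^^ i) \<dots>) = Atom \<longleftrightarrow> (if b = 0 then a else Cell Atom Atom) = Atom \<and> take i z = replicate i 0"
      by (rule Suc.IH) (use Suc.prems y in simp)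
    finally show ?case by (auto simp: y)
  qed simp
  from this[OF assms(2), of Atom] show ?thesis
    using assms(1) by (simp add: e_check_def e_one_def unary_def cfold_cell_of_list foldl_const cong: if_cong)
qed

lemma ev_pad:
  assumes "i \<le> clen k" "length v \<le> clen k"
  shows "ev k e_pad [unary i, cell_of_vec v] = cell_of_vec (replicate i 0 @ rev v)"
proof -
  have "(Cell Atom ^^ i) (cell_of_vec w) = cell_of_vec (replicate i 0 @ w)" for w
    by (induction i) (auto simp: cell_of_vec_def)
  moreover have "ev k e_rev [cell_of_vec v] = cell_of_vec (rev v)"
    using ev_rev[of "map cell_of_bit v" k] assms(2) by (simp add: cell_of_vec_def rev_map)
  ultimately show ?thesis
    using assms(1) by (simp add: e_pad_def unary_def cfold_cell_of_list foldl_const)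
qed

text \<open>Words are kept reversed. The last b bits, which vary freely, are then prepended to a
  common tail, which is the padding followed by the reversed message.\<close>

lemma ev_words:
  assumes "2 ^ i \<le> clen k"
  shows "\<exists>W. ev k e_words [unary i, cell_of_vec w] = cell_of_list (map cell_of_vec W) \<and>
    distinct W \<and> set W = (\<lambda>z. z @ w) ` bvecs i \<and> length W = 2 ^ i"
proof -
  let ?g = "\<lambda>acc x. Cell (Cell Atom x) (Cell (Cell (Cell Atom Atom) x) acc)"
  let ?h = "\<lambda>acc. cfold k ?g Atom acc"
  have inner: "foldl ?g (cell_of_list (map cell_of_vec M)) (map cell_of_vec W) =
      cell_of_list (map cell_of_vec (foldl (\<lambda>acc v. (0 # v) # (1 # v) # acc) M W))" for M W
  proof (induction W arbitrary: M)
    case (Cons v W)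
    from Cons[of "(0 # v) # (1 # v) # M"] show ?case by (simp add: cell_of_vec_Cons)
  qed simp
  have set: "set (foldl (\<lambda>acc v. (0 # v) # (1 # v) # acc) M W) =
      set M \<union> (\<lambda>v. 0 # v) ` set W \<union> (\<lambda>v. 1 # v) ` set W \<and>
      length (foldl (\<lambda>acc v. (0 # v) # (1 # v) # acc) M W) = length M + 2 * length W" for M W :: "bit list list"
    by (induction W arbitrary: M) auto
  have bv: "bvecs (Suc j) = (\<lambda>v. 0 # v) ` bvecs j \<union> (\<lambda>v. 1 # v) ` bvecs j" for j
    using bit_cases by (force simp: bvecs_def length_Suc_conv image_iff)
  have "\<exists>W. (?h ^^ j) (cell_of_list [cell_of_vec w]) = cell_of_list (map cell_of_vec W) \<and>
    distinct W \<and> set W = (\<lambda>z. z @ w) ` bvecs j \<and> length W = 2 ^ j" if "j \<le> i" for j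
    using that
  proof (induction j)
    case 0
    show ?case by (rule exI[of _ "[w]"]) (auto simp: bvecs_def)
  next
    case (Suc j)
    then obtain W where W: "(?h ^^ j) (cell_of_list [cell_of_vec w]) = cell_of_list (map cell_of_vec W)"
      "set W = (\<lambda>z. z @ w) ` bvecs j" "length W = 2 ^ j" by auto
    have "(2::nat) ^ j \<le> 2 ^ i" using Suc.prems by (intro power_increasing) auto
    then have len: "length W \<le> clen k" using W(3) assms by linarith
    define W' where "W' = foldl (\<lambda>acc v. (0 # v) # (1 # v) # acc) [] W"
    have W': "set W' = (\<lambda>z. z @ w) ` bvecs (Suc j)" "length W' = 2 ^ Suc j"
      using set[of "[]" W] W(2,3) unfolding W'_def bv by (auto simp: image_iff)
    have "(?h ^^ Suc j) (cell_of_list [cell_of_vec w]) = cell_of_list (map cell_of_vec W')"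
      using W(1) len inner[of "[]" W] by (simp add: cfold_cell_of_list W'_def)
    moreover have "card (set W') = length W'"
      unfolding W'(1) by (subst card_image) (auto simp: inj_on_def W'(2) card_bvecs)
    then have "distinct W'" by (rule card_distinct)
    ultimately show ?case using W' by blast
  qed
  moreover have "i \<le> clen k" using assms less_exp[of i] by linarith
  ultimately show ?thesis
    by (simp add: e_words_def e_one_def unary_def cfold_cell_of_list foldl_const cong: if_cong)
qed

lemma ev_append: "length xs \<le> clen k \<Longrightarrow>
    ev k e_append [cell_of_list xs, cell_of_list ys] = cell_of_list (rev xs @ ys)"
  using foldl_Cell[of "\<lambda>x. x" ys xs] by (simp add: e_append_def cfold_cell_of_list)

context gf
begin

definition coefs :: "nat \<Rightarrow> bit poly poly \<Rightarrow> kpoly" where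
  "coefs t P = map (\<lambda>i. \<phi> (coeff P i)) [0..<9 * t]"

lemma ev_zvec: "n \<le> clen k \<Longrightarrow> ev k e_zvec [G] = cell_of_vec (replicate n 0)"
proof -
  assume k: "n \<le> clen k"
  have tl: "right G = cell_of_list (map cell_of_bit (tl (vec_of (n + 1) g)))"
    by (simp add: G_def cell_of_vec_def map_tl)
  have "ev k e_zvec [G] = cell_of_list (map (\<lambda>_. Atom) (map cell_of_bit (tl (vec_of (n + 1) g))))"
    unfolding e_zvec_def by (rule ev_map) (use k in \<open>simp_all add: tl\<close>)
  then show ?thesis by (simp add: cell_of_vec_def map_replicate_const comp_def)
qed

lemma ev_zvec_enc: "n \<le> clen k \<Longrightarrow> ev k e_zvec [G] = enc 0"
  using ev_zvec enc_eqI[of "replicate n 0" 0] \<psi>_replicate_0[of n] by simp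

lemma rep_coefs:
  assumes "P \<in> mc_polys n t"
  shows "rep (coefs t P) (cell_of_list (map (\<lambda>i. cell_of_vec (vec_of n (coeff P i))) [0..<9 * t]))"
proof -
  have "cell_of_vec (vec_of n (coeff P i)) = enc (\<phi> (coeff P i))" for i
    by (rule enc_eqI) (use assms in \<open>auto simp: \<psi>_def Poly_vec_of mc_polys_def\<close>)
  then show ?thesis by (auto simp: rep_def coefs_def \<phi>_in_F comp_def)
qed

lemma Poly_coefs:
  assumes "P \<in> mc_polys n t" "0 < t"
  shows "Poly (coefs t P) = map_poly \<phi> P"
proof (rule poly_eqI)
  fix i
  have "degree P < 9 * t" using assms by (auto simp: mc_polys_def)
  then show "coeff (Poly (coefs t P)) i = coeff (map_poly \<phi> P) i"
    by (auto simp: coefs_def coeff_Poly_eq nth_default_def coeff_map_poly coeff_eq_0)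
qed

lemma ev_eval:
  assumes k: "n \<le> clen k" and C: "rep cs c" "length cs \<le> clen k" and u: "u \<in> F"
  shows "ev k e_eval [G, c, enc u] = enc (poly (Poly cs) u)"
proof -
  let ?h = "\<lambda>acc x. ev k e_vadd [ev k e_vmul [acc, enc u, G], x]"
  have fold: "foldl ?h (enc 0) (rev (map enc cs)) = enc (poly (Poly cs) u) \<and> poly (Poly cs) u \<in> F"
    if "set cs \<subseteq> F" for cs
    using that
  proof (induction cs)
    case (Cons y cs)
    have F: "poly (Poly cs) u \<in> F" "y \<in> F" "poly (Poly cs) u * u \<in> F" using Cons u F_mult by auto
    then show ?case
      using Cons ev_enc_vmul(1)[OF k F(1) u] ev_enc_vadd(1)[OF k F(3,2)] F_add[OF F(3,2)]
      by (simp add: add.commute mult.commute)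
  qed (simp add: F_0)
  have "ev k e_rev [c] = cell_of_list (rev (map enc cs))"
    using C ev_rev[of "map enc cs" k] by (simp add: rep_def)
  then show ?thesis
    using fold C ev_zvec_enc[OF k] cfold_cell_of_list[of "rev (map enc cs)" k ?h "enc 0"]
    by (simp add: e_eval_def rep_def)
qed

lemma mc_input_eq: "mc_input n k t g P x = cell_of_list
    [G, cell_of_list (map (\<lambda>i. cell_of_vec (vec_of n (coeff P i))) [0..<9 * t]),
      unary k, unary (mc_m n k t), unary (mc_b t), cell_of_vec x]"
  by (simp add: mc_input_def G_def)

lemma ev_dec:
  assumes K: "n \<le> clen c" "9 * t \<le> clen c" and t: "0 < t" and k: "k + mc_m n k t \<le> n"
    and P: "P \<in> mc_polys n t" and x: "x \<in> bvecs n"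
  shows "ev c e_dec [mc_input n k t g P x] = cell_of_decoded (DecMC n k t g P x)"
proof -
  let ?m = "mc_m n k t"
  let ?C = "cell_of_list (map (\<lambda>i. cell_of_vec (vec_of n (coeff P i))) [0..<9 * t])"
  define y where "y = mc_eval n g P x"
  have ly: "length y = n" using mc_eval_in by (simp add: y_def bvecs_def)
  have xF: "\<psi> x \<in> F" "enc (\<psi> x) = cell_of_vec x" using x by (auto simp: \<psi>_in_F enc_def vec_\<psi>)
  have "ev c e_eval [G, ?C, cell_of_vec x] = enc (poly (Poly (coefs t P)) (\<psi> x))"
    unfolding xF(2)[symmetric]
    by (rule ev_eval[OF K(1) rep_coefs[OF P] _ xF(1)]) (use K in \<open>simp add: coefs_def\<close>)
  also have "\<dots> = cell_of_vec y"
    unfolding Poly_coefs[OF P t] \<psi>_mc_eval[symmetric] y_def[symmetric] by (rule enc_\<psi>[OF ly])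
  finally have ev1: "ev c e_eval [G, ?C, cell_of_vec x] = cell_of_vec y" .
  have ev2: "ev c e_take [unary k, cell_of_vec y] =
      Cell (cell_of_vec (drop k y)) (cell_of_vec (rev (take k y)))"
    by (rule ev_take) (use K k ly in auto)
  have ev3: "ev c e_check [unary ?m, cell_of_vec (drop k y)] = Atom \<longleftrightarrow>
      take ?m (drop k y) = replicate ?m 0"
    by (rule ev_check) (use K k ly in auto)
  have ev4: "ev c e_rev [cell_of_vec (rev (take k y))] = cell_of_vec (take k y)"
    using ev_rev[of "map cell_of_bit (rev (take k y))" c] K k ly by (simp add: cell_of_vec_def rev_map)
  show ?thesis
    unfolding e_dec_def mc_input_eq ev.simps(10) ev_args
    by (simp add: ev1 ev2 ev3 ev4 DecMC_def y_def[symmetric] del: cell_of_list.simps)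
qed

text \<open>P takes one value at each point and the words are distinct, so the root sets for
  different words are disjoint; appending them keeps the list free of repetitions, which a uniform
  choice of position will require. Words that make P - y zero affect only the flag.\<close>

lemma ev_solve:
  fixes W :: "bit list list"
  assumes K: "n \<le> clen c" "4 * d + 1 \<le> clen c" and C: "rep cs C" "length cs \<le> d" "cs \<noteq> []"
    and W: "\<And>w. w \<in> set W \<Longrightarrow> length w = n" "length W \<le> clen c" "distinct W"
  shows "\<exists>xs. ev c e_solve [G, C, cell_of_list (map cell_of_vec W)] =
      Cell (if \<exists>w\<in>set W. Poly cs = [:\<psi> (rev w):] then Cell Atom Atom else Atom) (cell_of_list (map enc xs)) \<and>
    distinct xs \<and> set xs = {x\<in>F. \<exists>w\<in>set W. Poly cs \<noteq> [:\<psi> (rev w):] \<and> poly (Poly cs) x = \<psi> (rev w)}"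
proof -
  let ?sh = "\<lambda>w. ev c e_shift [C, w]"
  let ?h = "\<lambda>acc w. if ?sh w = Atom then Cell (Cell Atom Atom) (right acc)
    else Cell (left acc) (ev c e_append [ev c e_roots [?sh w, G], right acc])"
  define f where "f = (\<lambda>w. strip (rev ((hd cs + \<psi> (rev w)) # tl cs)))"
  have cs: "cs = hd cs # tl cs" using C(3) by simp
  have hF: "hd cs \<in> F" "left C = enc (hd cs)" using rep_left[OF C(1,3)] by auto
  have sh: "rep (f w) (?sh (cell_of_vec w))" "stripped (f w)" "length (f w) \<le> d"
    "hpoly (f w) = Poly cs + [:\<psi> (rev w):]" if w: "w \<in> set W" for w
  proof -
    have lw: "length w = n" by (rule W(1)[OF w])
    have r: "ev c e_rev [cell_of_vec w] = enc (\<psi> (rev w))"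
      using ev_rev[of "map cell_of_bit w" c] K(1) lw enc_\<psi>[of "rev w"] by (simp add: cell_of_vec_def rev_map)
    have \<psi>F: "\<psi> (rev w) \<in> F" using lw by (intro \<psi>_in_F) (simp add: bvecs_def)
    have "rep ((hd cs + \<psi> (rev w)) # tl cs)
        (Cell (ev c e_vadd [left C, ev c e_rev [cell_of_vec w]]) (right C))"
      unfolding r hF(2) ev_enc_vadd(1)[OF K(1) hF(1) \<psi>F]
      by (rule rep_Cons[OF F_add[OF hF(1) \<psi>F] rep_right[OF C(1)]])
    then have "rep (rev ((hd cs + \<psi> (rev w)) # tl cs))
        (ev c e_rev [Cell (ev c e_vadd [left C, ev c e_rev [cell_of_vec w]]) (right C)])"
      by (rule ev_rep_rev) (use C(2,3) K in \<open>cases cs; auto\<close>)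
    then have "rep (f w) (ev c e_strip [ev c e_rev [Cell (ev c e_vadd [left C, ev c e_rev [cell_of_vec w]]) (right C)]])"
      unfolding f_def by (rule ev_strip[OF K(1)]) (use C(2,3) K in \<open>cases cs; auto\<close>)
    then show "rep (f w) (?sh (cell_of_vec w))" by (simp add: e_shift_def)
    show "stripped (f w)" unfolding f_def by (rule stripped_strip)
    show "length (f w) \<le> d"
      using length_strip[of "rev ((hd cs + \<psi> (rev w)) # tl cs)"] C(2,3) unfolding f_def
      by (cases cs) auto
    have "Poly ((hd cs + \<psi> (rev w)) # tl cs) = Poly (hd cs # tl cs) + [:\<psi> (rev w):]" by simp
    then show "hpoly (f w) = Poly cs + [:\<psi> (rev w):]"
      unfolding f_def hpoly_strip unfolding hpoly_def rev_rev_ident using cs by simp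
  qed
  have add0: "p + q = 0 \<longleftrightarrow> p = q" for p q :: "bit alg_closure poly"
    using eq_iff_diff_eq_0[of p q] by (simp only: poly_minus_alg_closure)
  have addk: "p + q = 0 \<longleftrightarrow> p = q" for p q :: "bit alg_closure"
    using eq_iff_diff_eq_0[of p q] by (simp only: minus_bit_alg_closure)
  have empty: "f w = [] \<longleftrightarrow> Poly cs = [:\<psi> (rev w):]" if w: "w \<in> set W" for w
    using stripped_hpoly_0[OF sh(2)[OF w]] sh(4)[OF w] add0 by simp
  let ?S = "\<lambda>U. {x\<in>F. \<exists>w\<in>U. Poly cs \<noteq> [:\<psi> (rev w):] \<and> poly (Poly cs) x = \<psi> (rev w)}"
  have "\<exists>xs. foldl ?h (Cell Atom Atom) (map cell_of_vec V) =
      Cell (if \<exists>w\<in>set V. Poly cs = [:\<psi> (rev w):] then Cell Atom Atom else Atom) (cell_of_list (map enc xs)) \<and>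
      distinct xs \<and> set xs = ?S (set V)" if "set V \<subseteq> set W" "distinct V" for V
    using that
  proof (induction V rule: rev_induct)
    case Nil
    show ?case by (rule exI[of _ "[]"]) simp
  next
    case (snoc w V)
    then obtain xs where xs: "foldl ?h (Cell Atom Atom) (map cell_of_vec V) =
        Cell (if \<exists>w\<in>set V. Poly cs = [:\<psi> (rev w):] then Cell Atom Atom else Atom) (cell_of_list (map enc xs))"
      "distinct xs" "set xs = ?S (set V)" by auto
    have w: "w \<in> set W" "w \<notin> set V" "set V \<subseteq> set W" using snoc.prems by auto
    show ?case
    proof (cases "f w = []")
      case True
      then have "?sh (cell_of_vec w) = Atom" using sh(1)[OF w(1)] rep_Atom by blast
      moreover have "?S (set (V @ [w])) = ?S (set V)" using True empty[OF w(1)] by auto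
      ultimately show ?thesis
        using xs True empty[OF w(1)] by (intro exI[of _ xs]) simp
    next
      case False
      then have ne: "?sh (cell_of_vec w) \<noteq> Atom" using sh(1)[OF w(1)] rep_Atom by blast
      note rl = rootlist[OF sh(2)[OF w(1)] False sh(3)[OF w(1)] K(2)]
      let ?r = "rootlist (clen c) (f w)"
      have r: "ev c e_roots [?sh (cell_of_vec w), G] = cell_of_list (map enc ?r)"
        by (rule ev_roots[OF K(1) sh(2)[OF w(1)] False sh(3)[OF w(1)] sh(1)[OF w(1)] K(2)])
      have lr: "length ?r \<le> clen c"
        using length_pieces[OF sh(2)[OF w(1)] False sh(3)[OF w(1)] K(2), of n] K(2) by (simp add: rootlist_def)
      have a: "ev c e_append [cell_of_list (map enc ?r), cell_of_list (map enc xs)] =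
          cell_of_list (map enc (rev ?r @ xs))"
        using ev_append[of "map enc ?r" c "map enc xs"] lr by (simp add: rev_map)
      have sr: "set ?r = {x\<in>F. poly (Poly cs) x = \<psi> (rev w)}"
        unfolding rl(1) sh(4)[OF w(1)] by (simp add: addk)
      have "set ?r \<inter> set xs = {}"
      proof (rule ccontr)
        assume "set ?r \<inter> set xs \<noteq> {}"
        then obtain x w' where x: "poly (Poly cs) x = \<psi> (rev w)" "w' \<in> set V" "poly (Poly cs) x = \<psi> (rev w')"
          unfolding sr xs(3) by blast
        then have "rev w = rev w'"
          using inj_onD[OF inj_\<psi>, of "rev w" "rev w'"] W(1) w by (auto simp: bvecs_def)
        then show False using w x by simp
      qed
      moreover have "set (rev ?r @ xs) = ?S (set (V @ [w]))"
        using False empty[OF w(1)] sr xs(3) by auto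
      moreover have "foldl ?h (Cell Atom Atom) (map cell_of_vec (V @ [w])) =
          Cell (if \<exists>w\<in>set (V @ [w]). Poly cs = [:\<psi> (rev w):] then Cell Atom Atom else Atom)
            (cell_of_list (map enc (rev ?r @ xs)))"
        using xs(1) ne a False empty[OF w(1)] by (simp add: r)
      ultimately show ?thesis using rl(2) xs(2) by (intro exI[of _ "rev ?r @ xs"]) auto
    qed
  qed
  note main = this[of W]
  have "ev c e_solve [G, C, cell_of_list (map cell_of_vec W)] =
      foldl ?h (Cell Atom Atom) (map cell_of_vec W)"
    using W(2) by (simp add: e_solve_def e_one_def cfold_cell_of_list cong: if_cong)
  then show ?thesis using main W(3) by (simp only: order.refl simp_thms)
qed

text \<open>The alternatives are whether P is constant with its value in the block or not. In the
  second case the listed vectors are distinct and form exactly the set that \<open>EncMC\<close>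
  samples from, its default value included.\<close>

lemma ev_enc:
  assumes K: "n \<le> clen c" "4 * (9 * t) + 1 \<le> clen c" "2 ^ mc_b t \<le> clen c" and t: "0 < t"
    and k: "k + mc_m n k t + mc_b t = n" and P: "P \<in> mc_polys n t" and s: "s \<in> bvecs k"
  shows "(mc_E n k t g P s = bvecs n \<and> ev c e_enc [mc_input n k t g P s] =
      Cell Atom (cell_of_list (replicate n (cell_of_list [Atom, Cell Atom Atom])))) \<or>
    (\<exists>vs. vs \<noteq> [] \<and> distinct vs \<and>
      set vs = (if mc_E n k t g P s = {} then {replicate n 0} else mc_E n k t g P s) \<and>
      ev c e_enc [mc_input n k t g P s] =
        Cell (Cell Atom Atom) (cell_of_list [cell_of_list (map cell_of_vec vs)]))"
proof -
  let ?m = "mc_m n k t" and ?b = "mc_b t"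
  let ?C = "cell_of_list (map (\<lambda>i. cell_of_vec (vec_of n (coeff P i))) [0..<9 * t])"
  let ?\<Phi> = "map_poly \<phi> P"
  let ?E = "mc_E n k t g P s"
  have ls: "length s = k" using s by (simp add: bvecs_def)
  let ?w = "replicate ?m 0 @ rev s"
  have pad: "ev c e_pad [unary ?m, cell_of_vec s] = cell_of_vec ?w"
    by (rule ev_pad) (use K k ls in auto)
  obtain W where W: "ev c e_words [unary ?b, cell_of_vec ?w] = cell_of_list (map cell_of_vec W)"
    "distinct W" "set W = (\<lambda>z. z @ ?w) ` bvecs ?b" "length W = 2 ^ ?b"
    using ev_words[OF K(3), of ?w] by auto
  have lW: "length w = n" if "w \<in> set W" for w
    using that k ls by (auto simp: W(3) bvecs_def)
  have C: "rep (coefs t P) ?C" "length (coefs t P) \<le> 9 * t" "coefs t P \<noteq> []"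
    using rep_coefs[OF P] t by (auto simp: coefs_def)
  obtain xs where xs: "ev c e_solve [G, ?C, cell_of_list (map cell_of_vec W)] =
      Cell (if \<exists>w\<in>set W. ?\<Phi> = [:\<psi> (rev w):] then Cell Atom Atom else Atom) (cell_of_list (map enc xs))"
    "distinct xs" "set xs = {x\<in>F. \<exists>w\<in>set W. ?\<Phi> \<noteq> [:\<psi> (rev w):] \<and> poly ?\<Phi> x = \<psi> (rev w)}"
    using ev_solve[OF K(1,2) C lW _ W(2)] W(4) K(3) unfolding Poly_coefs[OF P t] by auto
  have rW: "rev ` set W = (\<lambda>z. s @ replicate ?m 0 @ z) ` bvecs ?b"
  proof -
    have "rev ` bvecs ?b = bvecs ?b"
      by (auto simp: bvecs_def image_iff) (metis length_rev rev_rev_ident)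
    moreover have "rev ` set W = (\<lambda>z. s @ replicate ?m 0 @ z) ` rev ` bvecs ?b"
      unfolding W(3) by (auto simp: image_iff)
    ultimately show ?thesis by (simp only:)
  qed
  have E: "x \<in> ?E \<longleftrightarrow> x \<in> bvecs n \<and> (\<exists>w\<in>set W. poly ?\<Phi> (\<psi> x) = \<psi> (rev w))" for x
  proof -
    have "x \<in> ?E \<longleftrightarrow> x \<in> bvecs n \<and> mc_eval n g P x \<in> rev ` set W"
      unfolding mc_E_def rW by auto
    also have "mc_eval n g P x \<in> rev ` set W \<longleftrightarrow> (\<exists>w\<in>set W. poly ?\<Phi> (\<psi> x) = \<psi> (rev w))"
    proof -
      have "mc_eval n g P x = rev w \<longleftrightarrow> \<psi> (mc_eval n g P x) = \<psi> (rev w)" if "w \<in> set W" for w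
        using inj_onD[OF inj_\<psi>, of "mc_eval n g P x" "rev w"] mc_eval_in lW[OF that] by (auto simp: bvecs_def)
      then show ?thesis unfolding \<psi>_mc_eval[symmetric] by blast
    qed
    finally show ?thesis .
  qed
  let ?body = "ELet (ECall e_solve [EVar 0, EVar 1, ECall e_words [EVar 4, ECall e_pad [EVar 3, EVar 5]]])
    (EIf (EHd (EVar 6))
      (ECons ENil (e_map 7 (ETl (EVar 0)) (ECons ENil (ECons e_one ENil))))
      (ECons e_one (ECons (EIf (ETl (EVar 6)) (ETl (EVar 6)) (ECons (ECall e_zvec [EVar 0]) ENil)) ENil)))"
  have ev: "ev c e_enc [mc_input n k t g P s] =
      ev c ?body [G, ?C, unary k, unary ?m, unary ?b, cell_of_vec s]"
    unfolding e_enc_def mc_input_eq ev.simps(10) ev_args ..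
  show ?thesis
  proof (cases "\<exists>w\<in>set W. ?\<Phi> = [:\<psi> (rev w):]")
    case True
    then have "?E = bvecs n" using E by (auto simp: Set.set_eq_iff)
    moreover have "ev c (e_map 7 (ETl (EVar 0)) (ECons ENil (ECons e_one ENil)))
        [G, ?C, unary k, unary ?m, unary ?b, cell_of_vec s, c'] =
        cell_of_list (map (\<lambda>_. cell_of_list [Atom, Cell Atom Atom]) (map cell_of_bit (tl (vec_of (n + 1) g))))" for c'
      by (rule ev_map) (use K(1) in \<open>simp_all add: e_one_def G_def cell_of_vec_def map_tl\<close>)
    ultimately show ?thesis
      unfolding ev using True by (simp add: pad W(1) xs(1) map_replicate_const comp_def del: cell_of_list.simps)
  next
    case False
    define vs where "vs = map vec xs"
    have inj: "inj_on vec F" by (rule inj_onI) (metis \<psi>_vec)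
    have dvs: "distinct vs" unfolding vs_def using xs(2,3) inj by (auto simp: distinct_map intro: inj_on_subset)
    have svs: "set vs = ?E"
    proof (rule Set.set_eqI)
      fix x
      have "x \<in> set vs \<longleftrightarrow> (\<exists>y\<in>F. x = vec y \<and> (\<exists>w\<in>set W. poly ?\<Phi> y = \<psi> (rev w)))"
        unfolding vs_def set_map xs(3) using False by blast
      also have "\<dots> \<longleftrightarrow> x \<in> ?E"
        unfolding E using vec_in \<psi>_vec vec_\<psi> \<psi>_in_F by metis
      finally show "x \<in> set vs \<longleftrightarrow> x \<in> ?E" .
    qed
    have ex: "map enc xs = map cell_of_vec vs" by (simp add: vs_def enc_def)
    have ev': "ev c e_enc [mc_input n k t g P s] = Cell (Cell Atom Atom) (cell_of_list
        [if vs = [] then cell_of_list [cell_of_vec (replicate n 0)] else cell_of_list (map cell_of_vec vs)])"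
      unfolding ev using False by (simp add: pad W(1) xs(1) ex e_one_def ev_zvec[OF K(1)])
    show ?thesis
    proof (cases "vs = []")
      case True
      then show ?thesis using ev' svs by (intro disjI2 exI[of _ "[replicate n 0]"]) auto
    next
      case nonempty: False
      then show ?thesis using ev' svs dvs by (intro disjI2 exI[of _ vs]) auto
    qed
  qed
qed

end

section \<open>From expressions to the complete programs with random choices\<close>

lemma poly_bounded_scale: "poly_bounded h \<Longrightarrow> 1 \<le> a \<Longrightarrow> poly_bounded (\<lambda>Z. h (a * Z))"
proof -
  assume h: "poly_bounded h" and a: "1 \<le> a"
  obtain c where c: "\<And>Z. Z \<ge> 1 \<Longrightarrow> h Z \<le> c * Z ^ c" using h unfolding poly_bounded_def by blast
  show ?thesis
  proof (rule poly_boundedI[of _ "c * a ^ c" c])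
    fix Z :: nat assume "1 \<le> Z"
    then have "h (a * Z) \<le> c * (a * Z) ^ c" using a by (intro c) simp
    then show "h (a * Z) \<le> c * a ^ c * Z ^ c" by (simp add: power_mult_distrib mult.assoc)
  qed
qed

text \<open>Saves the input in register 1, makes the coefficient list the first clock, computes the
  longer clock with it, and evaluates e under the new clock.\<close>

definition prologue :: "exp \<Rightarrow> com \<Rightarrow> com" where
  "prologue e c = Seq (Move 1 0) (Seq (Right 0 0) (Seq (Left 0 0) (Seq (compile e_clock [1] 2)
     (Seq (Move 0 2) (Seq (compile e [1] 2) c)))))"

definition mc_decoder :: com where
  "mc_decoder = prologue e_dec (Move 0 2)"

definition choice_loop :: com where
  "choice_loop = While 2 (Seq (Left 4 2) (Seq (Choose 4 4) (Seq (Pair 0 4 0) (Right 2 2))))"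

text \<open>With the flag set, the single choice is unpacked from the one-element list of choices.
  The assignment to register 4 is a dummy that makes both branches equally long.\<close>

definition epilogue :: com where
  "epilogue = Cond 3 (Left 0 0) (SetAtom 4)"

definition mc_encoder :: com where
  "mc_encoder = prologue e_enc (Seq (Left 3 2) (Seq (Right 2 2) (Seq (SetAtom 0) (Seq choice_loop epilogue))))"

text \<open>Retains what decides both halting and output, so that a single equation between
  distributions settles the two.\<close>

definition final :: "config \<Rightarrow> com list \<times> cell" where
  "final = (\<lambda>(cs, \<sigma>). (cs, \<sigma> 0))"

lemma compile_run:
  assumes "\<sigma> 0 = k"
  shows "\<exists>S \<sigma>'. S \<le> cost e (clen k) \<and> steps S (compile e [1] 2 # cs, \<sigma>) (cs, \<sigma>') \<and>
    \<sigma>' 2 = ev k e [\<sigma> 1] \<and> (\<forall>j<2. \<sigma>' j = \<sigma> j)"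
  using computesD[where \<sigma> = \<sigma> and cs = cs, OF compile_correct(1)[of e "[1]" 2 k] _ assms] by simp

lemma prologue_steps:
  fixes inp :: cell
  defines "k \<equiv> ev (left (right inp)) e_clock [inp]"
  shows "\<exists>S \<sigma>'. S \<le> cost e_clock (clen (left (right inp))) + cost e (clen k) + 10 \<and>
    steps S ([prologue e c], (\<lambda>_. Atom)(0 := inp)) ([c], \<sigma>') \<and> \<sigma>' 2 = ev k e [inp]"
proof -
  let ?\<sigma>0 = "(\<lambda>_. Atom)(0 := inp) :: nat \<Rightarrow> cell"
  let ?\<sigma>1 = "?\<sigma>0(1 := inp, 0 := left (right inp))"
  let ?R2 = "Seq (compile e [1] 2) c" let ?R1 = "Seq (Move 0 2) ?R2"
  have s1: "steps (Suc (Suc (Suc (Suc (Suc (Suc (Suc 0))))))) ([prologue e c], ?\<sigma>0)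
      ([compile e_clock [1] 2, ?R1], ?\<sigma>1)"
    by (simp add: steps_def iterate_Suc prologue_def fun_upd_twist)
  have "?\<sigma>1 0 = left (right inp)" "?\<sigma>1 1 = inp" by simp_all
  with compile_run[of ?\<sigma>1 "left (right inp)" e_clock "[?R1]"]
  obtain S2 \<sigma>2 where 2: "S2 \<le> cost e_clock (clen (left (right inp)))"
    "steps S2 ([compile e_clock [1] 2, ?R1], ?\<sigma>1) ([?R1], \<sigma>2)" "\<sigma>2 2 = k" "\<sigma>2 1 = inp"
    unfolding k_def by (metis one_less_numeral_iff semiring_norm(76))
  let ?\<sigma>3 = "\<sigma>2(0 := k)"
  have s3: "steps (Suc (Suc (Suc 0))) ([?R1], \<sigma>2) ([compile e [1] 2, c], ?\<sigma>3)"
    by (simp add: steps_def iterate_Suc 2(3))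
  have q: "?\<sigma>3 0 = k" "?\<sigma>3 1 = inp" using 2(4) by simp_all
  obtain S4 \<sigma>4 where 4: "S4 \<le> cost e (clen k)" "steps S4 ([compile e [1] 2, c], ?\<sigma>3) ([c], \<sigma>4)"
    "\<sigma>4 2 = ev k e [inp]"
    using compile_run[of ?\<sigma>3 k e "[c]"] unfolding q by blast
  have "steps (Suc (Suc (Suc (Suc (Suc (Suc (Suc 0)))))) + S2 + Suc (Suc (Suc 0)) + S4)
      ([prologue e c], ?\<sigma>0) ([c], \<sigma>4)"
    by (rule steps_trans[OF steps_trans[OF steps_trans[OF s1 2(2)] s3] 4(2)])
  then show ?thesis
    using 2(1) 4(1,3)
    by (intro exI[of _ "Suc (Suc (Suc (Suc (Suc (Suc (Suc 0)))))) + S2 + Suc (Suc (Suc 0)) + S4"]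
        exI[of _ \<sigma>4] conjI) simp_all
qed

lemma outputs_in_timeI:
  assumes "map_pmf final (iterate T (return_pmf ([c], (\<lambda>_. Atom)(0 := inp)))) = map_pmf (\<lambda>a. ([], a)) D"
    "real T \<le> B"
  shows "outputs_in_time c inp D B"
  unfolding outputs_in_time_def
proof (intro exI conjI)
  let ?p = "iterate T (return_pmf ([c], (\<lambda>_. Atom)(0 := inp)))"
  have run: "run T c inp = ?p" by (simp add: run_def iterate_def)
  show "\<forall>(cs, \<sigma>)\<in>set_pmf (run T c inp). cs = []"
  proof (clarify)
    fix cs \<sigma> assume "(cs, \<sigma>) \<in> set_pmf (run T c inp)"
    then have "final (cs, \<sigma>) \<in> set_pmf (map_pmf final ?p)" unfolding run by simp
    then show "cs = []" unfolding assms(1) by (auto simp: final_def)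
  qed
  have "map_pmf (\<lambda>(cs, \<sigma>). \<sigma> 0) (run T c inp) = map_pmf snd (map_pmf final ?p)"
    unfolding run map_pmf_comp by (simp add: final_def case_prod_unfold)
  then show "map_pmf (\<lambda>(cs, \<sigma>). \<sigma> 0) (run T c inp) = D"
    unfolding assms(1) map_pmf_comp by simp
qed (rule assms(2))

lemma iterate_from: "steps S c d \<Longrightarrow> iterate (S + T) (return_pmf c) = iterate T (return_pmf d)"
  by (simp add: steps_def iterate_add)

lemma decoder_outputs:
  assumes "ev (ev (left (right inp)) e_clock [inp]) e_dec [inp] = y"
    "real (cost e_clock (clen (left (right inp))) + cost e_dec (8 * clen (left (right inp))) + 11) \<le> B"
  shows "outputs_in_time mc_decoder inp (return_pmf y) B"
proof -
  let ?k = "ev (left (right inp)) e_clock [inp]"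
  obtain S \<sigma>' where S: "S \<le> cost e_clock (clen (left (right inp))) + cost e_dec (clen ?k) + 10"
    "steps S ([mc_decoder], (\<lambda>_. Atom)(0 := inp)) ([Move 0 2], \<sigma>')" "\<sigma>' 2 = y"
    using prologue_steps[where inp = inp and e = e_dec and c = "Move 0 2"] unfolding mc_decoder_def assms(1) by blast
  show ?thesis
  proof (rule outputs_in_timeI)
    show "map_pmf final (iterate (S + Suc 0) (return_pmf ([mc_decoder], (\<lambda>_. Atom)(0 := inp)))) =
        map_pmf (\<lambda>a. ([], a)) (return_pmf y)"
      unfolding iterate_from[OF S(2)] by (simp add: iterate_Suc final_def S(3))
    show "real (S + Suc 0) \<le> B" using S(1) assms(2) by (simp add: clen_clock)
  qed
qed

fun acc_choices :: "cell \<Rightarrow> cell list \<Rightarrow> cell pmf" where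
  "acc_choices a [] = return_pmf a"
| "acc_choices a (l # ls) = bind_pmf (choose_entry l) (\<lambda>v. acc_choices (Cell v a) ls)"

text \<open>A round takes exactly eight steps; leaving the loop and the epilogue take three
  more.\<close>

lemma choice_loop_outputs:
  "\<sigma> 2 = cell_of_list ls \<Longrightarrow>
    map_pmf final (iterate (8 * length ls + 3) (return_pmf ([choice_loop, epilogue], \<sigma>))) =
    map_pmf (\<lambda>a. ([], if \<sigma> 3 = Atom then a else left a)) (acc_choices (\<sigma> 0) ls)"
proof (induction ls arbitrary: \<sigma>)
  case Nil
  have "iterate (Suc (Suc (Suc 0))) (return_pmf ([choice_loop, epilogue], \<sigma>)) =
      return_pmf ([], if \<sigma> 3 = Atom then \<sigma>(4 := Atom) else \<sigma>(0 := left (\<sigma> 0)))"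
    using Nil by (simp add: iterate_Suc choice_loop_def epilogue_def)
  then show ?case by (simp add: numeral_3_eq_3 final_def)
next
  case (Cons l ls)
  let ?\<sigma>' = "\<lambda>v. \<sigma>(4 := l, 4 := v, 0 := Cell v (\<sigma> 0), 2 := cell_of_list ls)"
  let ?N = "8 * length ls + 3"
  let ?body = "Seq (Choose 4 4) (Seq (Pair 0 4 0) (Right 2 2))"
  have s: "steps (Suc (Suc (Suc (Suc 0)))) ([choice_loop, epilogue], \<sigma>)
      ([Choose 4 4, Seq (Pair 0 4 0) (Right 2 2), choice_loop, epilogue], \<sigma>(4 := l))"
    using Cons.prems by (simp add: steps_def iterate_Suc choice_loop_def)
  have after: "iterate (Suc (Suc (Suc ?N))) (return_pmf ([Seq (Pair 0 4 0) (Right 2 2), choice_loop, epilogue], \<sigma>(4 := l, 4 := v))) =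
      iterate ?N (return_pmf ([choice_loop, epilogue], ?\<sigma>' v))" for v
    by (simp only: iterate_Suc step.simps) (simp add: Cons.prems)
  have e: "8 * length (l # ls) + 3 = Suc (Suc (Suc (Suc 0))) + Suc (Suc (Suc (Suc ?N)))" by simp
  have "iterate (8 * length (l # ls) + 3) (return_pmf ([choice_loop, epilogue], \<sigma>)) =
      iterate (Suc (Suc (Suc (Suc ?N))))
        (return_pmf ([Choose 4 4, Seq (Pair 0 4 0) (Right 2 2), choice_loop, epilogue], \<sigma>(4 := l)))"
    unfolding e by (rule iterate_from[OF s])
  also have "\<dots> = iterate (Suc (Suc (Suc ?N)))
      (map_pmf (\<lambda>v. ([Seq (Pair 0 4 0) (Right 2 2), choice_loop, epilogue], \<sigma>(4 := l, 4 := v))) (choose_entry l))"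
    by (subst iterate_Suc) simp
  also have "\<dots> = bind_pmf (choose_entry l) (\<lambda>v. iterate ?N (return_pmf ([choice_loop, epilogue], ?\<sigma>' v)))"
    by (subst iterate_bind) (simp only: bind_map_pmf after)
  finally have "map_pmf final (iterate (8 * length (l # ls) + 3) (return_pmf ([choice_loop, epilogue], \<sigma>))) =
      bind_pmf (choose_entry l) (\<lambda>v. map_pmf final (iterate ?N (return_pmf ([choice_loop, epilogue], ?\<sigma>' v))))"
    by (simp only: map_bind_pmf)
  also have "\<dots> = bind_pmf (choose_entry l)
      (\<lambda>v. map_pmf (\<lambda>a. ([], if \<sigma> 3 = Atom then a else left a)) (acc_choices (Cell v (\<sigma> 0)) ls))"
    by (rule bind_pmf_cong[OF refl], subst Cons.IH) simp_all
  finally show ?case by (simp add: map_bind_pmf)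
qed

lemma encoder_outputs:
  assumes ev: "ev (ev (left (right inp)) e_clock [inp]) e_enc [inp] = Cell b (cell_of_list ls)"
    and D: "map_pmf (\<lambda>a. if b = Atom then a else left a) (acc_choices Atom ls) = D"
    and B: "real (cost e_clock (clen (left (right inp))) + cost e_enc (8 * clen (left (right inp))) +
      8 * length ls + 20) \<le> B"
  shows "outputs_in_time mc_encoder inp D B"
proof -
  let ?k = "ev (left (right inp)) e_clock [inp]"
  let ?c = "Seq (Left 3 2) (Seq (Right 2 2) (Seq (SetAtom 0) (Seq choice_loop epilogue)))"
  obtain S \<sigma> where S: "S \<le> cost e_clock (clen (left (right inp))) + cost e_enc (clen ?k) + 10"
    "steps S ([mc_encoder], (\<lambda>_. Atom)(0 := inp)) ([?c], \<sigma>)" "\<sigma> 2 = Cell b (cell_of_list ls)"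
    using prologue_steps[where inp = inp and e = e_enc and c = ?c] unfolding mc_encoder_def ev by blast
  let ?\<sigma>' = "\<sigma>(3 := b, 2 := cell_of_list ls, 0 := Atom)"
  have s: "steps (Suc (Suc (Suc (Suc (Suc (Suc (Suc 0))))))) ([?c], \<sigma>) ([choice_loop, epilogue], ?\<sigma>')"
    using S(3) by (simp add: steps_def iterate_Suc)
  note st = steps_trans[OF S(2) s]
  show ?thesis
  proof (rule outputs_in_timeI)
    let ?T = "S + Suc (Suc (Suc (Suc (Suc (Suc (Suc 0)))))) + (8 * length ls + 3)"
    have "map_pmf final (iterate ?T (return_pmf ([mc_encoder], (\<lambda>_. Atom)(0 := inp)))) =
        map_pmf (\<lambda>a. ([], if b = Atom then a else left a)) (acc_choices Atom ls)"
      unfolding iterate_from[OF st] by (subst choice_loop_outputs) simp_all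
    then show "map_pmf final (iterate ?T (return_pmf ([mc_encoder], (\<lambda>_. Atom)(0 := inp)))) = map_pmf (\<lambda>a. ([], a)) D"
      unfolding D[symmetric] map_pmf_comp .
    show "real ?T \<le> B" using S(1) B by (simp add: clen_clock)
  qed
qed

text \<open>Positions and entries correspond one to one in a list without repetitions, so a uniform
  position yields a uniform entry.\<close>

lemma choose_entry_pmf_of_set:
  assumes "distinct xs" "xs \<noteq> []" "inj_on h (set xs)"
  shows "choose_entry (cell_of_list (map h xs)) = map_pmf h (pmf_of_set (set xs))"
proof -
  have "choose_entry (cell_of_list (map h xs)) =
      map_pmf (\<lambda>i. map h xs ! i) (pmf_of_set {..<length xs})"
    using assms(2) by (simp add: choose_entry_def)
  also have "\<dots> = map_pmf (\<lambda>i. h (xs ! i)) (pmf_of_set {..<length xs})"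
    by (rule map_pmf_cong[OF refl]) (use assms(2) in \<open>auto simp: lessThan_empty_iff\<close>)
  also have "\<dots> = map_pmf h (map_pmf (\<lambda>i. xs ! i) (pmf_of_set {..<length xs}))"
    by (simp add: map_pmf_comp)
  also have "map_pmf (\<lambda>i. xs ! i) (pmf_of_set {..<length xs}) = pmf_of_set (set xs)"
    using assms(1,2) bij_betw_nth[OF assms(1) refl refl]
    by (subst map_pmf_of_set_inj) (auto simp: bij_betw_def lessThan_empty_iff)
  finally show ?thesis .
qed

text \<open>Each choice is put in front of the earlier ones, so in the induction a new bit appears
  between v and w. A uniform bit and an independent uniform word form a uniform longer word.\<close>

lemma acc_choices_bits:
  "acc_choices (cell_of_vec w) (replicate m (cell_of_list [Atom, Cell Atom Atom])) =
    map_pmf (\<lambda>v. cell_of_vec (v @ w)) (pmf_of_set (bvecs m))"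
proof (induction m arbitrary: w)
  case 0
  have "bvecs 0 = {[]}" by (auto simp: bvecs_def)
  then show ?case by (simp add: pmf_of_set_singleton)
next
  case (Suc m)
  have ne: "bvecs m \<noteq> {}" "bvecs (Suc m) \<noteq> {}" using card_bvecs[of m] card_bvecs[of "Suc m"] by auto
  have ce: "choose_entry (cell_of_list [Atom, Cell Atom Atom]) = map_pmf cell_of_bit (pmf_of_set {0, 1})"
    using choose_entry_pmf_of_set[of "[0, 1 :: bit]" cell_of_bit] by (simp add: inj_on_def)
  have im: "(\<lambda>(b, v). v @ [b]) ` ({0, 1} \<times> bvecs m) = bvecs (Suc m)"
  proof (rule Set.set_eqI)
    fix u :: "bit list"
    show "u \<in> (\<lambda>(b, v). v @ [b]) ` ({0, 1} \<times> bvecs m) \<longleftrightarrow> u \<in> bvecs (Suc m)"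
      using bit_cases by (cases u rule: rev_cases) (auto simp: bvecs_def image_iff)
  qed
  have "acc_choices (cell_of_vec w) (replicate (Suc m) (cell_of_list [Atom, Cell Atom Atom])) =
      bind_pmf (pmf_of_set {0, 1}) (\<lambda>b. acc_choices (cell_of_vec (b # w)) (replicate m (cell_of_list [Atom, Cell Atom Atom])))"
    by (simp only: replicate_Suc acc_choices.simps ce bind_map_pmf cell_of_vec_Cons)
  also have "\<dots> = bind_pmf (pmf_of_set {0, 1}) (\<lambda>b. map_pmf (\<lambda>v. cell_of_vec (v @ b # w)) (pmf_of_set (bvecs m)))"
    by (simp only: Suc)
  also have "\<dots> = map_pmf (\<lambda>u. cell_of_vec (u @ w)) (map_pmf (\<lambda>(b, v). v @ [b]) (pair_pmf (pmf_of_set {0, 1}) (pmf_of_set (bvecs m))))"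
    by (simp add: pair_pmf_def map_bind_pmf map_pmf_def bind_assoc_pmf bind_return_pmf)
  also have "pair_pmf (pmf_of_set {0, 1 :: bit}) (pmf_of_set (bvecs m)) = pmf_of_set ({0, 1} \<times> bvecs m)"
  proof (rule pmf_eqI)
    fix z :: "bit \<times> bit list"
    obtain b v where z: "z = (b, v)" by force
    have "pmf (pmf_of_set (bvecs m)) v = indicator (bvecs m) v / 2 ^ m"
      by (subst pmf_of_set[OF ne(1) card_bvecs(2)]) (simp add: card_bvecs)
    moreover have "pmf (pmf_of_set {0, 1}) b = 1 / 2"
      by (subst pmf_of_set) (use bit_cases[of b] in auto)
    moreover have "pmf (pmf_of_set ({0, 1} \<times> bvecs m)) (b, v) = indicator (bvecs m) v / (2 * 2 ^ m)"
    proof (subst pmf_of_set)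
      show "{0, 1 :: bit} \<times> bvecs m \<noteq> {}" "finite ({0, 1 :: bit} \<times> bvecs m)"
        using ne(1) card_bvecs(2) by auto
      show "indicator ({0, 1} \<times> bvecs m) (b, v) / real (card ({0, 1 :: bit} \<times> bvecs m)) =
          indicator (bvecs m) v / (2 * 2 ^ m)"
        using bit_cases[of b] by (auto simp: card_cartesian_product card_bvecs indicator_def)
    qed
    ultimately show "pmf (pair_pmf (pmf_of_set {0, 1}) (pmf_of_set (bvecs m))) z =
        pmf (pmf_of_set ({0, 1} \<times> bvecs m)) z"
      by (simp add: z pmf_pair)
  qed
  also have "map_pmf (\<lambda>(b, v). v @ [b]) (pmf_of_set ({0, 1} \<times> bvecs m)) = pmf_of_set (bvecs (Suc m))"
    unfolding im[symmetric] using ne card_bvecs by (subst map_pmf_of_set_inj) (auto simp: inj_on_def)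
  finally show ?case .
qed

context gf
begin

lemma mc_input_clock: "left (right (mc_input n k t g P x)) =
    cell_of_list (map (\<lambda>i. cell_of_vec (vec_of n (coeff P i))) [0..<9 * t])"
  "clen (left (right (mc_input n k t g P x))) = 9 * t"
  unfolding mc_input_eq by (simp_all add: clen_def)

lemma decoder_correct:
  assumes "n \<le> 9 * t" "0 < t" "k + mc_m n k t \<le> n" "P \<in> mc_polys n t" "x \<in> bvecs n"
    "real (cost e_clock (9 * t) + cost e_dec (8 * (9 * t)) + 11) \<le> B"
  shows "outputs_in_time mc_decoder (mc_input n k t g P x)
    (return_pmf (cell_of_decoded (DecMC n k t g P x))) B"
proof (rule decoder_outputs)
  let ?inp = "mc_input n k t g P x"
  show "ev (ev (left (right ?inp)) e_clock [?inp]) e_dec [?inp] = cell_of_decoded (DecMC n k t g P x)"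
    by (rule ev_dec) (use assms in \<open>simp_all add: clen_clock mc_input_clock\<close>)
qed (use assms(6) in \<open>simp only: mc_input_clock(2)\<close>)

lemma encoder_correct:
  assumes "n \<le> 9 * t" "2 ^ mc_b t \<le> 9 * t" "0 < t" and k: "k + mc_m n k t + mc_b t = n"
    and P: "P \<in> mc_polys n t" and s: "s \<in> bvecs k"
    and B: "real (cost e_clock (9 * t) + cost e_enc (8 * (9 * t)) + 8 * (9 * t) + 20) \<le> B"
  shows "outputs_in_time mc_encoder (mc_input n k t g P s) (map_pmf cell_of_vec (EncMC n k t g P s)) B"
proof -
  let ?inp = "mc_input n k t g P s"
  let ?c = "ev (left (right ?inp)) e_clock [?inp]"
  have c: "clen ?c = 8 * (9 * t)" by (simp only: clen_clock mc_input_clock(2))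
  have inj: "inj_on cell_of_vec A" for A by (rule inj_onI) (rule cell_of_vec_inj)
  have n1: "1 \<le> 9 * t" using assms(3) by simp
  consider (full) "mc_E n k t g P s = bvecs n"
      "ev ?c e_enc [?inp] = Cell Atom (cell_of_list (replicate n (cell_of_list [Atom, Cell Atom Atom])))"
    | (list) vs where "vs \<noteq> []" "distinct vs"
      "set vs = (if mc_E n k t g P s = {} then {replicate n 0} else mc_E n k t g P s)"
      "ev ?c e_enc [?inp] = Cell (Cell Atom Atom) (cell_of_list [cell_of_list (map cell_of_vec vs)])"
    using ev_enc[of ?c t k P s] assms c by fastforce
  then show ?thesis
  proof cases
    case full
    show ?thesis
    proof (rule encoder_outputs[OF full(2)])
      have c0: "cell_of_vec [] = Atom" by (simp add: cell_of_vec_def)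
      have "bvecs n \<noteq> {}" using card_bvecs[of n] by auto
      then show "map_pmf (\<lambda>a. if Atom = Atom then a else left a)
          (acc_choices Atom (replicate n (cell_of_list [Atom, Cell Atom Atom]))) =
          map_pmf cell_of_vec (EncMC n k t g P s)"
        using acc_choices_bits[of "[]" n, unfolded c0 append_Nil2]
        by (simp add: EncMC_def full(1) map_pmf_ident del: cell_of_list.simps(2))
      show "real (cost e_clock (clen (left (right ?inp))) + cost e_enc (8 * clen (left (right ?inp))) +
          8 * length (replicate n (cell_of_list [Atom, Cell Atom Atom])) + 20) \<le> B"
        using B assms(1) unfolding mc_input_clock(2) by simp
    qed
  next
    case (list vs)
    show ?thesis
    proof (rule encoder_outputs[OF list(4)])
      have "EncMC n k t g P s = pmf_of_set (set vs)"
        unfolding list(3) by (simp add: EncMC_def pmf_of_set_singleton)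
      then show "map_pmf (\<lambda>a. if Cell Atom Atom = Atom then a else left a)
          (acc_choices Atom [cell_of_list (map cell_of_vec vs)]) = map_pmf cell_of_vec (EncMC n k t g P s)"
        using choose_entry_pmf_of_set[OF list(2,1) inj]
        by (simp add: map_bind_pmf bind_return_pmf' map_pmf_comp flip: map_pmf_def)
      show "real (cost e_clock (clen (left (right ?inp))) + cost e_enc (8 * clen (left (right ?inp))) +
          8 * length [cell_of_list (map cell_of_vec vs)] + 20) \<le> B"
        using B n1 unfolding mc_input_clock(2) by simp
    qed
  qed
qed

end

lemma deterministic_mc_decoder: "deterministic mc_decoder"
  by (simp add: mc_decoder_def prologue_def deterministic_compile)

section \<open>The code under suitable parameters: correctness, non-malleability and the union
  bound\<close>

definition block :: "nat \<Rightarrow> nat \<Rightarrow> bit list \<Rightarrow> bit list set" where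
  "block m b s = (\<lambda>z. s @ replicate m 0 @ z) ` bvecs b"

lemma card_block: "card (block m b s) = 2 ^ b"
  unfolding block_def by (subst card_image) (auto simp: inj_on_def card_bvecs)

lemma block_subset: "length s + m + b = n \<Longrightarrow> block m b s \<subseteq> bvecs n"
  by (auto simp: block_def bvecs_def)

definition decodable :: "nat \<Rightarrow> nat \<Rightarrow> nat \<Rightarrow> bit list set" where
  "decodable n k m = {y \<in> bvecs n. take m (drop k y) = replicate m 0}"

lemma card_decodable:
  assumes "k + m + b = n"
  shows "card (decodable n k m) = 2 ^ (k + b)"
proof -
  have "decodable n k m = (\<lambda>(u, z). u @ replicate m 0 @ z) ` (bvecs k \<times> bvecs b)"
  proof (rule Set.set_eqI)
    fix y
    show "y \<in> decodable n k m \<longleftrightarrow> y \<in> (\<lambda>(u, z). u @ replicate m 0 @ z) ` (bvecs k \<times> bvecs b)"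
    proof
      assume y: "y \<in> decodable n k m"
      have "y = take k y @ take m (drop k y) @ drop m (drop k y)"
        by (simp only: append_take_drop_id)
      then have "y = take k y @ replicate m 0 @ drop m (drop k y)"
        using y by (simp only: decodable_def mem_Collect_eq)
      moreover have "take k y \<in> bvecs k" "drop m (drop k y) \<in> bvecs b"
        using y assms by (auto simp: decodable_def bvecs_def)
      ultimately show "y \<in> (\<lambda>(u, z). u @ replicate m 0 @ z) ` (bvecs k \<times> bvecs b)"
        by (intro image_eqI[of _ _ "(take k y, drop m (drop k y))"]) auto
    qed (use assms in \<open>auto simp: decodable_def bvecs_def\<close>)
  qed
  moreover have "inj_on (\<lambda>(u, z). u @ replicate m 0 @ z) (bvecs k \<times> bvecs b)"
    by (auto simp: inj_on_def bvecs_def)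
  ultimately show ?thesis by (simp add: card_image card_cartesian_product card_bvecs power_add)
qed

text \<open>The number of check bits is fixed by 2^m = 8s: it makes the density of decodable vectors
  1/(8s), the density allowed for Z in \<open>prob_not_good\<close>.\<close>

locale mc_setup = gf +
  fixes k t s \<tau> :: nat
  assumes t: "t = 2 ^ 13 * s ^ 3 * \<tau>" and s: "2 \<le> s" and \<tau>: "0 < \<tau>"
    and b: "2 ^ mc_b t = 2 * t" and m: "2 ^ mc_m n k t = 8 * s" and kmb: "k + mc_m n k t + mc_b t = n"
    and big: "9 * t \<le> 2 ^ n"
begin

lemma t_pos: "0 < t"
  using t s \<tau> by simp

sublocale kwise "pmf_of_set (mc_polys n t)" "mc_eval n g" "bvecs n" "bvecs n" "9 * t"
  by (rule kwise_mc_polys[OF t_pos big])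

abbreviation "blk \<equiv> block (mc_m n k t) (mc_b t)"
abbreviation "Z \<equiv> decodable n k (mc_m n k t)"

lemma blk: "u \<in> bvecs k \<Longrightarrow> blk u \<subseteq> bvecs n" "card (blk u) = 2 * t"
proof -
  show "u \<in> bvecs k \<Longrightarrow> blk u \<subseteq> bvecs n"
    by (rule block_subset) (use kmb in \<open>simp add: bvecs_def\<close>)
  show "card (blk u) = 2 * t" unfolding card_block b ..
qed

lemma mass: "real (card (bvecs n)) * (real (card (blk u)) / real (card (bvecs n))) = 2 * real t"
  unfolding blk(2) by (simp add: card_bvecs)

lemma prob_not_good_code:
  assumes f: "f \<in> bvecs n \<rightarrow>\<^sub>E bvecs n" and u: "u \<in> bvecs k"
  shows "measure_pmf.prob (pmf_of_set (mc_polys n t)) {P. \<not> good s t f (blk u) Z P} \<le> 4 * (1 / 2) ^ \<tau>"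
proof (rule prob_not_good[OF _ \<tau> t blk(1)[OF u] mass])
  show "0 < s" using s by simp
  show "f ` bvecs n \<subseteq> bvecs n" using f by auto
  show "Z \<subseteq> bvecs n" by (auto simp: decodable_def)
  have "2 ^ n = 8 * s * card Z"
    unfolding card_decodable[OF kmb] m[symmetric] power_add[symmetric] using kmb by (simp add: ac_simps)
  then have "real (card (bvecs n)) = 8 * real s * real (card Z)"
    unfolding card_bvecs by (metis of_nat_mult of_nat_numeral)
  then show "real (card Z) / real (card (bvecs n)) \<le> 1 / (8 * real s)"
    using s by (simp add: divide_le_eq)
qed simp

text \<open>A block enters the labels only through its size, which is 2t for every message. This is
  what makes the simulated distribution independent of the message.\<close>

lemma label_blk: "label \<kappa> f (blk u) = label \<kappa> f (blk u')"
  by (rule ext) (simp add: label_def cell_mass_def blk(2))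

lemma mc_E_eq: "mc_E n k t g P u = {x\<in>bvecs n. mc_eval n g P x \<in> blk u}"
  by (auto simp: mc_E_def block_def)

lemma DecMC_eq: "DecMC n k t g P x = (if mc_eval n g P x \<in> Z then Some (take k (mc_eval n g P x)) else None)"
  using mc_eval_in[of P x] by (simp add: DecMC_def decodable_def Let_def)

text \<open>The lower bound for the class of all labels says that there are at least (1 - 1/s) 2t
  encodings, a positive number as s \<ge> 2.\<close>

lemma good_nonempty:
  assumes "good s t f (blk u) Z P"
  shows "mc_E n k t g P u \<noteq> {}"
proof -
  let ?lab = "label (16 * (real s)\<^sup>2) f (blk u)"
  have "real (card (blk u)) / real (card (bvecs n)) * real (card {x\<in>bvecs n. ?lab x \<in> ?lab ` bvecs n}) -
      1 / real s * (2 * real t) \<le>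
      real (card {x\<in>bvecs n. mc_eval n g P x \<in> blk u \<and> ?lab x \<in> ?lab ` bvecs n})"
    using assms unfolding good_def by blast
  moreover have "{x\<in>bvecs n. ?lab x \<in> ?lab ` bvecs n} = bvecs n"
    "{x\<in>bvecs n. mc_eval n g P x \<in> blk u \<and> ?lab x \<in> ?lab ` bvecs n} = mc_E n k t g P u"
    by (auto simp: mc_E_eq)
  ultimately have "2 * real t - 1 / real s * (2 * real t) \<le> real (card (mc_E n k t g P u))"
    using mass[of u] by (simp add: mult.commute)
  moreover have "1 / real s * (2 * real t) \<le> 1 / 2 * (2 * real t)"
    using s by (intro mult_right_mono) (auto simp: field_simps)
  ultimately have "0 < real (card (mc_E n k t g P u))" using t_pos by simp
  then show ?thesis by auto
qed

lemma good_coding_scheme: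
  assumes "\<And>u. u \<in> bvecs k \<Longrightarrow> mc_E n k t g P u \<noteq> {}"
  shows "coding_scheme n k (EncMC n k t g P) (DecMC n k t g P)"
  unfolding coding_scheme_def
proof (intro conjI ballI)
  show "k \<le> n" using kmb by simp
  fix u assume u: "u \<in> bvecs k"
  let ?E = "mc_E n k t g P u"
  have E: "?E \<noteq> {}" "finite ?E" using assms[OF u] finite_Pts by (auto simp: mc_E_def)
  then show "set_pmf (EncMC n k t g P u) \<subseteq> bvecs n" by (auto simp: EncMC_def mc_E_def)
  have "DecMC n k t g P x = Some u" if x: "x \<in> ?E" for x
  proof -
    obtain z where "mc_eval n g P x = u @ replicate (mc_m n k t) 0 @ z" using x by (auto simp: mc_E_def)
    then show ?thesis using u by (simp add: DecMC_def bvecs_def)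
  qed
  then have "?E \<inter> {x. DecMC n k t g P x = Some u} = ?E" by auto
  then show "measure_pmf.prob (EncMC n k t g P u) {x. DecMC n k t g P x = Some u} = 1"
    using E by (simp add: EncMC_def measure_pmf_of_set)
next
  fix x assume "x \<in> bvecs n"
  show "DecMC n k t g P x \<in> insert None (Some ` bvecs k)"
    using mc_eval_in[of P x] kmb by (auto simp: DecMC_eq bvecs_def)
qed

text \<open>Applies \<open>stat_dist_sample_le\<close> with e = 1/s to the actual outcome and the
  one predicted by the label; this is the origin of the error 4/s.\<close>

lemma good_non_malleable:
  assumes Fm: "\<F> \<subseteq> bvecs n \<rightarrow>\<^sub>E bvecs n"
    and good: "\<And>f u. f \<in> \<F> \<Longrightarrow> u \<in> bvecs k \<Longrightarrow> good s t f (blk u) Z P"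
    and \<epsilon>: "4 / real s \<le> \<epsilon>"
  shows "non_malleable k \<F> \<epsilon> (EncMC n k t g P) (DecMC n k t g P)"
  unfolding non_malleable_def
proof
  fix f assume f: "f \<in> \<F>"
  let ?Dec = "DecMC n k t g P" and ?X = "bvecs n"
  \<comment> \<open>The zero message stands for all messages, by \<open>label_blk\<close>.\<close>
  define lab where "lab = label (16 * (real s)\<^sup>2) f (blk (replicate k 0))"
  define out where "out = (\<lambda>l :: bit list option outcome. case l of Same \<Rightarrow> Same | Val None \<Rightarrow> Val None | Val (Some y) \<Rightarrow> Val (?Dec y))"
  define D where "D = map_pmf (\<lambda>x. out (lab x)) (pmf_of_set ?X)"
  have X: "finite ?X" "?X \<noteq> {}" using finite_Pts Y_ne by auto
  have lab_cases: "lab x = Same \<and> f x = x \<or> lab x = Val None \<or> lab x = Val (Some (f x))" for x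
    by (auto simp: lab_def label_def)
  have Dec_in: "?Dec x \<in> insert None (Some ` bvecs k)" for x
    using mc_eval_in[of P x] kmb by (auto simp: DecMC_eq bvecs_def)
  have "set_pmf D \<subseteq> insert Same (Val ` insert None (Some ` bvecs k))"
  proof
    fix o' assume "o' \<in> set_pmf D"
    then obtain x where "o' = out (lab x)" using X by (auto simp: D_def)
    then show "o' \<in> insert Same (Val ` insert None (Some ` bvecs k))"
      using lab_cases[of x] Dec_in[of "f x"] by (auto simp: out_def)
  qed
  moreover have "stat_dist (map_pmf (\<lambda>x. ?Dec (f x)) (EncMC n k t g P u)) (map_pmf (\<lambda>s'. copy s' u) D) \<le> \<epsilon>"
    if u: "u \<in> bvecs k" for u
  proof -
    let ?E = "mc_E n k t g P u"
    let ?h' = "\<lambda>x. copy (out (lab x)) u"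
    let ?e = "1 / real s"
    have g: "good s t f (blk u) Z P" by (rule good[OF f u])
    have labu: "label (16 * (real s)\<^sup>2) f (blk u) = lab" unfolding lab_def by (rule label_blk)
    note gd = g[unfolded good_def labu]
    have E: "?E \<noteq> {}" "?E \<subseteq> ?X" using good_nonempty[OF g] by (auto simp: mc_E_def)
    have "stat_dist (map_pmf (\<lambda>x. ?Dec (f x)) (pmf_of_set ?E)) (map_pmf ?h' (pmf_of_set ?X)) \<le> 4 * ?e"
    proof (rule stat_dist_sample_le[OF X E(2,1)])
      show "0 < ?e" "?e \<le> 1 / 2" using s by (auto simp: field_simps)
      show "0 < 2 * real t" using t_pos by simp
      show "real (card (blk u)) / real (card ?X) * real (card ?X) = 2 * real t"
        using mass[of u] by (simp add: mult.commute)
      show "real (card ?E) \<le> (1 + ?e) * (2 * real t)" using gd unfolding mc_E_eq by blast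
      show "real (card (blk u)) / real (card ?X) * real (card {x\<in>?X. ?h' x \<in> T}) - ?e * (2 * real t) \<le>
          real (card {x\<in>?E. ?h' x \<in> T})" for T
      proof -
        \<comment> \<open>An event on the predicted outcome is a union of label classes. Since
          \<open>good\<close> covers every set of labels, it covers this one.\<close>
        let ?L = "{l \<in> lab ` ?X. copy (out l) u \<in> T}"
        have "{x\<in>?X. ?h' x \<in> T} = {x\<in>?X. lab x \<in> ?L}"
          "{x\<in>?E. ?h' x \<in> T} = {x\<in>?X. mc_eval n g P x \<in> blk u \<and> lab x \<in> ?L}"
          by (auto simp: mc_E_eq)
        moreover have "?L \<subseteq> lab ` ?X" by blast
        ultimately show ?thesis using gd by (simp only:)
      qed
      \<comment> \<open>Predictions are exact at fixed points, where x decodes to u, and at heavy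
        values. They can fail only at points labelled \<open>Val None\<close> whose image
        decodes.\<close>
      show "real (card {x\<in>?E. ?Dec (f x) \<noteq> ?h' x}) \<le> ?e * (2 * real t)"
      proof -
        have dec: "?Dec x = Some u" if "x \<in> ?E" for x
          using that u by (auto simp: mc_E_def DecMC_def bvecs_def)
        have "{x\<in>?E. ?Dec (f x) \<noteq> ?h' x} \<subseteq>
            {x\<in>?X. mc_eval n g P x \<in> blk u \<and> lab x = Val None \<and> mc_eval n g P (f x) \<in> Z}"
        proof (intro subsetI)
          fix x assume "x \<in> {x\<in>?E. ?Dec (f x) \<noteq> ?h' x}"
          then have x: "x \<in> ?E" "?Dec (f x) \<noteq> ?h' x" by auto
          have "lab x = Val None"
            using lab_cases[of x] x dec[OF x(1)] by (auto simp: out_def)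
          moreover from this have "mc_eval n g P (f x) \<in> Z"
            using x(2) by (auto simp: out_def DecMC_eq split: if_splits)
          ultimately show "x \<in> {x\<in>?X. mc_eval n g P x \<in> blk u \<and> lab x = Val None \<and> mc_eval n g P (f x) \<in> Z}"
            using x(1) by (simp add: mc_E_eq)
        qed
        then have "card {x\<in>?E. ?Dec (f x) \<noteq> ?h' x} \<le>
            card {x\<in>?X. mc_eval n g P x \<in> blk u \<and> lab x = Val None \<and> mc_eval n g P (f x) \<in> Z}"
          using X(1) by (intro card_mono) auto
        then show ?thesis using gd by linarith
      qed
    qed
    also have "4 * ?e \<le> \<epsilon>" using \<epsilon> by simp
    finally show ?thesis
      using E(1) by (simp add: EncMC_def D_def map_pmf_comp)
  qed
  ultimately show "\<exists>D. set_pmf D \<subseteq> insert Same (Val ` insert None (Some ` bvecs k)) \<and>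
      (\<forall>u\<in>bvecs k. stat_dist (map_pmf (\<lambda>x. ?Dec (f x)) (EncMC n k t g P u)) (map_pmf (\<lambda>s'. copy s' u) D) \<le> \<epsilon>)"
    by blast
qed

theorem prob_good_code:
  assumes Fm: "\<F> \<subseteq> bvecs n \<rightarrow>\<^sub>E bvecs n" "\<F> \<noteq> {}" and \<epsilon>: "4 / real s \<le> \<epsilon>"
    and \<eta>: "real (card \<F>) * 2 ^ k * (4 * (1 / 2) ^ \<tau>) \<le> \<eta>"
  shows "measure_pmf.prob (pmf_of_set (mc_polys n t))
    {P. coding_scheme n k (EncMC n k t g P) (DecMC n k t g P) \<and>
        non_malleable k \<F> \<epsilon> (EncMC n k t g P) (DecMC n k t g P)} \<ge> 1 - \<eta>"
proof -
  let ?p = "pmf_of_set (mc_polys n t)"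
  let ?A = "{P. coding_scheme n k (EncMC n k t g P) (DecMC n k t g P) \<and>
        non_malleable k \<F> \<epsilon> (EncMC n k t g P) (DecMC n k t g P)}"
  have "finite (bvecs n \<rightarrow>\<^sub>E bvecs n)" using finite_Pts by (intro finite_PiE) auto
  then have fin: "finite (\<F> \<times> bvecs k)" using Fm(1) card_bvecs finite_subset by blast
  have "- ?A \<subseteq> (\<Union>(f, u)\<in>\<F> \<times> bvecs k. {P. \<not> good s t f (blk u) Z P})"
  proof
    fix P assume P: "P \<in> - ?A"
    show "P \<in> (\<Union>(f, u)\<in>\<F> \<times> bvecs k. {P. \<not> good s t f (blk u) Z P})"
    proof (rule ccontr)
      assume "\<not> ?thesis"
      then have g: "\<And>f u. f \<in> \<F> \<Longrightarrow> u \<in> bvecs k \<Longrightarrow> good s t f (blk u) Z P" by blast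
      have "mc_E n k t g P u \<noteq> {}" if "u \<in> bvecs k" for u
        using Fm(2) g[OF _ that] good_nonempty by blast
      then have "P \<in> ?A" using good_coding_scheme good_non_malleable[OF Fm(1) g \<epsilon>] by simp
      then show False using P by simp
    qed
  qed
  then have "measure_pmf.prob ?p (- ?A) \<le>
      measure_pmf.prob ?p (\<Union>(f, u)\<in>\<F> \<times> bvecs k. {P. \<not> good s t f (blk u) Z P})"
    by (intro measure_pmf.finite_measure_mono) auto
  also have "\<dots> \<le> (\<Sum>(f, u)\<in>\<F> \<times> bvecs k. measure_pmf.prob ?p {P. \<not> good s t f (blk u) Z P})"
    unfolding case_prod_unfold by (rule measure_pmf.finite_measure_subadditive_finite[OF fin]) auto
  also have "\<dots> \<le> (\<Sum>(f, u)\<in>\<F> \<times> bvecs k. 4 * (1 / 2) ^ \<tau>)"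
    using prob_not_good_code Fm(1) by (intro sum_mono) auto
  also have "\<dots> = real (card \<F>) * 2 ^ k * (4 * (1 / 2) ^ \<tau>)"
    by (simp add: case_prod_unfold card_cartesian_product card_bvecs)
  also have "\<dots> \<le> \<eta>" by (rule \<eta>)
  finally have "measure_pmf.prob ?p (- ?A) \<le> \<eta>" .
  moreover have "measure_pmf.prob ?p (- ?A) = 1 - measure_pmf.prob ?p ?A"
    using measure_pmf.prob_compl[of ?A ?p] by (simp add: Compl_eq_Diff_UNIV)
  ultimately show ?thesis by linarith
qed

end


section \<open>Choice of the parameters and the bounds on rate, randomness and time\<close>

lemma pow2_ceiling:
  fixes x :: real
  assumes "1 \<le> x"
  defines "i \<equiv> nat \<lceil>log 2 x\<rceil>"
  shows "x \<le> 2 ^ i" "2 ^ i \<le> 2 * x" "real i \<le> log 2 x + 1"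
proof -
  have "0 \<le> log 2 x" using assms(1) by simp
  then have i: "log 2 x \<le> real i" "real i \<le> log 2 x + 1" unfolding i_def by linarith+
  then show "real i \<le> log 2 x + 1" by simp
  have p: "2 ^ i = (2::real) powr real i" by (simp add: powr_realpow)
  have x: "x = 2 powr log 2 x" using assms(1) by simp
  have "2 powr log 2 x \<le> 2 powr real i" using i(1) by (intro powr_mono) auto
  then show "x \<le> 2 ^ i" using p x by simp
  have "2 powr real i \<le> 2 powr (log 2 x + 1)" using i(2) by (intro powr_mono) auto
  also have "\<dots> = 2 * x" using x by (simp add: powr_add)
  finally show "2 ^ i \<le> 2 * x" using p by simp
qed

lemma mc_b_power: "t = 2 ^ a \<Longrightarrow> mc_b t = Suc a"
proof -
  assume "t = 2 ^ a"
  then have "2 * real t = 2 ^ Suc a" by simp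
  then have "log 2 (2 * real t) = real (Suc a)" using log_nat_power[of 2 2 "Suc a"] by (simp del: power_Suc)
  then show ?thesis unfolding mc_b_def by (simp only: floor_of_nat nat_int)
qed

lemma poly_bounded_time:
  assumes "poly_bounded h"
  obtains c where "\<And>t y. 1 \<le> t \<Longrightarrow> real t \<le> 2 ^ 25 * y ^ 3 \<Longrightarrow> real (h t) \<le> real c * 2 ^ (25 * c) * y ^ (3 * c)"
proof -
  obtain c where c: "\<And>Z. Z \<ge> 1 \<Longrightarrow> h Z \<le> c * Z ^ c" using assms unfolding poly_bounded_def by blast
  have "real (h t) \<le> real c * 2 ^ (25 * c) * y ^ (3 * c)" if t: "1 \<le> t" "real t \<le> 2 ^ 25 * y ^ 3" for t y
  proof -
    have "real (h t) \<le> real (c * t ^ c)" using c[OF t(1)] by (rule of_nat_mono)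
    also have "\<dots> = real c * real t ^ c" by simp
    also have "\<dots> \<le> real c * (2 ^ 25 * y ^ 3) ^ c" using t by (intro mult_left_mono power_mono) auto
    also have "\<dots> = real c * 2 ^ (25 * c) * y ^ (3 * c)" by (simp only: power_mult_distrib power_mult mult.assoc)
    finally show ?thesis .
  qed
  then show thesis using that by blast
qed

theorem theorem4p4:
  "\<exists>(C1::real) (C2::real) (C3::real) (c::nat) (encoder::com) (decoder::com).
     deterministic decoder \<and>
     (\<forall>(n::nat) (N::nat) (\<epsilon>::real) (\<eta>::real).
        0 < n \<and> 0 < \<epsilon> \<and> \<epsilon> \<le> 1 \<and> 0 < \<eta> \<and> 2 \<le> real N / \<eta> \<and>
        real n - log 2 (log 2 (real N / \<eta>)) - log 2 (real n) - 9 * log 2 (1 / \<epsilon>) - C1 > 0 \<longrightarrow>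
        (\<exists>k t. mc_params n k t \<and>
           (\<forall>g F. irreducible g \<and> degree g = n \<and>
                  F \<subseteq> (bvecs n \<rightarrow>\<^sub>E bvecs n) \<and> card F = N \<longrightarrow>
              measure_pmf.prob (pmf_of_set (mc_polys n t))
                {P. coding_scheme n k (EncMC n k t g P) (DecMC n k t g P) \<and>
                    non_malleable k F \<epsilon> (EncMC n k t g P) (DecMC n k t g P)} \<ge> 1 - \<eta>) \<and>
           real k \<ge> real n - log 2 (log 2 (real N / \<eta>)) - log 2 (real n) - 9 * log 2 (1 / \<epsilon>) - C1 \<and>
           mc_random_bits n t \<le> C2 * ((real n + log 2 (real N / \<eta>)) * real n / \<epsilon> ^ 6) \<and>
           (\<forall>g P. irreducible g \<and> degree g = n \<and> P \<in> mc_polys n t \<longrightarrow>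
              (\<forall>s\<in>bvecs k.
                 outputs_in_time encoder (mc_input n k t g P s)
                   (map_pmf cell_of_vec (EncMC n k t g P s))
                   (C3 * (log 2 (real N / \<eta>) * real n / \<epsilon>) ^ c)) \<and>
              (\<forall>x\<in>bvecs n.
                 outputs_in_time decoder (mc_input n k t g P x)
                   (return_pmf (cell_of_decoded (DecMC n k t g P x)))
                   (C3 * (log 2 (real N / \<eta>) * real n / \<epsilon>) ^ c)))))"
proof -
  define h1 where "h1 = (\<lambda>t. cost e_clock (9 * t) + cost e_enc (8 * (9 * t)) + 8 * (9 * t) + 20)"
  define h2 where "h2 = (\<lambda>t. cost e_clock (9 * t) + cost e_dec (8 * (9 * t)) + 11)"
  have clock: "poly_bounded (\<lambda>t. cost e_clock (9 * t))"
    by (rule poly_bounded_scale[OF poly_bounded_cost]) simp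
  have scaled: "poly_bounded (\<lambda>t. cost e (8 * (9 * t)))" for e
    by (rule poly_bounded_scale[where a = 9, OF poly_bounded_scale[where a = 8, OF poly_bounded_cost]]) simp_all
  have "poly_bounded h1" unfolding h1_def
    by (intro poly_bounded_add clock scaled poly_bounded_mult poly_bounded_const poly_bounded_id)
  then obtain c1 where c1: "\<And>t y. 1 \<le> t \<Longrightarrow> real t \<le> 2 ^ 25 * y ^ 3 \<Longrightarrow>
      real (h1 t) \<le> real c1 * 2 ^ (25 * c1) * y ^ (3 * c1)"
    by (rule poly_bounded_time) blast
  have "poly_bounded h2" unfolding h2_def
    by (intro poly_bounded_add clock scaled poly_bounded_const)
  then obtain c2 where c2: "\<And>t y. 1 \<le> t \<Longrightarrow> real t \<le> 2 ^ 25 * y ^ 3 \<Longrightarrow>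
      real (h2 t) \<le> real c2 * 2 ^ (25 * c2) * y ^ (3 * c2)"
    by (rule poly_bounded_time) blast
  define C3 where "C3 = real c1 * 2 ^ (25 * c1) + real c2 * 2 ^ (25 * c2)"
  define c where "c = 3 * c1 + 3 * c2"
  show ?thesis
  \<comment> \<open>With q \<le> 3 + log(1/\<epsilon>) and r \<le> 3 + log n + log L, the loss m + b
    = 17 + 4q + r is at most 4 log(1/\<epsilon>) + log n + log L plus 17 + 12 + 3 = 32. The
    polynomial takes 9 t n bits, where t \<le> 2^22 \<tau> / \<epsilon>^3 and \<tau> \<le> 4 (n +
    L); this gives 9 * 2^24.\<close>
  proof (rule exI[of _ 32], rule exI[of _ "9 * 2 ^ 24"], rule exI[of _ C3], rule exI[of _ c],
      rule exI[of _ mc_encoder], rule exI[of _ mc_decoder], intro conjI deterministic_mc_decoder allI impI,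
      elim conjE)
    fix n N :: nat and \<epsilon> \<eta> :: real
    assume n: "0 < n" and \<epsilon>: "0 < \<epsilon>" "\<epsilon> \<le> 1" and \<eta>: "0 < \<eta>" "2 \<le> real N / \<eta>"
      and room: "real n - log 2 (log 2 (real N / \<eta>)) - log 2 (real n) - 9 * log 2 (1 / \<epsilon>) - 32 > 0"
    define L where "L = log 2 (real N / \<eta>)"
    define l where "l = log 2 (1 / \<epsilon>)"
    \<comment> \<open>s = 2^q is at least 4/\<epsilon> to bring the error 4/s down to \<epsilon>.
      \<tau> = 2^r is at least n + L + 2 so that the union bound over N functions and at most 2^n
      messages, each failing with probability at most 4 * 2^-\<tau>, stays below \<eta>. Both are
      powers of two because t and 2^m have to be.\<close>
    define q where "q = nat \<lceil>log 2 (4 / \<epsilon>)\<rceil>"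
    define r where "r = nat \<lceil>log 2 (real n + L + 2)\<rceil>"
    define s \<tau> t :: nat where "s = 2 ^ q" and "\<tau> = 2 ^ r" and "t = 2 ^ (13 + 3 * q + r)"
    define k where "k = n - (q + 3) - (14 + 3 * q + r)"
    have L: "1 \<le> L"
      using log_le_cancel_iff[of 2 2 "real N / \<eta>"] \<eta> by (simp add: L_def)
    have l: "0 \<le> l" using \<epsilon> by (simp add: l_def)
    have n1: "1 \<le> real n" using n by simp
    have nL: "real n + L + 2 \<le> 4 * (real n * L)" "1 \<le> real n * L"
    proof -
      show nL1: "1 \<le> real n * L" using mult_mono[OF n1 L] by simp
      have "0 \<le> (real n - 1) * (L - 1)" using n1 L by simp
      then show "real n + L + 2 \<le> 4 * (real n * L)" using nL1 by (simp add: algebra_simps)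
    qed
    have "1 \<le> 4 / \<epsilon>" using \<epsilon> by simp
    note q = pow2_ceiling[OF this, folded q_def]
    have "1 \<le> real n + L + 2" using L by simp
    note r = pow2_ceiling[OF this, folded r_def]
    have ql: "real q \<le> 3 + l"
    proof -
      have "log 2 (4 * (1 / \<epsilon>)) = log 2 4 + log 2 (1 / \<epsilon>)" using \<epsilon> by (intro log_mult_pos) auto
      moreover have "log 2 4 = (2::real)" using log_nat_power[of 2 2 2] by simp
      ultimately show ?thesis using q(3) by (simp add: l_def)
    qed
    have rl: "real r \<le> 3 + log 2 (real n) + log 2 L"
    proof -
      have "log 2 (real n + L + 2) \<le> log 2 (4 * (real n * L))"
        using nL L by (subst log_le_cancel_iff) auto
      also have "\<dots> = log 2 4 + log 2 (real n * L)" using nL by (intro log_mult_pos) auto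
      also have "log 2 (real n * L) = log 2 (real n) + log 2 L" using n1 L by (intro log_mult_pos) auto
      also have "log 2 4 = (2::real)" using log_nat_power[of 2 2 2] by simp
      finally show ?thesis using r(3) by simp
    qed
    have "real (17 + 4 * q + r) \<le> 32 + 4 * l + log 2 (real n) + log 2 L" using ql rl by simp
    moreover have room': "0 < real n - log 2 L - log 2 (real n) - 9 * l - 32"
      using room by (simp add: L_def l_def)
    ultimately have "real (17 + 4 * q + r) < real n" using l by linarith
    then have lt: "17 + 4 * q + r < n" by (simp only: of_nat_less_iff)
    have b: "mc_b t = 14 + 3 * q + r" using mc_b_power[OF t_def] by simp
    have kn: "k + (q + 3) + (14 + 3 * q + r) = n" "0 < k" using lt unfolding k_def by linarith+
    have m: "mc_m n k t = q + 3" using kn by (simp add: mc_m_def b)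
    have st: "t = 2 ^ 13 * s ^ 3 * \<tau>" "2 \<le> s" "0 < \<tau>"
    proof -
      show "t = 2 ^ 13 * s ^ 3 * \<tau>"
        unfolding t_def s_def \<tau>_def by (simp only: power_add power_mult mult.commute[of 3 q])
      have "4 \<le> 4 / \<epsilon>" using \<epsilon> by (simp add: le_divide_eq)
      then have "2 \<le> (2::real) ^ q" using q(1) by linarith
      then show "2 \<le> s" unfolding s_def by (metis of_nat_le_iff of_nat_numeral of_nat_power)
      show "0 < \<tau>" by (simp add: \<tau>_def)
    qed
    have big: "9 * t \<le> 2 ^ n"
    proof -
      have "9 * t \<le> 2 ^ 4 * 2 ^ (13 + 3 * q + r)" unfolding t_def by (rule mult_le_mono1) simp
      also have "\<dots> = 2 ^ (17 + 3 * q + r)" by (simp only: power_add[symmetric]) simp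
      also have "\<dots> \<le> (2::nat) ^ n" using lt by (intro power_increasing) auto
      finally show ?thesis .
    qed
    have pw: "2 ^ mc_b t = 2 * t" "2 ^ mc_m n k t = 8 * s"
      unfolding b m unfolding t_def s_def by (simp_all add: power_add)
    have \<tau>_ge: "real n + L + 2 \<le> real \<tau>" and \<tau>_le: "real \<tau> \<le> 2 * (real n + L + 2)"
      using r(1,2) by (simp_all add: \<tau>_def)
    have \<tau>t: "\<tau> \<le> t" unfolding \<tau>_def t_def by (rule power_increasing) simp_all
    have nt: "n \<le> 9 * t"
    proof -
      have "real n \<le> real \<tau>" using \<tau>_ge L by linarith
      then show ?thesis using \<tau>t by simp
    qed
    have s3: "real s ^ 3 \<le> 2 ^ 9 / \<epsilon> ^ 3"
    proof -
      have "real s \<le> 8 / \<epsilon>" using q(2) by (simp add: s_def)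
      then have "real s ^ 3 \<le> (8 / \<epsilon>) ^ 3" by (intro power_mono) auto
      then show ?thesis by (simp add: power_divide)
    qed
    have t_le: "real t \<le> 2 ^ 22 / \<epsilon> ^ 3 * real \<tau>"
    proof -
      have "real t = 2 ^ 13 * real s ^ 3 * real \<tau>" unfolding st(1) by simp
      also have "\<dots> \<le> 2 ^ 13 * (2 ^ 9 / \<epsilon> ^ 3) * real \<tau>"
        using s3 by (intro mult_right_mono mult_left_mono) auto
      finally show ?thesis by simp
    qed
    define y where "y = L * real n / \<epsilon>"
    have y1: "1 \<le> y" using nL(2) \<epsilon> by (simp add: y_def mult.commute le_divide_eq)
    have ty: "real t \<le> 2 ^ 25 * y ^ 3"
    proof -
      have "2 * (real n + L + 2) \<le> 2 * (4 * (real n * L))" using nL(1) by (rule mult_left_mono) simp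
      with \<tau>_le have "real \<tau> \<le> 2 * (4 * (real n * L))" by (rule order_trans)
      then have "real \<tau> \<le> 8 * (real n * L)" by simp
      then have "real t \<le> 2 ^ 22 / \<epsilon> ^ 3 * (8 * (real n * L))"
        using t_le \<epsilon> mult_left_mono[of "real \<tau>" "8 * (real n * L)" "2 ^ 22 / \<epsilon> ^ 3"] by simp
      \<comment> \<open>The factor n L \<ge> 1 is raised to the exponent that 1/\<epsilon> has
        already, which makes the bound a power of y alone.\<close>
      also have "\<dots> \<le> 2 ^ 22 / \<epsilon> ^ 3 * (8 * (real n * L) ^ 3)"
        using nL(2) \<epsilon> self_le_power[of "real n * L" 3] by (intro mult_left_mono) auto
      also have "\<dots> = 2 ^ 25 * y ^ 3" by (simp add: y_def power_divide mult.commute)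
      finally show ?thesis .
    qed
    have t1: "1 \<le> t" by (simp add: t_def)
    have time: "real (h1 t) \<le> C3 * y ^ c" "real (h2 t) \<le> C3 * y ^ c"
    proof -
      have p: "y ^ (3 * c1) \<le> y ^ c" "y ^ (3 * c2) \<le> y ^ c"
        using y1 by (auto simp: c_def intro!: power_increasing)
      have "real (h1 t) \<le> real c1 * 2 ^ (25 * c1) * y ^ (3 * c1)" by (rule c1[OF t1 ty])
      also have "\<dots> \<le> C3 * y ^ c" using p y1 by (intro mult_mono) (auto simp: C3_def)
      finally show "real (h1 t) \<le> C3 * y ^ c" .
      have "real (h2 t) \<le> real c2 * 2 ^ (25 * c2) * y ^ (3 * c2)" by (rule c2[OF t1 ty])
      also have "\<dots> \<le> C3 * y ^ c" using p y1 by (intro mult_mono) (auto simp: C3_def)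
      finally show "real (h2 t) \<le> C3 * y ^ c" .
    qed
    show "\<exists>k t. mc_params n k t \<and>
           (\<forall>g F. irreducible g \<and> degree g = n \<and>
                  F \<subseteq> (bvecs n \<rightarrow>\<^sub>E bvecs n) \<and> card F = N \<longrightarrow>
              measure_pmf.prob (pmf_of_set (mc_polys n t))
                {P. coding_scheme n k (EncMC n k t g P) (DecMC n k t g P) \<and>
                    non_malleable k F \<epsilon> (EncMC n k t g P) (DecMC n k t g P)} \<ge> 1 - \<eta>) \<and>
           real k \<ge> real n - log 2 (log 2 (real N / \<eta>)) - log 2 (real n) - 9 * log 2 (1 / \<epsilon>) - 32 \<and>
           mc_random_bits n t \<le> 9 * 2 ^ 24 * ((real n + log 2 (real N / \<eta>)) * real n / \<epsilon> ^ 6) \<and>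
           (\<forall>g P. irreducible g \<and> degree g = n \<and> P \<in> mc_polys n t \<longrightarrow>
              (\<forall>s\<in>bvecs k.
                 outputs_in_time mc_encoder (mc_input n k t g P s)
                   (map_pmf cell_of_vec (EncMC n k t g P s))
                   (C3 * (log 2 (real N / \<eta>) * real n / \<epsilon>) ^ c)) \<and>
              (\<forall>x\<in>bvecs n.
                 outputs_in_time mc_decoder (mc_input n k t g P x)
                   (return_pmf (cell_of_decoded (DecMC n k t g P x)))
                   (C3 * (log 2 (real N / \<eta>) * real n / \<epsilon>) ^ c)))"
      unfolding L_def[symmetric] l_def[symmetric] y_def[symmetric]
    proof (rule exI[of _ k], rule exI[of _ t], intro conjI allI impI ballI; (elim conjE)?)
      have "1 < t" using \<tau>t st unfolding t_def by (metis One_nat_def add_gr_0 less_2_cases_iff one_less_power zero_less_numeral numeral_2_eq_2 lessI)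
      then show "mc_params n k t" unfolding mc_params_def using kn b t_def by auto
    next
      fix g :: "bit poly" and F :: "(bit list \<Rightarrow> bit list) set" assume g: "irreducible g" "degree g = n"
        and F: "F \<subseteq> (bvecs n \<rightarrow>\<^sub>E bvecs n)" "card F = N"
      interpret mc_setup n g k t s \<tau>
        by unfold_locales (use g n st pw kn m b big in \<open>simp_all add: ac_simps\<close>)
      have N: "0 < real N" using \<eta> by (cases "N = 0") auto
      show "1 - \<eta> \<le> measure_pmf.prob (pmf_of_set (mc_polys n t))
                {P. coding_scheme n k (EncMC n k t g P) (DecMC n k t g P) \<and>
                    non_malleable k F \<epsilon> (EncMC n k t g P) (DecMC n k t g P)}"
      proof (rule prob_good_code[OF F(1)])
        show "F \<noteq> {}" using N F(2) by auto
        have "4 / \<epsilon> \<le> real s" using q(1) by (simp add: s_def)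
        then show "4 / real s \<le> \<epsilon>" using \<epsilon> st(2) by (simp add: field_simps)
        have "2 ^ n * (real N / \<eta>) * 4 = 2 powr (real n + L + 2)"
          using N \<eta> by (simp add: powr_add powr_realpow L_def)
        also have "\<dots> \<le> 2 powr real \<tau>" using \<tau>_ge by (intro powr_mono) auto
        also have "\<dots> = 2 ^ \<tau>" by (simp add: powr_realpow)
        finally have big\<tau>: "2 ^ n * (real N / \<eta>) * 4 \<le> 2 ^ \<tau>" .
        have "(2::real) ^ k \<le> 2 ^ n" using kn by (intro power_increasing) auto
        then have "2 ^ k * (real N / \<eta>) * 4 \<le> 2 ^ n * (real N / \<eta>) * 4"
          using N \<eta> by (intro mult_right_mono) auto
        with big\<tau> have "2 ^ k * (real N / \<eta>) * 4 \<le> 2 ^ \<tau>" by (rule order_trans[rotated])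
        then have "2 ^ k * real N * 4 \<le> 2 ^ \<tau> * \<eta>" using \<eta> by (simp add: field_simps)
        then show "real (card F) * 2 ^ k * (4 * (1 / 2) ^ \<tau>) \<le> \<eta>"
          unfolding F(2) by (simp add: power_one_over divide_le_eq mult_ac)
      qed
    next
      have "real k = real n - real (17 + 4 * q + r)" using kn by (simp add: of_nat_diff)
      then show "real n - log 2 L - log 2 (real n) - 9 * l - 32 \<le> real k"
        using ql rl l by simp
    next
      have "mc_random_bits n t = real (n * (9 * t))"
      proof -
        have "real (card (mc_polys n t)) = 2 ^ (n * (9 * t))"
          using card_mc_polys(1)[OF n, of t] t1 by (simp add: power_mult)
        then show ?thesis unfolding mc_random_bits_def by (simp add: log_nat_power)
      qed
      also have "\<dots> = 9 * real n * real t" by simp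
      also have "\<dots> \<le> 9 * real n * (2 ^ 24 * (real n + L) / \<epsilon> ^ 6)"
      proof (rule mult_left_mono)
        have "real \<tau> \<le> 4 * (real n + L)"
          using \<tau>_le n1 L by (simp only: distrib_left)
        then have "real t \<le> 2 ^ 22 / \<epsilon> ^ 3 * (4 * (real n + L))"
          using t_le \<epsilon> mult_left_mono[of "real \<tau>" "4 * (real n + L)" "2 ^ 22 / \<epsilon> ^ 3"] by simp
        also have "\<dots> = 2 ^ 24 * (real n + L) / \<epsilon> ^ 3" by simp
        also have "\<dots> \<le> 2 ^ 24 * (real n + L) / \<epsilon> ^ 6"
          using \<epsilon> L by (intro divide_left_mono power_decreasing mult_pos_pos zero_less_power) auto
        finally show "real t \<le> 2 ^ 24 * (real n + L) / \<epsilon> ^ 6" .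
      qed simp
      also have "\<dots> = 9 * 2 ^ 24 * ((real n + L) * real n / \<epsilon> ^ 6)" by simp
      finally show "mc_random_bits n t \<le> 9 * 2 ^ 24 * ((real n + L) * real n / \<epsilon> ^ 6)" .
    next
      fix g :: "bit poly" and P u assume g: "irreducible g" "degree g = n" and P: "P \<in> mc_polys n t" and u: "u \<in> bvecs k"
      interpret gf n g by unfold_locales (use g n in auto)
      show "outputs_in_time mc_encoder (mc_input n k t g P u) (map_pmf cell_of_vec (EncMC n k t g P u)) (C3 * y ^ c)"
        by (rule encoder_correct[OF nt _ _ _ P u])
          (use pw(1) t1 kn m b time(1) in \<open>simp_all add: h1_def ac_simps\<close>)
    next
      fix g :: "bit poly" and P x assume g: "irreducible g" "degree g = n" and P: "P \<in> mc_polys n t" and x: "x \<in> bvecs n"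
      interpret gf n g by unfold_locales (use g n in auto)
      show "outputs_in_time mc_decoder (mc_input n k t g P x)
          (return_pmf (cell_of_decoded (DecMC n k t g P x))) (C3 * y ^ c)"
        by (rule decoder_correct[OF nt _ _ P x])
          (use t1 kn m time(2) in \<open>simp_all add: h2_def\<close>)
    qed
  qed
qed

end
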